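(* Let $u\in V^{\Delta_x}_{0,\underline 0}$ be the exact solution of the heat problem with source $f\in L^2(Q)$ and zero initial data, and let $\delta_h=\theta h$ with $\theta>0$ and mesh size $h>0$. For an approximation $v$ and a vector field $\boldsymbol y$ put $e=u-v$, $\mathbf r_{\mathrm{eq}}:=f-\partial_t v+\mathrm{div}_x\boldsymbol y$, $\mathbf r_{\mathrm d}:=\boldsymbol y-\nabla_x v$, $$\overline{\mathrm M}^{\mathrm I}(v,\boldsymbol y;\beta):=(1+\beta)\|\mathbf r_{\mathrm d}\|_Q^2+\Big(1+\frac1\beta\Big)C_{\mathrm F}^2\|\mathbf r_{\mathrm{eq}}\|_Q^2,\qquad \widetilde{\mathrm M}^{\mathrm I}(v,\boldsymbol y;\alpha):=(1+\alpha)\|\mathrm{div}_x\mathbf r_{\mathrm d}\|_Q^2+\Big(1+\frac1\alpha\Big)\|\mathbf r_{\mathrm{eq}}\|_Q^2 .$$ (i) If $v\in V^{\Delta_x}_{0,\underline 0}$ and $\boldsymbol y\in H^{\mathrm{div}_x,0}(Q)$, then for all $\gamma\in[\tfrac12,+\infty)$ and $\alpha,\beta>0$ $$\Big(2-\frac1\gamma\Big)\Big(\|\nabla_x e\|_Q^2+\delta_h\|\partial_t e\|_Q^2\Big)+\|e\|_{\Sigma_T}^2+\delta_h\|\nabla_x e\|_{\Sigma_T}^2\le\gamma\Big(\overline{\mathrm M}^{\mathrm I}(v,\boldsymbol y;\beta)+\delta_h\widetilde{\mathrm M}^{\mathrm I}(v,\boldsymbol y;\alpha)\Big).$$ The values of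 $\beta$ and $\alpha$ minimising the right-hand side are (whenever the norms involved are nonzero) $$\beta=\frac{C_{\mathrm F}\|\mathbf r_{\mathrm{eq}}\|_Q}{\|\mathbf r_{\mathrm d}\|_Q},\qquad \alpha=\frac{\|\mathbf r_{\mathrm{eq}}\|_Q}{\|\mathrm{div}_x\mathbf r_{\mathrm d}\|_Q}.$$ In particular, for $\gamma=1$, $$\|\nabla_x e\|_Q^2+\delta_h\|\partial_t e\|_Q^2+\|e\|_{\Sigma_T}^2+\delta_h\|\nabla_x e\|_{\Sigma_T}^2\le\overline{\mathrm M}^{\mathrm I}(v,\boldsymbol y;\beta)+\delta_h\widetilde{\mathrm M}^{\mathrm I}(v,\boldsymbol y;\alpha).$$ (ii) If $v\in V^{\nabla_x\partial_t}_{0,\underline 0}$ and $\boldsymbol y\in H^{\mathrm{div}_x,1}(Q)$, then for all $\zeta\in[\tfrac12,+\infty)$, $\epsilon\in[1,+\infty)$ and $\alpha,\beta>0$ $$\Big(2-\frac1\zeta\Big)\Big(\|\nabla_x e\|_Q^2+\delta_h\|\partial_t e\|_Q^2\Big)+\delta_h\Big(1-\frac1\epsilon\Big)\|\nabla_x e\|_{\Sigma_T}^2+\|e\|_{\Sigma_T}^2$$ $$\le\epsilon\,\delta_h\|\mathbf r_{\mathrm d}\|_{\Sigma_T}^2+\zeta\Big((1+\alpha)\overline{\mathrm M}^{\mathrm I}(v,\boldsymbol y;\beta)+\Big(1+\frac1\alpha\Big)\delta_h^2\|\partial_t\mathbf r_{\mathrm d}\|_Q^2+\delta_h\|\mathbf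 r_{\mathrm{eq}}\|_Q^2\Big).$$ The values of $\beta$ and $\alpha$ minimising the right-hand side are (whenever the norms involved are nonzero) $$\beta=\frac{C_{\mathrm F}\|\mathbf r_{\mathrm{eq}}\|_Q}{\|\mathbf r_{\mathrm d}\|_Q},\qquad \alpha=\frac{\delta_h\|\partial_t\mathbf r_{\mathrm d}\|_Q}{\sqrt{(1+\beta)\|\mathbf r_{\mathrm d}\|_Q^2+(1+\tfrac1\beta)C_{\mathrm F}^2\|\mathbf r_{\mathrm{eq}}\|_Q^2}}.$$ In particular, for $\zeta=1$ and $\epsilon=2$, $$\|\nabla_x e\|_Q^2+\delta_h\|\partial_t e\|_Q^2+\|e\|_{\Sigma_T}^2+\frac{\delta_h}{2}\|\nabla_x e\|_{\Sigma_T}^2\le 2\delta_h\|\mathbf r_{\mathrm d}\|_{\Sigma_T}^2+(1+\alpha)\overline{\mathrm M}^{\mathrm I}(v,\boldsymbol y;\beta)+\Big(1+\frac1\alpha\Big)\delta_h^2\|\partial_t\mathbf r_{\mathrm d}\|_Q^2+\delta_h\|\mathbf r_{\mathrm{eq}}\|_Q^2.$$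
   Context: Let $\Omega\subset\mathbb R^d$, $d\in\{1,2,3\}$, be a bounded Lipschitz domain, $0<T<\infty$, $Q=\Omega\times(0,T)$, $\Sigma=\partial\Omega\times(0,T)$, $\Sigma_0=\Omega\times\{0\}$, $\Sigma_T=\Omega\times\{T\}$. The operators $\nabla_x,\Delta_x,\mathrm{div}_x$ act in the spatial variables only. $\|\cdot\|_Q$ and $\|\cdot\|_{\Sigma_T}$ are the $L^2(Q)$- and $L^2(\Sigma_T)$-norms (scalar or vector valued); on $\Sigma_T$ one takes the value at $t=T$. The number $h>0$ is the global size of a mesh of $Q$ and $\theta>0$ a fixed parameter; they enter only through the positive number $\delta_h=\theta h$. Function spaces (boundary values in the sense of traces): - $H^{1,0}_0(Q)=\{w\in L^2(Q): \nabla_x w\in[L^2(Q)]^d,\ w|_\Sigma=0\}$. - $V^1_0=\{w\in H^1(Q): w|_\Sigma=0\}$. - $V^{\Delta_x}_{0,\underline 0}=\{w\in V^1_0:\ \Delta_x w\in L^2(Q),\ w|_{\Sigma_0}=0\}$. For $w$ in this space the function $t\mapsto\|\nabla_x w(\cdot,t)\|_\Omega^2$ is absolutely continuous on $[0,T]$, so $\|\nabla_x w\|_{\Sigma_T}$ is well defined. - $V^{\nabla_x\partial_t}_{0,\underline 0}=\{w\in V^{\Delta_x}_{0,\underline 0}:\ \nabla_x\partial_t w\in [L^2(Q)]^d\}$. - $H^{\mathrm{div}_x,0}(Q)=\{\boldsymbol y\in[L^2(Q)]^d:\ \mathrm{div}_x\boldsymbol y\in L^2(Q)\}$ and $H^{\mathrm{div}_x,1}(Q)=\{\boldsymbol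 y\in H^{\mathrm{div}_x,0}(Q):\ \partial_t\boldsymbol y\in[L^2(Q)]^d\}$. Exact solution: for given $f\in L^2(Q)$, $u\in V^{\Delta_x}_{0,\underline 0}$ is the unique function with $\partial_t u-\Delta_x u=f$ in $Q$ (so $u=0$ on $\Sigma$ and $u=0$ on $\Sigma_0$). $C_{\mathrm F}>0$ is a constant in the Friedrichs inequality $\|w\|_Q\le C_{\mathrm F}\|\nabla_x w\|_Q$ for all $w\in H^{1,0}_0(Q)$. *)

theory Defs
  imports "HOL-Analysis.Analysis"
begin

text \<open>
  Functions on the space-time cylinder \<open>\<Omega> \<times> {0<..<T}\<close> are total functions on \<open>'a \<times> real\<close> of
  which only the values on the cylinder, up to null sets, matter. A pair is (space, time), so
  \<open>(i, 0)\<close> with \<open>i \<in> Basis\<close> is a spatial direction and \<open>(0, 1)\<close> the time direction.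
\<close>

subsection \<open>Bounded Lipschitz domains\<close>

text \<open>Locally \<open>\<Omega>\<close> is the strict epigraph, in some direction \<open>\<nu>\<close>, of a Lipschitz function on the
  hyperplane orthogonal to \<open>\<nu>\<close>; only the values of \<open>\<phi>\<close> on that hyperplane are used.\<close>

definition bounded_lipschitz_domain :: "'a::euclidean_space set \<Rightarrow> bool" where
  "bounded_lipschitz_domain \<Omega> \<longleftrightarrow>
     open \<Omega> \<and> connected \<Omega> \<and> \<Omega> \<noteq> {} \<and> bounded \<Omega> \<and>
     (\<forall>p\<in>frontier \<Omega>. \<exists>\<nu> \<phi> L U. norm \<nu> = 1 \<and> L-lipschitz_on UNIV \<phi> \<and> open U \<and> p \<in> U \<and>
        \<Omega> \<inter> U = {x\<in>U. \<phi> (x - (x \<bullet> \<nu>) *\<^sub>R \<nu>) < x \<bullet> \<nu>})"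

subsection \<open>Square integrable functions\<close>

definition L2 :: "'a measure \<Rightarrow> ('a \<Rightarrow> 'b::euclidean_space) set" where
  "L2 M = {f \<in> borel_measurable M. integrable M (\<lambda>z. (norm (f z))\<^sup>2)}"

definition L2_norm :: "'a measure \<Rightarrow> ('a \<Rightarrow> 'b::euclidean_space) \<Rightarrow> real" where
  "L2_norm M f = sqrt (\<integral>z. (norm (f z))\<^sup>2 \<partial>M)"

definition L2_lim :: "'a measure \<Rightarrow> (nat \<Rightarrow> 'a \<Rightarrow> 'b::euclidean_space) \<Rightarrow> ('a \<Rightarrow> 'b) \<Rightarrow> bool" where
  "L2_lim M F f \<longleftrightarrow> (\<forall>k. F k \<in> L2 M) \<and> f \<in> L2 M \<and>
     (\<lambda>k. L2_norm M (\<lambda>z. F k z - f z)) \<longlonglongrightarrow> 0"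

abbreviation norm_on :: "'a::euclidean_space set \<Rightarrow> ('a \<Rightarrow> 'b::euclidean_space) \<Rightarrow> real" where
  "norm_on S f \<equiv> L2_norm (lebesgue_on S) f"

subsection \<open>Weak derivatives\<close>

definition C1 :: "('a::euclidean_space \<Rightarrow> real) \<Rightarrow> bool" where
  "C1 \<phi> \<longleftrightarrow> (\<forall>z. \<phi> differentiable at z) \<and>
     (\<forall>b\<in>Basis. continuous_on UNIV (\<lambda>z. frechet_derivative \<phi> (at z) b))"

text \<open>Only first order derivatives are moved to test functions, so these are taken once
  continuously differentiable (as in Gilbarg and Trudinger, Section 7.3).\<close>

definition test_fun :: "'a::euclidean_space set \<Rightarrow> ('a \<Rightarrow> real) set" where
  "test_fun Q = {\<phi>. C1 \<phi> \<and> compact (closure {z. \<phi> z \<noteq> 0}) \<and> closure {z. \<phi> z \<noteq> 0} \<subseteq> Q}"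

text \<open>\<open>w\<close> is in \<open>L\<^sup>2(Q)\<close> and has the weak derivative \<open>g \<in> L\<^sup>2(Q)\<close> in direction \<open>b\<close>.\<close>

definition has_weak_deriv ::
  "'a::euclidean_space set \<Rightarrow> 'a \<Rightarrow> ('a \<Rightarrow> 'b::euclidean_space) \<Rightarrow> ('a \<Rightarrow> 'b) \<Rightarrow> bool" where
  "has_weak_deriv Q b w g \<longleftrightarrow> w \<in> L2 (lebesgue_on Q) \<and> g \<in> L2 (lebesgue_on Q) \<and>
     (\<forall>\<phi>\<in>test_fun Q. (\<integral>z. frechet_derivative \<phi> (at z) b *\<^sub>R w z \<partial>lebesgue_on Q)
                     = - (\<integral>z. \<phi> z *\<^sub>R g z \<partial>lebesgue_on Q))"

abbreviation has_dt ::
  "('a::euclidean_space \<times> real) set \<Rightarrow> ('a \<times> real \<Rightarrow> 'b::euclidean_space) \<Rightarrow> ('a \<times> real \<Rightarrow> 'b) \<Rightarrow> bool" where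
  "has_dt Q w p \<equiv> has_weak_deriv Q (0, 1) w p"

definition has_grad_x ::
  "('a::euclidean_space \<times> real) set \<Rightarrow> ('a \<times> real \<Rightarrow> real) \<Rightarrow> ('a \<times> real \<Rightarrow> 'a) \<Rightarrow> bool" where
  "has_grad_x Q w g \<longleftrightarrow> (\<forall>i\<in>Basis. has_weak_deriv Q (i, 0) w (\<lambda>z. g z \<bullet> i))"

text \<open>By linearity of the derivative, \<open>frechet_derivative \<phi> (at z) (y z, 0)\<close> is the inner product
  of \<open>y z\<close> with the spatial gradient of \<open>\<phi>\<close> at \<open>z\<close>. The single components of \<open>y\<close> need not have
  weak derivatives.\<close>

definition has_div_x ::
  "('a::euclidean_space \<times> real) set \<Rightarrow> ('a \<times> real \<Rightarrow> 'a) \<Rightarrow> ('a \<times> real \<Rightarrow> real) \<Rightarrow> bool" where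
  "has_div_x Q y q \<longleftrightarrow> y \<in> L2 (lebesgue_on Q) \<and> q \<in> L2 (lebesgue_on Q) \<and>
     (\<forall>\<phi>\<in>test_fun Q. (\<integral>z. frechet_derivative \<phi> (at z) (y z, 0) \<partial>lebesgue_on Q)
                     = - (\<integral>z. \<phi> z * q z \<partial>lebesgue_on Q))"

text \<open>Weak derivatives are unique up to null sets, so the choices below are immaterial.\<close>

definition dt ::
  "('a::euclidean_space \<times> real) set \<Rightarrow> ('a \<times> real \<Rightarrow> 'b::euclidean_space) \<Rightarrow> 'a \<times> real \<Rightarrow> 'b" where
  "dt Q w = (SOME p. has_dt Q w p)"

definition grad_x ::
  "('a::euclidean_space \<times> real) set \<Rightarrow> ('a \<times> real \<Rightarrow> real) \<Rightarrow> 'a \<times> real \<Rightarrow> 'a" where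
  "grad_x Q w = (SOME g. has_grad_x Q w g)"

definition div_x ::
  "('a::euclidean_space \<times> real) set \<Rightarrow> ('a \<times> real \<Rightarrow> 'a) \<Rightarrow> 'a \<times> real \<Rightarrow> real" where
  "div_x Q y = (SOME q. has_div_x Q y q)"

definition lap_x ::
  "('a::euclidean_space \<times> real) set \<Rightarrow> ('a \<times> real \<Rightarrow> real) \<Rightarrow> 'a \<times> real \<Rightarrow> real" where
  "lap_x Q w = div_x Q (grad_x Q w)"

subsection \<open>Traces\<close>

text \<open>Hausdorff measure of integer dimension \<open>s\<close>, without the normalising constant, which plays no
  role for convergence in \<open>L\<^sup>2\<close>. Since \<open>0 ^ 0 = 1\<close>, it is the counting measure for \<open>s = 0\<close>; this
  is why empty covering sets have to be treated separately.\<close>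

definition hausdorff_content :: "nat \<Rightarrow> real \<Rightarrow> 'a::metric_space set \<Rightarrow> ennreal" where
  "hausdorff_content s r A =
     (INF U\<in>{U :: nat \<Rightarrow> 'a set. A \<subseteq> (\<Union>k. U k) \<and> (\<forall>k. bounded (U k) \<and> diameter (U k) \<le> r)}.
        \<Sum>k. if U k = {} then 0 else ennreal (diameter (U k) ^ s))"

definition hausdorff_measure :: "nat \<Rightarrow> 'a::metric_space measure" where
  "hausdorff_measure s =
     measure_of UNIV (sets borel) (\<lambda>A. SUP r\<in>{0<..}. hausdorff_content s r A)"

text \<open>\<open>w|\<^bsub>S\<^esub> = g\<close> in the sense of traces, \<open>M\<close> being the surface measure on the part \<open>S\<close> of the
  boundary of \<open>Q\<close>: the trace operator is the continuous extension of the restriction map from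
  functions that are \<open>C\<^sup>1\<close> up to the boundary, with respect to the \<open>L\<^sup>2(Q)\<close>-norms of the function
  and of its derivatives in the directions \<open>D\<close>.\<close>

definition has_trace ::
  "'a::euclidean_space set \<Rightarrow> 'a set \<Rightarrow> 'a measure \<Rightarrow> ('a \<Rightarrow> real) \<Rightarrow> ('a \<Rightarrow> real) \<Rightarrow> bool" where
  "has_trace Q D M w g \<longleftrightarrow>
     (\<exists>W. (\<forall>k. C1 (W k)) \<and> L2_lim (lebesgue_on Q) W w \<and>
          (\<forall>b\<in>D. \<exists>p. has_weak_deriv Q b w p \<and>
             L2_lim (lebesgue_on Q) (\<lambda>k z. frechet_derivative (W k) (at z) b) p) \<and>
          L2_lim M W g)"

text \<open>The lateral boundary \<open>frontier \<Omega> \<times> {0<..<T}\<close> and the bottom \<open>\<Omega> \<times> {0}\<close>.\<close>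

definition lateral_measure :: "'a::euclidean_space set \<Rightarrow> real \<Rightarrow> ('a \<times> real) measure" where
  "lateral_measure \<Omega> T =
     restrict_space (hausdorff_measure (DIM('a) - 1)) (frontier \<Omega>) \<Otimes>\<^sub>M restrict_space lborel {0<..<T}"

definition bottom_measure :: "'a::euclidean_space set \<Rightarrow> ('a \<times> real) measure" where
  "bottom_measure \<Omega> = distr (restrict_space lborel \<Omega>) borel (\<lambda>x. (x, 0))"

definition zero_lateral :: "'a::euclidean_space set \<Rightarrow> real \<Rightarrow> ('a \<times> real \<Rightarrow> real) \<Rightarrow> bool" where
  "zero_lateral \<Omega> T w \<longleftrightarrow>
     has_trace (\<Omega> \<times> {0<..<T}) {(i, 0) | i. i \<in> Basis} (lateral_measure \<Omega> T) w (\<lambda>_. 0)"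

definition zero_initial :: "'a::euclidean_space set \<Rightarrow> real \<Rightarrow> ('a \<times> real \<Rightarrow> real) \<Rightarrow> bool" where
  "zero_initial \<Omega> T w \<longleftrightarrow> has_trace (\<Omega> \<times> {0<..<T}) Basis (bottom_measure \<Omega>) w (\<lambda>_. 0)"

text \<open>The value at \<open>t = T\<close>: the limit in \<open>L\<^sup>2(\<Omega>)\<close> of the time slices as \<open>t\<close> tends to \<open>T\<close>, where a
  null set of times is disregarded because slices are determined only for almost every time.\<close>

definition has_final_value ::
  "'a::euclidean_space set \<Rightarrow> real \<Rightarrow> ('a \<times> real \<Rightarrow> 'b::euclidean_space) \<Rightarrow> ('a \<Rightarrow> 'b) \<Rightarrow> bool" where
  "has_final_value \<Omega> T F g \<longleftrightarrow> g \<in> L2 (lebesgue_on \<Omega>) \<and>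
     (\<forall>\<epsilon>>0. \<exists>\<tau>\<in>{0..<T}. AE t in lebesgue_on {\<tau><..<T}.
        (\<lambda>x. F (x, t)) \<in> L2 (lebesgue_on \<Omega>) \<and> norm_on \<Omega> (\<lambda>x. F (x, t) - g x) < \<epsilon>)"

definition final_norm ::
  "'a::euclidean_space set \<Rightarrow> real \<Rightarrow> ('a \<times> real \<Rightarrow> 'b::euclidean_space) \<Rightarrow> real" where
  "final_norm \<Omega> T F = norm_on \<Omega> (SOME g. has_final_value \<Omega> T F g)"

subsection \<open>Function spaces\<close>

definition H10_0 :: "'a::euclidean_space set \<Rightarrow> real \<Rightarrow> ('a \<times> real \<Rightarrow> real) set" where
  "H10_0 \<Omega> T = {w. (\<exists>g. has_grad_x (\<Omega> \<times> {0<..<T}) w g) \<and> zero_lateral \<Omega> T w}"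

definition V1_0 :: "'a::euclidean_space set \<Rightarrow> real \<Rightarrow> ('a \<times> real \<Rightarrow> real) set" where
  "V1_0 \<Omega> T = {w. (\<exists>g. has_grad_x (\<Omega> \<times> {0<..<T}) w g) \<and> (\<exists>p. has_dt (\<Omega> \<times> {0<..<T}) w p) \<and>
                  zero_lateral \<Omega> T w}"

definition V_lap :: "'a::euclidean_space set \<Rightarrow> real \<Rightarrow> ('a \<times> real \<Rightarrow> real) set" where
  "V_lap \<Omega> T = {w \<in> V1_0 \<Omega> T.
     (\<exists>q. has_div_x (\<Omega> \<times> {0<..<T}) (grad_x (\<Omega> \<times> {0<..<T}) w) q) \<and> zero_initial \<Omega> T w}"

definition V_grad_dt :: "'a::euclidean_space set \<Rightarrow> real \<Rightarrow> ('a \<times> real \<Rightarrow> real) set" where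
  "V_grad_dt \<Omega> T = {w \<in> V_lap \<Omega> T. \<exists>g. has_grad_x (\<Omega> \<times> {0<..<T}) (dt (\<Omega> \<times> {0<..<T}) w) g}"

definition Hdiv0 :: "('a::euclidean_space \<times> real) set \<Rightarrow> ('a \<times> real \<Rightarrow> 'a) set" where
  "Hdiv0 Q = {y. \<exists>q. has_div_x Q y q}"

definition Hdiv1 :: "('a::euclidean_space \<times> real) set \<Rightarrow> ('a \<times> real \<Rightarrow> 'a) set" where
  "Hdiv1 Q = {y \<in> Hdiv0 Q. \<exists>p. has_dt Q y p}"

subsection \<open>Residuals and majorants\<close>

definition r_eq :: "('a::euclidean_space \<times> real) set \<Rightarrow> ('a \<times> real \<Rightarrow> real) \<Rightarrow>
    ('a \<times> real \<Rightarrow> real) \<Rightarrow> ('a \<times> real \<Rightarrow> 'a) \<Rightarrow> 'a \<times> real \<Rightarrow> real" where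
  "r_eq Q f v y = (\<lambda>z. f z - dt Q v z + div_x Q y z)"

definition r_d :: "('a::euclidean_space \<times> real) set \<Rightarrow>
    ('a \<times> real \<Rightarrow> real) \<Rightarrow> ('a \<times> real \<Rightarrow> 'a) \<Rightarrow> 'a \<times> real \<Rightarrow> 'a" where
  "r_d Q v y = (\<lambda>z. y z - grad_x Q v z)"

definition M_bar :: "('a::euclidean_space \<times> real) set \<Rightarrow> ('a \<times> real \<Rightarrow> real) \<Rightarrow> real \<Rightarrow>
    ('a \<times> real \<Rightarrow> real) \<Rightarrow> ('a \<times> real \<Rightarrow> 'a) \<Rightarrow> real \<Rightarrow> real" where
  "M_bar Q f C\<^sub>F v y \<beta> = (1 + \<beta>) * (norm_on Q (r_d Q v y))\<^sup>2
     + (1 + 1 / \<beta>) * C\<^sub>F\<^sup>2 * (norm_on Q (r_eq Q f v y))\<^sup>2"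

definition M_tilde :: "('a::euclidean_space \<times> real) set \<Rightarrow> ('a \<times> real \<Rightarrow> real) \<Rightarrow>
    ('a \<times> real \<Rightarrow> real) \<Rightarrow> ('a \<times> real \<Rightarrow> 'a) \<Rightarrow> real \<Rightarrow> real" where
  "M_tilde Q f v y \<alpha> = (1 + \<alpha>) * (norm_on Q (div_x Q (r_d Q v y)))\<^sup>2
     + (1 + 1 / \<alpha>) * (norm_on Q (r_eq Q f v y))\<^sup>2"

text \<open>The right-hand sides of the two estimates; \<open>d\<close> stands for \<open>\<theta> h\<close>.\<close>

definition rhs1 :: "('a::euclidean_space \<times> real) set \<Rightarrow> ('a \<times> real \<Rightarrow> real) \<Rightarrow> real \<Rightarrow> real \<Rightarrow>
    ('a \<times> real \<Rightarrow> real) \<Rightarrow> ('a \<times> real \<Rightarrow> 'a) \<Rightarrow> real \<Rightarrow> real \<Rightarrow> real \<Rightarrow> real" where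
  "rhs1 Q f C\<^sub>F d v y \<gamma> \<alpha> \<beta> = \<gamma> * (M_bar Q f C\<^sub>F v y \<beta> + d * M_tilde Q f v y \<alpha>)"

definition rhs2 :: "'a::euclidean_space set \<Rightarrow> real \<Rightarrow> ('a \<times> real \<Rightarrow> real) \<Rightarrow> real \<Rightarrow> real \<Rightarrow>
    ('a \<times> real \<Rightarrow> real) \<Rightarrow> ('a \<times> real \<Rightarrow> 'a) \<Rightarrow> real \<Rightarrow> real \<Rightarrow> real \<Rightarrow> real \<Rightarrow> real" where
  "rhs2 \<Omega> T f C\<^sub>F d v y \<zeta> \<epsilon> \<alpha> \<beta> = (let Q = \<Omega> \<times> {0<..<T} in
     \<epsilon> * d * (final_norm \<Omega> T (r_d Q v y))\<^sup>2
     + \<zeta> * ((1 + \<alpha>) * M_bar Q f C\<^sub>F v y \<beta> + (1 + 1 / \<alpha>) * d\<^sup>2 * (norm_on Q (dt Q (r_d Q v y)))\<^sup>2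
            + d * (norm_on Q (r_eq Q f v y))\<^sup>2))"

end

(*
The error e = u - v solves e_t - div grad e = r_eq - div r_d. Testing this with e and with
e_t and integrating by parts yields the two energy identities
  |grad e|^2 + |e(T)|^2 / 2 = (r_eq, e) + (r_d, grad e),
  |e_t|^2 + |grad e(T)|^2 / 2 = (r_eq, e_t) - (div r_d, e_t),
and -(div r_d, e_t) = (r_d(T), grad e(T)) - (d/dt r_d, grad e) if r_d has a weak time
derivative. The estimates follow by the Cauchy-Schwarz, Friedrichs and Young inequalities.

Since grad e has no weak time derivative, the identities containing e_t are proved for
difference quotients in time, which are Steklov averages of e_t; Green's formula makes the
gradients of the averages a Cauchy sequence in C([0,T]; L^2), and their limit is grad e(T).
Green's formula itself rests on two facts about a Lipschitz domain: a function with zero lateral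
trace extends by zero (the trace is taken with respect to Hausdorff measure, so layers
along the boundary are estimated by coverings), and after localization and a shift into the
domain the extension can be mollified to a test function.
*)

theory Submission
 imports Defs
begin

text \<open>Every function on the cylinder is traded for a Borel function on all of space-time that
  vanishes off it; translations, convolutions and Fubini then apply without regard to the domain,
  and truncation in time enters only as the indicator of t < \<tau>. Zero initial values mean that e
  is the primitive from 0 of its time derivative p, so extending e by zero to negative times does no
  harm. Difference quotients look backward for this reason: for t < T they are exact averages of p
  over the preceding interval, and the false values caused by cutting e off at T arise only later,
  where nothing is integrated. The gradient g of e is just an L2 function, but its difference
  quotient has the averages of g as primitive, and the square of a primitive obeys a product rule
  proved by Fubini alone. The energy at any time \<tau> is then bounded by space-time norms
  independent of \<tau>; that uniformity is what yields a value at T. In the scalar part, 2 -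
  1/\<gamma> is what remains of the coefficient 2 of each energy term after Young's inequality has
  used up 1/\<gamma>.\<close>

abbreviation Borel where "Borel \<equiv> borel_measurable borel"

abbreviation nrm where "nrm \<equiv> L2_norm lborel"

abbreviation \<D> where "\<D> \<phi> z \<equiv> frechet_derivative \<phi> (at z)"

lemmas lebesgue_cong = Bochner_Integration.integral_cong
 and lebesgue_add = Bochner_Integration.integral_add
 and lebesgue_diff = Bochner_Integration.integral_diff
 and lebesgue_sum = Bochner_Integration.integral_sum
 and integrable_bd = Bochner_Integration.integrable_bound
 and integrable_sums = Bochner_Integration.integrable_sum
 and integrable_plus = Bochner_Integration.integrable_add
 and integrable_minus = Bochner_Integration.integrable_diff

section \<open>Norms, products and the triangle inequality in L2\<close>

lemma L2I: "f \<in> borel_measurable M ==> integrable M (\<lambda>z. (norm (f z))\<^sup>2) ==> f \<in> L2 M"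
 by (simp add: L2_def)

lemma L2_measurable [measurable_dest]: "f \<in> L2 M ==> f \<in> borel_measurable M"
 by (simp add: L2_def)

lemma L2_integrable: "f \<in> L2 M ==> integrable M (\<lambda>z. (norm (f z))\<^sup>2)"
 by (simp add: L2_def)

lemma L2_norm_nonneg: "0 \<le> L2_norm M f"
 by (simp add: L2_norm_def)

lemma L2_norm_power2: "(L2_norm M f)\<^sup>2 = (\<integral>z. (norm (f z))\<^sup>2 \<partial>M)"
 by (simp add: L2_norm_def)

lemma L2_nn_integral:
 "f \<in> L2 M ==> (\<integral>\<^sup>+z. ennreal ((norm (f z))\<^sup>2) \<partial>M) = ennreal ((L2_norm M f)\<^sup>2)"
 by (simp add: L2_norm_power2 nn_integral_eq_integral L2_integrable)

lemma L2_nnI: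
 assumes "f \<in> borel_measurable M" "(\<integral>\<^sup>+z. ennreal ((norm (f z))\<^sup>2) \<partial>M) < \<infinity>"
 shows "f \<in> L2 M"
 using assms by (intro L2I integrableI_bounded) auto

text \<open>The extended integral can be estimated before integrability is known; membership and the
  norm bound then come together.\<close>

lemma L2_norm_le_nnI:
 assumes "f \<in> borel_measurable M" "(\<integral>\<^sup>+z. ennreal ((norm (f z))\<^sup>2) \<partial>M) \<le> ennreal (c\<^sup>2)" "0 \<le> c"
 shows "f \<in> L2 M" "L2_norm M f \<le> c"
proof -
 show f: "f \<in> L2 M"
  using assms by (intro L2_nnI) (auto simp: less_top[symmetric] top_unique)
 have "ennreal ((L2_norm M f)\<^sup>2) \<le> ennreal (c\<^sup>2)"
  using assms L2_nn_integral[OF f] by simp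
 then have "(L2_norm M f)\<^sup>2 \<le> c\<^sup>2" by simp
 then show "L2_norm M f \<le> c" using assms(3) power2_le_imp_le by blast
qed

lemma L2_dominated:
 assumes "f \<in> L2 M" "g \<in> borel_measurable M" "AE z in M. norm (g z) \<le> B * norm (f z)"
 shows "g \<in> L2 M"
proof (rule L2I)
 show "integrable M (\<lambda>z. (norm (g z))\<^sup>2)"
 proof (rule integrable_bd)
  show "integrable M (\<lambda>z. B\<^sup>2 * (norm (f z))\<^sup>2)"
   using assms(1) by (simp add: L2_integrable)
  show "AE z in M. norm ((norm (g z))\<^sup>2) \<le> norm (B\<^sup>2 * (norm (f z))\<^sup>2)"
   using assms(3)
   by eventually_elim (metis abs_le_square_iff abs_norm_cancel norm_ge_zero norm_power
     order_trans power_mult_distrib real_norm_def abs_of_nonneg zero_le_power2)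
 qed (use assms in measurable)
qed (rule assms)

lemma L2_mono:
 assumes "f \<in> L2 M" "AE z in M. norm (g z) \<le> norm (f z)"
 shows "L2_norm M g \<le> L2_norm M f"
 unfolding L2_norm_def
proof (rule real_sqrt_le_mono, rule integral_mono_AE')
 show "integrable M (\<lambda>z. (norm (f z))\<^sup>2)" by (rule L2_integrable[OF assms(1)])
 show "AE x in M. (norm (g x))\<^sup>2 \<le> (norm (f x))\<^sup>2"
  using assms(2) by eventually_elim (simp add: power_mono)
qed simp

lemma L2_norm_cong_AE:
 assumes "f \<in> borel_measurable M" "g \<in> borel_measurable M" "AE z in M. f z = g z"
 shows "L2_norm M f = L2_norm M g"
 unfolding L2_norm_def
 by (rule arg_cong[where f=sqrt], rule integral_cong_AE)
  (use assms in \<open>auto intro: AE_mp\<close>)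

lemma L2_zero [simp]: "(\<lambda>_. 0) \<in> L2 M" by (simp add: L2_def)

lemma L2_norm_zero [simp]: "L2_norm M (\<lambda>_. 0) = 0" by (simp add: L2_norm_def)

lemma L2_norm_eq_0:
 assumes "f \<in> L2 M" shows "L2_norm M f = 0 \<longleftrightarrow> (AE z in M. f z = 0)"
 using integral_nonneg_eq_0_iff_AE[OF L2_integrable[OF assms]] by (simp add: L2_norm_def)

lemma L2_scaleR: "f \<in> L2 M ==> (\<lambda>z. c *\<^sub>R f z) \<in> L2 M"
 by (rule L2_dominated[where B="\<bar>c\<bar>"]) (auto dest: L2_measurable)

lemma L2_norm_scaleR: "L2_norm M (\<lambda>z. c *\<^sub>R f z) = \<bar>c\<bar> * L2_norm M f"
 by (simp add: L2_norm_def power_mult_distrib real_sqrt_mult)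

lemma L2_uminus: "f \<in> L2 M ==> (\<lambda>z. - f z) \<in> L2 M"
 using L2_scaleR[of f M "-1"] by simp

lemma L2_norm_minus_commute: "L2_norm M (\<lambda>z. f z - g z) = L2_norm M (\<lambda>z. g z - f z)"
 by (simp add: L2_norm_def norm_minus_commute)

lemma L2_inner_left: "f \<in> L2 M ==> (\<lambda>z. f z \<bullet> i) \<in> L2 M"
 by (rule L2_dominated[where B="norm i"])
  (auto dest: L2_measurable simp: Cauchy_Schwarz_ineq2 mult.commute[of "norm i"])

lemma L2_bounded_mult:
 assumes "f \<in> L2 M" "\<eta> \<in> borel_measurable M" "\<And>z. z \<in> space M ==> \<bar>\<eta> z\<bar> \<le> B"
 shows "(\<lambda>z. \<eta> z *\<^sub>R f z) \<in> L2 M"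
 by (rule L2_dominated[OF assms(1), where B=B])
  (use assms in \<open>auto dest: L2_measurable simp: mult_right_mono\<close>)

lemma L2_add:
 assumes "f \<in> L2 M" "g \<in> L2 M" shows "(\<lambda>z. f z + g z) \<in> L2 M"
proof (rule L2I)
 show "(\<lambda>z. f z + g z) \<in> borel_measurable M"
  using assms by measurable
 show "integrable M (\<lambda>z. (norm (f z + g z))\<^sup>2)"
 proof (rule integrable_bd)
  show "integrable M (\<lambda>z. 2 * (norm (f z))\<^sup>2 + 2 * (norm (g z))\<^sup>2)"
   using assms by (simp add: L2_integrable)
  have "(norm (f z + g z))\<^sup>2 \<le> 2 * (norm (f z))\<^sup>2 + 2 * (norm (g z))\<^sup>2" for z
  proof -
   have "(norm (f z + g z))\<^sup>2 \<le> (norm (f z) + norm (g z))\<^sup>2"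
    by (intro power_mono norm_triangle_ineq) auto
   also have "\<dots> \<le> 2 * (norm (f z))\<^sup>2 + 2 * (norm (g z))\<^sup>2"
    using sum_squares_bound[of "norm (f z)" "norm (g z)"] by (simp add: power2_sum)
   finally show ?thesis .
  qed
  then show "AE z in M. norm ((norm (f z + g z))\<^sup>2) \<le> norm (2 * (norm (f z))\<^sup>2 + 2 * (norm (g z))\<^sup>2)"
   by simp
 qed (use assms in \<open>auto dest: L2_measurable \<close>)
qed

lemma L2_diff: "f \<in> L2 M ==> g \<in> L2 M ==> (\<lambda>z. f z - g z) \<in> L2 M"
 using L2_add[OF _ L2_uminus, of f M g] by simp

lemma L2_sum: "(\<And>i. i \<in> I ==> f i \<in> L2 M) ==> (\<lambda>z. \<Sum>i\<in>I. f i z) \<in> L2 M"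
 by (induction I rule: infinite_finite_induct) (auto intro: L2_add)

lemma L2_componentwise:
 assumes "\<And>i. i \<in> Basis ==> (\<lambda>z. f z \<bullet> i) \<in> L2 M"
 shows "f \<in> L2 M"
proof -
 have "(\<lambda>z. (f z \<bullet> i) *\<^sub>R i) \<in> L2 M" if "i \<in> Basis" for i
  by (rule L2_dominated[OF assms[OF that], where B=1])
   (use assms that in \<open>auto dest: L2_measurable\<close>)
 then have "(\<lambda>z. \<Sum>i\<in>Basis. (f z \<bullet> i) *\<^sub>R i) \<in> L2 M" by (rule L2_sum)
 then show ?thesis by (simp add: euclidean_representation)
qed

lemma L2_norm_mult_integrable:
 assumes "f \<in> L2 M" "g \<in> L2 M" shows "integrable M (\<lambda>z. norm (f z) * norm (g z))"
proof (rule integrable_bd)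
 show "integrable M (\<lambda>z. (norm (f z))\<^sup>2 + (norm (g z))\<^sup>2)"
  using assms by (simp add: L2_integrable)
 have "norm (f z) * norm (g z) \<le> (norm (f z))\<^sup>2 + (norm (g z))\<^sup>2" for z
  using sum_squares_bound[of "norm (f z)" "norm (g z)"]
   mult_nonneg_nonneg[OF norm_ge_zero norm_ge_zero, of "f z" "g z"] by linarith
 then show "AE z in M. norm (norm (f z) * norm (g z)) \<le> norm ((norm (f z))\<^sup>2 + (norm (g z))\<^sup>2)"
  by simp
qed (use assms in \<open>auto dest: L2_measurable \<close>)

lemma L2_Cauchy_Schwarz_norm:
 assumes "f \<in> L2 M" "g \<in> L2 M"
 shows "(\<integral>z. norm (f z) * norm (g z) \<partial>M) \<le> L2_norm M f * L2_norm M g"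
proof -
 have "ennreal ((\<integral>z. norm (f z) * norm (g z) \<partial>M)\<^sup>2)
   = (\<integral>\<^sup>+z. ennreal (norm (f z)) * ennreal (norm (g z)) \<partial>M)\<^sup>2"
  using nn_integral_eq_integral[OF L2_norm_mult_integrable[OF assms]]
  by (simp add: ennreal_mult ennreal_power)
 also have "\<dots> \<le> (\<integral>\<^sup>+z. (ennreal (norm (f z)))\<^sup>2 \<partial>M) * (\<integral>\<^sup>+z. (ennreal (norm (g z)))\<^sup>2 \<partial>M)"
  using assms by (intro Cauchy_Schwarz_nn_integral) (auto dest!: L2_measurable)
 also have "\<dots> = ennreal ((L2_norm M f * L2_norm M g)\<^sup>2)"
  using L2_nn_integral[OF assms(1)] L2_nn_integral[OF assms(2)]
  by (simp add: ennreal_power ennreal_mult power_mult_distrib)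
 finally have "(\<integral>z. norm (f z) * norm (g z) \<partial>M)\<^sup>2 \<le> (L2_norm M f * L2_norm M g)\<^sup>2"
  by simp
 then show ?thesis by (rule power2_le_imp_le) (simp add: L2_norm_nonneg)
qed

lemma L2_inner_integrable:
 assumes "f \<in> L2 M" "g \<in> L2 M" shows "integrable M (\<lambda>z. f z \<bullet> g z)"
 by (rule integrable_bd[OF L2_norm_mult_integrable[OF assms]])
  (use assms in \<open>auto dest: L2_measurable simp: Cauchy_Schwarz_ineq2\<close>)

lemma L2_Cauchy_Schwarz:
 assumes "f \<in> L2 M" "g \<in> L2 M"
 shows "\<bar>\<integral>z. f z \<bullet> g z \<partial>M\<bar> \<le> L2_norm M f * L2_norm M g"
proof -
 have "\<bar>\<integral>z. f z \<bullet> g z \<partial>M\<bar> \<le> (\<integral>z. \<bar>f z \<bullet> g z\<bar> \<partial>M)" by simp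
 also have "\<dots> \<le> (\<integral>z. norm (f z) * norm (g z) \<partial>M)"
  by (intro integral_mono integrable_abs L2_inner_integrable L2_norm_mult_integrable assms)
   (rule Cauchy_Schwarz_ineq2)
 also note L2_Cauchy_Schwarz_norm[OF assms]
 finally show ?thesis .
qed

lemma L2_mult_integrable:
 fixes f g :: "'a => real"
 assumes "f \<in> L2 M" "g \<in> L2 M" shows "integrable M (\<lambda>z. f z * g z)"
 using L2_inner_integrable[OF assms] by simp

lemma L2_norm_triangle:
 assumes "f \<in> L2 M" "g \<in> L2 M"
 shows "L2_norm M (\<lambda>z. f z + g z) \<le> L2_norm M f + L2_norm M g"
proof (rule power2_le_imp_le)
 have "(L2_norm M (\<lambda>z. f z + g z))\<^sup>2
   = (\<integral>z. (norm (f z))\<^sup>2 + 2 * (f z \<bullet> g z) + (norm (g z))\<^sup>2 \<partial>M)"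
  unfolding L2_norm_power2
  by (intro lebesgue_cong refl)
   (simp add: power2_norm_eq_inner inner_add_left inner_add_right inner_commute)
 also have "\<dots> = (L2_norm M f)\<^sup>2 + 2 * (\<integral>z. f z \<bullet> g z \<partial>M) + (L2_norm M g)\<^sup>2"
  unfolding L2_norm_power2 using assms by (simp add: L2_integrable L2_inner_integrable)
 also have "\<dots> \<le> (L2_norm M f)\<^sup>2 + 2 * (L2_norm M f * L2_norm M g) + (L2_norm M g)\<^sup>2"
  using L2_Cauchy_Schwarz[OF assms] by linarith
 finally show "(L2_norm M (\<lambda>z. f z + g z))\<^sup>2 \<le> (L2_norm M f + L2_norm M g)\<^sup>2"
  by (simp add: power2_sum)
qed (simp add: L2_norm_nonneg)

lemma L2_norm_triangle_diff:
 assumes "f \<in> L2 M" "g \<in> L2 M" "h \<in> L2 M"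
 shows "L2_norm M (\<lambda>z. f z - h z) \<le> L2_norm M (\<lambda>z. f z - g z) + L2_norm M (\<lambda>z. g z - h z)"
 using L2_norm_triangle[OF L2_diff[OF assms(1,2)] L2_diff[OF assms(2,3)]] by simp

lemma L2_norm_diff_bound:
 assumes "f \<in> L2 M" "g \<in> L2 M"
 shows "\<bar>L2_norm M f - L2_norm M g\<bar> \<le> L2_norm M (\<lambda>z. f z - g z)"
 using L2_norm_triangle_diff[of f M g "\<lambda>_. 0"] L2_norm_triangle_diff[of g M f "\<lambda>_. 0"]
  L2_norm_minus_commute[of M f g] assms by simp

subsection \<open>Convergence\<close>

lemma L2_limD:
 assumes "L2_lim M F f"
 shows "F k \<in> L2 M" "f \<in> L2 M" "(\<lambda>k. L2_norm M (\<lambda>z. F k z - f z)) \<longlonglongrightarrow> 0"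
 using assms by (auto simp: L2_lim_def)

lemma L2_lim_bound:
 assumes "\<And>k. F k \<in> L2 M" "f \<in> L2 M" "\<And>k. L2_norm M (\<lambda>z. F k z - f z) \<le> c k" "c \<longlonglongrightarrow> 0"
 shows "L2_lim M F f"
 unfolding L2_lim_def
 using assms by (auto intro: tendsto_sandwich[of "\<lambda>_. 0" _ _ c] simp: L2_norm_nonneg)

lemma L2_lim_diff:
 assumes "L2_lim M F f" "L2_lim M G g" shows "L2_lim M (\<lambda>k z. F k z - G k z) (\<lambda>z. f z - g z)"
proof (rule L2_lim_bound)
 note D = L2_limD[OF assms(1)] L2_limD[OF assms(2)]
 show "(\<lambda>z. F k z - G k z) \<in> L2 M" for k using D by (intro L2_diff)
 show "(\<lambda>z. f z - g z) \<in> L2 M" using D by (intro L2_diff)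
 show "L2_norm M (\<lambda>z. F k z - G k z - (f z - g z))
   \<le> L2_norm M (\<lambda>z. F k z - f z) + L2_norm M (\<lambda>z. G k z - g z)" for k
  using L2_norm_triangle[of "\<lambda>z. F k z - f z" M "\<lambda>z. g z - G k z"] D
   L2_norm_minus_commute[of M g "G k"] by (simp add: L2_diff algebra_simps)
 show "(\<lambda>k. L2_norm M (\<lambda>z. F k z - f z) + L2_norm M (\<lambda>z. G k z - g z)) \<longlonglongrightarrow> 0"
  using tendsto_add[OF D(3) D(6)] by simp
qed

lemma L2_lim_norm:
 assumes "L2_lim M F f" shows "(\<lambda>k. L2_norm M (F k)) \<longlonglongrightarrow> L2_norm M f"
proof -
 have "(\<lambda>k. L2_norm M (F k) - L2_norm M f) \<longlonglongrightarrow> 0"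
  by (rule Lim_null_comparison[OF _ L2_limD(3)[OF assms]])
   (use L2_limD[OF assms] in \<open>auto intro!: always_eventually L2_norm_diff_bound\<close>)
 then show ?thesis using LIM_zero_iff by blast
qed

lemma L2_lim_inner:
 assumes "L2_lim M F f" "L2_lim M G g"
 shows "(\<lambda>k. \<integral>z. F k z \<bullet> G k z \<partial>M) \<longlonglongrightarrow> (\<integral>z. f z \<bullet> g z \<partial>M)"
proof -
 note D = L2_limD[OF assms(1)] L2_limD[OF assms(2)]
 have *: "(\<integral>z. F k z \<bullet> G k z \<partial>M) - (\<integral>z. f z \<bullet> g z \<partial>M)
   = (\<integral>z. (F k z - f z) \<bullet> G k z \<partial>M) + (\<integral>z. f z \<bullet> (G k z - g z) \<partial>M)" for k
  using D by (simp add: inner_diff_left inner_diff_right L2_inner_integrable)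
 have "(\<lambda>k. (\<integral>z. F k z \<bullet> G k z \<partial>M) - (\<integral>z. f z \<bullet> g z \<partial>M)) \<longlonglongrightarrow> 0"
 proof (rule Lim_null_comparison)
  show "\<forall>\<^sub>F k in sequentially. norm ((\<integral>z. F k z \<bullet> G k z \<partial>M) - (\<integral>z. f z \<bullet> g z \<partial>M))
   \<le> L2_norm M (\<lambda>z. F k z - f z) * L2_norm M (G k) + L2_norm M f * L2_norm M (\<lambda>z. G k z - g z)"
  proof (rule always_eventually, rule allI)
   fix k
   show "norm ((\<integral>z. F k z \<bullet> G k z \<partial>M) - (\<integral>z. f z \<bullet> g z \<partial>M))
   \<le> L2_norm M (\<lambda>z. F k z - f z) * L2_norm M (G k) + L2_norm M f * L2_norm M (\<lambda>z. G k z - g z)"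
    unfolding * real_norm_def
    using L2_Cauchy_Schwarz[OF L2_diff[OF D(1,2)] D(4), of k k]
     L2_Cauchy_Schwarz[OF D(2) L2_diff[OF D(4,5)], of k] by linarith
  qed
  show "(\<lambda>k. L2_norm M (\<lambda>z. F k z - f z) * L2_norm M (G k)
    + L2_norm M f * L2_norm M (\<lambda>z. G k z - g z)) \<longlonglongrightarrow> 0"
   using tendsto_add[OF tendsto_mult[OF D(3) L2_lim_norm[OF assms(2)]] tendsto_mult_left[OF D(6)]]
   by simp
 qed
 then show ?thesis using LIM_zero_iff by blast
qed

lemma L2_lim_const: "f \<in> L2 M ==> L2_lim M (\<lambda>_. f) f"
 by (simp add: L2_lim_def)

lemma L2_lim_bounded_mult:
 assumes "L2_lim M F f" "\<eta> \<in> borel_measurable M" "\<And>z. z \<in> space M ==> \<bar>\<eta> z\<bar> \<le> B"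
 shows "L2_lim M (\<lambda>k z. \<eta> z *\<^sub>R F k z) (\<lambda>z. \<eta> z *\<^sub>R f z)"
proof (rule L2_lim_bound)
 note D = L2_limD[OF assms(1)]
 show "(\<lambda>z. \<eta> z *\<^sub>R F k z) \<in> L2 M" for k by (rule L2_bounded_mult) (use D assms in auto)
 show "(\<lambda>z. \<eta> z *\<^sub>R f z) \<in> L2 M" by (rule L2_bounded_mult) (use D assms in auto)
 show "L2_norm M (\<lambda>z. \<eta> z *\<^sub>R F k z - \<eta> z *\<^sub>R f z) \<le> L2_norm M (\<lambda>z. B *\<^sub>R (F k z - f z))" for k
  by (rule L2_mono) (use D assms in
   \<open>force intro!: L2_scaleR L2_diff AE_I2 mult_right_mono simp flip: scaleR_diff_right\<close>)+
 show "(\<lambda>k. L2_norm M (\<lambda>z. B *\<^sub>R (F k z - f z))) \<longlonglongrightarrow> 0"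
  unfolding L2_norm_scaleR using tendsto_mult_left[OF D(3)] by simp
qed

text \<open>Riesz-Fischer for an arbitrary measure. A subsequence with increments of norm at most
  4^-k converges almost everywhere; Fatou's lemma along it then controls the distance of every late
  member of the original sequence to the limit.\<close>

theorem L2_complete:
 assumes F: "\<And>n. F n \<in> L2 M"
  and C: "\<And>\<epsilon>. 0 < \<epsilon> ==> \<exists>N. \<forall>m\<ge>N. \<forall>n\<ge>N. L2_norm M (\<lambda>z. F m z - F n z) < \<epsilon>"
 shows "\<exists>f. L2_lim M F f"
proof -
 have "\<exists>N. \<forall>k::nat. (\<forall>m\<ge>N k. \<forall>n\<ge>N k. L2_norm M (\<lambda>z. F m z - F n z) < (1/4)^k)"
  by (rule choice) (use C in auto)
 then obtain N where N: "\<And>k m n. m \<ge> N k ==> n \<ge> N k ==> L2_norm M (\<lambda>z. F m z - F n z) < (1/4)^k"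
  by blast
 \<comment> \<open>Partial sums turn the unordered thresholds \<open>N k\<close> into a monotone
   sequence lying above them.\<close>
 define r where "r k = (\<Sum>i\<le>k. N i)" for k
 have rN: "r k \<ge> N k" "r (Suc k) \<ge> r k" for k
  by (auto simp: r_def intro: member_le_sum)
 have rmono: "r l \<ge> N k" if "l \<ge> k" for l k
  using lift_Suc_mono_le[of r, OF rN(2) that] rN(1)[of k] by linarith
 define G where "G k = F (r k)" for k
 have G: "G k \<in> L2 M" for k by (simp add: G_def F)
 have Gm[measurable]: "G k \<in> borel_measurable M" and Fm[measurable]: "F k \<in> borel_measurable M" for k
  using G F by (auto dest: L2_measurable)
 define d where "d k z = G (Suc k) z - G k z" for k z
 have d: "d k \<in> L2 M" for k unfolding d_def by (intro L2_diff G)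
 have dn: "L2_norm M (d k) \<le> (1/4)^k" for k
  unfolding d_def G_def using N[of k "r (Suc k)" "r k"] rN rmono[of k "Suc k"] by (simp add: less_imp_le)
 \<comment> \<open>The squared increments integrate to at most 16^-k, so they stay summable after
   multiplication by 4^k. Finiteness of the sum at a point bounds its terms, which forces
   \<open>norm (d k z)\<close> below a constant times 2^-k there. Working with squares avoids a
   triangle inequality for infinite sums.\<close>
 have "(\<integral>\<^sup>+z. (\<Sum>k. ennreal (4^k * (norm (d k z))\<^sup>2)) \<partial>M) = (\<Sum>k. \<integral>\<^sup>+z. ennreal (4^k * (norm (d k z))\<^sup>2) \<partial>M)"
  by (rule nn_integral_suminf) (simp add: d_def)
 also have "\<dots> = (\<Sum>k. ennreal (4^k * (L2_norm M (d k))\<^sup>2))"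
  using L2_integrable[OF d] by (intro suminf_cong) (subst nn_integral_eq_integral, auto simp: L2_norm_power2)
 also have "\<dots> \<le> (\<Sum>k. ennreal ((1/4)^k))"
 proof (rule suminf_le)
  fix k
  have "4^k * (L2_norm M (d k))\<^sup>2 \<le> 4^k * ((1/4)^k)\<^sup>2"
   by (intro mult_left_mono power_mono dn) (auto simp: L2_norm_nonneg)
  also have "\<dots> = (4 * (1/16)::real)^k" by (simp only: power_mult_distrib power2_eq_square) (simp add: power_mult_distrib[symmetric])
  finally show "ennreal (4^k * (L2_norm M (d k))\<^sup>2) \<le> ennreal ((1/4)^k)" by (intro ennreal_leI) simp
 qed auto
 also have "\<dots> < \<infinity>"
  by (simp add: suminf_ennreal2 less_top[symmetric] summable_geometric)
 finally have fin: "(\<integral>\<^sup>+z. (\<Sum>k. ennreal (4^k * (norm (d k z))\<^sup>2)) \<partial>M) < \<infinity>" .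
 have "AE z in M. (\<Sum>k. ennreal (4^k * (norm (d k z))\<^sup>2)) \<noteq> \<infinity>"
  by (rule nn_integral_PInf_AE) (use fin in \<open>auto simp: d_def\<close>)
 then have conv: "AE z in M. convergent (\<lambda>k. G k z)"
 proof eventually_elim
  case (elim z)
  have "summable (\<lambda>k. 4^k * (norm (d k z))\<^sup>2)"
   using elim by (intro summable_suminf_not_top) auto
  then have "Bseq (\<lambda>k. 4^k * (norm (d k z))\<^sup>2)"
   by (intro convergent_imp_Bseq) (auto simp: convergent_def dest: summable_LIMSEQ_zero)
  then obtain K where K: "K > 0" "\<And>k. norm (4^k * (norm (d k z))\<^sup>2) \<le> K" by (auto elim: BseqE)
  have "norm (d k z) \<le> sqrt K * (1/2)^k" for k
  proof (rule power2_le_imp_le)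
   have "(norm (d k z))\<^sup>2 \<le> K / 4^k"
    using K(2)[of k] by (simp add: field_simps)
   also have "\<dots> = (sqrt K * (1/2)^k)\<^sup>2"
    using K(1) power_mult_distrib[of "1/2::real" "1/2" k]
    by (simp add: power_mult_distrib power2_eq_square field_simps)
   finally show "(norm (d k z))\<^sup>2 \<le> (sqrt K * (1/2)^k)\<^sup>2" .
  qed (use K in auto)
  moreover have "summable (\<lambda>k. sqrt K * (1/2)^k)" by (intro summable_mult summable_geometric) simp
  ultimately have "summable (\<lambda>k. d k z)"
   using summable_comparison_test'[of "\<lambda>k. sqrt K * (1/2)^k" 0 "\<lambda>k. d k z"] by blast
  then have "convergent (\<lambda>n. \<Sum>k<n. d k z)" by (simp add: summable_iff_convergent)
  then have "convergent (\<lambda>n. G n z - G 0 z)" by (simp add: d_def sum_lessThan_telescope[of "\<lambda>k. G k z"])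
  then show "convergent (\<lambda>n. G n z)"
   using convergent_add_const_iff[of "- G 0 z" "\<lambda>n. G n z"] by simp
 qed
 define f where "f z = lim (\<lambda>k. G k z)" for z
 have fm[measurable]: "f \<in> borel_measurable M"
  unfolding f_def by (rule borel_measurable_lim_metric) measurable
 \<comment> \<open>Fatou's lemma is applied for fixed \<open>n\<close>, letting only the subsequence
   index \<open>j\<close> grow; the Cauchy bound at level \<open>k\<close> passes to the limit
   unchanged.\<close>
 have bd: "(\<integral>\<^sup>+z. ennreal ((norm (F n z - f z))\<^sup>2) \<partial>M) \<le> ennreal (((1/4)^k)\<^sup>2)" if n: "n \<ge> N k" for n k
 proof -
  have "(\<integral>\<^sup>+z. ennreal ((norm (F n z - f z))\<^sup>2) \<partial>M)
    = (\<integral>\<^sup>+z. liminf (\<lambda>j. ennreal ((norm (F n z - G j z))\<^sup>2)) \<partial>M)"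
  proof (rule nn_integral_cong_AE)
   show "AE z in M. ennreal ((norm (F n z - f z))\<^sup>2) = liminf (\<lambda>j. ennreal ((norm (F n z - G j z))\<^sup>2))"
    using conv
   proof eventually_elim
    case (elim z)
    then have "(\<lambda>j. G j z) \<longlonglongrightarrow> f z" by (simp add: f_def convergent_LIMSEQ_iff)
    then have "(\<lambda>j. ennreal ((norm (F n z - G j z))\<^sup>2)) \<longlonglongrightarrow> ennreal ((norm (F n z - f z))\<^sup>2)"
     by (intro tendsto_intros)
    from lim_imp_Liminf[OF sequentially_bot this] show ?case by (rule sym)
   qed
  qed
  also have "\<dots> \<le> liminf (\<lambda>j. \<integral>\<^sup>+z. ennreal ((norm (F n z - G j z))\<^sup>2) \<partial>M)"
   by (rule nn_integral_liminf) measurable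
  also have "\<dots> \<le> ennreal (((1/4)^k)\<^sup>2)"
  proof (rule Liminf_le)
   show "\<forall>\<^sub>F j in sequentially. (\<integral>\<^sup>+z. ennreal ((norm (F n z - G j z))\<^sup>2) \<partial>M) \<le> ennreal (((1/4)^k)\<^sup>2)"
    using eventually_ge_at_top[of k]
   proof eventually_elim
    case (elim j)
    have "L2_norm M (\<lambda>z. F n z - G j z) \<le> (1/4)^k"
     unfolding G_def using N[OF n rmono[OF elim]] by simp
    then show ?case
     by (subst L2_nn_integral[OF L2_diff[OF F G]]) (auto intro!: ennreal_leI power_mono simp: L2_norm_nonneg)
   qed
  qed simp
  finally show ?thesis .
 qed
 have FL: "(\<lambda>z. F n z - f z) \<in> L2 M" "L2_norm M (\<lambda>z. F n z - f z) \<le> (1/4)^k" if "n \<ge> N k" for n k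
  using L2_norm_le_nnI[OF _ bd[OF that]] by auto
 have fL: "f \<in> L2 M" using L2_diff[OF F[of "N 0"] FL(1)[of 0 "N 0"]] by simp
 have "(\<lambda>k. L2_norm M (\<lambda>z. F k z - f z)) \<longlonglongrightarrow> 0"
 proof (rule LIMSEQ_I)
  fix e :: real assume "0 < e"
  then obtain k where k: "(1/4)^k < e" using real_arch_pow_inv[of e "1/4"] by auto
  then show "\<exists>no. \<forall>n\<ge>no. norm (L2_norm M (\<lambda>z. F n z - f z) - 0) < e"
   by (intro exI[of _ "N k"]) (use FL(2)[where k=k] in \<open>force simp: L2_norm_nonneg\<close>)
 qed
 with F fL show ?thesis by (auto simp: L2_lim_def)
qed

section \<open>Translations and reflections; continuity of translation in L1 and L2\<close>

lemma distr_lborel_translate: "distr lborel borel (\<lambda>z. z - c) = lborel" for c :: "'a::euclidean_space"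
proof -
 have "(\<lambda>z. z - c) = (+) (- c)" by auto
 then show ?thesis by (simp add: lborel_distr_plus)
qed

lemma distr_lborel_reflect: "distr lborel borel (\<lambda>z. c - z) = lborel" for c :: "'a::euclidean_space"
 using lborel_affine[of "-1" c] by (simp add: density_1)

lemma nn_integral_lborel_translate:
 fixes c :: "'a::euclidean_space"
 assumes [measurable]: "f \<in> Borel"
 shows "(\<integral>\<^sup>+z. f (z - c) \<partial>lborel) = (\<integral>\<^sup>+z. f z \<partial>lborel)"
 by (subst (2) distr_lborel_translate[of c, symmetric]) (simp add: nn_integral_distr)

lemma nn_integral_lborel_reflect:
 fixes c :: "'a::euclidean_space"
 assumes [measurable]: "f \<in> Borel"
 shows "(\<integral>\<^sup>+z. f (c - z) \<partial>lborel) = (\<integral>\<^sup>+z. f z \<partial>lborel)"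
 by (subst (2) distr_lborel_reflect[of c, symmetric]) (simp add: nn_integral_distr)

lemma lborel_integral_translate:
 fixes c :: "'a::euclidean_space" and f :: "'a => 'b::{banach, second_countable_topology}"
 assumes [measurable]: "f \<in> Borel"
 shows "(LBINT z. f (z - c)) = (LBINT z. f z)"
 by (subst (2) distr_lborel_translate[of c, symmetric]) (simp add: integral_distr)

lemma lborel_integral_reflect:
 fixes c :: "'a::euclidean_space" and f :: "'a => 'b::{banach, second_countable_topology}"
 assumes [measurable]: "f \<in> Borel"
 shows "(LBINT z. f (c - z)) = (LBINT z. f z)"
 by (subst (2) distr_lborel_reflect[of c, symmetric]) (simp add: integral_distr)

lemma lborel_integrable_translate:
 fixes c :: "'a::euclidean_space" and f :: "'a => 'b::{banach, second_countable_topology}"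
 assumes "integrable lborel f"
 shows "integrable lborel (\<lambda>z. f (z - c))"
proof -
 have "integrable (distr lborel borel (\<lambda>z. z - c)) f"
  using assms by (simp add: distr_lborel_translate)
 then show ?thesis by (rule integrable_distr[rotated]) simp
qed

lemma L2_translate:
 fixes c :: "'a::euclidean_space"
 assumes "f \<in> L2 lborel" shows "(\<lambda>z. f (z - c)) \<in> L2 lborel"
proof (rule L2I)
 have [measurable]: "f \<in> Borel" using L2_measurable[OF assms] by simp
 show "(\<lambda>z. f (z - c)) \<in> borel_measurable lborel" by simp
 show "integrable lborel (\<lambda>z. (norm (f (z - c)))\<^sup>2)"
  using lborel_integrable_translate[OF L2_integrable[OF assms]] .
qed

lemma L2_norm_translate:
 fixes c :: "'a::euclidean_space"
 assumes "f \<in> Borel" shows "nrm (\<lambda>z. f (z - c)) = nrm f"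
proof -
 have "(\<lambda>z. (norm (f z))\<^sup>2) \<in> Borel" using assms by measurable
 from lborel_integral_translate[OF this, of c] show ?thesis by (simp add: L2_norm_def)
qed

text \<open>Induction over integrable functions. The core is the indicator of an open set U, where z
  in U forces z - c n into U for large n; other Borel sets are enclosed in open sets of slightly
  larger measure, and limits are handled by a three-term estimate whose middle term is the induction
  hypothesis.\<close>

lemma L1_translation_continuous:
 fixes f :: "'a::euclidean_space => 'b::{banach, second_countable_topology}"
 assumes "integrable lborel f" "c \<longlonglongrightarrow> 0"
 shows "(\<lambda>n. \<integral>z. norm (f (z - c n) - f z) \<partial>lborel) \<longlonglongrightarrow> 0"
 using assms(1)
proof (induction rule: integrable_induct)
 case (base A v)
 have open_case: "(\<lambda>n. \<integral>z. \<bar>indicator U (z - c n) - indicat_real U z\<bar> \<partial>lborel) \<longlonglongrightarrow> (0::real)"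
  if U: "open U" "emeasure lborel U < \<infinity>" for U :: "'a set"
 proof -
  have [measurable]: "U \<in> sets borel" using U by simp
  have iU: "integrable lborel (indicator U :: 'a => real)" using U by simp
  note iUt = lborel_integrable_translate[OF iU]
  \<comment> \<open>Openness controls only the points that leave U. Since U and its translate have
    equal measure, as much is gained as is lost, so twice the positive part gives the full L1
    distance.\<close>
  have eq: "(LBINT z. \<bar>indicator U (z - c n) - indicat_real U z\<bar>)
   = 2 * (LBINT z. max 0 (indicator U z - indicator U (z - c n) :: real))" for n
  proof -
   have "(LBINT z. \<bar>indicator U (z - c n) - indicat_real U z\<bar>)
    = (LBINT z. 2 * max 0 (indicator U z - indicator U (z - c n) :: real)
       - (indicator U z - indicator U (z - c n)))"
    by (intro lebesgue_cong) (auto simp: max_def)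
   also have "\<dots> = 2 * (LBINT z. max 0 (indicator U z - indicator U (z - c n)))
     - ((LBINT z. indicator U z) - (LBINT z. indicator U (z - c n)))"
    using iU iUt[of "c n"] by (subst lebesgue_diff) auto
   finally show ?thesis using lborel_integral_translate[of "indicator U :: 'a => real" "c n"] by simp
  qed
  have "(\<lambda>n. \<integral>z. max 0 (indicator U z - indicator U (z - c n)) \<partial>lborel) \<longlonglongrightarrow> (\<integral>z. (0::real) \<partial>(lborel :: 'a measure))"
  proof (rule integral_dominated_convergence[where w="indicator U"])
   show "AE z in lborel. (\<lambda>n. max 0 (indicator U z - indicator U (z - c n))) \<longlonglongrightarrow> (0::real)"
   proof (rule AE_I2)
    fix z :: 'a
    show "(\<lambda>n. max 0 (indicator U z - indicator U (z - c n))) \<longlonglongrightarrow> (0::real)"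
    proof (cases "z \<in> U")
     case True
     have "(\<lambda>n. z - c n) \<longlonglongrightarrow> z - 0" by (intro tendsto_intros assms)
     then have "\<forall>\<^sub>F n in sequentially. z - c n \<in> U"
      using True U(1) topological_tendstoD by fastforce
     then have "\<forall>\<^sub>F n in sequentially. max 0 (indicator U z - indicator U (z - c n)) = (0::real)"
      by eventually_elim (simp add: True)
     then show ?thesis by (rule tendsto_eventually)
    next
     case False
     then have "max 0 (indicator U z - indicator U (z - c n)) = (0::real)" for n by simp
     then show ?thesis by simp
    qed
   qed
   show "AE z in lborel. norm (max 0 (indicator U z - indicator U (z - c n)) :: real) \<le> indicator U z" for n
    by (auto simp: max_def indicator_def)
  qed (use iU in auto)
  then show ?thesis unfolding eq by (intro tendsto_mult_right_zero) simp
 qed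
 have [measurable]: "A \<in> sets borel" using base by simp
 have iA: "integrable lborel (indicator A :: 'a => real)" using base by simp
 have main: "(\<lambda>n. \<integral>z. \<bar>indicator A (z - c n) - indicat_real A z\<bar> \<partial>lborel) \<longlonglongrightarrow> (0::real)"
 proof (rule LIMSEQ_I)
  fix e :: real assume e: "0 < e"
  obtain U where U: "open U" "A \<subseteq> U" "emeasure lborel (U - A) < e/4"
   using outer_regular_lborel[of A "e/4"] e base by auto
  have [measurable]: "U \<in> sets borel" using U by simp
  have "emeasure lborel U \<le> emeasure lborel A + emeasure lborel (U - A)"
   using U by (intro order.trans[OF _ emeasure_subadditive]) (auto intro!: emeasure_mono)
  also have "\<dots> < \<infinity>" using base U(3) by (auto simp: less_top[symmetric] top_unique)
  finally have Uf: "emeasure lborel U < \<infinity>" .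
  have UAf: "emeasure lborel (U - A) < \<infinity>" using U(3) by (simp add: order.strict_trans)
  have iUA: "integrable lborel (indicator (U - A) :: 'a => real)" using UAf by simp
  have iU: "integrable lborel (indicator U :: 'a => real)" using Uf by simp
  have UA: "(LBINT z. indicator (U - A) z) < e/4"
  proof -
   have "emeasure lborel (U - A) = ennreal (measure lborel (U - A))"
    using UAf by (intro emeasure_eq_ennreal_measure) auto
   with U(3) have "measure lborel (U - A) < e/4" by (simp add: ennreal_less_iff)
   then show ?thesis by simp
  qed
  obtain N where N: "\<And>n. n \<ge> N ==> (LBINT z. \<bar>indicator U (z - c n) - indicat_real U z\<bar>) < e/2"
   using LIMSEQ_D[OF open_case[OF U(1) Uf], of "e/2"] e by auto
  show "\<exists>no. \<forall>n\<ge>no. norm ((LBINT z. \<bar>indicator A (z - c n) - indicat_real A z\<bar>) - 0) < e"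
  proof (intro exI[of _ N] allI impI)
   fix n assume n: "n \<ge> N"
   note tr = lborel_integrable_translate[where c="c n"]
   have "(LBINT z. \<bar>indicator A (z - c n) - indicat_real A z\<bar>)
    \<le> (LBINT z. \<bar>indicator U (z - c n) - indicat_real U z\<bar> + indicator (U - A) (z - c n) + indicator (U - A) z)"
    using U(2)
    by (intro integral_mono integrable_plus integrable_minus
      integrable_abs tr[OF iA] tr[OF iU] tr[OF iUA] iA iU iUA) (auto simp: indicator_def)
   also have "\<dots> = (LBINT z. \<bar>indicator U (z - c n) - indicat_real U z\<bar>)
     + (LBINT z. indicator (U - A) (z - c n)) + (LBINT z. indicator (U - A) z)"
    using tr[OF iU] tr[OF iUA] iU iUA by simp
   also have "\<dots> < e/2 + e/4 + e/4"
    using N[OF n] UA lborel_integral_translate[of "indicator (U - A) :: 'a => real" "c n"] by auto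
   finally show "norm ((LBINT z. \<bar>indicator A (z - c n) - indicat_real A z\<bar>) - 0) < e" by simp
  qed
 qed
 have "norm (indicator A (z - c n) *\<^sub>R v - indicator A z *\<^sub>R v)
  = norm v * \<bar>indicator A (z - c n) - indicat_real A z\<bar>" for n z
  by (simp flip: scaleR_diff_left)
 then show ?case using tendsto_mult_left[OF main, of "norm v"] by simp
next
 case (add f g)
 note tr = lborel_integrable_translate
 have le: "(LBINT z. norm (f (z - c n) + g (z - c n) - (f z + g z)))
   \<le> (LBINT z. norm (f (z - c n) - f z)) + (LBINT z. norm (g (z - c n) - g z))" for n
  proof -
   have "(LBINT z. norm (f (z - c n) + g (z - c n) - (f z + g z)))
    \<le> (LBINT z. norm (f (z - c n) - f z) + norm (g (z - c n) - g z))"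
    using add.hyps tr[OF add.hyps(1), of "c n"] tr[OF add.hyps(2), of "c n"]
    by (intro integral_mono) (auto simp: add_diff_add norm_triangle_ineq)
   also have "\<dots> = (LBINT z. norm (f (z - c n) - f z)) + (LBINT z. norm (g (z - c n) - g z))"
    using add.hyps tr[OF add.hyps(1), of "c n"] tr[OF add.hyps(2), of "c n"]
    by (intro lebesgue_add) auto
   finally show "(LBINT z. norm (f (z - c n) + g (z - c n) - (f z + g z)))
    \<le> (LBINT z. norm (f (z - c n) - f z)) + (LBINT z. norm (g (z - c n) - g z))" .
  qed
 show ?case
  by (rule Lim_null_comparison[OF _ tendsto_add_zero[OF add.IH]])
   (use le in \<open>auto intro!: always_eventually\<close>)
next
 case (lim f s)
 note tr = lborel_integrable_translate
 \<comment> \<open>The approximants satisfy \<open>norm (s i z)\<close> at most twice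
   \<open>norm (f z)\<close>, which explains the factor 3 of the dominating function.\<close>
 have L: "(\<lambda>i. \<integral>z. norm (s i z - f z) \<partial>lborel) \<longlonglongrightarrow> (\<integral>z. 0 \<partial>(lborel :: 'a measure))"
 proof (rule integral_dominated_convergence[where w="\<lambda>z. 3 * norm (f z)"])
  show "AE z in lborel. (\<lambda>i. norm (s i z - f z)) \<longlonglongrightarrow> 0"
  proof (rule AE_I2)
   fix z :: 'a
   have "(\<lambda>i. s i z) \<longlonglongrightarrow> f z" using lim.hyps(2) by simp
   then show "(\<lambda>i. norm (s i z - f z)) \<longlonglongrightarrow> 0"
    by (simp add: LIM_zero tendsto_norm_zero)
  qed
  show "AE z in lborel. norm (norm (s i z - f z)) \<le> 3 * norm (f z)" for i
  proof (rule AE_I2)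
   fix z :: 'a
   show "norm (norm (s i z - f z)) \<le> 3 * norm (f z)"
    using lim.hyps(3)[of z i] norm_triangle_ineq4[of "s i z" "f z"] by simp
  qed
 qed (use lim.hyps(1,4) in auto)
 show ?case
 proof (rule LIMSEQ_I)
  fix e :: real assume e: "0 < e"
  obtain i where i: "(LBINT z. norm (s i z - f z)) < e/3"
   using LIMSEQ_D[OF L, of "e/3"] e by fastforce
  obtain N where N: "\<And>n. n \<ge> N ==> (LBINT z. norm (s i (z - c n) - s i z)) < e/3"
   using LIMSEQ_D[OF lim.IH[of i], of "e/3"] e by auto
  show "\<exists>no. \<forall>n\<ge>no. norm ((LBINT z. norm (f (z - c n) - f z)) - 0) < e"
  proof (intro exI[of _ N] allI impI)
   fix n assume n: "n \<ge> N"
   have d: "integrable lborel (\<lambda>z. norm (s i z - f z))" using lim.hyps(1,4) by simp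
   note int = lim.hyps(1)[of i] lim.hyps(4) tr[OF lim.hyps(1)[of i], of "c n"] tr[OF lim.hyps(4), of "c n"] d tr[OF d, of "c n"]
   have [measurable]: "s i \<in> Borel" "f \<in> Borel"
    using lim.hyps(1)[of i] lim.hyps(4) by auto
   have "(LBINT z. norm (f (z - c n) - f z))
    \<le> (LBINT z. norm (s i (z - c n) - f (z - c n)) + norm (s i (z - c n) - s i z) + norm (s i z - f z))"
   proof (intro integral_mono)
    fix z :: 'a
    show "norm (f (z - c n) - f z) \<le> norm (s i (z - c n) - f (z - c n)) + norm (s i (z - c n) - s i z) + norm (s i z - f z)"
     using norm_triangle_ineq[of "s i (z - c n) - s i z" "s i z - f z"]
      norm_triangle_ineq4[of "s i (z - c n) - f z" "s i (z - c n) - f (z - c n)"] by simp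
   qed (use int in auto)
   also have "\<dots> = (LBINT z. norm (s i (z - c n) - f (z - c n)))
     + (LBINT z. norm (s i (z - c n) - s i z)) + (LBINT z. norm (s i z - f z))"
    using int by (simp)
   also have "\<dots> < e/3 + e/3 + e/3"
    using N[OF n] i lborel_integral_translate[of "\<lambda>z. norm (s i z - f z)" "c n"] by auto
   finally show "norm ((LBINT z. norm (f (z - c n) - f z)) - 0) < e" by simp
  qed
 qed
qed

text \<open>Since \<open>(a |a| - b |b|) \<bullet> (a - b) \<ge> (|a| + |b|) |a - b|\<^sup>2 / 2\<close>.\<close>

lemma norm_diff_power2_le:
 fixes a b :: "'a::real_inner"
 shows "(norm (a - b))\<^sup>2 \<le> 2 * norm (norm a *\<^sub>R a - norm b *\<^sub>R b)"
proof (cases "a = b")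
 case False
 define s where "s = norm a + norm b"
 have d: "norm (a - b) \<le> s" "0 < norm (a - b)" using False by (auto simp: s_def norm_triangle_ineq4)
 have "2 * ((norm a *\<^sub>R a - norm b *\<^sub>R b) \<bullet> (a - b))
  = s * (norm (a - b))\<^sup>2 + s * (norm a - norm b)\<^sup>2"
 proof -
  have "2 * ((norm a *\<^sub>R a - norm b *\<^sub>R b) \<bullet> (a - b))
   = 2 * (norm a * (norm a)\<^sup>2) + 2 * (norm b * (norm b)\<^sup>2) - s * (2 * (a \<bullet> b))"
   by (simp add: s_def inner_diff_left inner_diff_right inner_commute power2_norm_eq_inner algebra_simps)
  also have "2 * (a \<bullet> b) = (norm a)\<^sup>2 + (norm b)\<^sup>2 - (norm (a - b))\<^sup>2"
   by (simp add: dot_norm_neg)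
  finally show ?thesis by (simp add: s_def algebra_simps power2_eq_square)
 qed
 then have "s * (norm (a - b))\<^sup>2 \<le> 2 * ((norm a *\<^sub>R a - norm b *\<^sub>R b) \<bullet> (a - b))"
  using d by (simp add: s_def)
 also have "\<dots> \<le> 2 * (norm (norm a *\<^sub>R a - norm b *\<^sub>R b) * norm (a - b))"
  using norm_cauchy_schwarz[of "norm a *\<^sub>R a - norm b *\<^sub>R b" "a - b"] by linarith
 finally have "s * norm (a - b) \<le> 2 * norm (norm a *\<^sub>R a - norm b *\<^sub>R b)"
  using d(2) by (simp add: power2_eq_square mult.assoc[symmetric])
 then show ?thesis using mult_right_mono[OF d(1), of "norm (a - b)"] by (simp add: power2_eq_square)
qed simp

text \<open>The map sending a to |a| a carries L2 functions to integrable ones, and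
  \<open>norm_diff_power2_le\<close> bounds squared L2 differences by L1 differences of the images.
  This reduces the claim to \<open>L1_translation_continuous\<close>, with no density argument in
  L2.\<close>

lemma L2_translation_continuous:
 fixes f :: "'a::euclidean_space => 'b::euclidean_space"
 assumes f: "f \<in> L2 lborel" and c: "c \<longlonglongrightarrow> 0"
 shows "(\<lambda>n. nrm (\<lambda>z. f (z - c n) - f z)) \<longlonglongrightarrow> 0"
proof -
 have [measurable]: "f \<in> Borel" using L2_measurable[OF f] by simp
 define F where "F z = norm (f z) *\<^sub>R f z" for z
 have [measurable]: "F \<in> Borel" unfolding F_def by measurable
 have F: "integrable lborel F"
  by (rule integrable_bd[OF L2_integrable[OF f]])
   (auto simp: F_def power2_eq_square)
 have "(LBINT z. (norm (f (z - c n) - f z))\<^sup>2) \<le> (LBINT z. 2 * norm (F (z - c n) - F z))" for n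
 proof (rule integral_mono)
  show "integrable lborel (\<lambda>z. 2 * norm (F (z - c n) - F z))"
   using F lborel_integrable_translate[OF F, of "c n"] by simp
 qed (use L2_integrable[OF L2_diff[OF L2_translate[OF f] f]] in \<open>auto simp: F_def norm_diff_power2_le\<close>)
 note le = this
 have "(\<lambda>n. \<integral>z. 2 * norm (F (z - c n) - F z) \<partial>lborel) \<longlonglongrightarrow> 0"
  using tendsto_mult_left[OF L1_translation_continuous[OF F c], of 2] by simp
 then have "(\<lambda>n. \<integral>z. (norm (f (z - c n) - f z))\<^sup>2 \<partial>lborel) \<longlonglongrightarrow> 0"
  by (rule Lim_null_comparison[rotated]) (use le in \<open>auto intro!: always_eventually\<close>)
 from tendsto_real_sqrt[OF this] show ?thesis by (simp add: L2_norm_def)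
qed

lemma L2_translation_uniform:
 fixes f :: "'a::euclidean_space => 'b::euclidean_space"
 assumes f: "f \<in> L2 lborel" and "0 < \<epsilon>"
 shows "\<exists>\<delta>>0. \<forall>\<xi>. norm \<xi> < \<delta> --> nrm (\<lambda>z. f (z - \<xi>) - f z) < \<epsilon>"
proof (rule ccontr)
 assume "\<not> ?thesis"
 then have "\<forall>n. \<exists>\<xi>. norm \<xi> < inverse (real (Suc n)) \<and> \<not> nrm (\<lambda>z. f (z - \<xi>) - f z) < \<epsilon>"
  by (metis inverse_positive_iff_positive of_nat_0_less_iff zero_less_Suc)
 then obtain c where c: "\<And>n. norm (c n) < inverse (real (Suc n))"
  "\<And>n. \<not> nrm (\<lambda>z. f (z - c n) - f z) < \<epsilon>" by metis
 have "c \<longlonglongrightarrow> 0"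
  by (rule Lim_null_comparison[OF _ LIMSEQ_inverse_real_of_nat])
   (use c(1) in \<open>auto intro!: always_eventually less_imp_le\<close>)
 from LIMSEQ_D[OF L2_translation_continuous[OF f this] assms(2)] c(2) show False
  by (auto simp: L2_norm_nonneg)
qed

subsection \<open>Averaging\<close>

text \<open>Convolution with a measure rather than with a density, because two families are needed:
  mollifiers, and the Steklov measures, which live on the time axis and have no density in
  space-time.\<close>

definition avg :: "'a::euclidean_space measure => ('a => 'b::euclidean_space) => 'a => 'b" where
 "avg \<mu> F z = (\<integral>\<xi>. F (z - \<xi>) \<partial>\<mu>)"

locale averaging =
 fixes \<mu> :: "'a::euclidean_space measure"
 assumes sets_\<mu> [measurable_cong, simp]: "sets \<mu> = sets borel"
  and total: "emeasure \<mu> UNIV = 1"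
begin

lemma space_\<mu> [simp]: "space \<mu> = UNIV"
 using sets_eq_imp_space_eq[OF sets_\<mu>] by simp

sublocale finite_measure \<mu> by standard (simp add: total)

sublocale P: pair_sigma_finite lborel \<mu> ..

lemma measure_UNIV [simp]: "measure \<mu> UNIV = 1"
 by (simp add: measure_def total)

lemma Jensen_square:
 fixes f :: "'a => 'b::euclidean_space"
 assumes [measurable]: "f \<in> Borel"
 shows "ennreal ((norm (\<integral>x. f x \<partial>\<mu>))\<^sup>2) \<le> (\<integral>\<^sup>+x. ennreal ((norm (f x))\<^sup>2) \<partial>\<mu>)"
proof (cases "(\<integral>\<^sup>+x. ennreal ((norm (f x))\<^sup>2) \<partial>\<mu>) < \<infinity>")
 case True
 have f: "f \<in> L2 \<mu>" by (rule L2_nnI) (use True in auto)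
 have 1: "(\<lambda>_. 1::real) \<in> L2 \<mu>" by (intro L2I) auto
 have "norm (\<integral>x. f x \<partial>\<mu>) \<le> (\<integral>x. norm (f x) * norm (1::real) \<partial>\<mu>)" by simp
 also have "\<dots> \<le> L2_norm \<mu> f * L2_norm \<mu> (\<lambda>_. 1::real)" by (rule L2_Cauchy_Schwarz_norm[OF f 1])
 also have "\<dots> = L2_norm \<mu> f" by (simp add: L2_norm_def)
 finally have "(norm (\<integral>x. f x \<partial>\<mu>))\<^sup>2 \<le> (L2_norm \<mu> f)\<^sup>2" by (intro power_mono) auto
 then show ?thesis by (simp add: L2_nn_integral[OF f])
qed (auto simp: less_top[symmetric])

context
 fixes F :: "'a => 'b::euclidean_space"
 assumes F: "F \<in> L2 lborel"
begin

lemma F_measurable [measurable]: "F \<in> Borel" using L2_measurable[OF F] by simp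

lemma avg_measurable [measurable]: "avg \<mu> F \<in> Borel"
proof -
 have "(\<lambda>z. \<integral>\<xi>. F (z - \<xi>) \<partial>\<mu>) \<in> borel_measurable lborel" by measurable
 then show ?thesis by (simp add: avg_def[abs_def])
qed

lemma avg_AE_integrable: "AE z in lborel. integrable \<mu> (\<lambda>\<xi>. F (z - \<xi>))"
proof -
 have "(\<integral>\<^sup>+z. \<integral>\<^sup>+\<xi>. ennreal ((norm (F (z - \<xi>)))\<^sup>2) \<partial>\<mu> \<partial>lborel)
   = (\<integral>\<^sup>+\<xi>. \<integral>\<^sup>+z. ennreal ((norm (F (z - \<xi>)))\<^sup>2) \<partial>lborel \<partial>\<mu>)"
  by (rule P.Fubini'[symmetric]) measurable
 also have "\<dots> = (\<integral>\<^sup>+\<xi>. ennreal ((nrm F)\<^sup>2) \<partial>\<mu>)"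
 proof (rule nn_integral_cong)
  fix \<xi>
  show "(\<integral>\<^sup>+z. ennreal ((norm (F (z - \<xi>)))\<^sup>2) \<partial>lborel) = ennreal ((nrm F)\<^sup>2)"
   using nn_integral_lborel_translate[of "\<lambda>z. ennreal ((norm (F z))\<^sup>2)" \<xi>] L2_nn_integral[OF F] by simp
 qed
 also have "\<dots> < \<infinity>" by (simp add: total)
 finally have fin: "(\<integral>\<^sup>+z. \<integral>\<^sup>+\<xi>. ennreal ((norm (F (z - \<xi>)))\<^sup>2) \<partial>\<mu> \<partial>lborel) < \<infinity>" .
 have "AE z in lborel. (\<integral>\<^sup>+\<xi>. ennreal ((norm (F (z - \<xi>)))\<^sup>2) \<partial>\<mu>) \<noteq> \<infinity>"
  by (rule nn_integral_PInf_AE) (use fin in auto)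
 then show ?thesis
 proof eventually_elim
  case (elim z)
  have f: "(\<lambda>\<xi>. F (z - \<xi>)) \<in> L2 \<mu>" by (rule L2_nnI) (use elim in \<open>auto simp: less_top\<close>)
  have 1: "(\<lambda>_. 1::real) \<in> L2 \<mu>" by (intro L2I) auto
  have "integrable \<mu> (\<lambda>\<xi>. norm (F (z - \<xi>)))"
   using L2_norm_mult_integrable[OF f 1] by simp
  then show ?case by (rule integrable_bd) auto
 qed
qed

text \<open>Jensen's inequality followed by an exchange of integrals: an average of translates is no
  farther from \<open>F\<close> than the worst translate that \<mu> charges.
  \<open>avg_AE_integrable\<close> justifies writing the difference under the integral sign.\<close>

lemma avg_diff_bound:
 assumes r: "AE \<xi> in \<mu>. norm \<xi> < r"
  and b: "\<And>\<xi>. norm \<xi> < r ==> nrm (\<lambda>z. F (z - \<xi>) - F z) \<le> c" and "0 \<le> c"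
 shows "(\<lambda>z. avg \<mu> F z - F z) \<in> L2 lborel" "nrm (\<lambda>z. avg \<mu> F z - F z) \<le> c"
proof -
 have "(\<integral>\<^sup>+z. ennreal ((norm (avg \<mu> F z - F z))\<^sup>2) \<partial>lborel)
  \<le> (\<integral>\<^sup>+z. \<integral>\<^sup>+\<xi>. ennreal ((norm (F (z - \<xi>) - F z))\<^sup>2) \<partial>\<mu> \<partial>lborel)"
 proof (rule nn_integral_mono_AE, use avg_AE_integrable in eventually_elim)
  fix z assume "integrable \<mu> (\<lambda>\<xi>. F (z - \<xi>))"
  then have "avg \<mu> F z - F z = (\<integral>\<xi>. F (z - \<xi>) - F z \<partial>\<mu>)" by (simp add: avg_def)
  then show "ennreal ((norm (avg \<mu> F z - F z))\<^sup>2) \<le> (\<integral>\<^sup>+\<xi>. ennreal ((norm (F (z - \<xi>) - F z))\<^sup>2) \<partial>\<mu>)"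
   by (simp add: Jensen_square)
 qed
 also have "\<dots> = (\<integral>\<^sup>+\<xi>. \<integral>\<^sup>+z. ennreal ((norm (F (z - \<xi>) - F z))\<^sup>2) \<partial>lborel \<partial>\<mu>)"
  by (rule P.Fubini'[symmetric]) measurable
 also have "\<dots> \<le> (\<integral>\<^sup>+\<xi>. ennreal (c\<^sup>2) \<partial>\<mu>)"
 proof (rule nn_integral_mono_AE, use r in eventually_elim)
  fix \<xi> :: 'a assume "norm \<xi> < r"
  from b[OF this] have "(nrm (\<lambda>z. F (z - \<xi>) - F z))\<^sup>2 \<le> c\<^sup>2"
   by (intro power_mono) (auto simp: L2_norm_nonneg)
  then show "(\<integral>\<^sup>+z. ennreal ((norm (F (z - \<xi>) - F z))\<^sup>2) \<partial>lborel) \<le> ennreal (c\<^sup>2)"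
   by (simp add: L2_nn_integral[OF L2_diff[OF L2_translate[OF F] F]])
 qed
 also have "\<dots> = ennreal (c\<^sup>2)" by (simp add: total)
 finally have *: "(\<integral>\<^sup>+z. ennreal ((norm (avg \<mu> F z - F z))\<^sup>2) \<partial>lborel) \<le> ennreal (c\<^sup>2)" .
 show "(\<lambda>z. avg \<mu> F z - F z) \<in> L2 lborel" "nrm (\<lambda>z. avg \<mu> F z - F z) \<le> c"
  using L2_norm_le_nnI[OF _ * \<open>0 \<le> c\<close>] by auto
qed

lemma avg_L2: "avg \<mu> F \<in> L2 lborel"
proof -
 have "(\<integral>\<^sup>+z. ennreal ((norm (avg \<mu> F z))\<^sup>2) \<partial>lborel)
  \<le> (\<integral>\<^sup>+z. \<integral>\<^sup>+\<xi>. ennreal ((norm (F (z - \<xi>)))\<^sup>2) \<partial>\<mu> \<partial>lborel)"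
  unfolding avg_def by (intro nn_integral_mono Jensen_square) measurable
 also have "\<dots> = (\<integral>\<^sup>+\<xi>. \<integral>\<^sup>+z. ennreal ((norm (F (z - \<xi>)))\<^sup>2) \<partial>lborel \<partial>\<mu>)"
  by (rule P.Fubini'[symmetric]) measurable
 also have "\<dots> = (\<integral>\<^sup>+\<xi>. ennreal ((nrm F)\<^sup>2) \<partial>\<mu>)"
 proof (rule nn_integral_cong)
  fix \<xi>
  show "(\<integral>\<^sup>+z. ennreal ((norm (F (z - \<xi>)))\<^sup>2) \<partial>lborel) = ennreal ((nrm F)\<^sup>2)"
   using nn_integral_lborel_translate[of "\<lambda>z. ennreal ((norm (F z))\<^sup>2)" \<xi>] L2_nn_integral[OF F] by simp
 qed
 also have "\<dots> = ennreal ((nrm F)\<^sup>2)" by (simp add: total)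
 finally show ?thesis by (intro L2_nnI) (auto intro: le_less_trans)
qed

lemma avg_inner:
 assumes \<Phi>: "\<Phi> \<in> L2 lborel"
 shows "(LBINT z. avg \<mu> F z \<bullet> \<Phi> z) = (\<integral>\<xi>. (LBINT z. F (z - \<xi>) \<bullet> \<Phi> z) \<partial>\<mu>)"
proof -
 have [measurable]: "\<Phi> \<in> Borel" using L2_measurable[OF \<Phi>] by simp
 have "(\<integral>\<^sup>+p. ennreal (norm (case p of (z,\<xi>) => F (z - \<xi>) \<bullet> \<Phi> z)) \<partial>(lborel \<Otimes>\<^sub>M \<mu>))
  = (\<integral>\<^sup>+\<xi>. \<integral>\<^sup>+z. ennreal (norm (F (z - \<xi>) \<bullet> \<Phi> z)) \<partial>lborel \<partial>\<mu>)"
  by (subst P.nn_integral_snd[symmetric]) (auto simp: split_beta')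
 also have "\<dots> \<le> (\<integral>\<^sup>+\<xi>. ennreal (nrm F * nrm \<Phi>) \<partial>\<mu>)"
 proof (rule nn_integral_mono)
  fix \<xi>
  note t = L2_translate[OF F, of \<xi>]
  have "(\<integral>\<^sup>+z. ennreal (norm (F (z - \<xi>) \<bullet> \<Phi> z)) \<partial>lborel) \<le> (\<integral>\<^sup>+z. ennreal (norm (F (z - \<xi>)) * norm (\<Phi> z)) \<partial>lborel)"
   by (intro nn_integral_mono ennreal_leI) (simp add: Cauchy_Schwarz_ineq2)
  also have "\<dots> = ennreal (LBINT z. norm (F (z - \<xi>)) * norm (\<Phi> z))"
   by (rule nn_integral_eq_integral[OF L2_norm_mult_integrable[OF t \<Phi>]]) auto
  also have "\<dots> \<le> ennreal (nrm F * nrm \<Phi>)"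
   using L2_Cauchy_Schwarz_norm[OF t \<Phi>] by (simp add: L2_norm_translate ennreal_leI)
  finally show "(\<integral>\<^sup>+z. ennreal (norm (F (z - \<xi>) \<bullet> \<Phi> z)) \<partial>lborel) \<le> ennreal (nrm F * nrm \<Phi>)" .
 qed
 also have "\<dots> < \<infinity>" by (simp add: total)
 finally have int: "integrable (lborel \<Otimes>\<^sub>M \<mu>) (\<lambda>(z,\<xi>). F (z - \<xi>) \<bullet> \<Phi> z)"
  by (intro integrableI_bounded) auto
 have "(\<integral>\<xi>. (LBINT z. F (z - \<xi>) \<bullet> \<Phi> z) \<partial>\<mu>) = (LBINT z. (\<integral>\<xi>. F (z - \<xi>) \<bullet> \<Phi> z \<partial>\<mu>))"
  by (rule P.Fubini_integral[OF int])
 also have "\<dots> = (LBINT z. avg \<mu> F z \<bullet> \<Phi> z)"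
 proof (rule integral_cong_AE)
  show "AE z in lborel. (\<integral>\<xi>. F (z - \<xi>) \<bullet> \<Phi> z \<partial>\<mu>) = avg \<mu> F z \<bullet> \<Phi> z"
   using avg_AE_integrable by eventually_elim (auto simp: avg_def)
 qed measurable
 finally show ?thesis by simp
qed

end
end

text \<open>All that enters is concentration near the origin, which covers off-centre mollifiers as
  well as one-sided averages in time.\<close>

lemma avg_lim:
 fixes F :: "'a::euclidean_space => 'b::euclidean_space"
 assumes \<mu>: "\<And>n. averaging (\<mu> n)" and F: "F \<in> L2 lborel"
  and r: "\<And>n. AE \<xi> in \<mu> n. norm \<xi> < r n" "r \<longlonglongrightarrow> 0"
 shows "L2_lim lborel (\<lambda>n. avg (\<mu> n) F) F"
 unfolding L2_lim_def
proof (intro conjI allI F averaging.avg_L2[OF \<mu> F] LIMSEQ_I)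
 fix e :: real assume e: "0 < e"
 obtain d where d: "d > 0" "\<And>\<xi>. norm \<xi> < d ==> nrm (\<lambda>z. F (z - \<xi>) - F z) < e/2"
  using L2_translation_uniform[OF F, of "e/2"] e by auto
 obtain N where N: "\<And>n. n \<ge> N ==> \<bar>r n\<bar> < d" using LIMSEQ_D[OF r(2) d(1)] by auto
 show "\<exists>no. \<forall>n\<ge>no. norm (nrm (\<lambda>z. avg (\<mu> n) F z - F z) - 0) < e"
 proof (intro exI[of _ N] allI impI)
  fix n assume "n \<ge> N"
  then have "r n < d" using N[of n] by auto
  then have "nrm (\<lambda>z. avg (\<mu> n) F z - F z) \<le> e/2"
   by (intro averaging.avg_diff_bound(2)[OF \<mu> F r(1)] less_imp_le[OF d(2)]) (use e in auto)
  then show "norm (nrm (\<lambda>z. avg (\<mu> n) F z - F z) - 0) < e"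
   using e by (simp add: L2_norm_nonneg)
 qed
qed

subsection \<open>Kernels\<close>

text \<open>The substitution of z - \<xi> for \<xi> turns the kernel into a weight on translates of
  \<open>f\<close>. Each translate has the same norm, so Cauchy-Schwarz in z followed by integration
  against |K| gives the bound of Young's convolution inequality.\<close>

lemma kernel_integrable:
 fixes f g :: "'a::euclidean_space => real"
 assumes K: "integrable lborel K" and f: "f \<in> L2 lborel" and g: "g \<in> L2 lborel"
 shows "integrable (lborel \<Otimes>\<^sub>M lborel) (\<lambda>(z,\<xi>). K (z - \<xi>) * f \<xi> * g z)"
proof -
 have [measurable]: "K \<in> Borel" "f \<in> Borel" "g \<in> Borel"
  using K L2_measurable[OF f] L2_measurable[OF g] by auto
 have "(\<integral>\<^sup>+p. ennreal (norm (case p of (z,\<xi>) => K (z - \<xi>) * f \<xi> * g z)) \<partial>(lborel \<Otimes>\<^sub>M lborel))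
  = (\<integral>\<^sup>+z. \<integral>\<^sup>+\<xi>. ennreal \<bar>K (z - \<xi>) * f \<xi> * g z\<bar> \<partial>lborel \<partial>lborel)"
  by (subst lborel.nn_integral_fst[symmetric]) (auto simp: split_beta')
 also have "\<dots> = (\<integral>\<^sup>+z. \<integral>\<^sup>+\<xi>. ennreal \<bar>K \<xi> * f (z - \<xi>) * g z\<bar> \<partial>lborel \<partial>lborel)"
 proof (rule nn_integral_cong)
  fix z
  show "(\<integral>\<^sup>+\<xi>. ennreal \<bar>K (z - \<xi>) * f \<xi> * g z\<bar> \<partial>lborel) = (\<integral>\<^sup>+\<xi>. ennreal \<bar>K \<xi> * f (z - \<xi>) * g z\<bar> \<partial>lborel)"
   using nn_integral_lborel_reflect[of "\<lambda>\<xi>. ennreal \<bar>K \<xi> * f (z - \<xi>) * g z\<bar>" z] by simp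
 qed
 also have "\<dots> = (\<integral>\<^sup>+\<xi>. \<integral>\<^sup>+z. ennreal \<bar>K \<xi> * f (z - \<xi>) * g z\<bar> \<partial>lborel \<partial>lborel)"
  by (rule lborel_pair.Fubini'[symmetric]) measurable
 also have "\<dots> \<le> (\<integral>\<^sup>+\<xi>. ennreal \<bar>K \<xi>\<bar> * ennreal (nrm f * nrm g) \<partial>lborel)"
 proof (rule nn_integral_mono)
  fix \<xi>
  note t = L2_translate[OF f, of \<xi>]
  have "(\<integral>\<^sup>+z. ennreal \<bar>K \<xi> * f (z - \<xi>) * g z\<bar> \<partial>lborel)
   = ennreal \<bar>K \<xi>\<bar> * (\<integral>\<^sup>+z. ennreal (norm (f (z - \<xi>)) * norm (g z)) \<partial>lborel)"
   by (subst nn_integral_cmult[symmetric]) (auto simp: abs_mult ennreal_mult mult.assoc)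
  also have "(\<integral>\<^sup>+z. ennreal (norm (f (z - \<xi>)) * norm (g z)) \<partial>lborel) = ennreal (LBINT z. norm (f (z - \<xi>)) * norm (g z))"
   by (rule nn_integral_eq_integral[OF L2_norm_mult_integrable[OF t g]]) auto
  also have "\<dots> \<le> ennreal (nrm f * nrm g)"
   using L2_Cauchy_Schwarz_norm[OF t g] by (simp add: L2_norm_translate ennreal_leI)
  finally show "(\<integral>\<^sup>+z. ennreal \<bar>K \<xi> * f (z - \<xi>) * g z\<bar> \<partial>lborel) \<le> ennreal \<bar>K \<xi>\<bar> * ennreal (nrm f * nrm g)"
   by (simp add: mult_left_mono)
 qed
 also have "\<dots> = (\<integral>\<^sup>+\<xi>. ennreal \<bar>K \<xi>\<bar> \<partial>lborel) * ennreal (nrm f * nrm g)"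
  by (rule nn_integral_multc) simp
 also have "\<dots> < \<infinity>"
  using integrable_iff_bounded[of lborel K] K by (simp add: ennreal_mult_less_top)
 finally show ?thesis by (intro integrableI_bounded) auto
qed

lemma kernel_swap:
 fixes f g :: "'a::euclidean_space => real"
 assumes K: "integrable lborel K" and f: "f \<in> L2 lborel" and g: "g \<in> L2 lborel"
 shows "(LBINT \<xi>. f \<xi> * (LBINT z. K (z - \<xi>) * g z)) = (LBINT z. (LBINT \<xi>. K (z - \<xi>) * f \<xi>) * g z)"
  "integrable lborel (\<lambda>\<xi>. f \<xi> * (LBINT z. K (z - \<xi>) * g z))"
  "integrable lborel (\<lambda>z. (LBINT \<xi>. K (z - \<xi>) * f \<xi>) * g z)"
proof -
 note int = kernel_integrable[OF K f g]
 have a: "(LBINT z. K (z - \<xi>) * f \<xi> * g z) = f \<xi> * (LBINT z. K (z - \<xi>) * g z)" for \<xi>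
  by (subst integral_mult_right_zero[symmetric]) (simp add: ac_simps)
 have b: "(LBINT \<xi>. K (z - \<xi>) * f \<xi> * g z) = (LBINT \<xi>. K (z - \<xi>) * f \<xi>) * g z" for z
  by simp
 show "(LBINT \<xi>. f \<xi> * (LBINT z. K (z - \<xi>) * g z)) = (LBINT z. (LBINT \<xi>. K (z - \<xi>) * f \<xi>) * g z)"
  using lborel_pair.Fubini_integral[OF int] by (simp only: a b)
 show "integrable lborel (\<lambda>\<xi>. f \<xi> * (LBINT z. K (z - \<xi>) * g z))"
  using lborel_pair.integrable_snd[OF int] by (simp only: a)
 show "integrable lborel (\<lambda>z. (LBINT \<xi>. K (z - \<xi>) * f \<xi>) * g z)"
  using lborel_pair.integrable_fst[OF int] by (simp only: b)
qed

subsection \<open>Continuously differentiable functions\<close>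

lemma C1I:
 assumes "\<And>z. (\<phi> has_derivative \<phi>' z) (at z)" "\<And>b. b \<in> Basis ==> continuous_on UNIV (\<lambda>z. \<phi>' z b)"
 shows "C1 \<phi>" "\<D> \<phi> z = \<phi>' z"
proof -
 have eq: "\<D> \<phi> z = \<phi>' z" for z using frechet_derivative_at[OF assms(1)] by simp
 show "\<D> \<phi> z = \<phi>' z" by (rule eq)
 show "C1 \<phi>" using assms by (auto simp: C1_def eq differentiable_def)
qed

lemma C1_has_derivative: "C1 \<phi> ==> (\<phi> has_derivative \<D> \<phi> z) (at z)"
 by (simp add: C1_def frechet_derivative_works[symmetric])

lemma C1_linear: "C1 \<phi> ==> bounded_linear (\<D> \<phi> z)"
 using C1_has_derivative has_derivative_bounded_linear by blast

lemma C1_continuous: "C1 \<phi> ==> continuous_on UNIV \<phi>"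
 using C1_has_derivative has_derivative_continuous by (metis continuous_at_imp_continuous_on)

lemma frechet_components:
 assumes "C1 \<phi>"
 shows "\<D> \<phi> z v = (\<Sum>b\<in>Basis. (v \<bullet> b) * \<D> \<phi> z b)"
proof -
 interpret bounded_linear "\<D> \<phi> z" by (rule C1_linear[OF assms])
 have "\<D> \<phi> z v = \<D> \<phi> z (\<Sum>b\<in>Basis. (v \<bullet> b) *\<^sub>R b)"
  by (simp add: euclidean_representation)
 then show ?thesis by (simp add: sum scaleR)
qed

lemma C1_continuous_deriv:
 assumes "C1 \<phi>" shows "continuous_on UNIV (\<lambda>z. \<D> \<phi> z v)"
proof (subst frechet_components[OF assms], intro continuous_intros)
qed (use assms in \<open>auto simp: C1_def\<close>)

lemma C1_measurable [measurable_dest]: "C1 \<phi> ==> \<phi> \<in> Borel"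
 by (rule borel_measurable_continuous_onI[OF C1_continuous])

lemma C1_deriv_measurable: "C1 \<phi> ==> (\<lambda>z. \<D> \<phi> z v) \<in> Borel"
 by (rule borel_measurable_continuous_onI[OF C1_continuous_deriv])

lemma C1_mult:
 assumes "C1 \<phi>" "C1 \<psi>"
 shows "C1 (\<lambda>z. \<phi> z * \<psi> z)"
  "\<D> (\<lambda>z. \<phi> z * \<psi> z) z
   = (\<lambda>v. \<phi> z * \<D> \<psi> z v + \<D> \<phi> z v * \<psi> z)"
proof -
 have d: "((\<lambda>z. \<phi> z * \<psi> z) has_derivative
  (\<lambda>v. \<phi> z * \<D> \<psi> z v + \<D> \<phi> z v * \<psi> z)) (at z)" for z
  by (rule has_derivative_mult[OF C1_has_derivative[OF assms(1)] C1_has_derivative[OF assms(2)]])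
 show "C1 (\<lambda>z. \<phi> z * \<psi> z)"
  "\<D> (\<lambda>z. \<phi> z * \<psi> z) z
   = (\<lambda>v. \<phi> z * \<D> \<psi> z v + \<D> \<phi> z v * \<psi> z)"
  by (rule C1I[OF d], intro continuous_intros C1_continuous_deriv C1_continuous assms)+
qed

lemma C1_compose_real:
 fixes h :: "real => real"
 assumes "C1 \<phi>" "\<And>s. (h has_real_derivative h' s) (at s)" "continuous_on UNIV h'"
 shows "C1 (\<lambda>z. h (\<phi> z))"
  "\<D> (\<lambda>z. h (\<phi> z)) z = (\<lambda>v. h' (\<phi> z) * \<D> \<phi> z v)"
proof -
 have d: "((\<lambda>z. h (\<phi> z)) has_derivative (\<lambda>v. h' (\<phi> z) * \<D> \<phi> z v)) (at z)" for z
  using diff_chain_at[OF C1_has_derivative[OF assms(1), of z]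
    assms(2)[of "\<phi> z", unfolded has_field_derivative_def]] by (simp add: o_def)
 have c: "continuous_on UNIV (\<lambda>z. h' (\<phi> z))"
  by (rule continuous_on_compose2[OF assms(3) C1_continuous[OF assms(1)]]) simp
 show "C1 (\<lambda>z. h (\<phi> z))"
  "\<D> (\<lambda>z. h (\<phi> z)) z = (\<lambda>v. h' (\<phi> z) * \<D> \<phi> z v)"
  by (rule C1I[OF d], intro continuous_intros C1_continuous_deriv c assms)+
qed

lemma C1_compose_affine:
 assumes "C1 \<phi>" "bounded_linear L"
 shows "C1 (\<lambda>z. \<phi> (L z + c))"
  "\<D> (\<lambda>z. \<phi> (L z + c)) z = (\<lambda>v. \<D> \<phi> (L z + c) (L v))"
proof -
 have l: "((\<lambda>z. L z + c) has_derivative L) (at z)" for z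
  using has_derivative_add[OF bounded_linear_imp_has_derivative[OF assms(2)] has_derivative_const[of c]] by simp
 have d: "((\<lambda>z. \<phi> (L z + c)) has_derivative (\<lambda>v. \<D> \<phi> (L z + c) (L v))) (at z)" for z
  using diff_chain_at[OF l C1_has_derivative[OF assms(1), of "L z + c"]] by (simp add: o_def)
 have c: "continuous_on UNIV (\<lambda>z. \<D> \<phi> (L z + c) v)" for v
  by (rule continuous_on_compose2[OF C1_continuous_deriv[OF assms(1)]
     continuous_on_add[OF linear_continuous_on[OF assms(2)] continuous_on_const]]) simp
 show "C1 (\<lambda>z. \<phi> (L z + c))"
  "\<D> (\<lambda>z. \<phi> (L z + c)) z = (\<lambda>v. \<D> \<phi> (L z + c) (L v))"
  by (rule C1I[OF d c])+
qed

lemmas C1_translate = C1_compose_affine[OF _ bounded_linear_ident, of _ "- c" for c, simplified]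
lemmas C1_reflect = C1_compose_affine[OF _ bounded_linear_minus[OF bounded_linear_ident], simplified]
lemmas C1_fst = C1_compose_affine[OF _ bounded_linear_fst, of _ 0, simplified]
lemmas C1_snd = C1_compose_affine[OF _ bounded_linear_snd, of _ 0, simplified]

lemma C1_real:
 fixes h :: "real => real"
 assumes "\<And>s. (h has_real_derivative h' s) (at s)" "continuous_on UNIV h'"
 shows "C1 h" "\<D> h s = (\<lambda>v. h' s * v)"
proof -
 have "(h has_derivative (*) (h' s)) (at s)" for s using assms(1) by (simp add: has_field_derivative_def)
 from C1I[OF this] assms(2) show "C1 h" "\<D> h s = (\<lambda>v. h' s * v)" by auto
qed

subsection \<open>Test functions\<close>

lemma test_funI:
 assumes "C1 \<phi>" "compact S" "S \<subseteq> Q" "\<And>z. z \<notin> S ==> \<phi> z = 0"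
 shows "\<phi> \<in> test_fun Q"
proof -
 have "closure {z. \<phi> z \<noteq> 0} \<subseteq> S"
  using assms by (intro closure_minimal) (auto simp: compact_imp_closed)
 then show ?thesis
  using assms by (auto simp: test_fun_def intro: compact_closure[THEN iffD2] bounded_subset[OF compact_imp_bounded[OF assms(2)]]
    closure_subset[THEN subset_trans])
qed

lemma test_fun_C1: "\<phi> \<in> test_fun Q ==> C1 \<phi>"
 by (simp add: test_fun_def)

lemma test_fun_deriv_0:
 assumes "\<phi> \<in> test_fun Q" "z \<notin> closure {z. \<phi> z \<noteq> 0}"
 shows "\<D> \<phi> z v = 0"
proof -
 have "((\<lambda>_. 0) has_derivative \<D> \<phi> z) (at z)"
  by (rule has_derivative_transform_within_open[OF C1_has_derivative[OF test_fun_C1[OF assms(1)]]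
     open_Compl[OF closed_closure[of "{z. \<phi> z \<noteq> 0}"]]])
   (use assms(2) closure_subset[of "{z. \<phi> z \<noteq> 0}"] in auto)
 then have "\<D> \<phi> z = (\<lambda>_. 0)"
  using has_derivative_unique has_derivative_const by blast
 then show ?thesis by simp
qed

lemma compact_support_L2:
 fixes f :: "'a::euclidean_space => real"
 assumes c: "continuous_on UNIV f" and S: "compact S" "\<And>z. z \<notin> S ==> f z = 0"
 shows "f \<in> L2 lborel" "integrable lborel f" "\<exists>B\<ge>0. \<forall>z. \<bar>f z\<bar> \<le> B"
proof -
 have [measurable]: "f \<in> Borel" by (rule borel_measurable_continuous_onI[OF c])
 have "bounded (f ` S)"
  using compact_continuous_image[OF continuous_on_subset[OF c] S(1)] by (simp add: compact_imp_bounded)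
 then obtain B where "\<And>z. z \<in> S ==> \<bar>f z\<bar> \<le> B" by (auto simp: bounded_iff)
 then have B: "\<bar>f z\<bar> \<le> \<bar>B\<bar>" for z using S(2)[of z] by (cases "z \<in> S") force+
 then show "\<exists>B\<ge>0. \<forall>z. \<bar>f z\<bar> \<le> B" by (intro exI[of _ "\<bar>B\<bar>"]) auto
 have Sm: "S \<in> sets lborel" "emeasure lborel S < \<infinity>"
  using S(1) by (auto simp: compact_imp_closed borel_closed intro: order.strict_trans2[OF emeasure_compact_finite])
 show "integrable lborel f"
  by (rule integrableI_bounded_set[of S, where B="\<bar>B\<bar>"]) (use Sm S B in auto)
 have "integrable lborel (\<lambda>z. (norm (f z))\<^sup>2)"
 proof (rule integrableI_bounded_set[of S, where B="\<bar>B\<bar>\<^sup>2"])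
  show "AE z\<in>S in lborel. norm ((norm (f z))\<^sup>2) \<le> \<bar>B\<bar>\<^sup>2"
   using B by (auto intro!: AE_I2 power_mono simp: power2_le_iff_abs_le abs_le_square_iff)
 qed (use Sm S in auto)
 then show "f \<in> L2 lborel" by (auto intro: L2I)
qed

lemma test_fun_L2:
 assumes "\<phi> \<in> test_fun Q"
 shows "\<phi> \<in> L2 lborel" "integrable lborel \<phi>" "\<exists>B\<ge>0. \<forall>z. \<bar>\<phi> z\<bar> \<le> B"
  "(\<lambda>z. \<D> \<phi> z v) \<in> L2 lborel"
  "integrable lborel (\<lambda>z. \<D> \<phi> z v)"
  "\<exists>B\<ge>0. \<forall>z. \<bar>\<D> \<phi> z v\<bar> \<le> B"
proof -
 let ?S = "closure {z. \<phi> z \<noteq> 0}"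
 have S: "compact ?S" "\<And>z. z \<notin> ?S ==> \<phi> z = 0"
  using assms closure_subset[of "{z. \<phi> z \<noteq> 0}"] by (auto simp: test_fun_def)
 note C = test_fun_C1[OF assms]
 show "\<phi> \<in> L2 lborel" "integrable lborel \<phi>" "\<exists>B\<ge>0. \<forall>z. \<bar>\<phi> z\<bar> \<le> B"
  using compact_support_L2[OF C1_continuous[OF C] S] by auto
 show "(\<lambda>z. \<D> \<phi> z v) \<in> L2 lborel"
  "integrable lborel (\<lambda>z. \<D> \<phi> z v)"
  "\<exists>B\<ge>0. \<forall>z. \<bar>\<D> \<phi> z v\<bar> \<le> B"
  using compact_support_L2[OF C1_continuous_deriv[OF C] S(1) test_fun_deriv_0[OF assms]] by auto
qed

section \<open>Bump functions and mollifiers\<close>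

definition sq_pos :: "real => real" where "sq_pos s = (max 0 s)\<^sup>2"

lemma sq_pos_deriv: "(sq_pos has_real_derivative 2 * max 0 s) (at s)"
proof (cases s "0::real" rule: linorder_cases)
 case less
 have "(sq_pos has_real_derivative 0) (at s)"
  by (rule has_field_derivative_transform_within_open[of "\<lambda>_. 0" 0 s "{..<0}"])
   (use less in \<open>auto simp: sq_pos_def\<close>)
 then show ?thesis using less by simp
next
 case greater
 have "(sq_pos has_real_derivative 2 * s) (at s)"
  by (rule has_field_derivative_transform_within_open[of "\<lambda>s. s\<^sup>2" _ s "{0<..}"])
   (use greater in \<open>auto simp: sq_pos_def intro!: derivative_eq_intros\<close>)
 then show ?thesis using greater by simp
next
 case equal
 have "((\<lambda>h. (sq_pos (0 + h) - sq_pos 0) / h) \<longlongrightarrow> 0) (at 0)"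
 proof (rule Lim_null_comparison)
  show "\<forall>\<^sub>F h in at 0. norm ((sq_pos (0 + h) - sq_pos 0) / h) \<le> \<bar>h\<bar>"
   by (rule always_eventually) (auto simp: sq_pos_def power2_eq_square abs_mult max_def)
  show "((\<lambda>h. \<bar>h\<bar>) \<longlongrightarrow> 0) (at (0::real))" by (auto intro!: tendsto_eq_intros)
 qed
 then show ?thesis using equal by (simp add: DERIV_def)
qed

lemma sq_pos_continuous: "continuous_on UNIV (\<lambda>s. 2 * max 0 s :: real)"
 by (intro continuous_intros)

text \<open>Test functions have one continuous derivative, so the squared positive part of r^2 -
  |x|^2 is smooth enough and keeps the gradient explicit. The function is even, hence its
  derivatives are odd.\<close>

definition bump :: "real => 'a::euclidean_space => real" where
 "bump r x = sq_pos (r\<^sup>2 - x \<bullet> x)"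

lemma
 fixes x v :: "'a::euclidean_space"
 shows bump_C1: "C1 (bump r :: 'a => real)"
  and bump_deriv: "\<D> (bump r) x v = - 4 * max 0 (r\<^sup>2 - x \<bullet> x) * (x \<bullet> v)"
proof -
 have d: "((\<lambda>x::'a. r\<^sup>2 - x \<bullet> x) has_derivative (\<lambda>v. - 2 * (x \<bullet> v))) (at x)" for x
  by (auto intro!: derivative_eq_intros simp: inner_commute)
 have C: "C1 (\<lambda>x::'a. r\<^sup>2 - x \<bullet> x)" "\<And>x. \<D> (\<lambda>x::'a. r\<^sup>2 - x \<bullet> x) x = (\<lambda>v. - 2 * (x \<bullet> v))"
  by (rule C1I[OF d], intro continuous_intros)+
 note R = C1_compose_real[OF C(1) sq_pos_deriv sq_pos_continuous]
 show "C1 (bump r :: 'a => real)" using R(1) by (simp add: bump_def[abs_def])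
 show "\<D> (bump r) x v = - 4 * max 0 (r\<^sup>2 - x \<bullet> x) * (x \<bullet> v)"
  using fun_cong[OF R(2)[of x], of v] by (simp add: bump_def[abs_def] C)
qed

lemma bump_nonneg: "0 \<le> bump r x" by (simp add: bump_def sq_pos_def)

lemma bump_pos: "0 < r ==> norm x < r ==> 0 < bump r x"
 by (simp add: bump_def sq_pos_def power2_norm_eq_inner[symmetric] power_strict_mono)

lemma bump_0: "0 < r ==> r \<le> norm x ==> bump r x = 0"
 by (simp add: bump_def sq_pos_def power2_norm_eq_inner[symmetric] power_mono)

lemma bump_minus: "bump r (- x) = bump r x" by (simp add: bump_def)

lemma bump_test_fun:
 assumes "0 < r" "cball c r \<subseteq> Q" shows "(\<lambda>z. bump r (z - c)) \<in> test_fun Q"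
proof (rule test_funI[OF C1_translate(1)[OF bump_C1] compact_cball assms(2)])
 fix z assume "z \<notin> cball c r"
 then show "bump r (z - c) = 0" using assms(1) by (intro bump_0) (auto simp: dist_norm norm_minus_commute)
qed

lemma bump_test_fun_UNIV: "0 < r ==> bump r \<in> test_fun UNIV"
 using bump_test_fun[of r 0 UNIV] by simp

definition bump_mass :: "'a::euclidean_space itself => real => real" where
 "bump_mass t r = (LBINT x. bump r (x::'a))"

lemma bump_mass_pos: "0 < r ==> 0 < bump_mass TYPE('a::euclidean_space) r"
proof -
 assume r: "0 < r"
 have "bump_mass TYPE('a) r \<noteq> 0"
 proof
  assume "bump_mass TYPE('a) r = 0"
  then have "AE x::'a in lborel. bump r x = 0"
   using integral_nonneg_eq_0_iff_AE[OF test_fun_L2(2)[OF bump_test_fun_UNIV[where 'a='a, OF r]]]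
   by (simp add: bump_mass_def bump_nonneg)
  then have "AE x::'a in lborel. x \<notin> ball 0 r"
   by eventually_elim (use bump_pos[OF r] in force)
  then have "emeasure lborel (ball (0::'a) r) = 0"
   by (subst (asm) AE_iff_measurable[where N="ball 0 r"]) auto
  then show False using r emeasure_ball[of r "0::'a"] by (simp add: unit_ball_vol_pos less_imp_neq[symmetric])
 qed
 then show ?thesis
  using Bochner_Integration.integral_nonneg[of lborel "bump r :: 'a => real"]
  by (simp add: bump_mass_def bump_nonneg less_le)
qed

text \<open>Normalised mass in the ball of radius r around c. The displacement c is what later moves
  supports away from the boundary.\<close>

definition mollifier :: "real => 'a::euclidean_space => 'a measure" where
 "mollifier r c = density lborel (\<lambda>\<xi>. ennreal (bump r (\<xi> - c) / bump_mass TYPE('a) r))"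

lemma bump_measurable [measurable]: "bump r \<in> Borel"
 by (rule C1_measurable[OF bump_C1])

lemma mollifier_averaging:
 fixes c :: "'a::euclidean_space"
 assumes r: "0 < r" shows "averaging (mollifier r c)"
proof
 show "sets (mollifier r c) = sets borel" by (simp add: mollifier_def)
 have i: "integrable lborel (\<lambda>\<xi>. bump r (\<xi> - c) / bump_mass TYPE('a) r)"
  using lborel_integrable_translate[OF test_fun_L2(2)[OF bump_test_fun_UNIV[where 'a='a, OF r]]] by simp
 have "emeasure (mollifier r c) UNIV = (\<integral>\<^sup>+\<xi>. ennreal (bump r (\<xi> - c) / bump_mass TYPE('a) r) \<partial>lborel)"
  by (simp add: mollifier_def emeasure_density)
 also have "\<dots> = ennreal (LBINT \<xi>. bump r (\<xi> - c) / bump_mass TYPE('a) r)"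
  using i bump_mass_pos[OF r, where 'a='a] by (intro nn_integral_eq_integral) (auto simp: bump_nonneg)
 also have "(LBINT \<xi>. bump r (\<xi> - c) / bump_mass TYPE('a) r) = 1"
  using bump_mass_pos[OF r, where 'a='a]
  by (simp add: lborel_integral_translate bump_mass_def)
 finally show "emeasure (mollifier r c) UNIV = 1" by simp
qed

lemma mollifier_AE:
 fixes c :: "'a::euclidean_space"
 assumes r: "0 < r" shows "AE \<xi> in mollifier r c. norm \<xi> < r + norm c"
 unfolding mollifier_def
proof (subst AE_density, simp, rule AE_I2, rule impI)
 fix \<xi> :: 'a assume "0 < ennreal (bump r (\<xi> - c) / bump_mass TYPE('a) r)"
 then have "bump r (\<xi> - c) \<noteq> 0" by auto
 then have "norm (\<xi> - c) < r" using bump_0[OF r, of "\<xi> - c"] by linarith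
 then show "norm \<xi> < r + norm c" using norm_triangle_sub[of \<xi> c] by linarith
qed

text \<open>The reflected form exhibits the kernel at fixed z as a function of \<xi>, ready to serve
  as a test function.\<close>

lemma avg_mollifier:
 fixes F :: "'a::euclidean_space => 'b::euclidean_space"
 assumes r: "0 < r" and [measurable]: "F \<in> Borel"
 shows "avg (mollifier r c) F z = (1 / bump_mass TYPE('a) r) *\<^sub>R (LBINT \<xi>. bump r (z - \<xi> - c) *\<^sub>R F \<xi>)"
proof -
 have "avg (mollifier r c) F z = (LBINT \<xi>. (bump r (\<xi> - c) / bump_mass TYPE('a) r) *\<^sub>R F (z - \<xi>))"
  unfolding avg_def mollifier_def using bump_mass_pos[OF r, where 'a='a]
  by (subst integral_density) (auto simp: bump_nonneg)
 also have "\<dots> = (LBINT \<xi>. (bump r (z - \<xi> - c) / bump_mass TYPE('a) r) *\<^sub>R F \<xi>)"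
  using lborel_integral_reflect[of "\<lambda>\<xi>. (bump r (z - \<xi> - c) / bump_mass TYPE('a) r) *\<^sub>R F \<xi>" z] by simp
 also have "\<dots> = (LBINT \<xi>. (1 / bump_mass TYPE('a) r) *\<^sub>R (bump r (z - \<xi> - c) *\<^sub>R F \<xi>))"
  by simp
 also have "\<dots> = (1 / bump_mass TYPE('a) r) *\<^sub>R (LBINT \<xi>. bump r (z - \<xi> - c) *\<^sub>R F \<xi>)"
  by (rule integral_scaleR_right)
 finally show ?thesis .
qed

subsection \<open>The fundamental lemma of the calculus of variations\<close>

lemma L2_lim_AE_subseq:
 assumes "L2_lim M F f"
 shows "\<exists>r::nat=>nat. strict_mono r \<and> (AE z in M. (\<lambda>n. F (r n) z) \<longlonglongrightarrow> f z)"
proof -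
 note D = L2_limD[OF assms]
 have "(\<lambda>n. (L2_norm M (\<lambda>z. F n z - f z))\<^sup>2) \<longlonglongrightarrow> 0\<^sup>2" by (intro tendsto_intros D)
 then have "(\<lambda>n. \<integral>z. norm ((norm (F n z - f z))\<^sup>2) \<partial>M) \<longlonglongrightarrow> 0" by (simp add: L2_norm_power2)
 from tendsto_L1_AE_subseq[OF L2_integrable[OF L2_diff[OF D(1,2)]] this]
 obtain r :: "nat => nat" where r: "strict_mono r" "AE z in M. (\<lambda>n. (norm (F (r n) z - f z))\<^sup>2) \<longlonglongrightarrow> 0"
  by blast
 from r(2) have "AE z in M. (\<lambda>n. F (r n) z) \<longlonglongrightarrow> f z"
 proof eventually_elim
  case (elim z)
  from tendsto_real_sqrt[OF elim] have "(\<lambda>n. norm (F (r n) z - f z)) \<longlonglongrightarrow> 0" by simp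
  then show ?case by (simp add: LIM_zero_cancel tendsto_norm_zero_iff)
 qed
 with r(1) show ?thesis by blast
qed

text \<open>Mollifications of \<open>H\<close> converge to \<open>H\<close> in L2 and, along a
  subsequence, almost everywhere. At a point of the open set \<open>Q\<close> the kernel, as a
  function of the integration variable, is eventually a test function on \<open>Q\<close>, so these
  mollifications are eventually 0 there.\<close>

lemma fundamental_lemma:
 fixes H :: "'a::euclidean_space => 'b::euclidean_space"
 assumes Q: "open Q" and H: "H \<in> L2 lborel"
  and 0: "\<And>\<phi>. \<phi> \<in> test_fun Q ==> (LBINT z. \<phi> z *\<^sub>R H z) = 0"
 shows "AE z in lborel. z \<in> Q --> H z = 0"
proof -
 define r where "r n = inverse (real (Suc n))" for n
 have r: "0 < r n" "r \<longlonglongrightarrow> 0" for n using LIMSEQ_inverse_real_of_nat by (auto simp: r_def[abs_def])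
 have "L2_lim lborel (\<lambda>n. avg (mollifier (r n) 0) H) H"
  by (rule avg_lim[OF mollifier_averaging[OF r(1)] H _ r(2)]) (use mollifier_AE[OF r(1), of _ "0::'a"] in simp)
 from L2_lim_AE_subseq[OF this] obtain s :: "nat => nat" where
  s: "strict_mono s" "AE z in lborel. (\<lambda>n. avg (mollifier (r (s n)) 0) H z) \<longlonglongrightarrow> H z" by blast
 from s(2) show ?thesis
 proof eventually_elim
  case (elim z)
  show ?case
  proof
   assume "z \<in> Q"
   then obtain d where d: "d > 0" "cball z d \<subseteq> Q" using Q open_contains_cball by metis
   have "\<forall>\<^sub>F n in sequentially. r n < d" using r(2) d(1) by (rule order_tendstoD)
   then have "\<forall>\<^sub>F n in sequentially. r (s n) < d"
    using eventually_compose_filterlim filterlim_subseq[OF s(1)] by blast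
   then have "\<forall>\<^sub>F n in sequentially. avg (mollifier (r (s n)) 0) H z = 0"
   proof eventually_elim
    case (elim n)
    have "(\<lambda>\<xi>. bump (r (s n)) (\<xi> - z)) \<in> test_fun Q"
     using elim d r by (intro bump_test_fun) auto
    from 0[OF this] have "(LBINT \<xi>. bump (r (s n)) (z - \<xi>) *\<^sub>R H \<xi>) = 0"
     using bump_minus[of "r (s n)" "z - _"] by simp
    then show ?case using L2_measurable[OF H] by (subst avg_mollifier) (auto simp: r)
   qed
   then have "(\<lambda>n. avg (mollifier (r (s n)) 0) H z) \<longlonglongrightarrow> 0" by (rule tendsto_eventually)
   with elim show "H z = 0" using LIMSEQ_unique by blast
  qed
 qed
qed

subsection \<open>Borel representatives\<close>

lemma integral_lebesgue_on_eq:
 fixes F F' :: "'a::euclidean_space => 'b::euclidean_space"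
 assumes Q: "Q \<in> sets borel" and F: "F \<in> borel_measurable (lebesgue_on Q)"
  and F': "F' \<in> Borel" "\<And>z. z \<notin> Q ==> F' z = 0"
  and ae: "AE z in lebesgue_on Q. F z = F' z"
 shows "(\<integral>z. F z \<partial>lebesgue_on Q) = (LBINT z. F' z)"
proof -
 have Ql: "Q \<in> sets lebesgue" using Q by simp
 have F'm: "F' \<in> borel_measurable lebesgue"
  by (rule measurable_completion) (simp add: F')
 have "(\<integral>z. F z \<partial>lebesgue_on Q) = (\<integral>z. F' z \<partial>lebesgue_on Q)"
  using F ae F'm by (intro integral_cong_AE) (auto intro: measurable_restrict_space1)
 also have "\<dots> = (\<integral>z. indicator Q z *\<^sub>R F' z \<partial>lebesgue)"
  using Ql by (subst integral_restrict_space) auto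
 also have "\<dots> = (\<integral>z. F' z \<partial>lebesgue)"
  by (rule lebesgue_cong) (use F'(2) in \<open>auto simp: indicator_def\<close>)
 also have "\<dots> = (LBINT z. F' z)"
  by (rule integral_completion) (simp add: F')
 finally show ?thesis .
qed

lemma AE_lebesgue_on_iff:
 assumes "Q \<in> sets borel"
 shows "(AE z in lebesgue_on Q. P z) \<longleftrightarrow> (AE z in lborel. z \<in> Q --> P z)"
 using assms by (subst AE_restrict_space_iff) (auto simp: AE_completion_iff)

lemma borel_on:
 assumes "F \<in> Borel" shows "F \<in> borel_measurable (lebesgue_on Q)"
proof (rule measurable_restrict_space1)
 show "F \<in> borel_measurable lebesgue" by (rule measurable_completion) (simp add: assms)
qed

definition repr :: "'a::euclidean_space set => ('a => 'b::euclidean_space) => 'a => 'b" where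
 "repr Q w = (SOME w'. w' \<in> Borel \<and> (\<forall>z. z \<notin> Q --> w' z = 0) \<and> (AE z in lborel. z \<in> Q --> w' z = w z))"

lemma
 fixes w :: "'a::euclidean_space => 'b::euclidean_space"
 assumes Q: "Q \<in> sets borel" and w: "w \<in> borel_measurable (lebesgue_on Q)"
 shows repr_measurable: "repr Q w \<in> Borel"
  and repr_0: "z \<notin> Q ==> repr Q w z = 0"
  and repr_AE: "AE z in lborel. z \<in> Q --> repr Q w z = w z"
proof -
 have "\<exists>g. g \<in> borel_measurable lborel \<and> (AE z in lborel. indicator Q z * (w z \<bullet> i) = g z)" for i
 proof -
  have "(\<lambda>z. w z \<bullet> i) \<in> borel_measurable (lebesgue_on Q)" using w by measurable
  then have "(\<lambda>z. indicator Q z * (w z \<bullet> i)) \<in> borel_measurable (completion lborel)"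
   using Q borel_measurable_restrict_space_iff[of Q lebesgue "\<lambda>z. w z \<bullet> i"] by (simp add: mult.commute)
  from completion_ex_borel_measurable_real[OF this] show ?thesis by blast
 qed
 then obtain g where g: "\<And>i. g i \<in> borel_measurable lborel" "\<And>i. AE z in lborel. indicator Q z * (w z \<bullet> i) = g i z"
  by metis
 define w' where "w' z = (\<Sum>i\<in>Basis. (indicator Q z * g i z) *\<^sub>R i)" for z
 have gm[measurable]: "g i \<in> Borel" for i using g by simp
 have 1: "w' \<in> Borel" unfolding w'_def using Q by measurable
 have "AE z in lborel. \<forall>i\<in>Basis. indicator Q z * (w z \<bullet> i) = g i z"
  by (rule AE_finite_allI) (use g in auto)
 then have "AE z in lborel. z \<in> Q --> w' z = w z"
 proof eventually_elim
  case (elim z)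
  show ?case
  proof
   assume z: "z \<in> Q"
   then have "w' z = (\<Sum>i\<in>Basis. (w z \<bullet> i) *\<^sub>R i)" using elim unfolding w'_def by (intro sum.cong) auto
   then show "w' z = w z" by (simp add: euclidean_representation)
  qed
 qed
 then have "w' \<in> Borel \<and> (\<forall>z. z \<notin> Q --> w' z = 0) \<and> (AE z in lborel. z \<in> Q --> w' z = w z)"
  using 1 by (simp add: w'_def)
 from someI[of "\<lambda>w'. w' \<in> Borel \<and> (\<forall>z. z \<notin> Q --> w' z = 0) \<and> (AE z in lborel. z \<in> Q --> w' z = w z)", OF this]
 show "repr Q w \<in> Borel" "z \<notin> Q ==> repr Q w z = 0" "AE z in lborel. z \<in> Q --> repr Q w z = w z"
  by (auto simp: repr_def)
qed

lemma L2_on_iff: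
 fixes w :: "'a::euclidean_space => 'b::euclidean_space"
 assumes Q: "Q \<in> sets borel" and w: "w \<in> borel_measurable (lebesgue_on Q)"
  and w': "w' \<in> Borel" "\<And>z. z \<notin> Q ==> w' z = 0" and ae: "AE z in lborel. z \<in> Q --> w' z = w z"
 shows "w \<in> L2 (lebesgue_on Q) \<longleftrightarrow> w' \<in> L2 lborel" "norm_on Q w = nrm w'"
proof -
 have Ql: "Q \<in> sets lebesgue" using Q by simp
 have ae': "AE z in lebesgue_on Q. w z = w' z" using ae Q by (simp add: AE_lebesgue_on_iff) (auto elim: AE_mp)
 have [measurable]: "w' \<in> borel_measurable lebesgue" by (rule measurable_completion) (simp add: w')
 have "integrable (lebesgue_on Q) (\<lambda>z. (norm (w z))\<^sup>2) \<longleftrightarrow> integrable (lebesgue_on Q) (\<lambda>z. (norm (w' z))\<^sup>2)"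
  using w ae' by (intro integrable_cong_AE) (auto intro!: measurable_restrict_space1)
 also have "\<dots> \<longleftrightarrow> integrable lebesgue (\<lambda>z. indicator Q z *\<^sub>R (norm (w' z))\<^sup>2)"
  using Ql by (subst integrable_restrict_space) auto
 also have "(\<lambda>z. indicator Q z *\<^sub>R (norm (w' z))\<^sup>2) = (\<lambda>z. (norm (w' z))\<^sup>2)"
  using w'(2) by (auto simp: fun_eq_iff split: split_indicator)
 also have "integrable lebesgue (\<lambda>z. (norm (w' z))\<^sup>2) \<longleftrightarrow> integrable lborel (\<lambda>z. (norm (w' z))\<^sup>2)"
  using w'(1) by (intro integrable_completion) simp
 finally show "w \<in> L2 (lebesgue_on Q) \<longleftrightarrow> w' \<in> L2 lborel" using w w' by (simp add: L2_def)
 have "(\<integral>z. (norm (w z))\<^sup>2 \<partial>lebesgue_on Q) = (LBINT z. (norm (w' z))\<^sup>2)"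
 proof (rule integral_lebesgue_on_eq[OF Q])
  show "AE z in lebesgue_on Q. (norm (w z))\<^sup>2 = (norm (w' z))\<^sup>2" using ae' by eventually_elim simp
 qed (use w w' in auto)
 then show "norm_on Q w = nrm w'" by (simp add: L2_norm_def)
qed

lemma
 fixes w :: "'a::euclidean_space => 'b::euclidean_space"
 assumes Q: "Q \<in> sets borel" and w: "w \<in> L2 (lebesgue_on Q)"
 shows repr_L2: "repr Q w \<in> L2 lborel"
 using L2_on_iff[OF Q L2_measurable[OF w] repr_measurable[OF Q L2_measurable[OF w]]
   repr_0[OF Q L2_measurable[OF w]] repr_AE[OF Q L2_measurable[OF w]]] w by auto

subsection \<open>Hausdorff measure\<close>

abbreviation covering :: "real => 'a::metric_space set => (nat => 'a set) => bool" where
 "covering r A U \<equiv> A \<subseteq> (\<Union>k. U k) \<and> (\<forall>k. bounded (U k) \<and> diameter (U k) \<le> r)"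

abbreviation cover_term :: "nat => 'a::metric_space set => ennreal" where
 "cover_term s V \<equiv> (if V = {} then 0 else ennreal (diameter V ^ s))"

text \<open>The outer measure on all sets. \<open>hausdorff_measure\<close> is built by
  \<open>measure_of\<close>, which yields this value on Borel sets only once countable additivity is
  known, so covering arguments are phrased with \<open>\<H>\<close>.\<close>

definition \<H> :: "nat => 'a::metric_space set => ennreal" where
 "\<H> s A = (SUP r\<in>{0<..}. hausdorff_content s r A)"

lemma content_le: "covering r A U ==> hausdorff_content s r A \<le> (\<Sum>k. cover_term s (U k))"
 unfolding hausdorff_content_def by (rule INF_lower) simp

lemma content_less:
 assumes "hausdorff_content s r A < c"
 obtains U where "covering r A U" "(\<Sum>k. cover_term s (U k)) < c"
 using assms unfolding hausdorff_content_def INF_less_iff by auto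

lemma content_greatest:
 assumes "\<And>U. covering r A U ==> c \<le> (\<Sum>k. cover_term s (U k))"
 shows "c \<le> hausdorff_content s r A"
 unfolding hausdorff_content_def by (rule INF_greatest) (use assms in simp)

lemma content_empty: "0 < r ==> hausdorff_content s r {} = 0"
 using content_le[of "{}" "\<lambda>_. {}" r s] by simp

lemma content_mono: "A \<subseteq> B ==> hausdorff_content s r A \<le> hausdorff_content s r B"
 by (rule content_greatest, rule content_le) auto

lemma content_antimono: "r \<le> r' ==> hausdorff_content s r' A \<le> hausdorff_content s r A"
 by (rule content_greatest, rule content_le) (auto intro: order_trans)

text \<open>Covers of the single sets that are optimal up to e/2^(n+1) are merged into one sequence
  by a pairing function. The scale bound r is inherited, so the argument works at each fixed
  scale.\<close>

lemma content_subadditive: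
 "hausdorff_content s r (\<Union>n. A n) \<le> (\<Sum>n. hausdorff_content s r (A n))"
proof (rule ennreal_le_epsilon)
 fix e :: real assume fin: "(\<Sum>n. hausdorff_content s r (A n)) < top" and e: "0 < e"
 have "\<exists>U. covering r (A n) U \<and> (\<Sum>k. cover_term s (U k)) \<le> hausdorff_content s r (A n) + ennreal (e * (1/2)^Suc n)" for n
 proof -
  have "hausdorff_content s r (A n) \<le> (\<Sum>n. hausdorff_content s r (A n))"
   using sum_le_suminf[of "\<lambda>n. hausdorff_content s r (A n)" "{n}"] by simp
  then have "hausdorff_content s r (A n) \<noteq> top" using fin by (auto simp: less_top top_unique)
  then have "hausdorff_content s r (A n) < hausdorff_content s r (A n) + ennreal (e * (1/2)^Suc n)"
   using e by (cases "hausdorff_content s r (A n)") (auto simp: ennreal_plus[symmetric] ennreal_less_iff simp del: ennreal_plus)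
  from content_less[OF this] obtain U where "covering r (A n) U"
   "(\<Sum>k. cover_term s (U k)) < hausdorff_content s r (A n) + ennreal (e * (1/2)^Suc n)" .
  then show ?thesis by - (rule exI[of _ U], rule conjI, assumption, erule less_imp_le)
 qed
 from choice[OF allI[OF this]] obtain U where
  U': "\<forall>n. covering r (A n) (U n) \<and> (\<Sum>k. cover_term s (U n k)) \<le> hausdorff_content s r (A n) + ennreal (e * (1/2)^Suc n)" ..
 note U = spec[OF U', THEN conjunct1] spec[OF U', THEN conjunct2]
 define V where "V k = U (fst (prod_decode k)) (snd (prod_decode k))" for k
 have "covering r (\<Union>n. A n) V"
 proof (intro conjI allI)
  show "(\<Union>n. A n) \<subseteq> (\<Union>k. V k)"
  proof
   fix x assume "x \<in> (\<Union>n. A n)"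
   then obtain n k where "x \<in> U n k" using U(1) by blast
   then have "x \<in> V (prod_encode (n, k))" by (simp add: V_def)
   then show "x \<in> (\<Union>k. V k)" by blast
  qed
 qed (use U(1) in \<open>auto simp: V_def\<close>)
 then have "hausdorff_content s r (\<Union>n. A n) \<le> (\<Sum>k. cover_term s (V k))" by (rule content_le)
 also have "\<dots> = (\<Sum>n. \<Sum>k. cover_term s (U n k))"
  using suminf_ennreal_2dimen[where f="\<lambda>(n,k). cover_term s (U n k)", OF refl]
  by (simp add: V_def split_beta' cong del: if_weak_cong)
 also have "\<dots> \<le> (\<Sum>n. hausdorff_content s r (A n) + ennreal (e * (1/2)^Suc n))"
  by (intro suminf_le U) auto
 also have "\<dots> = (\<Sum>n. hausdorff_content s r (A n)) + (\<Sum>n. ennreal (e * (1/2)^Suc n))"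
  by (intro suminf_add[symmetric]) auto
 also have "(\<Sum>n. ennreal (e * (1/2)^Suc n)) = ennreal e"
  using e sums_mult[OF power_half_series, of e] by (intro suminf_ennreal_eq) auto
 finally show "hausdorff_content s r (\<Union>n. A n) \<le> (\<Sum>n. hausdorff_content s r (A n)) + ennreal e" .
qed

lemma content_le_outer: "0 < r ==> hausdorff_content s r A \<le> \<H> s A"
 unfolding \<H>_def by (rule SUP_upper) simp

lemma outer_empty: "\<H> s {} = 0"
 unfolding \<H>_def by (auto simp: content_empty intro!: antisym SUP_least)

lemma outer_mono: "A \<subseteq> B ==> \<H> s A \<le> \<H> s B"
 unfolding \<H>_def by (intro SUP_mono) (auto intro: content_mono)

lemma outer_subadditive: "\<H> s (\<Union>n. A n) \<le> (\<Sum>n. \<H> s (A n))"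
proof -
 have "hausdorff_content s r (\<Union>n. A n) \<le> (\<Sum>n. \<H> s (A n))" if "0 < r" for r
  using content_subadditive[of s r A] suminf_le[OF content_le_outer[OF that, of s "A _"]]
  by (force intro: order_trans)
 then show ?thesis unfolding \<H>_def[of s "\<Union>n. A n"] by (intro SUP_least) auto
qed

lemma outer_Un: "\<H> s (A \<union> B) \<le> \<H> s A + \<H> s B"
proof -
 define F where "F n = (if n = 0 then A else if n = Suc 0 then B else {})" for n :: nat
 have "(\<Union>n. F n) = A \<union> B" by (auto simp: F_def split: if_splits)
 moreover have "(\<Sum>n. \<H> s (F n)) = (\<Sum>n<2. \<H> s (F n))"
  by (rule suminf_finite) (auto simp: F_def outer_empty)
 ultimately show ?thesis using outer_subadditive[of s F] by (simp add: F_def numeral_2_eq_2)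
qed

text \<open>A set of diameter at most r < d cannot meet both A and B, so every cover at such a scale
  splits into a cover of A and one of B.\<close>

lemma outer_separated:
 assumes d: "0 < d" "\<And>x y. x \<in> A ==> y \<in> B ==> d \<le> dist x y"
 shows "\<H> s A + \<H> s B \<le> \<H> s (A \<union> B)"
proof -
 have *: "hausdorff_content s r A + hausdorff_content s r B \<le> hausdorff_content s r (A \<union> B)"
  if r: "0 < r" "r < d" for r
 proof (rule content_greatest)
  fix U assume U: "covering r (A \<union> B) U"
  define U1 where "U1 k = (if U k \<inter> A = {} then {} else U k)" for k
  define U2 where "U2 k = (if U k \<inter> A = {} then U k else {})" for k
  have 1: "covering r A U1" using U r by (auto simp: U1_def) blast
  have "B \<subseteq> (\<Union>k. U2 k)"
  proof
   fix y assume y: "y \<in> B"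
   then obtain k where k: "y \<in> U k" using U by blast
   have "U k \<inter> A = {}"
   proof (rule ccontr)
    assume "U k \<inter> A \<noteq> {}"
    then obtain x where x: "x \<in> U k" "x \<in> A" by blast
    have "dist x y \<le> r" using diameter_bounded_bound[of "U k" x y] U x k by (metis order_trans)
    then show False using d(2)[OF x(2) y] r by simp
   qed
   then show "y \<in> (\<Union>k. U2 k)" using k by (auto simp: U2_def)
  qed
  then have 2: "covering r B U2" using U r by (auto simp: U2_def)
  have "hausdorff_content s r A + hausdorff_content s r B
   \<le> (\<Sum>k. cover_term s (U1 k)) + (\<Sum>k. cover_term s (U2 k))"
   by (intro add_mono content_le 1 2)
  also have "\<dots> = (\<Sum>k. cover_term s (U1 k) + cover_term s (U2 k))" by (rule suminf_add) auto
  also have "\<dots> = (\<Sum>k. cover_term s (U k))" by (rule suminf_cong) (auto simp: U1_def U2_def)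
  finally show "hausdorff_content s r A + hausdorff_content s r B \<le> (\<Sum>k. cover_term s (U k))" .
 qed
 have "hausdorff_content s r A + hausdorff_content s r' B \<le> \<H> s (A \<union> B)"
  if "0 < r" "0 < r'" for r r'
 proof -
  \<comment> \<open>The two suprema may be approached at different scales; passing to a common
    smaller scale below d only increases both contents.\<close>
  define q where "q = min (min r r') (d/2)"
  have q: "0 < q" "q < d" "q \<le> r" "q \<le> r'" using that d by (auto simp: q_def)
  have "hausdorff_content s r A + hausdorff_content s r' B \<le> hausdorff_content s q A + hausdorff_content s q B"
   by (intro add_mono content_antimono q)
  also have "\<dots> \<le> \<H> s (A \<union> B)"
   using *[OF q(1,2)] content_le_outer[OF q(1), of s "A \<union> B"] by simp
  finally show ?thesis .
 qed
 then have "hausdorff_content s r A + \<H> s B \<le> \<H> s (A \<union> B)" if "0 < r" for r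
  unfolding \<H>_def[of s B] using that
  by (subst ennreal_SUP_add_right) (auto intro!: SUP_least)
 then show ?thesis
  unfolding \<H>_def[of s A] by (subst ennreal_SUP_add_left[symmetric]) (auto intro!: SUP_least)
qed

text \<open>The classical argument for metric outer measures: the rings
 \<open>{x \<in> A. 1/(n+2) \<le> dist x C < 1/(n+1)}\<close> with indices of equal parity are separated.\<close>

lemma closed_caratheodory:
 fixes C :: "'a::metric_space set"
 assumes C: "closed C" "C \<noteq> {}"
 shows "\<H> s (A \<inter> C) + \<H> s (A - C) \<le> \<H> s A"
proof (cases "\<H> s A < top")
 case False
 then show ?thesis by (simp add: less_top[symmetric])
next
 case fin: True
 let ?m = "\<H> s" and ?d = "\<lambda>x. infdist x C"
 define a where "a n = 1 / (real n + 1)" for n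
 have a_dec: "a n < a m" if "m < n" for m n using that by (auto simp: a_def field_simps)
 define B where "B n = {x\<in>A. a n \<le> ?d x}" for n
 define D where "D n = {x\<in>A. a (Suc n) \<le> ?d x \<and> ?d x < a n}" for n
 have AC: "A - C = (\<Union>k. D (k + n)) \<union> B n" for n
 proof (intro equalityI subsetI)
  fix x assume "x \<in> A - C"
  then have x: "x \<in> A" "?d x > 0" using infdist_pos_not_in_closed[OF C, of x] by auto
  show "x \<in> (\<Union>k. D (k + n)) \<union> B n"
  proof (cases "a n \<le> ?d x")
   case False
   have "\<exists>m. a m \<le> ?d x"
   proof -
    obtain m where "inverse (real (Suc m)) < ?d x" using reals_Archimedean[OF x(2)] by blast
    then show ?thesis by (intro exI[of _ m]) (simp add: a_def inverse_eq_divide add.commute)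
   qed
   then obtain m where m: "a m \<le> ?d x" "\<And>j. j < m ==> \<not> a j \<le> ?d x"
    using exists_least_iff[of "\<lambda>m. a m \<le> ?d x"] by auto
   have "n < m"
   proof (rule ccontr)
    assume "\<not> n < m"
    then have "a n \<le> a m" using a_dec[of m n] by (cases "m = n") auto
    then show False using m(1) False by simp
   qed
   then obtain k where k: "m = Suc (k + n)" using less_iff_Suc_add[of n m] by (auto simp: add.commute)
   then have "x \<in> D (k + n)" using m(1) m(2)[of "k + n"] x by (simp add: D_def)
   then show ?thesis by blast
  qed (use x in \<open>auto simp: B_def\<close>)
 next
  fix x assume "x \<in> (\<Union>k. D (k + n)) \<union> B n"
  then have x: "x \<in> A" "?d x > 0" using a_def by (auto simp: D_def B_def intro: less_le_trans[rotated])
  then show "x \<in> A - C" by auto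
 qed
 have sep: "b - c \<le> dist x y" if "b \<le> ?d x" "?d y \<le> c" for x y b c
  using infdist_triangle[of x C y] that by linarith
 \<comment> \<open>Rings of equal parity are kept apart by the ring between them: the distance to C
   is at least \<open>a (2 * N + i - 1)\<close> on the earlier ones and below
   \<open>a (2 * N + i)\<close> on the last. For N = 0 there is nothing earlier.\<close>
 have rings: "(\<Sum>k<N. ?m (D (2 * k + i))) \<le> ?m (\<Union>k<N. D (2 * k + i))" for N i
 proof (induction N)
  case (Suc N)
  have "?m (\<Union>k<N. D (2 * k + i)) + ?m (D (2 * N + i)) \<le> ?m ((\<Union>k<N. D (2 * k + i)) \<union> D (2 * N + i))"
  proof (cases "N = 0")
   case False
   show ?thesis
   proof (rule outer_separated[of "a (2 * N + i - 1) - a (2 * N + i)"])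
    show "0 < a (2 * N + i - 1) - a (2 * N + i)" using False a_dec[of "2 * N + i - 1" "2 * N + i"] by simp
    fix x y assume "x \<in> (\<Union>k<N. D (2 * k + i))" "y \<in> D (2 * N + i)"
    then obtain k where k: "k < N" "a (Suc (2 * k + i)) \<le> ?d x" "?d y < a (2 * N + i)" by (auto simp: D_def)
    have "a (2 * N + i - 1) \<le> a (Suc (2 * k + i))"
    proof (cases "Suc (2 * k + i) = 2 * N + i - 1")
     case False
     then have "Suc (2 * k + i) < 2 * N + i - 1" using k(1) by linarith
     from a_dec[OF this] show ?thesis by simp
    next
     case True
     then show ?thesis by (simp only: order_refl)
    qed
    then show "a (2 * N + i - 1) - a (2 * N + i) \<le> dist x y" using k by (intro sep) auto
   qed
  qed (simp add: outer_empty)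
  moreover have "(\<Sum>k<Suc N. ?m (D (2 * k + i))) \<le> ?m (\<Union>k<N. D (2 * k + i)) + ?m (D (2 * N + i))"
   using Suc by (simp add: add_right_mono)
  moreover have "(\<Union>k<N. D (2 * k + i)) \<union> D (2 * N + i) = (\<Union>k<Suc N. D (2 * k + i))"
   by (simp add: lessThan_Suc Un_commute)
  ultimately show ?case by (simp only:)
 qed (simp add: outer_empty)
 \<comment> \<open>The rings of one parity have their union inside \<open>A\<close>, so finiteness
   of the outer measure of \<open>A\<close> makes both parity sums finite and hence all ring
   measures summable.\<close>
 have par: "(\<Sum>k. ?m (D (2 * k + i))) \<le> ?m A" for i
 proof (rule suminf_le_const)
  have "(\<Union>k<N. D (2 * k + i)) \<subseteq> A" for N by (auto simp: D_def)
  then show "(\<Sum>k<N. ?m (D (2 * k + i))) \<le> ?m A" for N by (rule order_trans[OF rings outer_mono])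
 qed simp
 have fD: "?m (D n) < top" for n
  using outer_mono[of "D n" A s] fin by (auto simp: D_def intro: le_less_trans)
 define \<delta> where "\<delta> n = enn2real (?m (D n))" for n
 have mD: "?m (D n) = ennreal (\<delta> n)" for n using fD by (simp add: \<delta>_def less_top)
 have \<delta>0: "0 \<le> \<delta> n" for n by (simp add: \<delta>_def)
 have sp: "summable (\<lambda>k. \<delta> (2 * k + i))" for i
  using par[of i] fin by (intro summable_suminf_not_top) (auto simp: \<delta>0 mD top_unique)
 have "summable \<delta>"
 proof -
  have "(\<Sum>k<n. \<delta> k) \<le> (\<Sum>k. \<delta> (2 * k + 0)) + (\<Sum>k. \<delta> (2 * k + 1))" for n
  proof -
   have "(\<Sum>k<n. \<delta> k) \<le> (\<Sum>k<2 * n. \<delta> k)" by (intro sum_mono2) (auto simp: \<delta>0)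
   also have "\<dots> = (\<Sum>k<n. \<delta> (2 * k + 0)) + (\<Sum>k<n. \<delta> (2 * k + 1))"
    by (induction n) auto
   also have "\<dots> \<le> (\<Sum>k. \<delta> (2 * k + 0)) + (\<Sum>k. \<delta> (2 * k + 1))"
    by (intro add_mono sum_le_suminf sp) (auto simp: \<delta>0)
   finally show ?thesis .
  qed
  then show ?thesis by (rule summableI_nonneg_bounded[OF \<delta>0])
 qed
 show ?thesis
 proof (rule ennreal_le_epsilon)
  fix e :: real assume e: "0 < e"
  \<comment> \<open>Replacing A - C by \<open>B n\<close> loses only the rings of index at least n,
    whose total measure is below e; \<open>B n\<close> keeps the distance \<open>a n\<close> from C,
    so additivity for separated sets applies to it.\<close>
  obtain n where n: "norm (\<Sum>k. \<delta> (k + n)) < e"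
   using suminf_exist_split[OF e \<open>summable \<delta>\<close>] by blast
  have "(\<Sum>k. ?m (D (k + n))) = ennreal (\<Sum>k. \<delta> (k + n))"
   using \<open>summable \<delta>\<close> by (simp add: mD suminf_ennreal2 \<delta>0 summable_ignore_initial_segment)
  also have "\<dots> \<le> ennreal e" using n by (intro ennreal_leI) simp
  finally have tail: "(\<Sum>k. ?m (D (k + n))) \<le> ennreal e" .
  have "?m (A \<inter> C) + ?m (A - C) \<le> ?m (A \<inter> C) + (ennreal e + ?m (B n))"
   unfolding AC[of n] using outer_Un[of s "\<Union>k. D (k + n)" "B n"] outer_subadditive[of s "\<lambda>k. D (k + n)"] tail
   by (intro add_left_mono) (meson add_mono order.trans order_refl)
  also have "\<dots> = (?m (A \<inter> C) + ?m (B n)) + ennreal e" by (simp add: ac_simps)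
  also have "?m (A \<inter> C) + ?m (B n) \<le> ?m (A \<inter> C \<union> B n)"
  proof (rule outer_separated[of "a n"])
   show "0 < a n" by (simp add: a_def)
   show "a n \<le> dist x y" if "x \<in> A \<inter> C" "y \<in> B n" for x y
    using sep[of "a n" y x 0] that by (simp add: B_def dist_commute)
  qed
  also have "\<dots> \<le> ?m A" by (rule outer_mono) (auto simp: B_def)
  finally show "?m (A \<inter> C) + ?m (A - C) \<le> ?m A + ennreal e" by (simp add: add_right_mono)
 qed
qed

text \<open>Caratheodory's construction gives a measure on the sets that split every set additively;
  \<open>closed_caratheodory\<close> places the nonempty closed sets among them, and closed sets
  generate the Borel sets.\<close>

lemma hausdorff_measure_space: "measure_space UNIV (sets borel) (\<H> s :: 'a::metric_space set => ennreal)"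
proof (rule measure_down)
 interpret sigma_algebra UNIV "Pow UNIV :: 'a set set" by (rule sigma_algebra_Pow)
 have oms: "outer_measure_space (Pow UNIV) (\<H> s :: 'a set => ennreal)"
  unfolding outer_measure_space_def
  by (auto simp: positive_def outer_empty increasing_def outer_mono countably_subadditive_def outer_subadditive)
 show ms: "measure_space UNIV (lambda_system UNIV (Pow UNIV) (\<H> s :: 'a set => ennreal)) (\<H> s)"
  by (rule caratheodory_lemma[OF oms])
 show "sigma_algebra UNIV (sets borel :: 'a set set)" using sets.sigma_algebra_axioms[of borel] by simp
 have "sigma_sets UNIV {C :: 'a set. closed C} \<subseteq> lambda_system UNIV (Pow UNIV) (\<H> s)"
 proof (rule sigma_algebra.sigma_sets_subset)
  show "sigma_algebra UNIV (lambda_system UNIV (Pow UNIV) (\<H> s :: 'a set => ennreal))"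
   using ms by (simp add: measure_space_def)
  show "{C :: 'a set. closed C} \<subseteq> lambda_system UNIV (Pow UNIV) (\<H> s)"
  proof
   fix C :: "'a set" assume "C \<in> {C. closed C}"
   then have C: "closed C" by simp
   show "C \<in> lambda_system UNIV (Pow UNIV) (\<H> s)"
   proof (cases "C = {}")
    case False
    have "\<H> s (C \<inter> A) + \<H> s ((UNIV - C) \<inter> A) = \<H> s A" for A
    proof (rule antisym)
     have "C \<inter> A = A \<inter> C" "(UNIV - C) \<inter> A = A - C" by auto
     then show "\<H> s (C \<inter> A) + \<H> s ((UNIV - C) \<inter> A) \<le> \<H> s A"
      using closed_caratheodory[OF C False, of s A] by simp
     show "\<H> s A \<le> \<H> s (C \<inter> A) + \<H> s ((UNIV - C) \<inter> A)"
      using outer_Un[of s "C \<inter> A" "(UNIV - C) \<inter> A"] by (simp add: Int_Un_distrib2[symmetric])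
    qed
    then show ?thesis by (auto simp: lambda_system_def)
   qed (auto simp: lambda_system_def outer_empty)
  qed
 qed
 then show "sets borel \<subseteq> lambda_system UNIV (Pow UNIV) (\<H> s :: 'a set => ennreal)"
  by (simp add: borel_eq_closed)
qed

lemma sets_hausdorff_measure [measurable_cong, simp]: "sets (hausdorff_measure s) = sets borel"
 by (simp add: hausdorff_measure_def sets.sigma_sets_eq[of borel, simplified])

lemma space_hausdorff_measure [simp]: "space (hausdorff_measure s) = UNIV"
 by (simp add: hausdorff_measure_def)

lemma emeasure_hausdorff_measure:
 assumes "A \<in> sets borel" shows "emeasure (hausdorff_measure s) A = \<H> s A"
proof (rule emeasure_measure_of)
 show "hausdorff_measure s = measure_of UNIV (sets borel) (\<H> s)"
  by (simp add: hausdorff_measure_def \<H>_def[abs_def])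
 show "positive (sets (hausdorff_measure s)) (\<H> s)" "countably_additive (sets (hausdorff_measure s)) (\<H> s)"
  using hausdorff_measure_space[of s] by (auto simp: measure_space_def)
qed (use assms in auto)

subsection \<open>Layers along a set of finite Hausdorff measure\<close>

definition layer :: "'a::real_vector => real => 'a set => 'a set" where
 "layer b \<sigma> A = {z + \<tau> *\<^sub>R b | z \<tau>. z \<in> A \<and> 0 \<le> \<tau> \<and> \<tau> \<le> \<sigma>}"

text \<open>The factor 2^d times the volume of the unit ball comes from balls of radius 2 \<rho>,
  the extra 2 from bounding \<sigma>/\<rho> + 1 by 2 \<sigma>/\<rho>.\<close>

definition layer_const :: "'a::euclidean_space itself => real" where
 "layer_const t = 2 * 2 ^ DIM('a) * unit_ball_vol (DIM('a))"

lemma layer_const_nonneg: "0 \<le> layer_const TYPE('a::euclidean_space)"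
 by (simp add: layer_const_def unit_ball_vol_nonneg)

text \<open>Sweeping a piece of diameter below \<rho> over the length \<sigma> is followed in steps
  of length \<rho>: at most \<sigma>/\<rho> + 1 balls of radius 2 \<rho> suffice, one \<rho> for the
  piece and one for the remainder of the step. As \<rho> \<le> \<sigma>, the volume is of order
  \<sigma> \<rho>^(d-1).\<close>

lemma layer_bounded_piece:
 fixes V :: "'a::euclidean_space set"
 assumes b: "norm b = 1" and \<rho>: "0 < \<rho>" "\<rho> \<le> \<sigma>" and V: "bounded V" "diameter V < \<rho>" "V \<noteq> {}"
 shows "\<exists>L\<in>sets borel. layer b \<sigma> V \<subseteq> L \<and>
  emeasure lborel L \<le> ennreal (layer_const TYPE('a) * \<sigma> * \<rho> ^ (DIM('a) - 1))"
proof -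
 obtain u where u: "u \<in> V" using V by blast
 define N where "N = nat \<lfloor>\<sigma> / \<rho>\<rfloor>"
 define L where "L = (\<Union>m\<le>N. ball (u + (real m * \<rho>) *\<^sub>R b) (2 * \<rho>))"
 have "layer b \<sigma> V \<subseteq> L"
 proof
  fix x assume "x \<in> layer b \<sigma> V"
  then obtain z \<tau> where x: "x = z + \<tau> *\<^sub>R b" "z \<in> V" "0 \<le> \<tau>" "\<tau> \<le> \<sigma>" by (auto simp: layer_def)
  define m where "m = nat \<lfloor>\<tau> / \<rho>\<rfloor>"
  have "m \<le> N" unfolding m_def N_def using x \<rho> by (intro nat_mono floor_mono divide_right_mono) auto
  have m: "real m * \<rho> \<le> \<tau>" "\<tau> < (real m + 1) * \<rho>"
  proof -
   have fl: "real m = of_int \<lfloor>\<tau> / \<rho>\<rfloor>" using x \<rho> by (simp add: m_def)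
   show "real m * \<rho> \<le> \<tau>" using mult_right_mono[OF of_int_floor_le[of "\<tau> / \<rho>"], of \<rho>] \<rho> by (simp add: fl)
   show "\<tau> < (real m + 1) * \<rho>" using mult_strict_right_mono[of "\<tau> / \<rho>" "of_int \<lfloor>\<tau> / \<rho>\<rfloor> + 1" \<rho>] floor_correct[of "\<tau> / \<rho>"] \<rho> by (simp add: fl)
  qed
  have "norm (x - (u + (real m * \<rho>) *\<^sub>R b)) = norm ((z - u) + (\<tau> - real m * \<rho>) *\<^sub>R b)"
   by (simp add: x algebra_simps)
  also have "\<dots> \<le> norm (z - u) + \<bar>\<tau> - real m * \<rho>\<bar>"
   by (rule order_trans[OF norm_triangle_ineq]) (simp add: b)
  also have "\<dots> < \<rho> + \<rho>"
   using diameter_bounded_bound[OF V(1) x(2) u] V(2) m by (intro add_strict_mono) (auto simp: dist_norm algebra_simps)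
  finally show "x \<in> L" using \<open>m \<le> N\<close> unfolding L_def
   by (intro UN_I[of m]) (auto simp: dist_norm norm_minus_commute)
 qed
 moreover have "emeasure lborel L \<le> ennreal (layer_const TYPE('a) * \<sigma> * \<rho> ^ (DIM('a) - 1))"
 proof -
  have "emeasure lborel L \<le> (\<Sum>m\<le>N. emeasure lborel (ball (u + (real m * \<rho>) *\<^sub>R b) (2 * \<rho>)))"
   unfolding L_def by (rule emeasure_subadditive_finite) auto
  also have "\<dots> = ennreal ((real N + 1) * (unit_ball_vol (DIM('a)) * (2 * \<rho>) ^ DIM('a)))"
   using \<rho> by (simp add: emeasure_ball ennreal_of_nat_eq_real_of_nat ennreal_mult[symmetric] unit_ball_vol_nonneg algebra_simps)
  also have "\<dots> \<le> ennreal (2 * (\<sigma> / \<rho>) * (unit_ball_vol (DIM('a)) * (2 * \<rho>) ^ DIM('a)))"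
  proof (intro ennreal_leI mult_right_mono)
   have "real N \<le> \<sigma> / \<rho>" using \<rho> by (simp add: N_def)
   moreover have "1 \<le> \<sigma> / \<rho>" using \<rho> by simp
   ultimately show "real N + 1 \<le> 2 * (\<sigma> / \<rho>)" by simp
  qed (use \<rho> in \<open>simp add: unit_ball_vol_nonneg\<close>)
  also have "2 * (\<sigma> / \<rho>) * (unit_ball_vol (DIM('a)) * (2 * \<rho>) ^ DIM('a)) = layer_const TYPE('a) * \<sigma> * \<rho> ^ (DIM('a) - 1)"
  proof -
   have "\<rho> ^ DIM('a) = \<rho> * \<rho> ^ (DIM('a) - 1)"
    using DIM_positive[where 'a='a] by (metis power_eq_if not_gr_zero)
   then show ?thesis using \<rho> by (simp add: layer_const_def power_mult_distrib)
  qed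
  finally show ?thesis .
 qed
 moreover have "L \<in> sets borel" unfolding L_def by auto
 ultimately show ?thesis by blast
qed

text \<open>A nearly optimal cover of \<open>A\<close> at scale \<sigma>/2 is swept piece by piece.
  The pieces being smaller than \<sigma>, the volume of the layer is at most a constant times
  \<sigma> times the Hausdorff measure; no normal field enters.\<close>

lemma layer_hausdorff:
 fixes A :: "'a::euclidean_space set"
 assumes b: "norm b = 1" and \<sigma>: "0 < \<sigma>" and A: "\<H> (DIM('a) - 1) A < top" and \<eta>: "0 < \<eta>"
 shows "\<exists>L\<in>sets borel. layer b \<sigma> A \<subseteq> L \<and>
  emeasure lborel L \<le> ennreal (layer_const TYPE('a) * \<sigma>) * (\<H> (DIM('a) - 1) A + ennreal \<eta>)"
proof -
 let ?s = "DIM('a) - 1" and ?c = "layer_const TYPE('a)"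
 have "hausdorff_content ?s (\<sigma>/2) A \<le> \<H> ?s A" using \<sigma> by (intro content_le_outer) simp
 also have "\<H> ?s A < \<H> ?s A + ennreal (\<eta>/2)"
  using \<eta> A by (cases "\<H> ?s A") (auto simp: ennreal_plus[symmetric] ennreal_less_iff simp del: ennreal_plus)
 finally obtain U where U: "covering (\<sigma>/2) A U" "(\<Sum>k. cover_term ?s (U k)) < \<H> ?s A + ennreal (\<eta>/2)"
  by (rule content_less)
 \<comment> \<open>A covering set may be a single point, so its diameter is enlarged to a positive
   \<rho>; continuity of the power keeps the extra cost below a geometric share of \<eta>/2. For
   exponent 0 both powers equal 1.\<close>
 have "\<exists>\<rho>. diameter (U k) < \<rho> \<and> \<rho> \<le> \<sigma> \<and> \<rho> ^ ?s \<le> diameter (U k) ^ ?s + \<eta>/2 * (1/2)^Suc k" for k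
 proof -
  have "((\<lambda>\<rho>. \<rho> ^ ?s) \<longlongrightarrow> diameter (U k) ^ ?s) (at_right (diameter (U k)))" by (intro tendsto_intros)
  then have "\<forall>\<^sub>F \<rho> in at_right (diameter (U k)). \<rho> ^ ?s < diameter (U k) ^ ?s + \<eta>/2 * (1/2)^Suc k"
   by (rule order_tendstoD) (use \<eta> in auto)
  moreover have "\<forall>\<^sub>F \<rho> in at_right (diameter (U k)). \<rho> \<in> {diameter (U k)<..<\<sigma>}"
  proof (rule eventually_at_right_real)
   have "diameter (U k) \<le> \<sigma> / 2" using U(1) by blast
   then show "diameter (U k) < \<sigma>" using \<sigma> by linarith
  qed
  ultimately have "\<forall>\<^sub>F \<rho> in at_right (diameter (U k)). diameter (U k) < \<rho> \<and> \<rho> \<le> \<sigma> \<and> \<rho> ^ ?s \<le> diameter (U k) ^ ?s + \<eta>/2 * (1/2)^Suc k"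
   by eventually_elim auto
  then show ?thesis using eventually_happens[OF _] by fastforce
 qed
 then obtain \<rho> where \<rho>: "\<And>k. diameter (U k) < \<rho> k" "\<And>k. \<rho> k \<le> \<sigma>"
  "\<And>k. \<rho> k ^ ?s \<le> diameter (U k) ^ ?s + \<eta>/2 * (1/2)^Suc k" by metis
 have \<rho>0: "0 < \<rho> k" for k using \<rho>(1)[of k] diameter_ge_0[of "U k"] U(1) by (auto intro: le_less_trans)
 have "\<exists>L\<in>sets borel. layer b \<sigma> (U k) \<subseteq> L \<and>
  emeasure lborel L \<le> ennreal (?c * \<sigma>) * (cover_term ?s (U k) + ennreal (\<eta>/2 * (1/2)^Suc k))" for k
 proof (cases "U k = {}")
  case True
  then show ?thesis by (intro bexI[of _ "{}"]) (auto simp: layer_def)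
 next
  case False
  obtain L where L: "L \<in> sets borel" "layer b \<sigma> (U k) \<subseteq> L" "emeasure lborel L \<le> ennreal (?c * \<sigma> * \<rho> k ^ ?s)"
   using layer_bounded_piece[OF b \<rho>0 \<rho>(2) _ \<rho>(1) False] U(1) by blast
  have "?c * \<sigma> * \<rho> k ^ ?s \<le> ?c * \<sigma> * (diameter (U k) ^ ?s + \<eta>/2 * (1/2)^Suc k)"
   using \<sigma> layer_const_nonneg[where 'a='a] by (intro mult_left_mono \<rho>) auto
  then have "ennreal (?c * \<sigma> * \<rho> k ^ ?s) \<le> ennreal (?c * \<sigma>) * ennreal (diameter (U k) ^ ?s + \<eta>/2 * (1/2)^Suc k)"
   using \<sigma> layer_const_nonneg[where 'a='a] by (subst ennreal_mult'[symmetric]) (auto intro!: ennreal_leI)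
  also have "ennreal (diameter (U k) ^ ?s + \<eta>/2 * (1/2)^Suc k) = cover_term ?s (U k) + ennreal (\<eta>/2 * (1/2)^Suc k)"
   using False \<eta> U(1) by (subst ennreal_plus) (auto simp: diameter_ge_0)
  finally show ?thesis using L by (intro bexI[of _ L]) auto
 qed
 then obtain L where L: "\<And>k. L k \<in> sets borel" "\<And>k. layer b \<sigma> (U k) \<subseteq> L k"
  "\<And>k. emeasure lborel (L k) \<le> ennreal (?c * \<sigma>) * (cover_term ?s (U k) + ennreal (\<eta>/2 * (1/2)^Suc k))" by metis
 have "layer b \<sigma> A \<subseteq> (\<Union>k. L k)"
 proof
  fix x assume "x \<in> layer b \<sigma> A"
  then obtain z \<tau> where z: "x = z + \<tau> *\<^sub>R b" "z \<in> A" "0 \<le> \<tau>" "\<tau> \<le> \<sigma>" by (auto simp: layer_def)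
  then obtain k where "z \<in> U k" using U(1) by blast
  then have "x \<in> layer b \<sigma> (U k)" using z by (auto simp: layer_def)
  then show "x \<in> (\<Union>k. L k)" using L(2) by blast
 qed
 moreover have "emeasure lborel (\<Union>k. L k) \<le> ennreal (?c * \<sigma>) * (\<H> ?s A + ennreal \<eta>)"
 proof -
  have "emeasure lborel (\<Union>k. L k) \<le> (\<Sum>k. emeasure lborel (L k))"
   using L(1) by (intro emeasure_subadditive_countably) auto
  also have "\<dots> \<le> (\<Sum>k. ennreal (?c * \<sigma>) * (cover_term ?s (U k) + ennreal (\<eta>/2 * (1/2)^Suc k)))"
   by (intro suminf_le L(3)) auto
  also have "\<dots> = ennreal (?c * \<sigma>) * ((\<Sum>k. cover_term ?s (U k)) + (\<Sum>k. ennreal (\<eta>/2 * (1/2)^Suc k)))"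
   by (subst suminf_add) (auto simp: ennreal_suminf_cmult)
  also have "(\<Sum>k. ennreal (\<eta>/2 * (1/2)^Suc k)) = ennreal (\<eta>/2)"
   using \<eta> sums_mult[OF power_half_series, of "\<eta>/2"] by (intro suminf_ennreal_eq) auto
  also have "(\<Sum>k. cover_term ?s (U k)) + ennreal (\<eta>/2) \<le> (\<H> ?s A + ennreal (\<eta>/2)) + ennreal (\<eta>/2)"
   by (intro add_right_mono less_imp_le U(2))
  also have "\<dots> = \<H> ?s A + ennreal \<eta>"
   using \<eta> by (simp add: add.assoc ennreal_plus[symmetric] del: ennreal_plus)
  finally show ?thesis by (simp add: mult_left_mono)
 qed
 moreover have "(\<Union>k. L k) \<in> sets borel" using L(1) by auto
 ultimately show ?thesis by blast
qed

subsection \<open>Lipschitz graphs have finite Hausdorff measure\<close>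

text \<open>A packing bound: translating an \<open>r\<close>-separated subset of the graph \<open>1/r\<close> times by multiples of \<open>r \<nu>\<close>
 gives an \<open>r/(1+L)\<close>-separated set, to which volume can be compared.\<close>

lemma lipschitz_graph_packing:
 fixes S :: "'a::euclidean_space set"
 assumes \<nu>: "norm \<nu> = 1" and L: "0 \<le> L" and R: "0 \<le> R" and S: "\<And>x. x \<in> S ==> norm x \<le> R"
  and lip: "\<And>x y. x \<in> S ==> y \<in> S ==> \<bar>x \<bullet> \<nu> - y \<bullet> \<nu>\<bar> \<le> L * norm ((x - (x \<bullet> \<nu>) *\<^sub>R \<nu>) - (y - (y \<bullet> \<nu>) *\<^sub>R \<nu>))"
  and r: "0 < r" "r \<le> 1" and F: "finite F" "F \<subseteq> S" "\<And>x y. x \<in> F ==> y \<in> F ==> x \<noteq> y ==> r \<le> dist x y"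
 shows "real (card F) * r ^ (DIM('a) - 1) \<le> ((R + 3) * (2 * (1 + L))) ^ DIM('a)"
proof -
 \<comment> \<open>Half of the separation r/(1+L), so that balls of radius \<open>q\<close> around
   the translates are disjoint.\<close>
 define q where "q = r / (2 * (1 + L))"
 have q: "0 < q" "2 * q \<le> r" "2 * (1 + L) * q = r" using r L by (auto simp: q_def field_simps)
 define M where "M = nat \<lceil>1 / r\<rceil>"
 have M: "1 \<le> real M * r" "real M * r \<le> 2"
 proof -
  have "real M = of_int \<lceil>1 / r\<rceil>" using r by (simp add: M_def)
  then have "1 / r \<le> real M" "real M \<le> 1 / r + 1" by linarith+
  note this[THEN mult_right_mono, of r]
  moreover have "1 / r * r = 1" "(1 / r + 1) * r = 1 + r" using r by (auto simp: distrib_right)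
  ultimately show "1 \<le> real M * r" "real M * r \<le> 2" using r by auto
 qed
 define p where "p = (\<lambda>(u, m). u + (real m * r) *\<^sub>R \<nu> :: 'a)"
 let ?I = "F \<times> {..<M}"
 have sep: "2 * q \<le> dist (p i) (p j)" if ij: "i \<in> ?I" "j \<in> ?I" "i \<noteq> j" for i j
 proof -
  obtain u m v n where i: "i = (u, m)" "j = (v, n)" by (cases i, cases j) auto
  have uv: "u \<in> F" "v \<in> F" using ij i by auto
  have \<nu>\<nu>: "\<nu> \<bullet> \<nu> = 1" using \<nu> by (simp add: dot_square_norm)
  show ?thesis
  proof (cases "u = v")
   case True
   then have "m \<noteq> n" using ij i by auto
   then have "1 \<le> \<bar>real m - real n\<bar>" by linarith
   then have "r \<le> \<bar>real m - real n\<bar> * r" using r by simp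
   also have "\<dots> = norm ((real m * r - real n * r) *\<^sub>R \<nu>)"
    using r \<nu> by (simp add: left_diff_distrib[symmetric] abs_mult)
   also have "\<dots> = dist (p i) (p j)" using True by (simp add: i p_def dist_norm scaleR_diff_left)
   finally show ?thesis using q by simp
  next
   case False
   define w where "w = u - v"
   \<comment> \<open>The component orthogonal to \<nu> is untouched by translations along \<nu>. The
     Lipschitz bound makes it at least r/(1+L) long for distinct points of F, so translates of
     different points stay apart.\<close>
   define w' where "w' = w - (w \<bullet> \<nu>) *\<^sub>R \<nu>"
   have w': "w' = (u - (u \<bullet> \<nu>) *\<^sub>R \<nu>) - (v - (v \<bullet> \<nu>) *\<^sub>R \<nu>)"
    by (simp add: w'_def w_def inner_diff_left algebra_simps)
   have "r \<le> norm w" using F(3)[OF uv False] by (simp add: w_def dist_norm)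
   also have "\<dots> \<le> norm w' + \<bar>w \<bullet> \<nu>\<bar>"
    using norm_triangle_ineq[of w' "(w \<bullet> \<nu>) *\<^sub>R \<nu>"] \<nu> by (simp add: w'_def)
   also have "\<bar>w \<bullet> \<nu>\<bar> \<le> L * norm w'"
    using lip[of u v] uv F(2) unfolding w' by (auto simp: w_def inner_diff_left)
   finally have rw: "r \<le> (1 + L) * norm w'" by (simp add: algebra_simps)
   have "2 * (1 + L) * q \<le> (1 + L) * norm w'" using rw q by simp
   then have "(1 + L) * (2 * q) \<le> (1 + L) * norm w'" by (simp only: ac_simps)
   then have "2 * q \<le> norm w'" by (rule mult_left_le_imp_le) (use L in linarith)
   also have "norm w' \<le> norm (p i - p j)"
   proof -
    define c where "c = w \<bullet> \<nu> + real m * r - real n * r"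
    have d: "p i - p j = w' + c *\<^sub>R \<nu>" by (simp add: i p_def w'_def w_def c_def algebra_simps)
    have "w' \<bullet> \<nu> = 0" by (simp add: w'_def inner_diff_left \<nu>\<nu>)
    then have "(norm (p i - p j))\<^sup>2 = (norm w')\<^sup>2 + (norm (c *\<^sub>R \<nu>))\<^sup>2"
     unfolding d by (intro norm_add_Pythagorean) (simp add: orthogonal_def)
    then have "(norm w')\<^sup>2 \<le> (norm (p i - p j))\<^sup>2" by (simp only: le_add_same_cancel1 zero_le_power2)
    then show ?thesis by (rule power2_le_imp_le) simp
   qed
   finally show ?thesis by (simp add: dist_norm)
  qed
 qed
 have disj: "disjoint_family_on (\<lambda>i. ball (p i) q) ?I"
  unfolding disjoint_family_on_def
 proof (intro ballI impI)
  fix i j assume ij: "i \<in> ?I" "j \<in> ?I" "i \<noteq> j"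
  show "ball (p i) q \<inter> ball (p j) q = {}"
  proof (rule ccontr)
   assume "ball (p i) q \<inter> ball (p j) q \<noteq> {}"
   then obtain x where "dist (p i) x < q" "dist (p j) x < q" by auto
   then show False using sep[OF ij] dist_triangle2[of "p i" "p j" x] by linarith
  qed
 qed
 \<comment> \<open>R accounts for the point of the graph, 2 for the translation, since M r is at
   most 2, and 1 for the radius of the ball.\<close>
 have sub: "(\<Union>i\<in>?I. ball (p i) q) \<subseteq> ball 0 (R + 3)"
 proof clarify
  fix u m x assume um: "u \<in> F" "m < M" and x: "x \<in> ball (p (u, m)) q"
  have "norm x \<le> norm u + norm ((real m * r) *\<^sub>R \<nu>) + norm (x - p (u, m))"
   using norm_triangle_ineq[of "u + (real m * r) *\<^sub>R \<nu>" "x - p (u, m)"]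
    norm_triangle_ineq[of u "(real m * r) *\<^sub>R \<nu>"] by (simp add: p_def)
  also have "\<dots> < R + 2 + q"
  proof (intro add_le_less_mono add_mono)
   show "norm u \<le> R" using S um F(2) by blast
   have "real m * r \<le> real M * r" using um r by (intro mult_right_mono) auto
   from order.trans[OF this M(2)] show "norm ((real m * r) *\<^sub>R \<nu>) \<le> 2" using r \<nu> by simp
   show "norm (x - p (u, m)) < q" using x by (simp add: dist_norm norm_minus_commute)
  qed
  finally show "x \<in> ball 0 (R + 3)" using q r by simp
 qed
 have "ennreal (real (card F * M) * (unit_ball_vol (DIM('a)) * q ^ DIM('a))) = (\<Sum>i\<in>?I. emeasure lborel (ball (p i) q))"
  using q by (simp add: emeasure_ball card_cartesian_product ennreal_mult ennreal_of_nat_eq_real_of_nat unit_ball_vol_nonneg)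
 also have "\<dots> = emeasure lborel (\<Union>i\<in>?I. ball (p i) q)"
  using F(1) disj by (intro sum_emeasure) auto
 also have "\<dots> \<le> emeasure lborel (ball (0::'a) (R + 3))" by (rule emeasure_mono[OF sub]) simp
 also have "\<dots> = ennreal (unit_ball_vol (DIM('a)) * (R + 3) ^ DIM('a))" using R by (simp add: emeasure_ball)
 finally have "real (card F * M) * (unit_ball_vol (DIM('a)) * q ^ DIM('a)) \<le> unit_ball_vol (DIM('a)) * (R + 3) ^ DIM('a)"
  using R by (simp add: unit_ball_vol_nonneg)
 then have "unit_ball_vol (DIM('a)) * (real (card F * M) * q ^ DIM('a)) \<le> unit_ball_vol (DIM('a)) * (R + 3) ^ DIM('a)"
  by (simp add: ac_simps)
 then have *: "real (card F * M) * q ^ DIM('a) \<le> (R + 3) ^ DIM('a)"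
  using unit_ball_vol_pos[of "DIM('a)"] by simp
 \<comment> \<open>The factor M r, which is at least 1, supplies the missing power of r; after that
   the volume bound for card F * M balls applies.\<close>
 have "real (card F) * r ^ (DIM('a) - 1) \<le> real (card F) * r ^ (DIM('a) - 1) * (real M * r)"
  using M r by (intro mult_left_mono[of 1 "real M * r", simplified]) auto
 also have "\<dots> = real (card F * M) * r ^ DIM('a)"
  using DIM_positive[where 'a='a] by (simp add: power_eq_if[of r "DIM('a)"])
 also have "r ^ DIM('a) = q ^ DIM('a) * (2 * (1 + L)) ^ DIM('a)"
  by (subst q(3)[symmetric]) (simp only: power_mult_distrib[symmetric] mult.commute)
 also have "real (card F * M) * (q ^ DIM('a) * (2 * (1 + L)) ^ DIM('a)) = (real (card F * M) * q ^ DIM('a)) * (2 * (1 + L)) ^ DIM('a)"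
  by (simp only: mult.assoc)
 also have "\<dots> \<le> (R + 3) ^ DIM('a) * (2 * (1 + L)) ^ DIM('a)"
  using * L by (intro mult_right_mono) auto
 finally show ?thesis by (simp only: power_mult_distrib)
qed

text \<open>Balls of radius r around a maximal r-separated subset cover \<open>S\<close>, and the
  packing bound limits their number times r^(d-1) independently of r. Hence the contents at all
  small scales have a common bound, and larger scales follow by monotonicity.\<close>

lemma lipschitz_graph_outer_finite:
 fixes S :: "'a::euclidean_space set"
 assumes \<nu>: "norm \<nu> = 1" and L: "0 \<le> L" and S: "bounded S"
  and lip: "\<And>x y. x \<in> S ==> y \<in> S ==> \<bar>x \<bullet> \<nu> - y \<bullet> \<nu>\<bar> \<le> L * norm ((x - (x \<bullet> \<nu>) *\<^sub>R \<nu>) - (y - (y \<bullet> \<nu>) *\<^sub>R \<nu>))"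
 shows "\<H> (DIM('a) - 1) S < top"
proof -
 obtain R where R: "0 \<le> R" "\<And>x. x \<in> S ==> norm x \<le> R"
  using S by (auto simp: bounded_pos intro: less_imp_le)
 let ?s = "DIM('a) - 1"
 define K where "K = ((R + 3) * (2 * (1 + L))) ^ DIM('a)"
 have content: "hausdorff_content ?s (2 * r) S \<le> ennreal (2 ^ ?s * K)" if r: "0 < r" "r \<le> 1" for r
 proof -
  define sep where "sep F \<longleftrightarrow> finite F \<and> F \<subseteq> S \<and> (\<forall>x\<in>F. \<forall>y\<in>F. x \<noteq> y --> r \<le> dist x y)" for F
  have pack: "real (card F) * r ^ ?s \<le> K" if "sep F" for F
   unfolding K_def using that by (intro lipschitz_graph_packing[OF \<nu> L R lip r]) (auto simp: sep_def)
  have "card F < Suc (nat \<lceil>K / r ^ ?s\<rceil>)" if "sep F" for F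
  proof -
   have "real (card F) \<le> K / r ^ ?s" using pack[OF that] r by (simp add: field_simps)
   then show ?thesis by linarith
  qed
  moreover have "sep {}" by (simp add: sep_def)
  ultimately obtain F where F: "sep F" "\<And>G. sep G ==> card G \<le> card F"
   using ex_has_greatest_nat[of sep "{}" card] by (metis less_imp_le)
  have cov: "\<exists>u\<in>F. dist u x < r" if x: "x \<in> S" for x
  proof (rule ccontr)
   assume n: "\<not> (\<exists>u\<in>F. dist u x < r)"
   then have "x \<notin> F" using r by force
   moreover have "sep (insert x F)" using F(1) n x by (auto simp: sep_def dist_commute not_less)
   ultimately show False using F(2)[of "insert x F"] F(1) by (simp add: sep_def)
  qed
  have fF: "finite F" using F(1) by (simp add: sep_def)
  obtain h where h: "bij_betw h {0..<card F} F" using ex_bij_betw_nat_finite[OF fF] by blast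
  define U where "U k = (if k < card F then cball (h k) r else {})" for k
  have diam: "diameter (U k) \<le> 2 * r" for k
  proof (rule diameter_le)
   fix x y assume "x \<in> U k" "y \<in> U k"
   then have "dist (h k) x \<le> r" "dist (h k) y \<le> r" by (auto simp: U_def split: if_splits)
   then show "norm (x - y) \<le> 2 * r" using dist_triangle3[of x y "h k"] by (simp add: dist_norm)
  qed (use r in auto)
  have "covering (2 * r) S U"
  proof (intro conjI allI diam)
   show "S \<subseteq> (\<Union>k. U k)"
   proof
    fix x assume "x \<in> S"
    then obtain u where u: "u \<in> F" "dist u x < r" using cov by blast
    have "u \<in> h ` {0..<card F}" using h u(1) by (simp add: bij_betw_def)
    then obtain k where "k < card F" "h k = u" by auto
    then show "x \<in> (\<Union>k. U k)" using u by (intro UN_I[of k]) (auto simp: U_def)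
   qed
   show "bounded (U k)" for k by (simp add: U_def)
  qed
  then have "hausdorff_content ?s (2 * r) S \<le> (\<Sum>k. cover_term ?s (U k))" by (rule content_le)
  also have "\<dots> = (\<Sum>k<card F. cover_term ?s (U k))" by (rule suminf_finite) (auto simp: U_def)
  also have "\<dots> \<le> (\<Sum>k<card F. ennreal ((2 * r) ^ ?s))"
  proof (rule sum_mono)
   fix k
   have "bounded (U k)" by (simp add: U_def)
   then have "diameter (U k) ^ ?s \<le> (2 * r) ^ ?s" by (intro power_mono diam diameter_ge_0)
   then show "cover_term ?s (U k) \<le> ennreal ((2 * r) ^ ?s)" by (simp add: ennreal_leI)
  qed
  also have "\<dots> = ennreal (2 ^ ?s * (real (card F) * r ^ ?s))"
   using r by (simp add: ennreal_of_nat_eq_real_of_nat ennreal_mult[symmetric] power_mult_distrib ac_simps)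
  also have "\<dots> \<le> ennreal (2 ^ ?s * K)" by (intro ennreal_leI mult_left_mono pack F) simp
  finally show ?thesis .
 qed
 have "hausdorff_content ?s r S \<le> ennreal (2 ^ ?s * K)" if "0 < r" for r
  using content_antimono[of "2 * min 1 (r/2)" r ?s S] content[of "min 1 (r/2)"] that
  by (force intro: order_trans)
 then have "\<H> ?s S \<le> ennreal (2 ^ ?s * K)"
  unfolding \<H>_def by (intro SUP_least) auto
 then show ?thesis by (rule le_less_trans) simp
qed

text \<open>The part of U strictly below the graph is open and misses \<Omega>, so it misses the
  closure. A frontier point does not lie in the open set \<Omega> and is thereby pinned to the
  graph.\<close>

lemma epigraph_frontier:
 fixes \<Omega> :: "'a::euclidean_space set"
 assumes \<Omega>: "open \<Omega>" and \<phi>: "L-lipschitz_on UNIV \<phi>" and U: "open U"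
  and eq: "\<Omega> \<inter> U = {x\<in>U. \<phi> (x - (x \<bullet> \<nu>) *\<^sub>R \<nu>) < x \<bullet> \<nu>}"
 shows "x \<in> closure \<Omega> ==> x \<in> U ==> \<phi> (x - (x \<bullet> \<nu>) *\<^sub>R \<nu>) \<le> x \<bullet> \<nu>"
  and "x \<in> frontier \<Omega> ==> x \<in> U ==> \<phi> (x - (x \<bullet> \<nu>) *\<^sub>R \<nu>) = x \<bullet> \<nu>"
proof -
 show le: "\<phi> (x - (x \<bullet> \<nu>) *\<^sub>R \<nu>) \<le> x \<bullet> \<nu>" if x: "x \<in> closure \<Omega>" "x \<in> U" for x
 proof (rule ccontr)
  assume n: "\<not> ?thesis"
  have c: "continuous_on UNIV (\<lambda>x. \<phi> (x - (x \<bullet> \<nu>) *\<^sub>R \<nu>))"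
   by (rule continuous_on_compose2[OF lipschitz_on_continuous_on[OF \<phi>]]) (auto intro!: continuous_intros)
  have "open {x. x \<bullet> \<nu> < \<phi> (x - (x \<bullet> \<nu>) *\<^sub>R \<nu>)}"
   by (rule open_Collect_less) (auto intro!: continuous_intros c)
  then have "open (U \<inter> {x. x \<bullet> \<nu> < \<phi> (x - (x \<bullet> \<nu>) *\<^sub>R \<nu>)})" using U by blast
  moreover have "x \<in> U \<inter> {x. x \<bullet> \<nu> < \<phi> (x - (x \<bullet> \<nu>) *\<^sub>R \<nu>)}" using n x by simp
  ultimately obtain y where "y \<in> \<Omega>" "y \<in> U" "y \<bullet> \<nu> < \<phi> (y - (y \<bullet> \<nu>) *\<^sub>R \<nu>)"
   using x(1) unfolding closure_iff_nhds_not_empty by blast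
  then have "y \<in> {x\<in>U. \<phi> (x - (x \<bullet> \<nu>) *\<^sub>R \<nu>) < x \<bullet> \<nu>}" unfolding eq[symmetric] by simp
  with \<open>y \<bullet> \<nu> < \<phi> (y - (y \<bullet> \<nu>) *\<^sub>R \<nu>)\<close> show False by simp
 qed
 show "\<phi> (x - (x \<bullet> \<nu>) *\<^sub>R \<nu>) = x \<bullet> \<nu>" if x: "x \<in> frontier \<Omega>" "x \<in> U" for x
 proof (rule antisym)
  show "\<phi> (x - (x \<bullet> \<nu>) *\<^sub>R \<nu>) \<le> x \<bullet> \<nu>" using x by (intro le) (auto simp: frontier_def)
  have "x \<notin> \<Omega>" using x \<Omega> by (simp add: frontier_def interior_open)
  then have "x \<notin> {x\<in>U. \<phi> (x - (x \<bullet> \<nu>) *\<^sub>R \<nu>) < x \<bullet> \<nu>}" unfolding eq[symmetric] by simp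
  then show "x \<bullet> \<nu> \<le> \<phi> (x - (x \<bullet> \<nu>) *\<^sub>R \<nu>)" using x(2) by simp
 qed
qed

text \<open>By compactness finitely many Lipschitz graph pieces make up the frontier.\<close>

lemma frontier_outer_finite:
 fixes \<Omega> :: "'a::euclidean_space set"
 assumes "bounded_lipschitz_domain \<Omega>"
 shows "\<H> (DIM('a) - 1) (frontier \<Omega>) < top"
proof -
 have \<Omega>: "open \<Omega>" "bounded \<Omega>" using assms by (auto simp: bounded_lipschitz_domain_def)
 have "\<exists>U. open U \<and> p \<in> U \<and> \<H> (DIM('a) - 1) (frontier \<Omega> \<inter> U) < top" if p: "p \<in> frontier \<Omega>" for p
 proof -
  obtain \<nu> \<phi> L U where c: "norm \<nu> = 1" "L-lipschitz_on UNIV \<phi>" "open U" "p \<in> U"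
   "\<Omega> \<inter> U = {x\<in>U. \<phi> (x - (x \<bullet> \<nu>) *\<^sub>R \<nu>) < x \<bullet> \<nu>}"
   using assms p unfolding bounded_lipschitz_domain_def by blast
  have "\<H> (DIM('a) - 1) (frontier \<Omega> \<inter> U) < top"
  proof (rule lipschitz_graph_outer_finite[OF c(1) lipschitz_on_nonneg[OF c(2)]])
   show "bounded (frontier \<Omega> \<inter> U)" using compact_imp_bounded[OF compact_frontier_bounded[OF \<Omega>(2)]] by blast
   fix x y assume "x \<in> frontier \<Omega> \<inter> U" "y \<in> frontier \<Omega> \<inter> U"
   then have e: "\<phi> (x - (x \<bullet> \<nu>) *\<^sub>R \<nu>) = x \<bullet> \<nu>" "\<phi> (y - (y \<bullet> \<nu>) *\<^sub>R \<nu>) = y \<bullet> \<nu>"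
    using epigraph_frontier(2)[OF \<Omega>(1) c(2,3,5)] by auto
   from lipschitz_onD[OF c(2), of "x - (x \<bullet> \<nu>) *\<^sub>R \<nu>" "y - (y \<bullet> \<nu>) *\<^sub>R \<nu>"]
   show "\<bar>x \<bullet> \<nu> - y \<bullet> \<nu>\<bar> \<le> L * norm ((x - (x \<bullet> \<nu>) *\<^sub>R \<nu>) - (y - (y \<bullet> \<nu>) *\<^sub>R \<nu>))"
    by (simp only: e UNIV_I dist_norm real_norm_def simp_thms)
  qed
  with c show ?thesis by blast
 qed
 then obtain U where U: "\<And>p. p \<in> frontier \<Omega> ==> open (U p)" "\<And>p. p \<in> frontier \<Omega> ==> p \<in> U p"
  "\<And>p. p \<in> frontier \<Omega> ==> \<H> (DIM('a) - 1) (frontier \<Omega> \<inter> U p) < top" by metis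
 obtain P where P: "finite P" "P \<subseteq> frontier \<Omega>" "frontier \<Omega> \<subseteq> (\<Union>p\<in>P. U p)"
 proof (rule compactE_image[OF compact_frontier_bounded[OF \<Omega>(2)]])
  show "frontier \<Omega> \<subseteq> (\<Union>p\<in>frontier \<Omega>. U p)" using U(2) by blast
 qed (use U(1) in auto)
 have "\<H> (DIM('a) - 1) (frontier \<Omega> \<inter> (\<Union>p\<in>G. U p)) < top" if "finite G" "G \<subseteq> P" for G
  using that
 proof (induction G)
  case (insert p G)
  have "frontier \<Omega> \<inter> (\<Union>p\<in>insert p G. U p) = (frontier \<Omega> \<inter> U p) \<union> (frontier \<Omega> \<inter> (\<Union>p\<in>G. U p))" by blast
  then have "\<H> (DIM('a) - 1) (frontier \<Omega> \<inter> (\<Union>p\<in>insert p G. U p))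
   \<le> \<H> (DIM('a) - 1) (frontier \<Omega> \<inter> U p) + \<H> (DIM('a) - 1) (frontier \<Omega> \<inter> (\<Union>p\<in>G. U p))"
   by (simp only: outer_Un)
  also have "\<dots> < top" using insert U(3)[of p] P(2) by (auto simp: ennreal_add_less_top)
  finally show ?case .
 qed (simp add: outer_empty)
 from this[OF P(1) order_refl] P(3) show ?thesis by (simp add: Int_absorb2)
qed

subsection \<open>Weak derivatives and Borel versions\<close>

lemma L2_scaleR_integrable:
 assumes "f \<in> L2 M" "g \<in> L2 M" shows "integrable M (\<lambda>z. f z *\<^sub>R g z)"
 by (rule integrable_bd[OF L2_norm_mult_integrable[OF assms]])
  (use assms in \<open>auto dest: L2_measurable\<close>)

definition version :: "'a::euclidean_space set => ('a => 'b::euclidean_space) => ('a => 'b) => bool" where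
 "version Q w w' \<longleftrightarrow> w \<in> L2 (lebesgue_on Q) \<and> w' \<in> L2 lborel \<and> (\<forall>z. z \<notin> Q --> w' z = 0) \<and>
  (AE z in lborel. z \<in> Q --> w' z = w z)"

lemma versionD:
 assumes "version Q w w'"
 shows "w \<in> L2 (lebesgue_on Q)" "w' \<in> L2 lborel" "w' \<in> Borel" "\<And>z. z \<notin> Q ==> w' z = 0"
  "AE z in lborel. z \<in> Q --> w' z = w z"
 using assms L2_measurable[of w' lborel] by (auto simp: version_def)

lemma version_repr:
 assumes "Q \<in> sets borel" "w \<in> L2 (lebesgue_on Q)" shows "version Q w (repr Q w)"
 using repr_L2[OF assms] repr_0[OF assms(1) L2_measurable[OF assms(2)]]
  repr_AE[OF assms(1) L2_measurable[OF assms(2)]] assms by (simp add: version_def)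

lemma version_norm: "Q \<in> sets borel ==> version Q w w' ==> norm_on Q w = nrm w'"
 using L2_on_iff(2)[of Q w w'] versionD[of Q w w'] by (auto dest: L2_measurable)

lemma version_self:
 assumes "Q \<in> sets borel" "w' \<in> L2 lborel" "\<And>z. z \<notin> Q ==> w' z = 0"
 shows "version Q w' w'"
proof -
 have m: "w' \<in> Borel" using L2_measurable[OF assms(2)] by simp
 have "w' \<in> L2 (lebesgue_on Q)"
  using L2_on_iff(1)[OF assms(1) borel_on[OF m] m assms(3)] assms(2) by simp
 then show ?thesis using assms by (simp add: version_def)
qed

lemma version_diff:
 "version Q w w' ==> version Q v v' ==> version Q (\<lambda>z. w z - v z) (\<lambda>z. w' z - v' z)"
 unfolding version_def by (auto intro: L2_diff elim!: AE_mp)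

lemma version_inner: "version Q w w' ==> version Q (\<lambda>z. w z \<bullet> i) (\<lambda>z. w' z \<bullet> i)"
 unfolding version_def by (auto intro: L2_inner_left elim!: AE_mp)

lemma version_cong:
 assumes "Q \<in> sets borel" "version Q w w'" "v \<in> L2 (lebesgue_on Q)" "AE z in lebesgue_on Q. w z = v z"
 shows "version Q v w'"
proof -
 have "AE z in lborel. z \<in> Q --> w z = v z" using assms(1,4) by (simp add: AE_lebesgue_on_iff)
 with versionD(5)[OF assms(2)] have "AE z in lborel. z \<in> Q --> w' z = v z" by eventually_elim auto
 then show ?thesis using assms by (simp add: version_def)
qed

lemma version_change:
 assumes "version Q w w'" "v' \<in> L2 lborel" "\<And>z. z \<notin> Q ==> v' z = 0" "AE z in lborel. w' z = v' z"
 shows "version Q w v'"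
proof -
 from versionD(5)[OF assms(1)] assms(4) have "AE z in lborel. z \<in> Q --> v' z = w z"
  by eventually_elim auto
 then show ?thesis using assms by (simp add: version_def)
qed

lemma integral_version:
 fixes w :: "'a::euclidean_space => 'b::euclidean_space"
 assumes Q: "Q \<in> sets borel" and w: "version Q w w'" and \<phi>: "\<phi> \<in> Borel"
 shows "(\<integral>z. \<phi> z *\<^sub>R w z \<partial>lebesgue_on Q) = (LBINT z. \<phi> z *\<^sub>R w' z)"
proof (rule integral_lebesgue_on_eq[OF Q])
 note V = versionD[OF w]
 show "(\<lambda>z. \<phi> z *\<^sub>R w z) \<in> borel_measurable (lebesgue_on Q)"
  using borel_on[OF \<phi>] L2_measurable[OF V(1)] by measurable
 show "(\<lambda>z. \<phi> z *\<^sub>R w' z) \<in> Borel" using V(3) \<phi> by measurable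
 show "\<phi> z *\<^sub>R w' z = 0" if "z \<notin> Q" for z using V(4)[OF that] by simp
 show "AE z in lebesgue_on Q. \<phi> z *\<^sub>R w z = \<phi> z *\<^sub>R w' z"
  using V(5) Q by (auto simp: AE_lebesgue_on_iff elim!: AE_mp)
qed

text \<open>The two integrals of the definition are joined into one over the whole space; linear
  combinations and cutoffs act on this single integrand.\<close>

lemma weak_deriv_version:
 assumes Q: "Q \<in> sets borel" and w: "version Q w w'" and g: "version Q g g'"
 shows "has_weak_deriv Q b w g \<longleftrightarrow>
  (\<forall>\<phi>\<in>test_fun Q. (LBINT z. \<D> \<phi> z b *\<^sub>R w' z + \<phi> z *\<^sub>R g' z) = 0)"
proof -
 have "((\<integral>z. \<D> \<phi> z b *\<^sub>R w z \<partial>lebesgue_on Q) = - (\<integral>z. \<phi> z *\<^sub>R g z \<partial>lebesgue_on Q))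
  \<longleftrightarrow> (LBINT z. \<D> \<phi> z b *\<^sub>R w' z + \<phi> z *\<^sub>R g' z) = 0" if \<phi>: "\<phi> \<in> test_fun Q" for \<phi>
 proof -
  note C = test_fun_C1[OF \<phi>]
  have "(LBINT z. \<D> \<phi> z b *\<^sub>R w' z + \<phi> z *\<^sub>R g' z)
   = (LBINT z. \<D> \<phi> z b *\<^sub>R w' z) + (LBINT z. \<phi> z *\<^sub>R g' z)"
   using versionD(2)[OF w] versionD(2)[OF g] test_fun_L2[OF \<phi>]
   by (intro lebesgue_add L2_scaleR_integrable)
  then show ?thesis
   using integral_version[OF Q w C1_deriv_measurable[OF C]] integral_version[OF Q g C1_measurable[OF C]]
   by (simp add: eq_neg_iff_add_eq_0)
 qed
 then show ?thesis using versionD(1)[OF w] versionD(1)[OF g] by (auto simp: has_weak_deriv_def)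
qed

definition gradx :: "('a::euclidean_space \<times> real => real) => 'a \<times> real => 'a" where
 "gradx \<phi> z = (\<Sum>i\<in>Basis. \<D> \<phi> z (i, 0) *\<^sub>R i)"

lemma frechet_gradx: "C1 \<phi> ==> \<D> \<phi> z (v, 0) = v \<bullet> gradx \<phi> z"
proof -
 assume "C1 \<phi>"
 then interpret bounded_linear "\<D> \<phi> z" by (rule C1_linear)
 have "(v, 0) = (\<Sum>i\<in>Basis. (v \<bullet> i) *\<^sub>R (i, 0::real))"
  by (simp add: scaleR_prod_def sum_prod euclidean_representation)
 then have "\<D> \<phi> z (v, 0) = (\<Sum>i\<in>Basis. (v \<bullet> i) * \<D> \<phi> z (i, 0))"
  by (simp only: sum scaleR) simp
 then show ?thesis by (simp add: gradx_def inner_sum_right ac_simps)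
qed

lemma gradx_inner: "i \<in> Basis ==> gradx \<phi> z \<bullet> i = \<D> \<phi> z (i, 0)"
 unfolding gradx_def by (simp add: inner_sum_left inner_Basis if_distrib cong: if_cong)

lemma gradx_mult: "C1 \<phi> ==> C1 \<psi> ==> gradx (\<lambda>z. \<phi> z * \<psi> z) z = \<phi> z *\<^sub>R gradx \<psi> z + \<psi> z *\<^sub>R gradx \<phi> z"
 by (simp add: gradx_def C1_mult(2) scaleR_sum_right sum.distrib[symmetric] scaleR_add_left mult.commute)

lemma gradx_time: "C1 h ==> gradx (\<lambda>z. h (snd z)) z = 0"
proof -
 assume "C1 h"
 moreover from this have "\<D> h t 0 = 0" for t
  by (simp add: linear_simps(3)[OF C1_linear])
 ultimately show ?thesis by (simp add: gradx_def C1_snd(2))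
qed

lemma gradx_continuous: "C1 \<phi> ==> continuous_on UNIV (gradx \<phi>)"
 unfolding gradx_def[abs_def] by (intro continuous_intros C1_continuous_deriv)

lemma gradx_measurable: "C1 \<phi> ==> gradx \<phi> \<in> Borel"
 by (rule borel_measurable_continuous_onI[OF gradx_continuous])

lemma gradx_L2: "\<phi> \<in> test_fun Q ==> gradx \<phi> \<in> L2 lborel"
 by (rule L2_componentwise) (simp add: gradx_inner test_fun_L2)

lemma div_version:
 assumes Q: "Q \<in> sets borel" and y: "version Q y y'" and q: "version Q q q'"
 shows "has_div_x Q y q \<longleftrightarrow> (\<forall>\<phi>\<in>test_fun Q. (LBINT z. y' z \<bullet> gradx \<phi> z + \<phi> z * q' z) = 0)"
proof -
 note Y = versionD[OF y]
 have "((\<integral>z. \<D> \<phi> z (y z, 0) \<partial>lebesgue_on Q) = - (\<integral>z. \<phi> z * q z \<partial>lebesgue_on Q))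
  \<longleftrightarrow> (LBINT z. y' z \<bullet> gradx \<phi> z + \<phi> z * q' z) = 0" if \<phi>: "\<phi> \<in> test_fun Q" for \<phi>
 proof -
  note C = test_fun_C1[OF \<phi>]
  have "(\<integral>z. y z \<bullet> gradx \<phi> z \<partial>lebesgue_on Q) = (LBINT z. y' z \<bullet> gradx \<phi> z)"
  proof (rule integral_lebesgue_on_eq[OF Q])
   show "(\<lambda>z. y z \<bullet> gradx \<phi> z) \<in> borel_measurable (lebesgue_on Q)"
    using borel_on[OF gradx_measurable[OF C]] L2_measurable[OF Y(1)] by measurable
   show "(\<lambda>z. y' z \<bullet> gradx \<phi> z) \<in> Borel" using Y(3) gradx_measurable[OF C] by measurable
   show "y' z \<bullet> gradx \<phi> z = 0" if "z \<notin> Q" for z using Y(4)[OF that] by simp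
   show "AE z in lebesgue_on Q. y z \<bullet> gradx \<phi> z = y' z \<bullet> gradx \<phi> z"
    using Y(5) Q by (auto simp: AE_lebesgue_on_iff elim!: AE_mp)
  qed
  moreover have "(LBINT z. y' z \<bullet> gradx \<phi> z + \<phi> z * q' z)
   = (LBINT z. y' z \<bullet> gradx \<phi> z) + (LBINT z. \<phi> z * q' z)"
   using Y(2) versionD(2)[OF q] test_fun_L2(1)[OF \<phi>] gradx_L2[OF \<phi>]
   by (intro lebesgue_add L2_inner_integrable L2_mult_integrable)
  ultimately show ?thesis
   using integral_version[OF Q q C1_measurable[OF C]] by (simp add: eq_neg_iff_add_eq_0 frechet_gradx[OF C])
 qed
 then show ?thesis using Y(1) versionD(1)[OF q] by (auto simp: has_div_x_def)
qed

lemma weak_deriv_L2: "has_weak_deriv Q b w g ==> w \<in> L2 (lebesgue_on Q)" "has_weak_deriv Q b w g ==> g \<in> L2 (lebesgue_on Q)"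
 by (auto simp: has_weak_deriv_def)

lemma div_L2: "has_div_x Q b w ==> b \<in> L2 (lebesgue_on Q)" "has_div_x Q b w ==> w \<in> L2 (lebesgue_on Q)"
 by (auto simp: has_div_x_def)

lemma weak_deriv_diff:
 assumes Q: "open Q" and 1: "has_weak_deriv Q b w g" and 2: "has_weak_deriv Q b v k"
 shows "has_weak_deriv Q b (\<lambda>z. w z - v z) (\<lambda>z. g z - k z)"
proof -
 have Qb: "Q \<in> sets borel" using Q by simp
 note V = version_repr[OF Qb weak_deriv_L2(1)[OF 1]] version_repr[OF Qb weak_deriv_L2(2)[OF 1]]
  version_repr[OF Qb weak_deriv_L2(1)[OF 2]] version_repr[OF Qb weak_deriv_L2(2)[OF 2]]
 show ?thesis
  unfolding weak_deriv_version[OF Qb version_diff[OF V(1,3)] version_diff[OF V(2,4)]]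
 proof
  fix \<phi> assume \<phi>: "\<phi> \<in> test_fun Q"
  note T = test_fun_L2(1,4)[OF \<phi>]
  have "(LBINT z. \<D> \<phi> z b *\<^sub>R (repr Q w z - repr Q v z) + \<phi> z *\<^sub>R (repr Q g z - repr Q k z))
   = (LBINT z. (\<D> \<phi> z b *\<^sub>R repr Q w z + \<phi> z *\<^sub>R repr Q g z)
    - (\<D> \<phi> z b *\<^sub>R repr Q v z + \<phi> z *\<^sub>R repr Q k z))"
   by (simp add: algebra_simps)
  also have "\<dots> = 0"
   using 1 2 \<phi> V[THEN versionD(2)] T unfolding weak_deriv_version[OF Qb V(1,2)] weak_deriv_version[OF Qb V(3,4)]
   by (subst lebesgue_diff) (auto intro!: integrable_plus L2_scaleR_integrable)
  finally show "(LBINT z. \<D> \<phi> z b *\<^sub>R (repr Q w z - repr Q v z) + \<phi> z *\<^sub>R (repr Q g z - repr Q k z)) = 0" .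
 qed
qed

lemma div_diff:
 assumes Q: "open Q" and 1: "has_div_x Q w g" and 2: "has_div_x Q v k"
 shows "has_div_x Q (\<lambda>z. w z - v z) (\<lambda>z. g z - k z)"
proof -
 have Qb: "Q \<in> sets borel" using Q by simp
 note V = version_repr[OF Qb div_L2(1)[OF 1]] version_repr[OF Qb div_L2(2)[OF 1]]
  version_repr[OF Qb div_L2(1)[OF 2]] version_repr[OF Qb div_L2(2)[OF 2]]
 show ?thesis
  unfolding div_version[OF Qb version_diff[OF V(1,3)] version_diff[OF V(2,4)]]
 proof
  fix \<phi> assume \<phi>: "\<phi> \<in> test_fun Q"
  note T = test_fun_L2(1)[OF \<phi>] gradx_L2[OF \<phi>]
  have "(LBINT z. (repr Q w z - repr Q v z) \<bullet> gradx \<phi> z + \<phi> z * (repr Q g z - repr Q k z))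
   = (LBINT z. (repr Q w z \<bullet> gradx \<phi> z + \<phi> z * repr Q g z) - (repr Q v z \<bullet> gradx \<phi> z + \<phi> z * repr Q k z))"
   by (simp add: algebra_simps)
  also have "\<dots> = 0"
   using 1 2 \<phi> V[THEN versionD(2)] T unfolding div_version[OF Qb V(1,2)] div_version[OF Qb V(3,4)]
   by (subst lebesgue_diff)
    (auto intro!: integrable_plus L2_inner_integrable L2_mult_integrable)
  finally show "(LBINT z. (repr Q w z - repr Q v z) \<bullet> gradx \<phi> z + \<phi> z * (repr Q g z - repr Q k z)) = 0" .
 qed
qed

lemma weak_deriv_zero:
 assumes Q: "open Q" and 1: "has_weak_deriv Q b (\<lambda>_. 0) g"
 shows "AE z in lebesgue_on Q. g z = 0"
proof -
 have Qb: "Q \<in> sets borel" using Q by simp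
 note V = version_self[OF Qb L2_zero refl] version_repr[OF Qb weak_deriv_L2(2)[OF 1]]
 have "AE z in lborel. z \<in> Q --> repr Q g z = 0"
  using 1 unfolding weak_deriv_version[OF Qb V]
  by (intro fundamental_lemma[OF Q versionD(2)[OF V(2)]]) auto
 with versionD(5)[OF V(2)] have "AE z in lborel. z \<in> Q --> g z = 0" by eventually_elim auto
 then show ?thesis by (simp add: AE_lebesgue_on_iff[OF Qb])
qed

lemma weak_deriv_unique:
 assumes Q: "open Q" and 1: "has_weak_deriv Q b w g" and 2: "has_weak_deriv Q b w k"
 shows "AE z in lebesgue_on Q. g z = k z"
 using weak_deriv_zero[OF Q, of b "\<lambda>z. g z - k z"] weak_deriv_diff[OF assms] by simp

lemma div_unique:
 assumes Q: "open Q" and 1: "has_div_x Q w g" and 2: "has_div_x Q w k"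
 shows "AE z in lebesgue_on Q. g z = k z"
proof -
 have Qb: "Q \<in> sets borel" using Q by simp
 have D: "has_div_x Q (\<lambda>z. 0) (\<lambda>z. g z - k z)" using div_diff[OF assms] by simp
 note V = version_self[OF Qb L2_zero refl] version_repr[OF Qb div_L2(2)[OF D]]
 have "AE z in lborel. z \<in> Q --> repr Q (\<lambda>z. g z - k z) z = 0"
  using D unfolding div_version[OF Qb V]
  by (intro fundamental_lemma[OF Q versionD(2)[OF V(2)]]) auto
 with versionD(5)[OF V(2)] have "AE z in lborel. z \<in> Q --> g z = k z" by eventually_elim auto
 then show ?thesis by (simp add: AE_lebesgue_on_iff[OF Qb])
qed

lemma grad_L2:
 assumes "has_grad_x Q w g"
 shows "g \<in> L2 (lebesgue_on Q)" "w \<in> L2 (lebesgue_on Q)"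
proof -
 show "g \<in> L2 (lebesgue_on Q)"
 proof (rule L2_componentwise)
  show "(\<lambda>z. g z \<bullet> i) \<in> L2 (lebesgue_on Q)" if "i \<in> Basis" for i
   using assms that by (intro weak_deriv_L2(2)[of Q "(i, 0)" w]) (auto simp: has_grad_x_def)
 qed
 obtain i :: 'a where "i \<in> Basis" using nonempty_Basis by blast
 then show "w \<in> L2 (lebesgue_on Q)"
  using assms weak_deriv_L2(1)[of Q "(i, 0)" w "\<lambda>z. g z \<bullet> i"] by (simp add: has_grad_x_def)
qed

lemma grad_unique:
 assumes Q: "open Q" and 1: "has_grad_x Q w g" and 2: "has_grad_x Q w k"
 shows "AE z in lebesgue_on Q. g z = k z"
proof -
 have "AE z in lebesgue_on Q. \<forall>i\<in>Basis. g z \<bullet> i = k z \<bullet> i"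
 proof (rule AE_finite_allI)
  show "AE z in lebesgue_on Q. g z \<bullet> i = k z \<bullet> i" if "i \<in> Basis" for i
   using 1 2 that by (intro weak_deriv_unique[OF Q, of "(i, 0)" w]) (auto simp: has_grad_x_def)
 qed simp
 then show ?thesis by eventually_elim (auto intro: euclidean_eqI)
qed

lemma grad_diff:
 assumes "open Q" "has_grad_x Q w g" "has_grad_x Q v k"
 shows "has_grad_x Q (\<lambda>z. w z - v z) (\<lambda>z. g z - k z)"
 using assms weak_deriv_diff[of Q "(_, 0)" w _ v] unfolding has_grad_x_def by (auto simp: inner_diff_left)

lemma dt_D: "has_dt Q w p ==> has_dt Q w (dt Q w)"
 unfolding dt_def by (rule someI[of "has_dt Q w" p])

lemma grad_x_D: "has_grad_x Q w g ==> has_grad_x Q w (grad_x Q w)"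
 unfolding grad_x_def by (rule someI[of "has_grad_x Q w" g])

lemma div_x_D: "has_div_x Q y q ==> has_div_x Q y (div_x Q y)"
 unfolding div_x_def by (rule someI[of "has_div_x Q y" q])

subsection \<open>Cutoff in time\<close>

text \<open>On [0, 1] this is 1 - (1 - u^2)^2, whose slope is 0 at both ends; elsewhere it is
  constant.\<close>

definition ramp :: "real => real" where "ramp u = 1 - sq_pos (1 - sq_pos u)"

lemma ramp_C1: "C1 ramp"
proof -
 have d: "(ramp has_real_derivative 4 * max 0 (1 - sq_pos u) * max 0 u) (at u)" for u
  unfolding ramp_def by (auto intro!: derivative_eq_intros DERIV_chain2[OF sq_pos_deriv] sq_pos_deriv)
 have "continuous_on UNIV (\<lambda>u. 4 * max 0 (1 - sq_pos u) * max 0 u)"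
  unfolding sq_pos_def by (intro continuous_intros)
 from C1_real(1)[OF d this] show ?thesis .
qed

lemma ramp_range: "0 \<le> ramp u" "ramp u \<le> 1"
 by (auto simp: ramp_def sq_pos_def power_le_one max_def)

lemma ramp_0: "u \<le> 0 ==> ramp u = 0"
 by (simp add: ramp_def sq_pos_def)

lemma ramp_1: "1 \<le> u ==> ramp u = 1"
proof -
 assume "1 \<le> u"
 then have "1 \<le> (max 0 u)\<^sup>2" by simp
 then show ?thesis by (simp add: ramp_def sq_pos_def)
qed

text \<open>Equal to 0 within 1/(n+1) of the endpoints 0 and \<tau>, and to 1 between them at
  distance at least 2/(n+1) from both. The first margin makes supports compact in the open time
  interval.\<close>

definition cutoff :: "real => nat => real => real" where
 "cutoff \<tau> n s = ramp (real (Suc n) * s - 1) * ramp (real (Suc n) * (\<tau> - s) - 1)"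

lemma cutoff_C1: "C1 (cutoff \<tau> n)"
proof -
 have 1: "C1 (\<lambda>s. ramp (real (Suc n) * s + -1))"
  by (rule C1_compose_affine(1)[OF ramp_C1 bounded_linear_mult_right])
 have 2: "C1 (\<lambda>s. ramp ((- real (Suc n)) * s + (real (Suc n) * \<tau> - 1)))"
  by (rule C1_compose_affine(1)[OF ramp_C1 bounded_linear_mult_right])
 have "cutoff \<tau> n = (\<lambda>s. ramp (real (Suc n) * s + -1) * ramp ((- real (Suc n)) * s + (real (Suc n) * \<tau> - 1)))"
  by (simp add: cutoff_def fun_eq_iff algebra_simps)
 then show ?thesis using C1_mult(1)[OF 1 2] by simp
qed

lemma cutoff_bound: "\<bar>cutoff \<tau> n s\<bar> \<le> 1"
 using ramp_range by (auto simp: cutoff_def abs_mult intro!: mult_le_one)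

lemma cutoff_0: "s \<notin> {1 / real (Suc n)..\<tau> - 1 / real (Suc n)} ==> cutoff \<tau> n s = 0"
 by (auto simp: cutoff_def not_le field_simps intro!: ramp_0)

lemma cutoff_lim: "(\<lambda>n. cutoff \<tau> n s) \<longlonglongrightarrow> indicator {0<..<\<tau>} s"
proof (cases "s \<in> {0<..<\<tau>}")
 case True
 then have s: "0 < s" "0 < \<tau> - s" by auto
 obtain N1 where N1: "2 / s < real N1" using reals_Archimedean2 by blast
 obtain N2 where N2: "2 / (\<tau> - s) < real N2" using reals_Archimedean2 by blast
 have "cutoff \<tau> n s = 1" if "n \<ge> max N1 N2" for n
 proof -
  have "2 / s < real (Suc n)" "2 / (\<tau> - s) < real (Suc n)" using that N1 N2 by linarith+
  then have "2 < real (Suc n) * s" "2 < real (Suc n) * (\<tau> - s)" using s by (simp_all add: pos_divide_less_eq del: of_nat_Suc)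
  then show ?thesis by (simp add: cutoff_def ramp_1 del: of_nat_Suc)
 qed
 then have "\<forall>\<^sub>F n in sequentially. cutoff \<tau> n s = 1" unfolding eventually_sequentially by blast
 then show ?thesis using True by (simp add: tendsto_eventually)
next
 case False
 have "cutoff \<tau> n s = 0" for n
 proof -
  have "0 < 1 / real (Suc n)" by simp
  then show ?thesis using False by (intro cutoff_0) (unfold atLeastAtMost_iff greaterThanLessThan_iff, linarith)
 qed
 then show ?thesis using False by simp
qed

text \<open>The weak spatial divergence on every slab of times before \<tau>, with test functions
  whose support is unrestricted in time. Quantifying over \<tau> makes the notion stable under
  averaging in time, since a time shift moves the end of the slab.\<close>

definition slab_div :: "'a::euclidean_space set => ('a \<times> real => 'a) => ('a \<times> real => real) => bool" where
 "slab_div \<Omega> y q \<longleftrightarrow> y \<in> L2 lborel \<and> q \<in> L2 lborel \<and> (\<forall>\<phi>\<in>test_fun (\<Omega> \<times> UNIV). \<forall>\<tau>.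
  (LBINT z. indicator {..<\<tau>} (snd z) * (y z \<bullet> gradx \<phi> z + \<phi> z * q z)) = 0)"

lemma test_fun_cutoff:
 assumes "\<phi> \<in> test_fun (\<Omega> \<times> UNIV)" "\<tau> \<le> T"
 shows "(\<lambda>z. \<phi> z * cutoff \<tau> n (snd z)) \<in> test_fun (\<Omega> \<times> {0<..<T})"
proof (rule test_funI)
 let ?S = "closure {z. \<phi> z \<noteq> 0} \<inter> (UNIV \<times> {1 / real (Suc n)..\<tau> - 1 / real (Suc n)})"
 show "C1 (\<lambda>z. \<phi> z * cutoff \<tau> n (snd z))"
  by (rule C1_mult(1)[OF test_fun_C1[OF assms(1)] C1_snd(1)[OF cutoff_C1]])
 show "compact ?S"
  using assms(1) by (intro compact_Int_closed closed_Times) (auto simp: test_fun_def)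
 have "0 < 1 / real (Suc n)" by simp
 then have "{1 / real (Suc n)..\<tau> - 1 / real (Suc n)} \<subseteq> {0<..<T}" using assms(2) by (intro subsetI) (unfold atLeastAtMost_iff greaterThanLessThan_iff, linarith)
 then show "?S \<subseteq> \<Omega> \<times> {0<..<T}" using assms(1) unfolding test_fun_def by blast
 fix z assume "z \<notin> ?S"
 then show "\<phi> z * cutoff \<tau> n (snd z) = 0"
  using closure_subset[of "{z. \<phi> z \<noteq> 0}"] cutoff_0[of "snd z" n \<tau>] by (cases z) auto
qed

lemma time_measurable [measurable]:
 fixes f :: "real => 'b::topological_space"
 assumes "f \<in> Borel"
 shows "(\<lambda>z::'a::euclidean_space \<times> real. f (snd z)) \<in> Borel"
 using measurable_compose[OF borel_measurable_continuous_onI[OF continuous_on_snd[OF continuous_on_id]] assms] by simp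

text \<open>Only spatial derivatives fall on the test function, so a cutoff in time passes through
  the gradient. Letting the cutoff tend to the indicator of the time interval removes the
  restriction on the support in time.\<close>

lemma slab_div_version:
 fixes y :: "'a::euclidean_space \<times> real => 'a"
 assumes \<Omega>: "open \<Omega>" and D: "has_div_x (\<Omega> \<times> {0<..<T}) y q"
  and y: "version (\<Omega> \<times> {0<..<T}) y y'" and q: "version (\<Omega> \<times> {0<..<T}) q q'"
 shows "slab_div \<Omega> y' q'"
 unfolding slab_div_def
proof (intro conjI ballI allI)
 have Qb: "\<Omega> \<times> {0<..<T} \<in> sets borel" using \<Omega> by (intro borel_open open_Times) auto
 show "y' \<in> L2 lborel" "q' \<in> L2 lborel" using versionD(2) y q by auto
 fix \<phi> :: "'a \<times> real => real" and \<tau> assume \<phi>: "\<phi> \<in> test_fun (\<Omega> \<times> UNIV)"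
 define G where "G z = y' z \<bullet> gradx \<phi> z + \<phi> z * q' z" for z
 have G: "integrable lborel G" unfolding G_def
  using versionD(2)[OF y] versionD(2)[OF q] test_fun_L2(1)[OF \<phi>] gradx_L2[OF \<phi>]
  by (intro integrable_plus L2_inner_integrable L2_mult_integrable)
 then have [measurable]: "G \<in> Borel" by auto
 have G0: "G z = 0" if "z \<notin> \<Omega> \<times> {0<..<T}" for z
  using versionD(4)[OF y that] versionD(4)[OF q that] by (simp add: G_def)
 have cm[measurable]: "cutoff t n \<in> Borel" for t n by (rule C1_measurable[OF cutoff_C1])
 \<comment> \<open>Beyond T the integrand vanishes, so a larger \<tau> may be replaced by T, for
   which the cutoff still yields test functions on the cylinder.\<close>
 let ?t = "min \<tau> T"
 have 0: "(LBINT z. cutoff ?t n (snd z) * G z) = 0" for n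
 proof -
  have "(\<lambda>z. \<phi> z * cutoff ?t n (snd z)) \<in> test_fun (\<Omega> \<times> {0<..<T})" by (rule test_fun_cutoff[OF \<phi>]) simp
  then have "(LBINT z. y' z \<bullet> gradx (\<lambda>z. \<phi> z * cutoff ?t n (snd z)) z + (\<phi> z * cutoff ?t n (snd z)) * q' z) = 0"
   using D unfolding div_version[OF Qb y q] by blast
  moreover have "gradx (\<lambda>z. \<phi> z * cutoff ?t n (snd z)) z = cutoff ?t n (snd z) *\<^sub>R gradx \<phi> z" for z
   by (simp add: gradx_mult test_fun_C1[OF \<phi>] C1_snd cutoff_C1 gradx_time)
  ultimately show ?thesis by (simp add: G_def algebra_simps)
 qed
 have "(\<lambda>n. \<integral>z. cutoff ?t n (snd z) * G z \<partial>lborel) \<longlonglongrightarrow> (LBINT z. indicator {0<..<?t} (snd z) * G z)"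
 proof (rule integral_dominated_convergence[where w="\<lambda>z. norm (G z)"])
  show "AE z in lborel. (\<lambda>n. cutoff ?t n (snd z) * G z) \<longlonglongrightarrow> indicator {0<..<?t} (snd z) * G z"
   by (intro AE_I2 tendsto_intros cutoff_lim)
  show "AE z in lborel. norm (cutoff ?t n (snd z) * G z) \<le> norm (G z)" for n
   using cutoff_bound by (auto simp: abs_mult intro!: AE_I2 mult_left_le_one_le)
 qed (use G in auto)
 then have "(LBINT z. indicator {0<..<?t} (snd z) * G z) = 0" using 0 LIMSEQ_unique by (simp add: LIMSEQ_const_iff)
 moreover have "(\<lambda>z. indicator {0<..<?t} (snd z) * G z) = (\<lambda>z. indicator {..<\<tau>} (snd z) * G z)"
 proof
  fix z show "indicator {0<..<?t} (snd z) * G z = indicator {..<\<tau>} (snd z) * G z"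
   using G0[of z] by (cases "z \<in> \<Omega> \<times> {0<..<T}") (auto simp: indicator_def)
 qed
 ultimately show "(LBINT z. indicator {..<\<tau>} (snd z) * (y' z \<bullet> gradx \<phi> z + \<phi> z * q' z)) = 0"
  unfolding G_def[symmetric] by (simp only:)
qed

subsection \<open>Boundary terms\<close>

lemma test_fun_lipschitz:
 fixes \<psi> :: "'a::euclidean_space => real"
 assumes "\<psi> \<in> test_fun Q"
 shows "\<exists>\<Lambda>\<ge>0. \<forall>x y. \<bar>\<psi> x - \<psi> y\<bar> \<le> \<Lambda> * norm (x - y)"
proof -
 note C = test_fun_C1[OF assms]
 have "\<forall>b. \<exists>B\<ge>0. \<forall>z. \<bar>\<D> \<psi> z b\<bar> \<le> B" using test_fun_L2(6)[OF assms] by blast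
 then obtain B where B: "\<And>b. 0 \<le> B b" "\<And>b z. \<bar>\<D> \<psi> z b\<bar> \<le> B b" by metis
 define \<Lambda> where "\<Lambda> = (\<Sum>b\<in>Basis. B b)"
 have "onorm (\<D> \<psi> z) \<le> \<Lambda>" for z
 proof (rule onorm_le)
  fix v
  have "norm (\<D> \<psi> z v) \<le> (\<Sum>b\<in>Basis. \<bar>v \<bullet> b\<bar> * \<bar>\<D> \<psi> z b\<bar>)"
   unfolding frechet_components[OF C, of z v] by (auto simp: abs_mult[symmetric] intro: sum_abs)
  also have "\<dots> \<le> (\<Sum>b\<in>Basis. norm v * B b)"
   by (intro sum_mono mult_mono B) (auto simp: Basis_le_norm)
  also have "\<dots> = \<Lambda> * norm v" unfolding \<Lambda>_def sum_distrib_right by (simp add: mult.commute)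
  finally show "norm (\<D> \<psi> z v) \<le> \<Lambda> * norm v" .
 qed
 then have "norm (\<psi> x - \<psi> y) \<le> \<Lambda> * norm (x - y)" for x y
  by (intro differentiable_bound[of UNIV \<psi> "\<lambda>z. \<D> \<psi> z"] C1_has_derivative C) auto
 moreover have "0 \<le> \<Lambda>" by (simp add: \<Lambda>_def B sum_nonneg)
 ultimately show ?thesis by auto
qed

abbreviation surface :: "'a::euclidean_space set => 'a measure" where
 "surface \<Omega> \<equiv> restrict_space (hausdorff_measure (DIM('a) - 1)) (frontier \<Omega>)"

lemma surface_finite:
 fixes \<Omega> :: "'a::euclidean_space set"
 assumes "bounded_lipschitz_domain \<Omega>"
 shows "finite_measure (surface \<Omega>)"
proof
 have "frontier \<Omega> \<in> sets borel" by (simp add: borel_closed)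
 then show "emeasure (surface \<Omega>) (space (surface \<Omega>)) \<noteq> \<infinity>"
  using frontier_outer_finite[OF assms]
  by (simp add: emeasure_restrict_space space_restrict_space emeasure_hausdorff_measure)
qed

lemma borel_on_surface: "f \<in> Borel ==> f \<in> borel_measurable (surface \<Omega>)"
 by (rule measurable_restrict_space1) simp

text \<open>The frontier is cut into level sets of |\<psi>| with step \<eta>, each swept separately.
  Along the layer \<psi> differs from its boundary value by at most \<Lambda> \<sigma>, so summing
  level times volume produces a lower sum of the surface integral plus errors of order \<eta> and
  \<Lambda> \<sigma>.\<close>

lemma layer_integral:
 fixes \<Omega> :: "'a::euclidean_space set"
 assumes \<Omega>: "bounded_lipschitz_domain \<Omega>" and \<psi>: "\<psi> \<in> test_fun Q"
  and lip: "\<And>x y. \<bar>\<psi> x - \<psi> y\<bar> \<le> \<Lambda> * norm (x - y)" "0 \<le> \<Lambda>"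
  and b: "norm b = 1" and \<sigma>: "0 < \<sigma>" and \<eta>: "0 < \<eta>"
  and X: "X \<in> sets borel" "X \<subseteq> layer b \<sigma> (frontier \<Omega>)"
 shows "(LBINT x. indicator X x * \<bar>\<psi> x\<bar>) \<le> layer_const TYPE('a) * \<sigma> *
  ((\<integral>x. \<bar>\<psi> x\<bar> \<partial>surface \<Omega>) + (\<eta> + \<Lambda> * \<sigma>) * measure (surface \<Omega>) (frontier \<Omega>) + \<eta>)"
proof -
 let ?S = "surface \<Omega>" and ?F = "frontier \<Omega>" and ?c = "layer_const TYPE('a)" and ?s = "DIM('a) - 1"
 interpret S: finite_measure ?S by (rule surface_finite[OF \<Omega>])
 have Fb: "?F \<in> sets borel" by (simp add: borel_closed)
 have \<psi>m[measurable]: "\<psi> \<in> Borel" by (rule C1_measurable[OF test_fun_C1[OF \<psi>]])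
 obtain B where B: "0 \<le> B" "\<And>z. \<bar>\<psi> z\<bar> \<le> B" using test_fun_L2(3)[OF \<psi>] by blast
 define J where "J = Suc (nat \<lfloor>B / \<eta>\<rfloor>)"
 define P where "P j = {z\<in>?F. real j * \<eta> \<le> \<bar>\<psi> z\<bar> \<and> \<bar>\<psi> z\<bar> < (real j + 1) * \<eta>}" for j :: nat
 have Pb: "P j \<in> sets borel" for j
 proof -
  have "P j = ?F \<inter> {z\<in>space borel. real j * \<eta> \<le> \<bar>\<psi> z\<bar> \<and> \<bar>\<psi> z\<bar> < (real j + 1) * \<eta>}" by (auto simp: P_def)
  also have "\<dots> \<in> sets borel" using Fb by measurable
  finally show ?thesis .
 qed
 have PS: "P j \<in> sets ?S" "emeasure ?S (P j) = \<H> ?s (P j)" for j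
 proof -
  have "P j \<subseteq> ?F" by (auto simp: P_def)
  then show "P j \<in> sets ?S" "emeasure ?S (P j) = \<H> ?s (P j)"
   using Pb[of j] Fb by (auto simp: sets_restrict_space_iff emeasure_restrict_space emeasure_hausdorff_measure)
 qed
 have cover: "\<exists>j<J. z \<in> P j" if z: "z \<in> ?F" for z
 proof -
  define j where "j = nat \<lfloor>\<bar>\<psi> z\<bar> / \<eta>\<rfloor>"
  have "j < J" unfolding j_def J_def using B(2)[of z] \<eta>
   by (intro le_imp_less_Suc nat_mono floor_mono divide_right_mono) auto
  have jr: "real j = of_int \<lfloor>\<bar>\<psi> z\<bar> / \<eta>\<rfloor>" using \<eta> by (simp add: j_def)
  have "real j * \<eta> \<le> \<bar>\<psi> z\<bar> / \<eta> * \<eta>"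
   unfolding jr using \<eta> by (intro mult_right_mono) auto
  moreover have "\<bar>\<psi> z\<bar> / \<eta> * \<eta> < (real j + 1) * \<eta>"
   unfolding jr using \<eta> floor_correct[of "\<bar>\<psi> z\<bar> / \<eta>"] by (intro mult_strict_right_mono) auto
  ultimately have "z \<in> P j" using z \<eta> by (simp add: P_def)
  with \<open>j < J\<close> show ?thesis by blast
 qed
 have Pdisj: "disjoint_family_on P {..<J}"
 proof -
  have False if "z \<in> P i" "z \<in> P j" "i < j" for i j z
  proof -
   have "(real i + 1) * \<eta> \<le> real j * \<eta>" using \<eta> that(3) by (intro mult_right_mono) auto
   then show False using that by (auto simp: P_def)
  qed
  then show ?thesis unfolding disjoint_family_on_def by (metis disjoint_iff linorder_neqE_nat)
 qed
 define C where "C j = (real j + 1) * \<eta> + \<Lambda> * \<sigma>" for j :: nat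
 have C0: "0 \<le> C j" for j using \<eta> lip(2) \<sigma> by (simp add: C_def)
 \<comment> \<open>Tolerance for the volume of one swept level set, small enough that all of them
   together, weighted with the bounds \<open>C j\<close>, cost at most \<eta>.\<close>
 define \<eta>' where "\<eta>' = \<eta> / (1 + (\<Sum>j<J. C j))"
 have sC: "0 \<le> (\<Sum>j<J. C j)" by (intro sum_nonneg C0)
 have \<eta>': "0 < \<eta>'" "(\<Sum>j<J. C j) * \<eta>' \<le> \<eta>" using \<eta> sC by (auto simp: \<eta>'_def field_simps)
 have "\<exists>L\<in>sets borel. layer b \<sigma> (P j) \<subseteq> L \<and> emeasure lborel L \<le> ennreal (?c * \<sigma> * (measure ?S (P j) + \<eta>'))" for j
 proof -
  have fin: "\<H> ?s (P j) = ennreal (measure ?S (P j))"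
   using PS(2)[of j] S.emeasure_eq_measure[of "P j"] by simp
  have "\<H> ?s (P j) < top" by (simp only: fin ennreal_less_top)
  moreover have "ennreal (?c * \<sigma>) * (\<H> ?s (P j) + ennreal \<eta>') = ennreal (?c * \<sigma> * (measure ?S (P j) + \<eta>'))"
  proof -
   have "\<H> ?s (P j) + ennreal \<eta>' = ennreal (measure ?S (P j) + \<eta>')"
    unfolding fin using \<eta>'(1) by (intro ennreal_plus[symmetric]) auto
   moreover have "0 \<le> ?c * \<sigma>" using \<sigma> layer_const_nonneg[where 'a='a] by simp
   ultimately show ?thesis by (simp only: ennreal_mult')
  qed
  ultimately show ?thesis using layer_hausdorff[OF b \<sigma> _ \<eta>'(1), of "P j"] by (simp only:)
 qed
 then obtain L where L: "\<And>j. L j \<in> sets borel" "\<And>j. layer b \<sigma> (P j) \<subseteq> L j"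
  "\<And>j. emeasure lborel (L j) \<le> ennreal (?c * \<sigma> * (measure ?S (P j) + \<eta>'))" by metis
 have Lf: "emeasure lborel (L j) < \<infinity>" for j using L(3)[of j] by (auto intro: le_less_trans)
 have Lm: "measure lborel (L j) \<le> ?c * \<sigma> * (measure ?S (P j) + \<eta>')" for j
 proof -
  have "ennreal (measure lborel (L j)) \<le> ennreal (?c * \<sigma> * (measure ?S (P j) + \<eta>'))"
   using L(3)[of j] Lf[of j] by (subst emeasure_eq_ennreal_measure[symmetric]) auto
  then show ?thesis using \<sigma> layer_const_nonneg[where 'a='a] \<eta>'(1) by (subst (asm) ennreal_le_iff) auto
 qed
 have point: "indicator X x * \<bar>\<psi> x\<bar> \<le> (\<Sum>j<J. indicator (L j) x * C j)" for x
 proof (cases "x \<in> X")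
  case True
  then obtain z \<tau> where z: "x = z + \<tau> *\<^sub>R b" "z \<in> ?F" "0 \<le> \<tau>" "\<tau> \<le> \<sigma>"
   using X(2) by (auto simp: layer_def)
  obtain j where j: "j < J" "z \<in> P j" using cover[OF z(2)] by blast
  have "x \<in> L j" using L(2)[of j] z j(2) by (auto simp: layer_def)
  have "\<bar>\<psi> x - \<psi> z\<bar> \<le> \<Lambda> * \<tau>" using lip(1)[of x z] z b by simp
  also have "\<dots> \<le> \<Lambda> * \<sigma>" using z lip(2) by (intro mult_left_mono) auto
  finally have "\<bar>\<psi> x\<bar> \<le> C j" using j(2) by (auto simp: P_def C_def)
  also have "\<dots> \<le> (\<Sum>j<J. indicator (L j) x * C j)"
   using \<open>x \<in> L j\<close> j(1) member_le_sum[of j "{..<J}" "\<lambda>j. indicator (L j) x * C j"] C0 by auto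
  finally show ?thesis using True by simp
 qed (auto intro!: sum_nonneg mult_nonneg_nonneg C0)
 have "(LBINT x. indicator X x * \<bar>\<psi> x\<bar>) \<le> (LBINT x. (\<Sum>j<J. indicator (L j) x * C j))"
 proof (rule integral_mono)
  show "integrable lborel (\<lambda>x. \<Sum>j<J. indicator (L j) x * C j)"
   using L(1) Lf by (intro integrable_sums integrable_mult_left) auto
  have "integrable lborel (\<lambda>x. \<psi> x * indicator X x)"
   using test_fun_L2(2)[OF \<psi>] X(1) by (intro integrable_real_mult_indicator) auto
  then have "integrable lborel (\<lambda>x. \<bar>\<psi> x * indicator X x\<bar>)" by (rule integrable_abs)
  then show "integrable lborel (\<lambda>x. indicator X x * \<bar>\<psi> x\<bar>)" by (simp add: abs_mult mult.commute)
 qed (rule point)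
 also have "\<dots> = (\<Sum>j<J. measure lborel (L j) * C j)"
  using L(1) Lf by (subst lebesgue_sum) auto
 also have "\<dots> \<le> (\<Sum>j<J. (?c * \<sigma> * (measure ?S (P j) + \<eta>')) * C j)"
  by (intro sum_mono mult_right_mono Lm C0)
 also have "\<dots> = ?c * \<sigma> * ((\<Sum>j<J. measure ?S (P j) * (real j * \<eta>)) + (\<eta> + \<Lambda> * \<sigma>) * (\<Sum>j<J. measure ?S (P j)) + (\<Sum>j<J. C j) * \<eta>')"
  by (simp add: C_def sum_distrib_left sum_distrib_right sum.distrib[symmetric] algebra_simps)
 also have "\<dots> \<le> ?c * \<sigma> * ((\<integral>x. \<bar>\<psi> x\<bar> \<partial>?S) + (\<eta> + \<Lambda> * \<sigma>) * measure ?S ?F + \<eta>)"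
 proof (intro mult_left_mono add_mono \<eta>'(2))
  have i\<psi>: "integrable ?S (\<lambda>x. \<bar>\<psi> x\<bar>)"
   using B borel_on_surface[OF \<psi>m] by (intro S.integrable_const_bound[of _ B]) auto
  have iP: "integrable ?S (indicat_real (P j))" for j
   using PS(1)[of j] S.emeasure_finite[of "P j"] by (intro integrable_real_indicator) (simp_all only: less_top infinity_ennreal_def)
  have "(\<Sum>j<J. measure ?S (P j) * (real j * \<eta>)) = (\<integral>x. (\<Sum>j<J. indicator (P j) x * (real j * \<eta>)) \<partial>?S)"
  proof -
   have "P j \<inter> ?F = P j" for j by (auto simp: P_def)
   then show ?thesis using iP by (subst lebesgue_sum) (auto simp: space_restrict_space)
  qed
  also have "\<dots> \<le> (\<integral>x. \<bar>\<psi> x\<bar> \<partial>?S)"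
  proof (rule integral_mono[OF _ i\<psi>])
   show "integrable ?S (\<lambda>x. \<Sum>j<J. indicator (P j) x * (real j * \<eta>))"
    by (intro integrable_sums integrable_mult_left iP)
   fix x
   show "(\<Sum>j<J. indicator (P j) x * (real j * \<eta>)) \<le> \<bar>\<psi> x\<bar>"
   proof (cases "\<exists>j<J. x \<in> P j")
    case True
    then obtain j where j: "j < J" "x \<in> P j" by blast
    have "(\<Sum>i<J. indicator (P i) x * (real i * \<eta>)) = (\<Sum>i\<in>{j}. indicator (P i) x * (real i * \<eta>))"
     using Pdisj j by (intro sum.mono_neutral_right) (auto simp: disjoint_family_on_def indicator_def)
    also have "\<dots> = real j * \<eta>" using j by simp
    also have "\<dots> \<le> \<bar>\<psi> x\<bar>" using j(2) by (simp add: P_def)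
    finally show ?thesis .
   next
    case False
    then have "(\<Sum>j<J. indicator (P j) x * (real j * \<eta>)) = 0" by (intro sum.neutral) auto
    then show ?thesis by simp
   qed
  qed
  finally show "(\<Sum>j<J. measure ?S (P j) * (real j * \<eta>)) \<le> (\<integral>x. \<bar>\<psi> x\<bar> \<partial>?S)" .
  have "(\<Sum>j<J. measure ?S (P j)) = measure ?S (\<Union>j<J. P j)"
   using PS(1) Pdisj by (intro S.finite_measure_finite_Union[symmetric]) auto
  also have "(\<Union>j<J. P j) = ?F" using cover unfolding P_def by blast
  finally show "(\<Sum>j<J. measure ?S (P j)) \<le> measure ?S ?F" by simp
  show "0 \<le> ?c * \<sigma>" "0 \<le> \<eta> + \<Lambda> * \<sigma>" using layer_const_nonneg[where 'a='a] \<sigma> \<eta> lip(2) by auto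
 qed
 finally show ?thesis .
qed

text \<open>A substitute for the divergence theorem, as an inequality. The integral over \<Omega> of
  \<psi>(x + \<sigma> b) - \<psi>(x) is, after a translation, carried by the symmetric difference of
  \<Omega> and its shift, which lies in the layer of width \<sigma>; dividing by \<sigma> leaves the
  surface integral in the limit.\<close>

theorem boundary_estimate:
 fixes \<Omega> :: "'a::euclidean_space set"
 assumes \<Omega>: "bounded_lipschitz_domain \<Omega>" and \<psi>: "\<psi> \<in> test_fun UNIV" and b: "norm b = 1"
 shows "\<bar>\<integral>x. indicator \<Omega> x * \<D> \<psi> x b \<partial>lborel\<bar>
  \<le> layer_const TYPE('a) * (\<integral>x. \<bar>\<psi> x\<bar> \<partial>surface \<Omega>)"
proof -
 let ?c = "layer_const TYPE('a)" and ?I = "\<integral>x. \<bar>\<psi> x\<bar> \<partial>surface \<Omega>" and ?h = "measure (surface \<Omega>) (frontier \<Omega>)"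
 have \<Omega>o: "open \<Omega>" "bounded \<Omega>" using \<Omega> by (auto simp: bounded_lipschitz_domain_def)
 have \<Omega>m[measurable]: "\<Omega> \<in> sets borel" using \<Omega>o by simp
 have \<Omega>f: "emeasure lborel \<Omega> < \<infinity>" using emeasure_bounded_finite[OF \<Omega>o(2)] by (simp add: less_top)
 note C = test_fun_C1[OF \<psi>]
 have \<psi>m[measurable]: "\<psi> \<in> Borel" by (rule C1_measurable[OF C])
 obtain \<Lambda> where \<Lambda>: "0 \<le> \<Lambda>" "\<And>x y. \<bar>\<psi> x - \<psi> y\<bar> \<le> \<Lambda> * norm (x - y)" using test_fun_lipschitz[OF \<psi>] by blast
 define \<sigma> where "\<sigma> n = inverse (real (Suc n))" for n
 have \<sigma>: "0 < \<sigma> n" "\<sigma> \<longlonglongrightarrow> 0" for n using LIMSEQ_inverse_real_of_nat by (auto simp: \<sigma>_def[abs_def])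
 define D where "D n = (LBINT x. indicator \<Omega> x * ((\<psi> (x + \<sigma> n *\<^sub>R b) - \<psi> x) / \<sigma> n))" for n
 have lim: "D \<longlonglongrightarrow> (LBINT x. indicator \<Omega> x * \<D> \<psi> x b)"
  unfolding D_def
 proof (rule integral_dominated_convergence[where w="\<lambda>x. indicator \<Omega> x * \<Lambda>"])
  show "AE x in lborel. (\<lambda>n. indicator \<Omega> x * ((\<psi> (x + \<sigma> n *\<^sub>R b) - \<psi> x) / \<sigma> n)) \<longlonglongrightarrow> indicator \<Omega> x * \<D> \<psi> x b"
  proof (rule AE_I2, intro tendsto_intros)
   fix x
   have "((\<lambda>s. x + s *\<^sub>R b) has_derivative (\<lambda>s. s *\<^sub>R b)) (at 0)" by (auto intro!: derivative_eq_intros)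
   from diff_chain_at[OF this, of \<psi> "\<D> \<psi> x"] C1_has_derivative[OF C, of x]
   have "((\<lambda>s. \<psi> (x + s *\<^sub>R b)) has_derivative (\<lambda>s. \<D> \<psi> x (s *\<^sub>R b))) (at 0)"
    by (simp add: o_def)
   moreover have "(\<lambda>s. \<D> \<psi> x (s *\<^sub>R b)) = (*) (\<D> \<psi> x b)"
    by (auto simp: linear_simps(5)[OF C1_linear[OF C]])
   ultimately have "((\<lambda>s. \<psi> (x + s *\<^sub>R b)) has_real_derivative \<D> \<psi> x b) (at 0)"
    by (simp add: has_field_derivative_def)
   then have "((\<lambda>s. (\<psi> (x + s *\<^sub>R b) - \<psi> x) / s) \<longlongrightarrow> \<D> \<psi> x b) (at 0)"
    by (simp add: DERIV_def)
   moreover have "filterlim \<sigma> (at 0) sequentially" using \<sigma> by (auto simp: filterlim_at intro!: always_eventually less_imp_neq[symmetric])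
   ultimately show "(\<lambda>n. (\<psi> (x + \<sigma> n *\<^sub>R b) - \<psi> x) / \<sigma> n) \<longlonglongrightarrow> \<D> \<psi> x b"
    by (rule filterlim_compose)
  qed
  show "AE x in lborel. norm (indicator \<Omega> x * ((\<psi> (x + \<sigma> n *\<^sub>R b) - \<psi> x) / \<sigma> n)) \<le> indicator \<Omega> x * \<Lambda>" for n
  proof (rule AE_I2)
   fix x
   have "\<bar>\<psi> (x + \<sigma> n *\<^sub>R b) - \<psi> x\<bar> \<le> \<Lambda> * \<sigma> n" using \<Lambda>(2)[of "x + \<sigma> n *\<^sub>R b" x] b \<sigma>(1)[of n] by simp
   then have "\<bar>(\<psi> (x + \<sigma> n *\<^sub>R b) - \<psi> x) / \<sigma> n\<bar> \<le> \<Lambda>" using \<sigma>(1)[of n] by (simp add: field_simps)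
   then show "norm (indicator \<Omega> x * ((\<psi> (x + \<sigma> n *\<^sub>R b) - \<psi> x) / \<sigma> n)) \<le> indicator \<Omega> x * \<Lambda>"
    by (simp add: indicator_def del: abs_divide)
  qed
  show "integrable lborel (\<lambda>x. indicator \<Omega> x * \<Lambda>)" using \<Omega>f by (intro integrable_mult_left) simp
  have [measurable]: "(\<lambda>x. \<D> \<psi> x b) \<in> Borel" by (rule C1_deriv_measurable[OF C])
  show "(\<lambda>x. indicator \<Omega> x * \<D> \<psi> x b) \<in> borel_measurable lborel" by measurable
 qed measurable
 have bound: "\<bar>D n\<bar> \<le> ?c * (?I + \<sigma> n * (?h + \<Lambda> * ?h + 1))" for n
 proof -
  let ?s = "\<sigma> n"
  define X where "X = {x. x - ?s *\<^sub>R b \<in> \<Omega> \<longleftrightarrow> x \<notin> \<Omega>}"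
  have X: "X \<in> sets borel"
  proof -
   have "X = {x\<in>space borel. x - ?s *\<^sub>R b \<in> \<Omega> \<longleftrightarrow> x \<notin> \<Omega>}" by (simp add: X_def)
   also have "\<dots> \<in> sets borel" by measurable
   finally show ?thesis .
  qed
  have XL: "X \<subseteq> layer b ?s (frontier \<Omega>)"
  proof
   fix x assume x: "x \<in> X"
   \<comment> \<open>The segment joins a point of \<Omega> to a point outside, so by connectedness
     it meets the frontier; the crossing is the foot point of x in the layer.\<close>
   let ?G = "closed_segment (x - ?s *\<^sub>R b) x"
   have "?G \<inter> frontier \<Omega> \<noteq> {}"
   proof (rule connected_Int_frontier[OF connected_segment(1)])
    have "x \<in> ?G" "x - ?s *\<^sub>R b \<in> ?G" by (rule ends_in_segment)+
    then show "?G \<inter> \<Omega> \<noteq> {}" "?G - \<Omega> \<noteq> {}" using x unfolding X_def by blast+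
   qed
   then obtain z where "z \<in> frontier \<Omega>" "z \<in> ?G" by blast
   then obtain u where z: "z \<in> frontier \<Omega>" "0 \<le> u" "u \<le> 1" "z = (1 - u) *\<^sub>R (x - ?s *\<^sub>R b) + u *\<^sub>R x"
    unfolding in_segment by blast
   have "x = z + ((1 - u) * ?s) *\<^sub>R b" by (simp add: z(4) algebra_simps)
   moreover have "(1 - u) * ?s \<le> ?s" using z(2,3) \<sigma>(1)[of n] by (simp add: mult_left_le_one_le)
   ultimately show "x \<in> layer b ?s (frontier \<Omega>)"
    unfolding layer_def using z \<sigma>(1)[of n] by (intro CollectI exI[of _ z] exI[of _ "(1 - u) * ?s"]) auto
  qed
  have i1: "integrable lborel (\<lambda>x. indicator \<Omega> x * \<psi> x)"
   using integrable_real_mult_indicator[OF _ test_fun_L2(2)[OF \<psi>], of \<Omega>] by (simp add: mult.commute)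
  have "integrable lborel (\<lambda>x. \<psi> (x - - (?s *\<^sub>R b)))" by (rule lborel_integrable_translate[OF test_fun_L2(2)[OF \<psi>]])
  then have i2: "integrable lborel (\<lambda>x. indicator \<Omega> x * \<psi> (x + ?s *\<^sub>R b))"
   using integrable_real_mult_indicator[of \<Omega> lborel "\<lambda>x. \<psi> (x + ?s *\<^sub>R b)"] by (simp add: mult.commute)
  have i3: "integrable lborel (\<lambda>x. indicator \<Omega> (x - ?s *\<^sub>R b) * \<psi> x)"
   using lborel_integrable_translate[OF i2, of "?s *\<^sub>R b"] by simp
  have "?s * D n = (LBINT x. indicator \<Omega> x * \<psi> (x + ?s *\<^sub>R b) - indicator \<Omega> x * \<psi> x)"
  proof -
   have "(\<lambda>x. indicator \<Omega> x * \<psi> (x + ?s *\<^sub>R b) - indicator \<Omega> x * \<psi> x)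
    = (\<lambda>x. ?s * (indicator \<Omega> x * ((\<psi> (x + ?s *\<^sub>R b) - \<psi> x) / ?s)))"
    using \<sigma>(1)[of n] by (simp add: fun_eq_iff field_simps)
   then show ?thesis by (simp only: D_def integral_mult_right_zero)
  qed
  also have "\<dots> = (LBINT x. indicator \<Omega> x * \<psi> (x + ?s *\<^sub>R b)) - (LBINT x. indicator \<Omega> x * \<psi> x)"
   by (rule lebesgue_diff[OF i2 i1])
  also have "(LBINT x. indicator \<Omega> x * \<psi> (x + ?s *\<^sub>R b)) = (LBINT x. indicator \<Omega> (x - ?s *\<^sub>R b) * \<psi> x)"
   using lborel_integral_translate[of "\<lambda>x. indicator \<Omega> x * \<psi> (x + ?s *\<^sub>R b)" "?s *\<^sub>R b"] by simp
  also have "\<dots> - (LBINT x. indicator \<Omega> x * \<psi> x) = (LBINT x. indicator \<Omega> (x - ?s *\<^sub>R b) * \<psi> x - indicator \<Omega> x * \<psi> x)"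
   by (rule lebesgue_diff[symmetric, OF i3 i1])
  finally have "?s * \<bar>D n\<bar> = \<bar>\<integral>x. indicator \<Omega> (x - ?s *\<^sub>R b) * \<psi> x - indicator \<Omega> x * \<psi> x \<partial>lborel\<bar>"
   using \<sigma>(1)[of n] by (metis abs_mult abs_of_pos)
  also have "\<dots> \<le> (LBINT x. \<bar>indicator \<Omega> (x - ?s *\<^sub>R b) * \<psi> x - indicator \<Omega> x * \<psi> x\<bar>)" by simp
  also have "(\<lambda>x. \<bar>indicator \<Omega> (x - ?s *\<^sub>R b) * \<psi> x - indicator \<Omega> x * \<psi> x\<bar>) = (\<lambda>x. indicator X x * \<bar>\<psi> x\<bar>)"
   by (auto simp: X_def fun_eq_iff indicator_def)
  \<comment> \<open>The slicing step \<eta> is taken equal to the width \<open>\<sigma> n\<close>,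
    so all error terms vanish together.\<close>
  also have "(LBINT x. indicator X x * \<bar>\<psi> x\<bar>) \<le> ?c * ?s * (?I + (?s + \<Lambda> * ?s) * ?h + ?s)"
   by (rule layer_integral[OF \<Omega> \<psi> \<Lambda>(2,1) b \<sigma>(1) \<sigma>(1) X XL])
  also have "\<dots> = ?s * (?c * (?I + ?s * (?h + \<Lambda> * ?h + 1)))" by (simp add: algebra_simps)
  finally show ?thesis using \<sigma>(1)[of n] by simp
 qed
 have a: "(\<lambda>n. \<bar>D n\<bar>) \<longlonglongrightarrow> \<bar>\<integral>x. indicator \<Omega> x * \<D> \<psi> x b \<partial>lborel\<bar>"
  by (rule tendsto_rabs[OF lim])
 have b: "(\<lambda>n. ?c * (?I + \<sigma> n * (?h + \<Lambda> * ?h + 1))) \<longlonglongrightarrow> ?c * (?I + 0 * (?h + \<Lambda> * ?h + 1))"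
  by (intro tendsto_intros \<sigma>)
 from LIMSEQ_le[OF a b exI[of _ 0]] bound show ?thesis by simp
qed

subsection \<open>Extension by zero\<close>

text \<open>The test functions may be nonzero at the lateral boundary; for a function extended by 0
  this is the weak form of a zero lateral trace.\<close>

definition global_grad :: "('a::euclidean_space \<times> real => real) => ('a \<times> real => 'a) => bool" where
 "global_grad w g \<longleftrightarrow> w \<in> L2 lborel \<and> g \<in> L2 lborel \<and>
  (\<forall>\<phi>\<in>test_fun UNIV. (LBINT z. w z *\<^sub>R gradx \<phi> z + \<phi> z *\<^sub>R g z) = 0)"

lemma L2_lim_version:
 assumes Q: "Q \<in> sets borel" and lim: "L2_lim (lebesgue_on Q) W w" and w: "version Q w w'" and W: "\<And>k. version Q (W k) (W' k)"
 shows "L2_lim lborel W' w'"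
 using L2_limD(3)[OF lim] version_norm[OF Q version_diff[OF W w]] versionD(2)[OF W] versionD(2)[OF w]
 by (simp add: L2_lim_def)

lemma version_indicator:
 fixes f :: "'a::euclidean_space => 'b::euclidean_space"
 assumes Q: "Q \<in> sets borel" and f: "f \<in> Borel" "f \<in> L2 (lebesgue_on Q)"
 shows "version Q f (\<lambda>z. indicator Q z *\<^sub>R f z)"
proof -
 have m: "(\<lambda>z. indicator Q z *\<^sub>R f z) \<in> Borel" using Q f(1) by measurable
 have "(\<lambda>z. indicator Q z *\<^sub>R f z) \<in> L2 lborel"
  using L2_on_iff(1)[OF Q L2_measurable[OF f(2)] m] f(2) by auto
 then show ?thesis using f(2) by (simp add: version_def)
qed

lemma slice_test_fun:
 fixes \<phi> W :: "'a::euclidean_space \<times> real => real"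
 assumes \<phi>: "\<phi> \<in> test_fun UNIV" and W: "C1 W"
 shows "(\<lambda>x. \<phi> (x, t) * W (x, t)) \<in> test_fun UNIV"
  "\<D> (\<lambda>x. \<phi> (x, t) * W (x, t)) x v = \<D> (\<lambda>z. \<phi> z * W z) (x, t) (v, 0)"
proof -
 have L: "bounded_linear (\<lambda>x::'a. (x, 0::real))" by (intro bounded_linear_Pair bounded_linear_ident bounded_linear_zero)
 have C: "C1 (\<lambda>z. \<phi> z * W z)" by (rule C1_mult(1)[OF test_fun_C1[OF \<phi>] W])
 note A = C1_compose_affine[OF C L, of "(0, t)", simplified]
 show "\<D> (\<lambda>x. \<phi> (x, t) * W (x, t)) x v = \<D> (\<lambda>z. \<phi> z * W z) (x, t) (v, 0)"
  by (simp add: A(2))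
 show "(\<lambda>x. \<phi> (x, t) * W (x, t)) \<in> test_fun UNIV"
 proof (rule test_funI[OF A(1)])
  show "compact (fst ` closure {z. \<phi> z \<noteq> 0})"
   using \<phi> by (intro compact_continuous_image continuous_on_fst continuous_on_id) (simp add: test_fun_def)
  fix x assume "x \<notin> fst ` closure {z. \<phi> z \<noteq> 0}"
  then have "(x, t) \<notin> {z. \<phi> z \<noteq> 0}" using closure_subset[of "{z. \<phi> z \<noteq> 0}"] by force
  then show "\<phi> (x, t) * W (x, t) = 0" by simp
 qed simp
qed

text \<open>\<open>boundary_estimate\<close> is applied on every time slice and integrated over (0,
  T); Cauchy-Schwarz on the finite lateral measure then brings in the L2 norm on the lateral
  boundary.\<close>

lemma lateral_estimate:
 fixes \<Omega> :: "'a::euclidean_space set" and \<phi> W :: "'a \<times> real => real"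
 assumes \<Omega>: "bounded_lipschitz_domain \<Omega>" and \<phi>: "\<phi> \<in> test_fun UNIV" and W: "C1 W" and b: "norm b = 1"
  and L: "W \<in> L2 (lateral_measure \<Omega> T)" and B: "0 \<le> B" "\<And>z. \<bar>\<phi> z\<bar> \<le> B"
 shows "\<bar>\<integral>z. indicator (\<Omega> \<times> {0<..<T}) z * \<D> (\<lambda>z. \<phi> z * W z) z (b, 0) \<partial>lborel\<bar>
  \<le> layer_const TYPE('a) * B * sqrt (measure (lateral_measure \<Omega> T) (space (lateral_measure \<Omega> T))) * L2_norm (lateral_measure \<Omega> T) W"
proof -
 let ?S = "surface \<Omega>" and ?R = "restrict_space lborel {0<..<T} :: real measure" and ?c = "layer_const TYPE('a)"
 let ?M = "lateral_measure \<Omega> T" and ?Q = "\<Omega> \<times> {0<..<T}"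
 have M: "?M = ?S \<Otimes>\<^sub>M ?R" by (simp add: lateral_measure_def)
 interpret S: finite_measure ?S by (rule surface_finite[OF \<Omega>])
 interpret R: finite_measure ?R
  by (rule finite_measureI, cases "0 \<le> T") (auto simp: emeasure_restrict_space space_restrict_space)
 interpret P: pair_sigma_finite ?S ?R ..
 interpret M: finite_measure ?M unfolding M by (rule finite_measure_pair_measure) unfold_locales
 have \<Omega>o: "open \<Omega>" "bounded \<Omega>" using \<Omega> by (auto simp: bounded_lipschitz_domain_def)
 have Qm[measurable]: "?Q \<in> sets borel" using \<Omega>o by (intro borel_open open_Times) auto
 have Qf: "emeasure lborel ?Q < \<infinity>"
  using emeasure_bounded_finite[of ?Q] \<Omega>o by (simp add: less_top bounded_Times)
 have C: "C1 (\<lambda>z. \<phi> z * W z)" by (rule C1_mult(1)[OF test_fun_C1[OF \<phi>] W])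
 let ?D = "\<lambda>z. \<D> (\<lambda>z. \<phi> z * W z) z (b, 0)"
 have \<phi>W: "(\<lambda>z. \<phi> z * W z) \<in> test_fun UNIV"
  by (rule test_funI[OF C, of "closure {z. \<phi> z \<noteq> 0}"])
   (use \<phi> closure_subset[of "{z. \<phi> z \<noteq> 0}"] in \<open>auto simp: test_fun_def\<close>)
 have [measurable]: "?D \<in> Borel" by (rule C1_deriv_measurable[OF C])
 have i: "integrable lborel (\<lambda>z. indicator ?Q z * ?D z)"
  using integrable_real_mult_indicator[OF _ test_fun_L2(5)[OF \<phi>W], of ?Q "(b, 0)"] by (simp add: mult.commute)
 have fst_m: "fst \<in> measurable ?M borel" "snd \<in> measurable ?M borel"
  unfolding M
  by (rule measurable_compose[OF measurable_fst], simp add: measurable_restrict_space1)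
   (rule measurable_compose[OF measurable_snd], simp add: measurable_restrict_space1)
 have "(\<lambda>z. (fst z, snd z)) \<in> measurable ?M (borel \<Otimes>\<^sub>M borel)" by (intro measurable_Pair fst_m)
 then have idm: "(\<lambda>z. z) \<in> measurable ?M borel" by (simp add: borel_prod)
 have \<phi>m: "\<phi> \<in> borel_measurable ?M" using measurable_compose[OF idm C1_measurable[OF test_fun_C1[OF \<phi>]]] .
 have Wm: "W \<in> borel_measurable ?M" using L by (rule L2_measurable)
 have 1: "(\<lambda>_. 1::real) \<in> L2 ?M" by (intro L2I) auto
 have iW: "integrable ?M (\<lambda>z. \<bar>W z\<bar>)" using L2_norm_mult_integrable[OF L 1] by simp
 have i\<phi>W: "integrable ?M (\<lambda>z. \<bar>\<phi> z * W z\<bar>)"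
  by (rule integrable_bd[OF integrable_mult_right[OF iW, of B]])
   (use \<phi>m Wm B in \<open>auto simp: abs_mult intro!: AE_I2 mult_right_mono\<close>)
 have int_t: "integrable ?R (\<lambda>t. \<integral>x. \<bar>\<phi> (x, t) * W (x, t)\<bar> \<partial>?S)"
  using P.integrable_snd[of "\<lambda>x t. \<bar>\<phi> (x, t) * W (x, t)\<bar>"] i\<phi>W by (simp add: M split_beta')
 define A where "A t = (LBINT x. indicator \<Omega> x * ?D (x, t))" for t
 have A: "\<bar>A t\<bar> \<le> ?c * (\<integral>x. \<bar>\<phi> (x, t) * W (x, t)\<bar> \<partial>?S)" for t
  using boundary_estimate[OF \<Omega> slice_test_fun(1)[OF \<phi> W] b, of t] by (simp add: A_def slice_test_fun(2)[OF \<phi> W])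
 have i': "integrable (lborel \<Otimes>\<^sub>M lborel) (\<lambda>(x, t). indicator ?Q (x, t) * ?D (x, t))"
  using i by (simp add: lborel_prod split_beta')
 have inner_eq: "(LBINT x. indicator ?Q (x, t) * ?D (x, t)) = indicator {0<..<T} t * A t" for t
  unfolding A_def by (subst integral_mult_right_zero[symmetric]) (auto intro!: lebesgue_cong simp: indicator_def)
 have iA: "integrable lborel (\<lambda>t. indicator {0<..<T} t * A t)"
  using lborel_pair.integrable_snd[OF i'] by (simp add: inner_eq)
 have "(LBINT z. indicator ?Q z * ?D z) = (LBINT t. (LBINT x. indicator ?Q (x, t) * ?D (x, t)))"
  using lborel_pair.integral_snd[OF i'] by (simp add: lborel_prod split_beta')
 also have "\<dots> = (\<integral>t. A t \<partial>?R)"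
  unfolding inner_eq by (subst integral_restrict_space) auto
 finally have "\<bar>\<integral>z. indicator ?Q z * ?D z \<partial>lborel\<bar> = \<bar>\<integral>t. A t \<partial>?R\<bar>" by simp
 also have "\<dots> \<le> (\<integral>t. \<bar>A t\<bar> \<partial>?R)" by simp
 also have "\<dots> \<le> (\<integral>t. ?c * (\<integral>x. \<bar>\<phi> (x, t) * W (x, t)\<bar> \<partial>?S) \<partial>?R)"
 proof (rule integral_mono)
  have "integrable ?R A" using iA by (subst integrable_restrict_space) auto
  then show "integrable ?R (\<lambda>t. \<bar>A t\<bar>)" by simp
 qed (use int_t A in auto)
 also have "\<dots> = ?c * (\<integral>t. (\<integral>x. \<bar>\<phi> (x, t) * W (x, t)\<bar> \<partial>?S) \<partial>?R)" by simp
 also have "(\<integral>t. (\<integral>x. \<bar>\<phi> (x, t) * W (x, t)\<bar> \<partial>?S) \<partial>?R) = (\<integral>z. \<bar>\<phi> z * W z\<bar> \<partial>?M)"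
  using P.integral_snd[of "\<lambda>x t. \<bar>\<phi> (x, t) * W (x, t)\<bar>"] i\<phi>W by (simp add: M split_beta')
 also have "\<dots> \<le> (\<integral>z. B * (norm (1::real) * norm (W z)) \<partial>?M)"
  using i\<phi>W iW B by (intro integral_mono) (auto simp: abs_mult intro: mult_right_mono)
 also have "\<dots> = B * (\<integral>z. norm (1::real) * norm (W z) \<partial>?M)" by simp
 also have "\<dots> \<le> B * (L2_norm ?M (\<lambda>_. 1::real) * L2_norm ?M W)"
  by (intro mult_left_mono L2_Cauchy_Schwarz_norm 1 L B)
 also have "L2_norm ?M (\<lambda>_. 1::real) = sqrt (measure ?M (space ?M))" by (simp add: L2_norm_def)
 finally show ?thesis using layer_const_nonneg[where 'a='a] by (simp add: mult_left_mono mult.assoc)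
qed

text \<open>For the C1 approximants \<open>W k\<close> the identity fails only by the integral of
  the derivative of \<phi> W k over the cylinder. \<open>lateral_estimate\<close> bounds this by the
  lateral norm of \<open>W k\<close>, which tends to 0, while the remaining terms converge.\<close>

theorem zero_lateral_global_grad:
 fixes \<Omega> :: "'a::euclidean_space set"
 assumes \<Omega>: "bounded_lipschitz_domain \<Omega>" and z: "zero_lateral \<Omega> T w"
  and g: "has_grad_x (\<Omega> \<times> {0<..<T}) w g"
  and w': "version (\<Omega> \<times> {0<..<T}) w w'" and g': "version (\<Omega> \<times> {0<..<T}) g g'"
 shows "global_grad w' g'"
proof -
 let ?Q = "\<Omega> \<times> {0<..<T}" and ?M = "lateral_measure \<Omega> T"
 have \<Omega>o: "open \<Omega>" using \<Omega> by (auto simp: bounded_lipschitz_domain_def)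
 have Qo: "open ?Q" using \<Omega>o by (intro open_Times) auto
 have Qb[measurable]: "?Q \<in> sets borel" using Qo by simp
 obtain W where W: "\<And>k. C1 (W k)" "L2_lim (lebesgue_on ?Q) W w" "L2_lim ?M W (\<lambda>_. 0)"
  "\<And>i. i \<in> Basis ==> \<exists>p. has_weak_deriv ?Q (i, 0) w p \<and>
    L2_lim (lebesgue_on ?Q) (\<lambda>k z. \<D> (W k) z (i, 0)) p"
  using z unfolding zero_lateral_def has_trace_def by blast
 have main: "(LBINT z. \<D> \<phi> z (i, 0) * w' z + \<phi> z * (g' z \<bullet> i)) = 0"
  if i: "i \<in> Basis" and \<phi>: "\<phi> \<in> test_fun UNIV" for i :: 'a and \<phi>
 proof -
  obtain p where p: "has_weak_deriv ?Q (i, 0) w p"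
   "L2_lim (lebesgue_on ?Q) (\<lambda>k z. \<D> (W k) z (i, 0)) p" using W(4)[OF i] by blast
  have "has_weak_deriv ?Q (i, 0) w (\<lambda>z. g z \<bullet> i)" using g i by (simp add: has_grad_x_def)
  \<comment> \<open>The limit \<open>p\<close> supplied by the trace belongs to one direction;
    uniqueness identifies it with the corresponding component of the given gradient.\<close>
  from weak_deriv_unique[OF Qo this p(1)]
  have p': "version ?Q p (\<lambda>z. g' z \<bullet> i)"
   by (intro version_cong[OF Qb version_inner[OF g']] weak_deriv_L2(2)[OF p(1)])
  note T = test_fun_L2[OF \<phi>] and C = test_fun_C1[OF \<phi>]
  let ?W = "\<lambda>k z. indicator ?Q z *\<^sub>R W k z" and ?DW = "\<lambda>k z. indicator ?Q z *\<^sub>R \<D> (W k) z (i, 0)"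
  have L1: "L2_lim lborel ?W w'"
   using L2_limD(1)[OF W(2)] C1_measurable[OF W(1)]
   by (intro L2_lim_version[OF Qb W(2) w'] version_indicator Qb)
  have L2': "L2_lim lborel ?DW (\<lambda>z. g' z \<bullet> i)"
   using L2_limD(1)[OF p(2)] C1_deriv_measurable[OF W(1)]
   by (intro L2_lim_version[OF Qb p(2) p'] version_indicator Qb)
  have "(\<lambda>k. (LBINT z. \<D> \<phi> z (i, 0) \<bullet> ?W k z) + (LBINT z. \<phi> z \<bullet> ?DW k z))
   \<longlonglongrightarrow> (LBINT z. \<D> \<phi> z (i, 0) \<bullet> w' z) + (LBINT z. \<phi> z \<bullet> (g' z \<bullet> i))"
   by (intro tendsto_add L2_lim_inner L2_lim_const T L1 L2')
  moreover have "(LBINT z. \<D> \<phi> z (i, 0) \<bullet> ?W k z) + (LBINT z. \<phi> z \<bullet> ?DW k z)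
   = (LBINT z. indicator ?Q z * \<D> (\<lambda>z. \<phi> z * W k z) z (i, 0))" for k
   using L2_inner_integrable[OF T(4) L2_limD(1)[OF L1]] L2_inner_integrable[OF T(1) L2_limD(1)[OF L2']]
   by (subst lebesgue_add[symmetric]) (auto simp: C1_mult(2)[OF C W(1)] algebra_simps)
  moreover have "(\<lambda>k. \<integral>z. indicator ?Q z * \<D> (\<lambda>z. \<phi> z * W k z) z (i, 0) \<partial>lborel) \<longlonglongrightarrow> 0"
  proof -
   obtain B where B: "0 \<le> B" "\<And>z. \<bar>\<phi> z\<bar> \<le> B" using T(3) by blast
   let ?K = "layer_const TYPE('a) * B * sqrt (measure ?M (space ?M))"
   have le: "\<bar>\<integral>z. indicator ?Q z * \<D> (\<lambda>z. \<phi> z * W k z) z (i, 0) \<partial>lborel\<bar> \<le> ?K * L2_norm ?M (W k)" for k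
    by (rule lateral_estimate[OF \<Omega> \<phi> W(1) _ L2_limD(1)[OF W(3)] B]) (use i in simp)
   have "(\<lambda>k. ?K * L2_norm ?M (W k)) \<longlonglongrightarrow> 0"
    using L2_limD(3)[OF W(3)] by (intro tendsto_mult_right_zero) simp
   then show ?thesis by (rule Lim_null_comparison[rotated]) (use le in \<open>auto intro!: always_eventually\<close>)
  qed
  ultimately have "(LBINT z. \<D> \<phi> z (i, 0) \<bullet> w' z) + (LBINT z. \<phi> z \<bullet> (g' z \<bullet> i)) = 0"
   using LIMSEQ_unique by simp
  then show ?thesis
   using L2_inner_integrable[OF T(4) versionD(2)[OF w']] L2_inner_integrable[OF T(1) versionD(2)[OF p']]
   by (subst lebesgue_add) auto
 qed
 show ?thesis
  unfolding global_grad_def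
 proof (intro conjI ballI versionD(2)[OF w'] versionD(2)[OF g'])
  fix \<phi> :: "'a \<times> real => real" assume \<phi>: "\<phi> \<in> test_fun UNIV"
  have int: "integrable lborel (\<lambda>z. w' z *\<^sub>R gradx \<phi> z + \<phi> z *\<^sub>R g' z)"
   using versionD(2)[OF w'] versionD(2)[OF g'] test_fun_L2(1)[OF \<phi>] gradx_L2[OF \<phi>]
   by (intro integrable_plus L2_scaleR_integrable)
  show "(LBINT z. w' z *\<^sub>R gradx \<phi> z + \<phi> z *\<^sub>R g' z) = 0"
  proof (rule euclidean_eqI)
   fix i :: 'a assume i: "i \<in> Basis"
   have "(LBINT z. w' z *\<^sub>R gradx \<phi> z + \<phi> z *\<^sub>R g' z) \<bullet> i = (LBINT z. (w' z *\<^sub>R gradx \<phi> z + \<phi> z *\<^sub>R g' z) \<bullet> i)"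
    using int by (rule integral_inner_left[symmetric])
   then show "(LBINT z. w' z *\<^sub>R gradx \<phi> z + \<phi> z *\<^sub>R g' z) \<bullet> i = 0 \<bullet> i"
    using main[OF i \<phi>] by (simp add: inner_add_left gradx_inner[OF i] mult.commute)
  qed
 qed
qed

subsection \<open>Green's formula\<close>

definition weak_div :: "'a::euclidean_space set => ('a \<times> real => 'a) => ('a \<times> real => real) => bool" where
 "weak_div \<Omega> y q \<longleftrightarrow> y \<in> L2 lborel \<and> q \<in> L2 lborel \<and>
  (\<forall>\<phi>\<in>test_fun (\<Omega> \<times> UNIV). (LBINT z. y z \<bullet> gradx \<phi> z + \<phi> z * q z) = 0)"

lemma slab_div_weak_div:
 assumes "slab_div \<Omega> y q"
 shows "weak_div \<Omega> (\<lambda>z. indicator {..<\<tau>} (snd z) *\<^sub>R y z) (\<lambda>z. indicator {..<\<tau>} (snd z) *\<^sub>R q z)"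
proof -
 have m: "(\<lambda>z::'a \<times> real. indicator {..<\<tau>} (snd z) :: real) \<in> borel_measurable lborel"
  using time_measurable[of "indicator {..<\<tau>}"] by simp
 have L: "y \<in> L2 lborel" "q \<in> L2 lborel" using assms by (auto simp: slab_div_def)
 have "(\<lambda>z. indicator {..<\<tau>} (snd z) *\<^sub>R y z) \<in> L2 lborel" "(\<lambda>z. indicator {..<\<tau>} (snd z) *\<^sub>R q z) \<in> L2 lborel"
  by (rule L2_bounded_mult[OF L(1) m, of 1], simp) (rule L2_bounded_mult[OF L(2) m, of 1], simp)
 then show ?thesis using assms unfolding slab_div_def weak_div_def by (simp add: algebra_simps)
qed

lemma gradx_translate: "C1 \<phi> ==> gradx (\<lambda>z. \<phi> (z - c)) z = gradx \<phi> (z - c)"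
 by (simp add: gradx_def C1_translate(2))

lemma gradx_reflect: "C1 \<phi> ==> gradx (\<lambda>z. \<phi> (c - z)) z = - gradx \<phi> (c - z)"
proof -
 assume C: "C1 \<phi>"
 have "\<D> \<phi> x (- v) = - \<D> \<phi> x v" for x v
  by (rule linear_simps(4)[OF C1_linear[OF C]])
 moreover have "(\<lambda>z. \<phi> (c - z)) = (\<lambda>z. \<phi> (- z + c))" by simp
 ultimately show ?thesis using C1_reflect(2)[OF C, of c z]
  by (simp add: gradx_def sum_negf)
qed

text \<open>A mollifier whose support is shifted into the direction \<open>(\<nu>, 0)\<close> turns a localized function that
 vanishes outside \<open>\<Omega>\<close> into a test function.\<close>

lemma green_kernel:
 fixes W :: "'a::euclidean_space \<times> real => real"
 assumes WG: "global_grad W G" and yq: "weak_div \<Omega> y q" and \<epsilon>: "0 < \<epsilon>"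
  and supp: "\<And>\<xi>. W \<xi> \<noteq> 0 ==> cball (\<xi> + c) \<epsilon> \<subseteq> \<Omega> \<times> UNIV"
 shows "(LBINT z. avg (mollifier \<epsilon> c) G z \<bullet> y z) + (LBINT z. avg (mollifier \<epsilon> c) W z \<bullet> q z) = 0"
proof -
 define k where "k = (\<lambda>u::'a \<times> real. bump \<epsilon> (u - c))"
 have k: "k \<in> test_fun UNIV" unfolding k_def by (rule bump_test_fun[OF \<epsilon>]) simp
 note C = test_fun_C1[OF k]
 have L2: "W \<in> L2 lborel" "G \<in> L2 lborel" "y \<in> L2 lborel" "q \<in> L2 lborel"
  using WG yq by (auto simp: global_grad_def weak_div_def)
 have kt: "(\<lambda>z. k (z - \<xi>)) \<in> test_fun UNIV" for \<xi>
  using bump_test_fun[OF \<epsilon>, of "\<xi> + c" UNIV] by (simp add: k_def diff_diff_eq)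
 have kr: "(\<lambda>\<xi>. k (z - \<xi>)) \<in> test_fun UNIV" for z
 proof -
  have "(\<lambda>\<xi>. k (z - \<xi>)) = (\<lambda>\<xi>. bump \<epsilon> (\<xi> - (z - c)))"
   using bump_minus[of \<epsilon> "_ - (z - c)"] by (auto simp: k_def fun_eq_iff algebra_simps)
  then show ?thesis using bump_test_fun[OF \<epsilon>, of "z - c" UNIV] by simp
 qed
 have gk: "integrable lborel (\<lambda>u. gradx k u \<bullet> i)" if "i \<in> Basis" for i :: 'a
  using test_fun_L2(5)[OF k] by (simp add: gradx_inner[OF that])
 \<comment> \<open>For fixed \<xi> the kernel in z is an admissible test function for the divergence
   as soon as \<open>W \<xi>\<close> is nonzero; elsewhere the factor \<open>W \<xi>\<close>
   annihilates the expression.\<close>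
 have inner: "W \<xi> * (LBINT z. k (z - \<xi>) * q z) + (\<Sum>i\<in>Basis. W \<xi> * (LBINT z. (gradx k (z - \<xi>) \<bullet> i) * (y z \<bullet> i))) = 0" for \<xi>
 proof (cases "W \<xi> = 0")
  case False
  have t: "(\<lambda>z. k (z - \<xi>)) \<in> test_fun (\<Omega> \<times> UNIV)"
   using bump_test_fun[OF \<epsilon> supp[OF False]] by (simp add: k_def diff_diff_eq)
  have g: "gradx (\<lambda>z. k (z - \<xi>)) z = gradx k (z - \<xi>)" for z by (rule gradx_translate[OF C])
  have gL: "(\<lambda>z. gradx k (z - \<xi>)) \<in> L2 lborel" using gradx_L2[OF t] unfolding g[symmetric] .
  have "0 = (LBINT z. y z \<bullet> gradx k (z - \<xi>) + k (z - \<xi>) * q z)"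
   using yq t by (auto simp: weak_div_def g)
  also have "\<dots> = (LBINT z. y z \<bullet> gradx k (z - \<xi>)) + (LBINT z. k (z - \<xi>) * q z)"
   by (intro lebesgue_add L2_inner_integrable L2_mult_integrable L2 gL test_fun_L2(1)[OF kt])
  also have "(LBINT z. y z \<bullet> gradx k (z - \<xi>)) = (LBINT z. (\<Sum>i\<in>Basis. (gradx k (z - \<xi>) \<bullet> i) * (y z \<bullet> i)))"
   by (subst euclidean_inner) (simp add: mult.commute)
  also have "\<dots> = (\<Sum>i\<in>Basis. \<integral>z. (gradx k (z - \<xi>) \<bullet> i) * (y z \<bullet> i) \<partial>lborel)"
   by (intro lebesgue_sum L2_mult_integrable L2_inner_left L2 gL)
  finally show ?thesis by (simp add: sum_distrib_left[symmetric] distrib_left[symmetric] add.commute)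
 qed simp
 \<comment> \<open>For fixed z the kernel is a test function of \<xi> on the whole space. The sign
   from reflecting it cancels the one from integrating by parts, and the derivative lands on
   \<open>W\<close>.\<close>
 have flip: "(LBINT \<xi>. (gradx k (z - \<xi>) \<bullet> i) * W \<xi>) = (LBINT \<xi>. k (z - \<xi>) * (G \<xi> \<bullet> i))" if i: "i \<in> Basis" for z and i :: 'a
 proof -
  have g: "gradx (\<lambda>\<xi>. k (z - \<xi>)) \<xi> = - gradx k (z - \<xi>)" for \<xi> by (rule gradx_reflect[OF C])
  have gL: "(\<lambda>\<xi>. gradx k (z - \<xi>)) \<in> L2 lborel" using L2_uminus[OF gradx_L2[OF kr[of z]]] by (simp add: g)
  note kL = test_fun_L2(1)[OF kr[of z]]
  have "0 = (LBINT \<xi>. W \<xi> *\<^sub>R (- gradx k (z - \<xi>)) + k (z - \<xi>) *\<^sub>R G \<xi>) \<bullet> i"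
   using WG kr[of z] by (auto simp: global_grad_def g)
  also have "\<dots> = (LBINT \<xi>. (W \<xi> *\<^sub>R (- gradx k (z - \<xi>)) + k (z - \<xi>) *\<^sub>R G \<xi>) \<bullet> i)"
   by (intro integral_inner_left[symmetric] integrable_plus L2_scaleR_integrable L2 L2_uminus gL kL)
  also have "\<dots> = (LBINT \<xi>. k (z - \<xi>) * (G \<xi> \<bullet> i) - (gradx k (z - \<xi>) \<bullet> i) * W \<xi>)"
   by (simp add: inner_add_left algebra_simps)
  also have "\<dots> = (LBINT \<xi>. k (z - \<xi>) * (G \<xi> \<bullet> i)) - (LBINT \<xi>. (gradx k (z - \<xi>) \<bullet> i) * W \<xi>)"
   by (intro lebesgue_diff L2_mult_integrable L2_inner_left L2 gL kL)
  finally show ?thesis by simp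
 qed
 note swap0 = kernel_swap[OF test_fun_L2(2)[OF k] L2(1) L2(4)]
 note swap = kernel_swap[OF gk L2(1) L2_inner_left[OF L2(3)]]
 have "0 = (LBINT \<xi>. W \<xi> * (LBINT z. k (z - \<xi>) * q z) + (\<Sum>i\<in>Basis. W \<xi> * (LBINT z. (gradx k (z - \<xi>) \<bullet> i) * (y z \<bullet> i))))"
  by (simp add: inner)
 also have "\<dots> = (LBINT \<xi>. W \<xi> * (LBINT z. k (z - \<xi>) * q z))
   + (\<Sum>i\<in>Basis. \<integral>\<xi>. W \<xi> * (LBINT z. (gradx k (z - \<xi>) \<bullet> i) * (y z \<bullet> i)) \<partial>lborel)"
  using swap0(2) swap(2) by (subst lebesgue_add) (auto intro!: integrable_sums lebesgue_sum)
 also have "\<dots> = (LBINT z. (LBINT \<xi>. k (z - \<xi>) * W \<xi>) * q z)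
   + (\<Sum>i\<in>Basis. \<integral>z. (LBINT \<xi>. k (z - \<xi>) * (G \<xi> \<bullet> i)) * (y z \<bullet> i) \<partial>lborel)"
  using swap0(1) swap(1) flip by simp
 finally have 0: "(LBINT z. (LBINT \<xi>. k (z - \<xi>) * W \<xi>) * q z)
   + (\<Sum>i\<in>Basis. \<integral>z. (LBINT \<xi>. k (z - \<xi>) * (G \<xi> \<bullet> i)) * (y z \<bullet> i) \<partial>lborel) = 0" by simp
 let ?m = "bump_mass TYPE('a \<times> real) \<epsilon>"
 have m: "?m > 0" by (rule bump_mass_pos[OF \<epsilon>])
 have aW: "(LBINT \<xi>. k (z - \<xi>) * W \<xi>) = ?m * avg (mollifier \<epsilon> c) W z" for z
  using L2_measurable[OF L2(1)] m by (simp add: avg_mollifier[OF \<epsilon>] k_def)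
 have aG: "(LBINT \<xi>. k (z - \<xi>) * (G \<xi> \<bullet> i)) = ?m * (avg (mollifier \<epsilon> c) G z \<bullet> i)" for z i
 proof -
  have "(LBINT \<xi>. k (z - \<xi>) * (G \<xi> \<bullet> i)) = (LBINT \<xi>. (k (z - \<xi>) *\<^sub>R G \<xi>) \<bullet> i)" by simp
  also have "\<dots> = (LBINT \<xi>. k (z - \<xi>) *\<^sub>R G \<xi>) \<bullet> i"
   by (intro integral_inner_left L2_scaleR_integrable L2 test_fun_L2(1)[OF kr])
  also have "\<dots> = ?m * (avg (mollifier \<epsilon> c) G z \<bullet> i)"
   using L2_measurable[OF L2(2)] m by (simp add: avg_mollifier[OF \<epsilon>] k_def)
  finally show ?thesis .
 qed
 note aL = averaging.avg_L2[OF mollifier_averaging[OF \<epsilon>, of c]]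
 have "?m * ((LBINT z. avg (mollifier \<epsilon> c) W z * q z) + (\<Sum>i\<in>Basis. \<integral>z. (avg (mollifier \<epsilon> c) G z \<bullet> i) * (y z \<bullet> i) \<partial>lborel)) = 0"
  using 0 by (simp add: aW aG mult.assoc sum_distrib_left distrib_left)
 moreover have "(\<Sum>i\<in>Basis. \<integral>z. (avg (mollifier \<epsilon> c) G z \<bullet> i) * (y z \<bullet> i) \<partial>lborel) = (LBINT z. avg (mollifier \<epsilon> c) G z \<bullet> y z)"
  by (subst euclidean_inner)
   (intro lebesgue_sum[symmetric] L2_mult_integrable L2_inner_left L2 aL)
 ultimately show ?thesis using m by simp
qed

text \<open>The bound \<open>norm \<nu> \<le> 1\<close> admits \<nu> = 0, the choice at interior
  points; where the ball misses the closure the condition is void. Direction and step bound depend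
  on p, while the radius r can be made uniform.\<close>

definition inward :: "'a::euclidean_space set => 'a => real => bool" where
 "inward \<Omega> p r \<longleftrightarrow> (\<exists>\<nu> s\<^sub>0. norm \<nu> \<le> 1 \<and> 0 < s\<^sub>0 \<and>
  (\<forall>s x. 0 < s \<and> s < s\<^sub>0 \<and> x \<in> closure \<Omega> \<and> x \<in> cball p r --> x + s *\<^sub>R \<nu> \<in> \<Omega>))"

text \<open>Near a frontier point, moving along \<nu> leaves the projection fixed and raises the
  height, so points on or above the graph end strictly above it. Half the radius d, for the ball and
  for the step, keeps the shifted points inside \<open>U\<close>.\<close>

lemma inward_local:
 assumes \<Omega>: "bounded_lipschitz_domain \<Omega>" and p: "p \<in> closure \<Omega>"
 shows "\<exists>\<rho>>0. inward \<Omega> p \<rho>"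
proof (cases "p \<in> \<Omega>")
 case True
 moreover have "open \<Omega>" using \<Omega> by (simp add: bounded_lipschitz_domain_def)
 ultimately obtain \<rho> where "\<rho> > 0" "cball p \<rho> \<subseteq> \<Omega>" unfolding open_contains_cball by blast
 then show ?thesis unfolding inward_def by (intro exI[of _ \<rho>] conjI exI[of _ 0] exI[of _ 1]) auto
next
 case False
 have o: "open \<Omega>" using \<Omega> by (simp add: bounded_lipschitz_domain_def)
 have "p \<in> frontier \<Omega>" using False p o by (simp add: frontier_def interior_open)
 then obtain \<nu> \<phi> L U where c: "norm \<nu> = 1" "L-lipschitz_on UNIV \<phi>" "open U" "p \<in> U"
  "\<Omega> \<inter> U = {x\<in>U. \<phi> (x - (x \<bullet> \<nu>) *\<^sub>R \<nu>) < x \<bullet> \<nu>}"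
  using \<Omega> unfolding bounded_lipschitz_domain_def by blast
 obtain d where d: "d > 0" "cball p d \<subseteq> U" using c(3,4) open_contains_cball by metis
 have "x + s *\<^sub>R \<nu> \<in> \<Omega>" if s: "0 < s" "s < d/2" and x: "x \<in> closure \<Omega>" "x \<in> cball p (d/2)" for s x
 proof -
  have "x \<in> U" using x(2) d by (auto simp: subset_iff)
  from epigraph_frontier(1)[OF o c(2,3,5) x(1) this]
  have le: "\<phi> (x - (x \<bullet> \<nu>) *\<^sub>R \<nu>) \<le> x \<bullet> \<nu>" .
  have "dist p (x + s *\<^sub>R \<nu>) \<le> dist p x + dist x (x + s *\<^sub>R \<nu>)" by (rule dist_triangle)
  also have "\<dots> \<le> d" using x(2) s c(1) by (simp add: dist_norm)
  finally have U': "x + s *\<^sub>R \<nu> \<in> U" using d by auto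
  have \<nu>\<nu>: "\<nu> \<bullet> \<nu> = 1" using c(1) by (simp add: dot_square_norm)
  have i: "(x + s *\<^sub>R \<nu>) \<bullet> \<nu> = x \<bullet> \<nu> + s" by (simp add: inner_add_left \<nu>\<nu>)
  have "(x + s *\<^sub>R \<nu>) - ((x + s *\<^sub>R \<nu>) \<bullet> \<nu>) *\<^sub>R \<nu> = x - (x \<bullet> \<nu>) *\<^sub>R \<nu>" unfolding i by (simp add: algebra_simps)
  then have "\<phi> ((x + s *\<^sub>R \<nu>) - ((x + s *\<^sub>R \<nu>) \<bullet> \<nu>) *\<^sub>R \<nu>) < (x + s *\<^sub>R \<nu>) \<bullet> \<nu>"
   using le s i by (simp only:)
  then have "x + s *\<^sub>R \<nu> \<in> {x\<in>U. \<phi> (x - (x \<bullet> \<nu>) *\<^sub>R \<nu>) < x \<bullet> \<nu>}" using U' by blast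
  then show ?thesis unfolding c(5)[symmetric] by simp
 qed
 then show ?thesis unfolding inward_def using d(1) c(1)
  by (intro exI[of _ "d/2"] conjI exI[of _ \<nu>]) (auto intro!: exI[of _ "d/2"])
qed

text \<open>A Lebesgue number \<delta> of the cover by local balls gives the radius: a ball of
  radius \<delta>/3 has diameter below \<delta>, so its part in the closure lies in one local ball
  and inherits the direction of that ball.\<close>

lemma inward_uniform:
 assumes \<Omega>: "bounded_lipschitz_domain \<Omega>"
 shows "\<exists>r>0. \<forall>p. inward \<Omega> p r"
proof -
 obtain \<rho> where \<rho>: "\<And>p. p \<in> closure \<Omega> ==> 0 < \<rho> p" "\<And>p. p \<in> closure \<Omega> ==> inward \<Omega> p (\<rho> p)"
  using inward_local[OF \<Omega>] by metis
 have ne: "closure \<Omega> \<noteq> {}" and cc: "compact (closure \<Omega>)"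
  using \<Omega> by (auto simp: bounded_lipschitz_domain_def compact_closure)
 obtain \<delta> where \<delta>: "0 < \<delta>" "\<And>T. T \<subseteq> closure \<Omega> ==> diameter T < \<delta> ==> \<exists>B\<in>(\<lambda>p. ball p (\<rho> p)) ` closure \<Omega>. T \<subseteq> B"
 proof (rule Lebesgue_number_lemma[OF cc, of "(\<lambda>p. ball p (\<rho> p)) ` closure \<Omega>"])
  show "closure \<Omega> \<subseteq> \<Union> ((\<lambda>p. ball p (\<rho> p)) ` closure \<Omega>)" using \<rho>(1) by force
 qed (use ne in auto)
 have "inward \<Omega> p (\<delta>/3)" for p
 proof -
  have "diameter (closure \<Omega> \<inter> cball p (\<delta>/3)) \<le> 2 * (\<delta>/3)"
  proof (rule diameter_le)
   fix x y assume "x \<in> closure \<Omega> \<inter> cball p (\<delta>/3)" "y \<in> closure \<Omega> \<inter> cball p (\<delta>/3)"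
   then show "norm (x - y) \<le> 2 * (\<delta>/3)" using dist_triangle3[of x y p] by (simp add: dist_norm)
  qed (use \<delta> in auto)
  then have "diameter (closure \<Omega> \<inter> cball p (\<delta>/3)) < \<delta>" using \<delta>(1) by simp
  from \<delta>(2)[OF _ this] obtain p' where p': "p' \<in> closure \<Omega>" "closure \<Omega> \<inter> cball p (\<delta>/3) \<subseteq> ball p' (\<rho> p')" by auto
  obtain \<nu> s\<^sub>0 where \<nu>: "norm \<nu> \<le> 1" "0 < s\<^sub>0"
   "\<And>s x. 0 < s ==> s < s\<^sub>0 ==> x \<in> closure \<Omega> ==> x \<in> cball p' (\<rho> p') ==> x + s *\<^sub>R \<nu> \<in> \<Omega>"
   using \<rho>(2)[OF p'(1)] unfolding inward_def by blast
  have "x + s *\<^sub>R \<nu> \<in> \<Omega>" if "0 < s" "s < s\<^sub>0" "x \<in> closure \<Omega>" "x \<in> cball p (\<delta>/3)" for s x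
   using p'(2) that by (intro \<nu>(3)) (auto simp: subset_iff intro: less_imp_le)
  then show ?thesis unfolding inward_def using \<nu>(1,2) by blast
 qed
 then show ?thesis using \<delta>(1) by (intro exI[of _ "\<delta>/3"]) auto
qed

text \<open>The compact part of the closure over which \<open>W\<close> lives is pushed into
  \<Omega> by the step \<open>s n\<close>, and the mollification radius is chosen afterwards, so
  small that the smoothed support stays inside. Both parameters tend to 0, and the exact identity
  for the mollified pair passes to the limit.\<close>

lemma green_local:
 fixes W :: "'a::euclidean_space \<times> real => real"
 assumes \<Omega>: "open \<Omega>" "bounded \<Omega>" and WG: "global_grad W G" and yq: "weak_div \<Omega> y q" and p: "inward \<Omega> p r"
  and supp: "\<And>z. W z \<noteq> 0 ==> fst z \<in> \<Omega> \<and> fst z \<in> cball p r"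
 shows "(LBINT z. G z \<bullet> y z + W z * q z) = 0"
proof -
 have L2: "W \<in> L2 lborel" "G \<in> L2 lborel" "y \<in> L2 lborel" "q \<in> L2 lborel"
  using WG yq by (auto simp: global_grad_def weak_div_def)
 obtain \<nu> s\<^sub>0 where \<nu>: "norm \<nu> \<le> 1" "0 < s\<^sub>0"
  "\<And>s x. 0 < s ==> s < s\<^sub>0 ==> x \<in> closure \<Omega> ==> x \<in> cball p r ==> x + s *\<^sub>R \<nu> \<in> \<Omega>"
  using p unfolding inward_def by blast
 have eps: "\<exists>\<epsilon>. 0 < \<epsilon> \<and> \<epsilon> \<le> s \<and> (\<forall>x. x \<in> closure \<Omega> \<and> x \<in> cball p r --> cball (x + s *\<^sub>R \<nu>) \<epsilon> \<subseteq> \<Omega>)"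
  if s: "0 < s" "s < s\<^sub>0" for s
 proof -
  let ?K = "(\<lambda>x. x + s *\<^sub>R \<nu>) ` (closure \<Omega> \<inter> cball p r)"
  have K: "compact ?K" "?K \<subseteq> \<Omega>"
   using \<Omega>(2) \<nu>(3)[OF s] by (auto intro!: compact_continuous_image continuous_intros compact_Int simp: compact_closure)
  obtain e where e: "e > 0" "(\<Union>x\<in>?K. cball x e) \<subseteq> \<Omega>"
   using compact_subset_open_imp_cball_epsilon_subset[OF K(1) \<Omega>(1) K(2)] by blast
  have "cball (x + s *\<^sub>R \<nu>) (min e s) \<subseteq> \<Omega>" if "x \<in> closure \<Omega>" "x \<in> cball p r" for x
  proof -
   have "cball (x + s *\<^sub>R \<nu>) (min e s) \<subseteq> cball (x + s *\<^sub>R \<nu>) e" by (rule subset_cball) simp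
   also have "\<dots> \<subseteq> \<Omega>" using e(2) that by blast
   finally show ?thesis .
  qed
  then show ?thesis using e(1) s by (intro exI[of _ "min e s"]) auto
 qed
 define s where "s n = s\<^sub>0 / 2 * inverse (real (Suc n))" for n
 have s: "0 < s n" "s n < s\<^sub>0" for n
 proof -
  have "inverse (real (Suc n)) \<le> 1" by (simp add: inverse_le_1_iff)
  then have "s n \<le> s\<^sub>0 / 2 * 1" unfolding s_def using \<nu>(2) by (intro mult_left_mono) auto
  then show "0 < s n" "s n < s\<^sub>0" using \<nu>(2) by (auto simp: s_def)
 qed
 have s0: "s \<longlonglongrightarrow> 0" unfolding s_def[abs_def] by (intro tendsto_mult_right_zero LIMSEQ_inverse_real_of_nat)
 obtain \<epsilon> where \<epsilon>: "\<And>n. 0 < \<epsilon> n" "\<And>n. \<epsilon> n \<le> s n"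
  "\<And>n x. x \<in> closure \<Omega> ==> x \<in> cball p r ==> cball (x + s n *\<^sub>R \<nu>) (\<epsilon> n) \<subseteq> \<Omega>"
  using eps[OF s] by metis
 define c where "c n = (s n *\<^sub>R \<nu>, 0::real)" for n
 have 0: "(LBINT z. avg (mollifier (\<epsilon> n) (c n)) G z \<bullet> y z) + (LBINT z. avg (mollifier (\<epsilon> n) (c n)) W z \<bullet> q z) = 0" for n
 proof (rule green_kernel[OF WG yq \<epsilon>(1)])
  fix \<xi> :: "'a \<times> real" assume "W \<xi> \<noteq> 0"
  then have x: "fst \<xi> \<in> closure \<Omega>" "fst \<xi> \<in> cball p r" using supp[of \<xi>] closure_subset[of \<Omega>] by auto
  show "cball (\<xi> + c n) (\<epsilon> n) \<subseteq> \<Omega> \<times> UNIV"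
  proof
   fix z assume "z \<in> cball (\<xi> + c n) (\<epsilon> n)"
   then have "dist (fst \<xi> + s n *\<^sub>R \<nu>) (fst z) \<le> \<epsilon> n" using dist_fst_le[of "\<xi> + c n" z] by (simp add: c_def)
   then show "z \<in> \<Omega> \<times> UNIV" using \<epsilon>(3)[OF x, of n] by (cases z) (auto simp: subset_iff)
  qed
 qed
 \<comment> \<open>The mollifier at step n lives in the ball of radius \<open>\<epsilon> n\<close>
   around \<open>c n\<close>, and both lengths are at most \<open>s n\<close>.\<close>
 have ae: "AE \<xi> in mollifier (\<epsilon> n) (c n). norm \<xi> < 2 * s n" for n
  using mollifier_AE[OF \<epsilon>(1)[of n], of "c n"]
 proof eventually_elim
  case (elim \<xi>)
  have "norm (c n) = s n * norm \<nu>" using s(1)[of n] by (simp add: c_def norm_Pair)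
  also have "\<dots> \<le> s n" using mult_left_mono[OF \<nu>(1), of "s n"] s(1)[of n] by simp
  finally show ?case using elim \<epsilon>(2)[of n] by linarith
 qed
 have r0: "(\<lambda>n. 2 * s n) \<longlonglongrightarrow> 0" using tendsto_mult_left[OF s0, of 2] by simp
 note lim = avg_lim[OF mollifier_averaging[OF \<epsilon>(1)] _ ae r0]
 have "(\<lambda>n. (LBINT z. avg (mollifier (\<epsilon> n) (c n)) G z \<bullet> y z) + (LBINT z. avg (mollifier (\<epsilon> n) (c n)) W z \<bullet> q z))
  \<longlonglongrightarrow> (LBINT z. G z \<bullet> y z) + (LBINT z. W z \<bullet> q z)"
  by (intro tendsto_add L2_lim_inner L2_lim_const lim L2)
 then have "(LBINT z. G z \<bullet> y z) + (LBINT z. W z \<bullet> q z) = 0"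
  unfolding 0 using LIMSEQ_unique tendsto_const by blast
 then show ?thesis
  using L2 by (subst lebesgue_add) (auto intro: L2_inner_integrable L2_mult_integrable)
qed

lemma global_grad_mult:
 assumes WG: "global_grad w g" and \<beta>: "C1 \<beta>" and B: "\<And>z. \<bar>\<beta> z\<bar> \<le> B" "\<And>z. norm (gradx \<beta> z) \<le> B"
 shows "global_grad (\<lambda>z. \<beta> z * w z) (\<lambda>z. \<beta> z *\<^sub>R g z + w z *\<^sub>R gradx \<beta> z)"
proof -
 have L: "w \<in> L2 lborel" "g \<in> L2 lborel" using WG by (auto simp: global_grad_def)
 have [measurable]: "\<beta> \<in> Borel" "gradx \<beta> \<in> Borel"
  using C1_measurable[OF \<beta>] gradx_measurable[OF \<beta>] by auto
 have [measurable]: "w \<in> Borel" using L2_measurable[OF L(1)] by simp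
 have L': "(\<lambda>z. \<beta> z * w z) \<in> L2 lborel"
  using L2_bounded_mult[OF L(1), of \<beta> B] B(1) by simp
 have "(\<lambda>z. \<beta> z *\<^sub>R g z) \<in> L2 lborel" using L2_bounded_mult[OF L(2), of \<beta> B] B(1) by simp
 moreover have "(\<lambda>z. w z *\<^sub>R gradx \<beta> z) \<in> L2 lborel"
  by (rule L2_dominated[OF L(1), of _ B]) (use B(2) in \<open>auto simp: mult.commute[of B] intro!: AE_I2 mult_left_mono\<close>)
 ultimately have L'': "(\<lambda>z. \<beta> z *\<^sub>R g z + w z *\<^sub>R gradx \<beta> z) \<in> L2 lborel" by (rule L2_add)
 show ?thesis unfolding global_grad_def
 proof (intro conjI ballI L' L'')
  fix \<phi> :: "'a \<times> real => real" assume \<phi>: "\<phi> \<in> test_fun UNIV"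
  note C = test_fun_C1[OF \<phi>]
  have t: "(\<lambda>z. \<phi> z * \<beta> z) \<in> test_fun UNIV"
   by (rule test_funI[OF C1_mult(1)[OF C \<beta>], of "closure {z. \<phi> z \<noteq> 0}"])
    (use \<phi> closure_subset[of "{z. \<phi> z \<noteq> 0}"] in \<open>auto simp: test_fun_def\<close>)
  have "(LBINT z. (\<beta> z * w z) *\<^sub>R gradx \<phi> z + \<phi> z *\<^sub>R (\<beta> z *\<^sub>R g z + w z *\<^sub>R gradx \<beta> z))
   = (LBINT z. w z *\<^sub>R gradx (\<lambda>z. \<phi> z * \<beta> z) z + (\<phi> z * \<beta> z) *\<^sub>R g z)"
   unfolding gradx_mult[OF C \<beta>] by (simp add: algebra_simps)
  also have "\<dots> = 0" using WG t by (auto simp: global_grad_def)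
  finally show "(LBINT z. (\<beta> z * w z) *\<^sub>R gradx \<phi> z + \<phi> z *\<^sub>R (\<beta> z *\<^sub>R g z + w z *\<^sub>R gradx \<beta> z)) = 0" .
 qed
qed

text \<open>Integrating a translated weight over all centres p reproduces F up to the total weight.
  In \<open>green\<close> this is used for the bump itself, whose weight is positive, and for its
  derivatives, whose weight is 0.\<close>

lemma partition_Fubini:
 fixes k :: "'a::euclidean_space => real" and F :: "'a \<times> real => real"
 assumes k: "integrable lborel k" and F: "integrable lborel F"
 shows "(LBINT p. (LBINT z. k (fst z - p) * F z)) = (LBINT x. k x) * (LBINT z. F z)"
  "integrable lborel (\<lambda>p. \<integral>z. k (fst z - p) * F z \<partial>lborel)"
proof -
 have [measurable]: "k \<in> Borel" "F \<in> Borel" using k F by auto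
 have [measurable]: "(\<lambda>(z::'a \<times> real, p). k (fst z - p) * F z) \<in> borel_measurable (lborel \<Otimes>\<^sub>M lborel)"
 proof -
  have "(\<lambda>z::'a \<times> real. fst z) \<in> Borel"
   by (intro borel_measurable_continuous_onI continuous_on_fst continuous_on_id)
  then show ?thesis by measurable
 qed
 have kr: "(LBINT p. k (x - p)) = (LBINT x. k x)" "(LBINT p. \<bar>k (x - p)\<bar>) = (LBINT x. \<bar>k x\<bar>)" for x
  using lborel_integral_reflect[of k x] lborel_integral_reflect[of "\<lambda>x. \<bar>k x\<bar>" x] by simp_all
 have ik: "integrable lborel (\<lambda>p. k (x - p))" for x
 proof -
  have "integrable (distr lborel borel (\<lambda>z. x - z)) k" using k by (simp add: distr_lborel_reflect)
  then show ?thesis by (rule integrable_distr[rotated]) simp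
 qed
 have int: "integrable (lborel \<Otimes>\<^sub>M lborel) (\<lambda>(z::'a \<times> real, p). k (fst z - p) * F z)"
 proof (rule lborel_pair.Fubini_integrable)
  have "(LBINT p. norm (case (z, p) of (z, p) => k (fst z - p) * F z)) = (LBINT x. \<bar>k x\<bar>) * \<bar>F z\<bar>" for z :: "'a \<times> real"
   by (simp add: abs_mult kr)
  then show "integrable lborel (\<lambda>z::'a \<times> real. \<integral>p. norm (case (z, p) of (z, p) => k (fst z - p) * F z) \<partial>lborel)"
   using F by simp
  show "AE z::'a \<times> real in lborel. integrable lborel (\<lambda>p. case (z, p) of (z, p) => k (fst z - p) * F z)"
   using ik by simp
 qed simp
 show "(LBINT p. (LBINT z. k (fst z - p) * F z)) = (LBINT x. k x) * (LBINT z. F z)"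
  using lborel_pair.Fubini_integral[OF int] by (simp add: kr)
 show "integrable lborel (\<lambda>p. \<integral>z. k (fst z - p) * F z \<partial>lborel)"
  using lborel_pair.integrable_snd[OF int] by simp
qed

text \<open>Instead of a finite partition of unity we use the continuous one \<open>bump r (x - p) dp\<close>.\<close>

theorem green:
 fixes w :: "'a::euclidean_space \<times> real => real"
 assumes \<Omega>: "bounded_lipschitz_domain \<Omega>" and wg: "global_grad w g" and yq: "weak_div \<Omega> y q"
  and supp: "\<And>z. fst z \<notin> \<Omega> ==> w z = 0"
 shows "(LBINT z. g z \<bullet> y z + w z * q z) = 0"
proof -
 have \<Omega>o: "open \<Omega>" "bounded \<Omega>" using \<Omega> by (auto simp: bounded_lipschitz_domain_def)
 have L2: "w \<in> L2 lborel" "g \<in> L2 lborel" "y \<in> L2 lborel" "q \<in> L2 lborel"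
  using wg yq by (auto simp: global_grad_def weak_div_def)
 obtain r where r: "0 < r" "\<And>p. inward \<Omega> p r" using inward_uniform[OF \<Omega>] by blast
 note tb = bump_test_fun_UNIV[where 'a='a, OF r(1)]
 define d where "d i x = \<D> (bump r) x i" for i x :: 'a
 have id: "integrable lborel (d i)" for i unfolding d_def by (rule test_fun_L2(5)[OF tb])
 have grad: "gradx (\<lambda>z. bump r (fst z - p)) z = (\<Sum>i\<in>Basis. d i (fst z - p) *\<^sub>R i)"
  and C1b: "C1 (\<lambda>z::'a \<times> real. bump r (fst z - p))" for p :: 'a and z
  using C1_fst(1)[OF C1_translate(1)[OF bump_C1, of r p]]
  by (simp_all add: gradx_def d_def C1_fst(2)[OF C1_translate(1)[OF bump_C1]] C1_translate(2)[OF bump_C1])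
 obtain B0 where B0: "\<And>x::'a. \<bar>bump r x\<bar> \<le> B0" using test_fun_L2(3)[OF tb] by blast
 obtain B1 where B1: "\<And>i x. \<bar>d i x\<bar> \<le> B1 i" using test_fun_L2(6)[OF tb] unfolding d_def by metis
 define B where "B = max B0 (\<Sum>i\<in>Basis. B1 i)"
 have Bg: "norm (gradx (\<lambda>z. bump r (fst z - p)) z) \<le> B" for p :: 'a and z
 proof -
  have "norm (gradx (\<lambda>z. bump r (fst z - p)) z) \<le> (\<Sum>i\<in>Basis. \<bar>d i (fst z - p)\<bar>)"
   unfolding grad by (rule order_trans[OF norm_sum]) simp
  also have "\<dots> \<le> (\<Sum>i\<in>Basis. B1 i)" by (intro sum_mono B1)
  finally show ?thesis by (simp add: B_def)
 qed
 have Bb: "\<bar>bump r (fst z - p)\<bar> \<le> B" for p and z :: "'a \<times> real"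
  using B0[of "fst z - p"] by (simp add: B_def)
 define H where "H z = g z \<bullet> y z + w z * q z" for z
 define K where "K i z = w z * (y z \<bullet> i)" for i z
 have H: "integrable lborel H" unfolding H_def
  using L2 by (intro integrable_plus L2_inner_integrable L2_mult_integrable)
 have K: "integrable lborel (K i)" for i unfolding K_def by (intro L2_mult_integrable L2_inner_left L2)
 \<comment> \<open>Localization by a bump centred at p adds commutator terms in which the gradient
   of the bump meets w y; they are recorded by components.\<close>
 have local: "(LBINT z. bump r (fst z - p) * H z) + (\<Sum>i\<in>Basis. \<integral>z. d i (fst z - p) * K i z \<partial>lborel) = 0" for p
 proof -
  let ?\<beta> = "\<lambda>z::'a \<times> real. bump r (fst z - p)"
  have i1: "integrable lborel (\<lambda>z. ?\<beta> z * H z)"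
   by (rule integrable_bd[OF integrable_mult_right[OF H, of B]])
    (use Bb[of _ p] order_trans[OF abs_ge_zero Bb[of undefined p]] H C1_measurable[OF C1b[of p]] in
     \<open>auto simp: abs_mult intro!: AE_I2 mult_right_mono\<close>)
  have dm: "(\<lambda>z::'a \<times> real. d i (fst z - p)) \<in> Borel" for i
  proof (intro borel_measurable_continuous_onI)
   show "continuous_on UNIV (\<lambda>z::'a \<times> real. d i (fst z - p))" unfolding d_def
    by (rule continuous_on_compose2[OF C1_continuous_deriv[OF bump_C1]]) (auto intro!: continuous_intros)
  qed
  have B1': "0 \<le> B1 i" for i using order_trans[OF abs_ge_zero B1] .
  have i2: "integrable lborel (\<lambda>z. d i (fst z - p) * K i z)" for i
   by (rule integrable_bd[OF integrable_mult_right[OF K[of i], of "B1 i"]])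
    (use B1 B1' K dm in \<open>auto simp: abs_mult intro!: AE_I2 mult_right_mono\<close>)
  have "(LBINT z. (?\<beta> z *\<^sub>R g z + w z *\<^sub>R gradx ?\<beta> z) \<bullet> y z + (?\<beta> z * w z) * q z) = 0"
  proof (rule green_local[OF \<Omega>o global_grad_mult[OF wg C1b Bb Bg] yq r(2)])
   fix z :: "'a \<times> real" assume z: "bump r (fst z - p) * w z \<noteq> 0"
   then have "norm (fst z - p) < r" using bump_0[OF r(1), of "fst z - p"] by force
   then show "fst z \<in> \<Omega> \<and> fst z \<in> cball p r" using z supp[of z] by (auto simp: dist_norm norm_minus_commute)
  qed
  also have "(\<lambda>z. (?\<beta> z *\<^sub>R g z + w z *\<^sub>R gradx ?\<beta> z) \<bullet> y z + (?\<beta> z * w z) * q z)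
   = (\<lambda>z. ?\<beta> z * H z + (\<Sum>i\<in>Basis. d i (fst z - p) * K i z))"
   by (auto simp: fun_eq_iff grad H_def K_def inner_add_left inner_sum_left inner_sum_right sum_distrib_left inner_commute algebra_simps)
  finally show ?thesis using i1 i2
   by (simp add: lebesgue_sum integrable_sums)
 qed
 \<comment> \<open>Derivatives of the even function \<open>bump r\<close> are odd, so the commutator
   terms disappear after integration over all centres p, while the main term acquires the positive
   factor \<open>bump_mass\<close>.\<close>
 have odd: "(LBINT x. d i x) = 0" for i
 proof -
  have "d i (0 - x) = - d i x" for x by (simp add: d_def bump_deriv)
  then show ?thesis using lborel_integral_reflect[of "d i" 0] id[of i] by simp
 qed
 note F1 = partition_Fubini[OF test_fun_L2(2)[OF tb] H] and F2 = partition_Fubini[OF id K]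
 have "0 = (LBINT p. (LBINT z. bump r (fst z - p) * H z) + (\<Sum>i\<in>Basis. \<integral>z. d i (fst z - p) * K i z \<partial>lborel))"
  by (simp add: local)
 also have "\<dots> = (LBINT x. bump r (x::'a)) * (LBINT z. H z)"
  using F1 F2 by (simp add: lebesgue_sum integrable_sums odd)
 finally show ?thesis
  using bump_mass_pos[OF r(1), where 'a='a] by (simp add: bump_mass_def H_def)
qed

corollary green_slab:
 fixes w :: "'a::euclidean_space \<times> real => real"
 assumes "bounded_lipschitz_domain \<Omega>" "global_grad w g" "slab_div \<Omega> y q" "\<And>z. fst z \<notin> \<Omega> ==> w z = 0"
 shows "(LBINT z. indicator {..<\<tau>} (snd z) * (g z \<bullet> y z + w z * q z)) = 0"
 using green[OF assms(1,2) slab_div_weak_div[OF assms(3)] assms(4), of \<tau>] by (simp add: algebra_simps)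

subsection \<open>Time slices and integration in time\<close>

lemma AE_fst:
 assumes "AE x in lborel. P x" shows "AE z::'a::euclidean_space \<times> real in lborel. P (fst z)"
proof -
 obtain N where N: "N \<in> null_sets lborel" "{x. \<not> P x} \<subseteq> N"
  using assms unfolding eventually_ae_filter by auto
 have Nm[measurable]: "N \<in> sets borel" using N(1) by auto
 have "AE x in lborel. x \<notin> N" using N(1) by (rule AE_not_in)
 then have "AE x in lborel. AE y in (lborel :: real measure). fst (x, y) \<notin> N" by eventually_elim simp
 then have "AE z in lborel \<Otimes>\<^sub>M (lborel :: real measure). fst z \<notin> N"
  by (rule lborel_pair.AE_pair_measure[rotated]) measurable
 then have "AE z::'a \<times> real in lborel. fst z \<notin> N" by (simp only: lborel_prod)
 then show ?thesis by eventually_elim (use N(2) in auto)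
qed

lemma AE_slices:
 assumes "AE z::'a::euclidean_space \<times> real in lborel. P z"
 shows "AE x in lborel. AE t in lborel. P (x, t)" "AE t in lborel. AE x in lborel. P (x, t)"
proof -
 obtain N where N: "N \<in> null_sets lborel" "{z. \<not> P z} \<subseteq> N"
  using assms unfolding eventually_ae_filter by auto
 have Nm: "N \<in> sets (lborel \<Otimes>\<^sub>M lborel)" unfolding lborel_prod using N(1) by auto
 have "AE z in lborel \<Otimes>\<^sub>M lborel. z \<notin> N" using AE_not_in[OF N(1)] by (simp only: lborel_prod)
 then have 1: "AE x in lborel. AE t in lborel. (x, t) \<notin> N" by (rule lborel_pair.AE_pair)
 then show "AE x in lborel. AE t in lborel. P (x, t)"
 proof eventually_elim
  case (elim y)
  then show ?case by eventually_elim (use N(2) in auto)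
 qed
 have "{z \<in> space (lborel \<Otimes>\<^sub>M lborel). (case z of (x, t) => (x, t) \<notin> N)} = space (lborel \<Otimes>\<^sub>M lborel) - N" by auto
 then have "{z \<in> space (lborel \<Otimes>\<^sub>M lborel). (case z of (x, t) => (x, t) \<notin> N)} \<in> sets (lborel \<Otimes>\<^sub>M lborel)"
  by (simp only: sets.Diff[OF sets.top Nm])
 then have "AE t in lborel. AE x in lborel. (x, t) \<notin> N"
  using lborel_pair.AE_commute[of "\<lambda>x t. (x, t) \<notin> N"] 1 by (simp add: split_beta')
 then show "AE t in lborel. AE x in lborel. P (x, t)"
 proof eventually_elim
  case (elim y)
  then show ?case by eventually_elim (use N(2) in auto)
 qed
qed

lemma borel_slices:
 fixes F :: "'a::euclidean_space \<times> real => 'b::topological_space"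
 assumes "F \<in> Borel"
 shows "(\<lambda>x. F (x, t)) \<in> Borel" "(\<lambda>t. F (x, t)) \<in> Borel"
 using assms by (auto intro!: measurable_compose[OF borel_measurable_continuous_onI assms] continuous_intros)

lemma nn_integral_slices:
 fixes f :: "'a::euclidean_space \<times> real => ennreal"
 assumes "f \<in> Borel"
 shows "(\<integral>\<^sup>+z. f z \<partial>lborel) = (\<integral>\<^sup>+x. \<integral>\<^sup>+t. f (x, t) \<partial>lborel \<partial>lborel)"
  "(\<integral>\<^sup>+z. f z \<partial>lborel) = (\<integral>\<^sup>+t. \<integral>\<^sup>+x. f (x, t) \<partial>lborel \<partial>lborel)"
proof -
 have m: "f \<in> borel_measurable (lborel \<Otimes>\<^sub>M lborel)" using assms by (simp add: lborel_prod)
 have m': "(\<lambda>(x, t). f (x, t)) \<in> borel_measurable (lborel \<Otimes>\<^sub>M lborel)" using m by simp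
 show "(\<integral>\<^sup>+z. f z \<partial>lborel) = (\<integral>\<^sup>+x. \<integral>\<^sup>+t. f (x, t) \<partial>lborel \<partial>lborel)"
  using lborel.nn_integral_fst[OF m] by (simp add: lborel_prod)
 show "(\<integral>\<^sup>+z. f z \<partial>lborel) = (\<integral>\<^sup>+t. \<integral>\<^sup>+x. f (x, t) \<partial>lborel \<partial>lborel)"
  using lborel_pair.nn_integral_snd[OF m'] by (simp add: lborel_prod)
qed

lemma integral_slices:
 fixes f :: "'a::euclidean_space \<times> real => 'b::euclidean_space"
 assumes "integrable lborel f"
 shows "(LBINT z. f z) = (LBINT x. \<integral>t. f (x, t) \<partial>lborel)"
  "AE x in lborel. integrable lborel (\<lambda>t. f (x, t))"
  "integrable lborel (\<lambda>x. \<integral>t. f (x, t) \<partial>lborel)"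
proof -
 have i: "integrable (lborel \<Otimes>\<^sub>M lborel) (case_prod (\<lambda>x t. f (x, t)))" using assms by (simp add: lborel_prod)
 show "(LBINT z. f z) = (LBINT x. \<integral>t. f (x, t) \<partial>lborel)"
  using lborel_pair.integral_fst[OF i] by (simp add: lborel_prod)
 show "AE x in lborel. integrable lborel (\<lambda>t. f (x, t))" using lborel_pair.AE_integrable_fst[OF i] .
 show "integrable lborel (\<lambda>x. \<integral>t. f (x, t) \<partial>lborel)" using lborel_pair.integrable_fst[OF i] .
qed

abbreviation slice_norm :: "('a::euclidean_space \<times> real => 'b::euclidean_space) => real => real" where
 "slice_norm F t \<equiv> nrm (\<lambda>x. F (x, t))"

lemma L2_slices:
 fixes F :: "'a::euclidean_space \<times> real => 'b::euclidean_space"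
 assumes F: "F \<in> L2 lborel"
 shows "AE x in lborel. (\<lambda>t. F (x, t)) \<in> L2 lborel" "AE t in lborel. (\<lambda>x. F (x, t)) \<in> L2 lborel"
  "integrable lborel (\<lambda>t. (slice_norm F t)\<^sup>2)" "(LBINT t. (slice_norm F t)\<^sup>2) = (nrm F)\<^sup>2"
  "(\<integral>\<^sup>+x. ennreal (LBINT s. (norm (F (x, s)))\<^sup>2) \<partial>lborel) = ennreal ((nrm F)\<^sup>2)"
proof -
 have Fm[measurable]: "F \<in> Borel" using L2_measurable[OF F] by simp
 have m: "(\<lambda>z. ennreal ((norm (F z))\<^sup>2)) \<in> Borel" by measurable
 note B = borel_slices[OF Fm]
 note N = nn_integral_slices[OF m]
 have fin: "(\<integral>\<^sup>+z. ennreal ((norm (F z))\<^sup>2) \<partial>lborel) = ennreal ((nrm F)\<^sup>2)" by (rule L2_nn_integral[OF F])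
 have i: "integrable lborel (\<lambda>z. (norm (F z))\<^sup>2)" by (rule L2_integrable[OF F])
 have i': "integrable (lborel \<Otimes>\<^sub>M lborel) (case_prod (\<lambda>x t. (norm (F (x, t)))\<^sup>2))" using i by (simp add: lborel_prod split_beta')
 show 1: "AE x in lborel. (\<lambda>t. F (x, t)) \<in> L2 lborel"
  using lborel_pair.AE_integrable_fst[OF i'] by eventually_elim (use B in \<open>auto intro: L2I\<close>)
 show 2: "AE t in lborel. (\<lambda>x. F (x, t)) \<in> L2 lborel"
  using lborel_pair.AE_integrable_snd[OF i'] by eventually_elim (use B in \<open>auto intro: L2I\<close>)
 show "integrable lborel (\<lambda>t. (slice_norm F t)\<^sup>2)" "(LBINT t. (slice_norm F t)\<^sup>2) = (nrm F)\<^sup>2"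
  using lborel_pair.integrable_snd[OF i'] lborel_pair.integral_snd[OF i']
  by (simp_all add: L2_norm_power2 lborel_prod split_beta')
 have "(\<integral>\<^sup>+x. ennreal (LBINT s. (norm (F (x, s)))\<^sup>2) \<partial>lborel) = (\<integral>\<^sup>+x. \<integral>\<^sup>+s. ennreal ((norm (F (x, s)))\<^sup>2) \<partial>lborel \<partial>lborel)"
 proof (rule nn_integral_cong_AE, use 1 in eventually_elim)
  fix x assume "(\<lambda>t. F (x, t)) \<in> L2 lborel"
  then show "ennreal (LBINT s. (norm (F (x, s)))\<^sup>2) = (\<integral>\<^sup>+s. ennreal ((norm (F (x, s)))\<^sup>2) \<partial>lborel)"
   by (intro nn_integral_eq_integral[symmetric] L2_integrable) auto
 qed
 then show "(\<integral>\<^sup>+x. ennreal (LBINT s. (norm (F (x, s)))\<^sup>2) \<partial>lborel) = ennreal ((nrm F)\<^sup>2)"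
  using N(1) fin by simp
qed

text \<open>The length S is a parameter because difference quotients with step h live on (0, S +
  h).\<close>

definition timed :: "real => ('a::euclidean_space \<times> real => 'b::euclidean_space) => bool" where
 "timed S F \<longleftrightarrow> F \<in> L2 lborel \<and> (\<forall>z. snd z \<notin> {0<..<S} --> F z = 0)"

definition seg :: "real => real => ('a::euclidean_space \<times> real => 'b::euclidean_space) => 'a => 'b" where
 "seg a b F x = (LBINT s. indicator {a..<b} s *\<^sub>R F (x, s))"

text \<open>The lower limit is minus infinity, which makes time shifts act simply; for
  \<open>timed\<close> functions this is the primitive that vanishes at time 0.\<close>

definition tint :: "('a::euclidean_space \<times> real => 'b::euclidean_space) => 'a \<times> real => 'b" where
 "tint F z = (LBINT s. indicator {..<snd z} s *\<^sub>R F (fst z, s))"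

lemma tint_measurable:
 fixes F :: "'a::euclidean_space \<times> real => 'b::euclidean_space"
 assumes "F \<in> Borel" shows "tint F \<in> Borel"
proof -
 have F: "F \<in> borel_measurable (borel \<Otimes>\<^sub>M borel)" using assms by (simp add: borel_prod)
 have m: "fst \<in> borel_measurable (borel :: ('a \<times> real) measure)" "snd \<in> borel_measurable (borel :: ('a \<times> real) measure)"
  by (intro borel_measurable_continuous_onI continuous_intros)+
 have [measurable]: "(\<lambda>p. snd (fst p)) \<in> borel_measurable ((borel :: ('a \<times> real) measure) \<Otimes>\<^sub>M (lborel :: real measure))"
  by (rule measurable_compose[OF measurable_fst m(2)])
 have "(\<lambda>p. (fst (fst p), snd p)) \<in> (borel :: ('a \<times> real) measure) \<Otimes>\<^sub>M (lborel :: real measure) \<rightarrow>\<^sub>M borel \<Otimes>\<^sub>M borel"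
  by (rule measurable_Pair[OF measurable_compose[OF measurable_fst m(1)]]) simp
 from measurable_compose[OF this F]
 have [measurable]: "(\<lambda>p. F (fst (fst p), snd p)) \<in> borel_measurable ((borel :: ('a \<times> real) measure) \<Otimes>\<^sub>M (lborel :: real measure))" .
 have "(\<lambda>p. if snd p < snd (fst p) then F (fst (fst p), snd p) else 0) \<in> borel_measurable ((borel :: ('a \<times> real) measure) \<Otimes>\<^sub>M (lborel :: real measure))"
  by measurable
 then have "(\<lambda>z. \<integral>s. (if s < snd z then F (fst z, s) else 0) \<partial>lborel) \<in> Borel"
  by (intro lborel.borel_measurable_lebesgue_integral) (simp add: split_beta')
 moreover have "tint F = (\<lambda>z. \<integral>s. (if s < snd z then F (fst z, s) else 0) \<partial>lborel)"
  unfolding tint_def by (intro ext lebesgue_cong) (auto simp: indicator_def)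
 ultimately show ?thesis by simp
qed

lemma seg_measurable:
 fixes F :: "'a::euclidean_space \<times> real => 'b::euclidean_space"
 assumes "F \<in> Borel" shows "seg a b F \<in> Borel"
proof -
 have [measurable]: "F \<in> borel_measurable (borel \<Otimes>\<^sub>M borel)" using assms by (simp add: borel_prod)
 have "(\<lambda>x. \<integral>s. indicator {a..<b} s *\<^sub>R F (x, s) \<partial>lborel) \<in> Borel" by measurable
 then show ?thesis by (simp add: seg_def[abs_def])
qed

lemma timed_measurable: "timed S F ==> F \<in> Borel"
 using L2_measurable[of F lborel] by (simp add: timed_def)

lemma timed_L2: "timed S F ==> F \<in> L2 lborel"
 by (simp add: timed_def)

lemma indicator_L2:
 fixes a b :: real
 shows "(\<lambda>s. indicator {a..<b} s :: real) \<in> L2 lborel"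
proof (rule L2I)
 have "(\<lambda>s. (norm (indicator {a..<b} s :: real))\<^sup>2) = indicator {a..<b}" by (auto simp: fun_eq_iff indicator_def)
 moreover have "emeasure lborel {a..<b} < \<infinity>" by (cases "a \<le> b") auto
 ultimately show "integrable lborel (\<lambda>s. (norm (indicator {a..<b} s :: real))\<^sup>2)" by simp
qed simp

lemma timed_AE:
 fixes F :: "'a::euclidean_space \<times> real => 'b::euclidean_space"
 assumes F: "timed S F"
 shows "AE x in lborel. integrable lborel (\<lambda>s. F (x, s))"
 using L2_slices(1)[OF timed_L2[OF F]]
proof eventually_elim
 case (elim x)
 have "integrable lborel (\<lambda>s. indicator {0..<S} s *\<^sub>R F (x, s))"
  by (rule L2_scaleR_integrable[OF indicator_L2 elim])
 also have "(\<lambda>s. indicator {0..<S} s *\<^sub>R F (x, s)) = (\<lambda>s. F (x, s))"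
  using F by (auto simp: timed_def indicator_def fun_eq_iff)
 finally show ?case .
qed

lemma integrable_seg:
 fixes F :: "'a \<times> real => 'b::euclidean_space"
 shows "integrable lborel (\<lambda>s. F (x, s)) ==> A \<in> sets borel ==> integrable lborel (\<lambda>s. indicator A s *\<^sub>R F (x, s :: real))"
 by (rule integrable_mult_indicator) auto

lemma tint_diff_seg:
 assumes "integrable lborel (\<lambda>s. F (x, s))" "t' \<le> t"
 shows "tint F (x, t) - tint F (x, t') = seg t' t F x"
proof -
 have "tint F (x, t) - tint F (x, t') = (LBINT s. indicator {..<t} s *\<^sub>R F (x, s) - indicator {..<t'} s *\<^sub>R F (x, s))"
  unfolding tint_def fst_conv snd_conv
  by (rule lebesgue_diff[symmetric]) (intro integrable_seg assms; simp)+
 also have "\<dots> = seg t' t F x"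
  unfolding seg_def using assms(2) by (intro lebesgue_cong) (auto simp: indicator_def)
 finally show ?thesis .
qed

lemma tint_eq_seg: "timed S F ==> tint F (x, t) = seg 0 t F x"
 unfolding tint_def seg_def
 by (intro lebesgue_cong) (auto simp: indicator_def timed_def)

text \<open>Cauchy-Schwarz in time for almost every x. The factor \<open>sqrt (b - a)\<close> makes
  primitives Hoelder continuous in time with values in L2.\<close>

lemma seg_L2:
 fixes F :: "'a::euclidean_space \<times> real => 'b::euclidean_space"
 assumes F: "F \<in> L2 lborel" and ab: "a \<le> b"
 shows "seg a b F \<in> L2 lborel" "nrm (seg a b F) \<le> sqrt (b - a) * nrm F"
proof -
 have m: "F \<in> Borel" using L2_measurable[OF F] by simp
 have "(\<integral>\<^sup>+x. ennreal ((norm (seg a b F x))\<^sup>2) \<partial>lborel)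
  \<le> (\<integral>\<^sup>+x. ennreal (b - a) * ennreal (LBINT s. (norm (F (x, s)))\<^sup>2) \<partial>lborel)"
 proof (rule nn_integral_mono_AE, use L2_slices(1)[OF F] in eventually_elim)
  fix x assume x: "(\<lambda>t. F (x, t)) \<in> L2 lborel"
  have "norm (seg a b F x) \<le> (LBINT s. norm (indicator {a..<b} s :: real) * norm (F (x, s)))"
   unfolding seg_def by (rule order_trans[OF integral_norm_bound]) simp
  also have "\<dots> \<le> nrm (\<lambda>s. indicator {a..<b} s :: real) * nrm (\<lambda>s. F (x, s))"
   by (rule L2_Cauchy_Schwarz_norm[OF indicator_L2 x])
  finally have "(norm (seg a b F x))\<^sup>2 \<le> (nrm (\<lambda>s. indicator {a..<b} s :: real) * nrm (\<lambda>s. F (x, s)))\<^sup>2"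
   by (rule power_mono) simp
  also have "(nrm (\<lambda>s. indicator {a..<b} s :: real))\<^sup>2 = b - a"
  proof -
   have "(LBINT s. (norm (indicator {a..<b} s :: real))\<^sup>2) = (LBINT s. indicator {a..<b} s)"
    by (intro lebesgue_cong) (auto simp: indicator_def)
   then show ?thesis using ab by (simp add: L2_norm_power2)
  qed
  then have "(nrm (\<lambda>s. indicator {a..<b} s :: real) * nrm (\<lambda>s. F (x, s)))\<^sup>2
   = (b - a) * (LBINT s. (norm (F (x, s)))\<^sup>2)" by (simp add: power_mult_distrib L2_norm_power2)
  finally show "ennreal ((norm (seg a b F x))\<^sup>2) \<le> ennreal (b - a) * ennreal (LBINT s. (norm (F (x, s)))\<^sup>2)"
   using ab by (simp add: ennreal_mult'[symmetric] ennreal_leI)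
 qed
 also have "\<dots> = ennreal (b - a) * (\<integral>\<^sup>+x. ennreal (LBINT s. (norm (F (x, s)))\<^sup>2) \<partial>lborel)"
 proof (rule nn_integral_cmult)
  have [measurable]: "F \<in> borel_measurable (borel \<Otimes>\<^sub>M borel)" using m by (simp add: borel_prod)
  show "(\<lambda>x. ennreal (LBINT s. (norm (F (x, s)))\<^sup>2)) \<in> borel_measurable lborel" by measurable
 qed
 also have "\<dots> = ennreal ((sqrt (b - a) * nrm F)\<^sup>2)"
  using ab by (simp add: L2_slices(5)[OF F] ennreal_mult'[symmetric] power_mult_distrib)
 finally have *: "(\<integral>\<^sup>+x. ennreal ((norm (seg a b F x))\<^sup>2) \<partial>lborel) \<le> ennreal ((sqrt (b - a) * nrm F)\<^sup>2)" .
 show "seg a b F \<in> L2 lborel" "nrm (seg a b F) \<le> sqrt (b - a) * nrm F"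
  using L2_norm_le_nnI[OF _ *] seg_measurable[OF m] ab by (auto simp: L2_norm_nonneg)
qed

lemma tint_slice:
 fixes F :: "'a::euclidean_space \<times> real => 'b::euclidean_space"
 assumes F: "timed S F"
 shows "(\<lambda>x. tint F (x, t)) \<in> L2 lborel"
  "0 \<le> t ==> slice_norm (tint F) t \<le> sqrt t * nrm F"
  "t' \<le> t ==> nrm (\<lambda>x. tint F (x, t) - tint F (x, t')) \<le> sqrt (t - t') * nrm F"
proof -
 show "0 \<le> t ==> slice_norm (tint F) t \<le> sqrt t * nrm F"
  using seg_L2(2)[OF timed_L2[OF F], of 0 t] by (simp add: tint_eq_seg[OF F])
 show L: "(\<lambda>x. tint F (x, t)) \<in> L2 lborel" for t
 proof (cases "0 \<le> t")
  case True
  then show ?thesis using seg_L2(1)[OF timed_L2[OF F], of 0 t] by (simp add: tint_eq_seg[OF F])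
 next
  case False
  then show ?thesis by (simp add: tint_eq_seg[OF F] seg_def)
 qed
 assume t: "t' \<le> t"
 have m: "tint F \<in> Borel" by (rule tint_measurable[OF timed_measurable[OF F]])
 have "nrm (\<lambda>x. tint F (x, t) - tint F (x, t')) = nrm (seg t' t F)"
 proof (rule L2_norm_cong_AE)
  show "AE x in lborel. tint F (x, t) - tint F (x, t') = seg t' t F x"
   using timed_AE[OF F] by eventually_elim (rule tint_diff_seg[OF _ t])
 qed (use L2_measurable[OF L] L2_measurable[OF seg_L2(1)[OF timed_L2[OF F] t]] in auto)
 then show "nrm (\<lambda>x. tint F (x, t) - tint F (x, t')) \<le> sqrt (t - t') * nrm F"
  using seg_L2(2)[OF timed_L2[OF F] t] by simp
qed

abbreviation before :: "real => ('a \<times> real => 'b::real_vector) => 'a \<times> real => 'b" where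
 "before T F \<equiv> (\<lambda>z. indicator {..<T} (snd z) *\<^sub>R F z)"

lemma before_L2:
 fixes F :: "'a::euclidean_space \<times> real => 'b::euclidean_space"
 assumes "F \<in> L2 lborel" shows "before T F \<in> L2 lborel"
 by (rule L2_bounded_mult[OF assms, of _ 1]) (use time_measurable[of "indicator {..<T}"] in auto)

lemma tint_0: "timed S F ==> t \<le> 0 ==> tint F (x, t) = 0"
 by (simp add: tint_eq_seg seg_def)

lemma before_tint_L2:
 fixes F :: "'a::euclidean_space \<times> real => 'b::euclidean_space"
 assumes F: "timed S F" and T: "0 \<le> T"
 shows "before T (tint F) \<in> L2 lborel" "nrm (before T (tint F)) \<le> T * nrm F"
proof -
 have tm: "tint F \<in> Borel" by (rule tint_measurable[OF timed_measurable[OF F]])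
 define G where "G = before T (tint F)"
 have m: "before T (tint F) \<in> Borel"
  using time_measurable[of "indicator {..<T} :: real => real"] tm by measurable
 then have [measurable]: "G \<in> Borel" by (simp only: G_def)
 have "(\<integral>\<^sup>+z. ennreal ((norm (before T (tint F) z))\<^sup>2) \<partial>lborel)
   = (\<integral>\<^sup>+t. \<integral>\<^sup>+x. ennreal ((norm (before T (tint F) (x, t)))\<^sup>2) \<partial>lborel \<partial>lborel)"
 proof -
  have "(\<lambda>z. ennreal ((norm (G z))\<^sup>2)) \<in> Borel" by measurable
  from nn_integral_slices(2)[OF this] show ?thesis unfolding G_def .
 qed
 also have "\<dots> \<le> (\<integral>\<^sup>+t. ennreal (T * (nrm F)\<^sup>2) * indicator {0..T} t \<partial>lborel)"
 proof (rule nn_integral_mono)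
  fix t :: real
  show "(\<integral>\<^sup>+x. ennreal ((norm (before T (tint F) (x, t)))\<^sup>2) \<partial>lborel) \<le> ennreal (T * (nrm F)\<^sup>2) * indicator {0..T} t"
  proof (cases "0 \<le> t \<and> t < T")
   case True
   have "(\<integral>\<^sup>+x. ennreal ((norm (before T (tint F) (x, t)))\<^sup>2) \<partial>lborel) = ennreal ((slice_norm (tint F) t)\<^sup>2)"
    using True L2_nn_integral[OF tint_slice(1)[OF F]] by simp
   also have "(slice_norm (tint F) t)\<^sup>2 \<le> (sqrt t * nrm F)\<^sup>2"
    using True tint_slice(2)[OF F] by (intro power_mono) (auto simp: L2_norm_nonneg)
   also have "\<dots> = t * (nrm F)\<^sup>2" using True by (simp add: power_mult_distrib)
   also have "\<dots> \<le> T * (nrm F)\<^sup>2" using True by (intro mult_right_mono) auto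
   finally show ?thesis using True by (simp add: ennreal_leI)
  next
   case False
   then have z: "before T (tint F) (x, t) = 0" for x using tint_0[OF F, of t x] by (auto simp: indicator_def)
   show ?thesis by (simp only: z) simp
  qed
 qed
 also have "\<dots> = ennreal ((T * nrm F)\<^sup>2)"
  using T by (subst nn_integral_cmult_indicator) (auto simp: ennreal_mult'[symmetric] power2_eq_square ac_simps)
 finally have *: "(\<integral>\<^sup>+z. ennreal ((norm (before T (tint F) z))\<^sup>2) \<partial>lborel) \<le> ennreal ((T * nrm F)\<^sup>2)" .
 show "before T (tint F) \<in> L2 lborel" "nrm (before T (tint F)) \<le> T * nrm F"
  using L2_norm_le_nnI[OF _ *] m T by (auto simp: L2_norm_nonneg)
qed

lemma timed_diff: "timed S F ==> timed S G ==> timed S (\<lambda>z. F z - G z)"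
 by (simp add: timed_def L2_diff)

lemma timed_mono: "timed S F ==> S \<le> S' ==> timed S' F"
 unfolding timed_def by (meson greaterThanLessThan_subseteq_greaterThanLessThan order_refl subsetD)

lemma tint_diff:
 assumes "timed S F" "timed S G"
 shows "AE x in lborel. \<forall>t. tint (\<lambda>z. F z - G z) (x, t) = tint F (x, t) - tint G (x, t)"
 using timed_AE[OF assms(1)] timed_AE[OF assms(2)]
proof eventually_elim
 case (elim x)
 show ?case
  unfolding tint_def fst_conv snd_conv scaleR_diff_right
  by (intro allI lebesgue_diff integrable_seg elim) simp_all
qed

text \<open>The product of two integrals is a double integral over the plane, split along the
  diagonal; each triangle is one of the two terms. This is integration by parts for primitives of
  merely integrable functions.\<close>

lemma product_formula_1d:
 fixes p r :: "real => 'b::euclidean_space"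
 assumes p: "integrable lborel p" and r: "integrable lborel r"
 shows "(LBINT s. p s) \<bullet> (LBINT s. r s)
  = (LBINT s. p s \<bullet> (LBINT u. indicator {..<s} u *\<^sub>R r u) + r s \<bullet> (LBINT u. indicator {..<s} u *\<^sub>R p u))"
proof -
 have [measurable]: "p \<in> Borel" "r \<in> Borel" using p r by auto
 have int: "integrable (lborel \<Otimes>\<^sub>M lborel) (\<lambda>(s, u). p s \<bullet> r u)"
 proof (rule integrable_bd)
  show "integrable (lborel \<Otimes>\<^sub>M lborel) (\<lambda>(s, u). norm (p s) * norm (r u))"
   by (rule lborel_pair.Fubini_integrable) (use p r in \<open>auto simp: split_beta'\<close>)
 qed (auto simp: Cauchy_Schwarz_ineq2)
 have Sm: "{(s, u::real) | s u. u < (s::real)} \<in> sets (lborel \<Otimes>\<^sub>M lborel)" "{(s, u::real) | s u. (s::real) < u} \<in> sets (lborel \<Otimes>\<^sub>M lborel)"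
 proof -
  have "open {z :: real \<times> real. snd z < fst z}" "open {z :: real \<times> real. fst z < snd z}"
   by (intro open_Collect_less continuous_intros)+
  then have "{z :: real \<times> real. snd z < fst z} \<in> sets borel" "{z :: real \<times> real. fst z < snd z} \<in> sets borel" by auto
  moreover have "{(s, u::real) | s u. u < (s::real)} = {z. snd z < fst z}" "{(s, u::real) | s u. (s::real) < u} = {z. fst z < snd z}" by auto
  ultimately show "{(s, u::real) | s u. u < (s::real)} \<in> sets (lborel \<Otimes>\<^sub>M lborel)" "{(s, u::real) | s u. (s::real) < u} \<in> sets (lborel \<Otimes>\<^sub>M lborel)"
   unfolding lborel_prod by simp_all
 qed
 have i1: "integrable (lborel \<Otimes>\<^sub>M lborel) (\<lambda>(s, u). indicator {..<s} u * (p s \<bullet> r u))"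
 proof -
  have "(\<lambda>(s, u). indicator {..<s} u * (p s \<bullet> r u)) = (\<lambda>x. indicator {(s, u) | s u. u < s} x *\<^sub>R (case x of (s, u) => p s \<bullet> r u))"
   by (auto simp: fun_eq_iff indicator_def)
  then show ?thesis using integrable_mult_indicator[OF Sm(1) int] by (simp only:)
 qed
 have i2: "integrable (lborel \<Otimes>\<^sub>M lborel) (\<lambda>(s, u). indicator {..<u} s * (p s \<bullet> r u))"
 proof -
  have "(\<lambda>(s, u). indicator {..<u} s * (p s \<bullet> r u)) = (\<lambda>x. indicator {(s, u) | s u. s < u} x *\<^sub>R (case x of (s, u) => p s \<bullet> r u))"
   by (auto simp: fun_eq_iff indicator_def)
  then show ?thesis using integrable_mult_indicator[OF Sm(2) int] by (simp only:)
 qed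
 have seg: "integrable lborel (\<lambda>u. indicator {..<s} u *\<^sub>R f u)" if "integrable lborel f" for f :: "real => 'b" and s
  using that by (intro integrable_mult_indicator) auto
 have 1: "(LBINT u. indicator {..<s} u * (p s \<bullet> r u)) = p s \<bullet> (LBINT u. indicator {..<s} u *\<^sub>R r u)" for s
 proof -
  have "(LBINT u. indicator {..<s} u * (p s \<bullet> r u)) = (LBINT u. p s \<bullet> (indicator {..<s} u *\<^sub>R r u))" by simp
  also have "\<dots> = p s \<bullet> (LBINT u. indicator {..<s} u *\<^sub>R r u)" by (rule integral_inner_right[OF seg[OF r]])
  finally show ?thesis .
 qed
 have 2: "(LBINT s. indicator {..<u} s * (p s \<bullet> r u)) = r u \<bullet> (LBINT s. indicator {..<u} s *\<^sub>R p s)" for u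
 proof -
  have "(LBINT s. indicator {..<u} s * (p s \<bullet> r u)) = (LBINT s. r u \<bullet> (indicator {..<u} s *\<^sub>R p s))" by (simp add: inner_commute)
  also have "\<dots> = r u \<bullet> (LBINT s. indicator {..<u} s *\<^sub>R p s)" by (rule integral_inner_right[OF seg[OF p]])
  finally show ?thesis .
 qed
 have "(LBINT s. p s) \<bullet> (LBINT u. r u) = (LBINT s. p s \<bullet> (LBINT u. r u))"
  using p by simp
 also have "\<dots> = (LBINT s. (LBINT u. indicator {..<s} u * (p s \<bullet> r u)) + (LBINT u. indicator {..<u} s * (p s \<bullet> r u)))"
 proof (rule integral_cong_AE)
  show "AE s in lborel. p s \<bullet> (LBINT u. r u) = (LBINT u. indicator {..<s} u * (p s \<bullet> r u)) + (LBINT u. indicator {..<u} s * (p s \<bullet> r u))"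
   using lborel_pair.AE_integrable_fst[OF i1] lborel_pair.AE_integrable_fst[OF i2]
  proof eventually_elim
   case (elim s)
   have "p s \<bullet> (LBINT u. r u) = (LBINT u. p s \<bullet> r u)" using r by simp
   also have "\<dots> = (LBINT u. indicator {..<s} u * (p s \<bullet> r u) + indicator {..<u} s * (p s \<bullet> r u))"
   proof (rule integral_cong_AE)
    \<comment> \<open>The two open triangles omit the diagonal, which is a single u for each
      s.\<close>
    show "AE u in lborel. p s \<bullet> r u = indicator {..<s} u * (p s \<bullet> r u) + indicator {..<u} s * (p s \<bullet> r u)"
     using AE_lborel_singleton[of s] by eventually_elim (auto simp: indicator_def)
    have eq: "(\<lambda>u. indicator {..<s} u * (p s \<bullet> r u) + indicator {..<u} s * (p s \<bullet> r u))
     = (\<lambda>u. indicator {..<s} u * (p s \<bullet> r u) + indicator {s<..} u * (p s \<bullet> r u))"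
     by (auto simp: fun_eq_iff indicator_def)
    show "(\<lambda>u. indicator {..<s} u * (p s \<bullet> r u) + indicator {..<u} s * (p s \<bullet> r u)) \<in> borel_measurable lborel"
     unfolding eq by measurable
   qed simp
   also have "\<dots> = (LBINT u. indicator {..<s} u * (p s \<bullet> r u)) + (LBINT u. indicator {..<u} s * (p s \<bullet> r u))"
    using elim by (intro lebesgue_add) auto
   finally show ?case .
  qed
  show "(\<lambda>s. (LBINT u. indicator {..<s} u * (p s \<bullet> r u)) + (LBINT u. indicator {..<u} s * (p s \<bullet> r u))) \<in> borel_measurable lborel"
   using lborel_pair.integrable_fst[OF i1] lborel_pair.integrable_fst[OF i2] by auto
 qed measurable
 also have "\<dots> = (LBINT s. (LBINT u. indicator {..<s} u * (p s \<bullet> r u))) + (LBINT s. (LBINT u. indicator {..<u} s * (p s \<bullet> r u)))"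
  using lborel_pair.integrable_fst[OF i1] lborel_pair.integrable_fst[OF i2] by (intro lebesgue_add) auto
 also have "(LBINT s. (LBINT u. indicator {..<u} s * (p s \<bullet> r u))) = (LBINT u. (LBINT s. indicator {..<u} s * (p s \<bullet> r u)))"
  by (rule lborel_pair.Fubini_integral[OF i2, symmetric])
 also have "(LBINT s. (LBINT u. indicator {..<s} u * (p s \<bullet> r u))) + \<dots>
  = (LBINT s. (LBINT u. indicator {..<s} u * (p s \<bullet> r u)) + (LBINT u. indicator {..<s} u * (p u \<bullet> r s)))"
  using lborel_pair.integrable_fst[OF i1] lborel_pair.integrable_snd[OF i2] by (intro lebesgue_add[symmetric]) auto
 finally show ?thesis by (simp only: 1 2)
qed

text \<open>\<open>product_formula_1d\<close> is applied for almost every x to integrands truncated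
  at T; before T the truncation does not change the primitives.\<close>

theorem product_formula:
 fixes P R :: "'a::euclidean_space \<times> real => 'b::euclidean_space"
 assumes P: "timed S P" and R: "timed S R" and T: "0 \<le> T"
 shows "(LBINT x. tint P (x, T) \<bullet> tint R (x, T))
  = (LBINT z. indicator {..<T} (snd z) * (P z \<bullet> tint R z + R z \<bullet> tint P z))"
proof -
 have I: "integrable lborel (\<lambda>z. P z \<bullet> before T (tint R) z + R z \<bullet> before T (tint P) z)"
  using timed_L2[OF P] timed_L2[OF R] before_tint_L2(1)[OF P T] before_tint_L2(1)[OF R T]
  by (intro integrable_plus L2_inner_integrable)
 have eq: "(\<lambda>z. P z \<bullet> before T (tint R) z + R z \<bullet> before T (tint P) z)
  = (\<lambda>z. indicator {..<T} (snd z) * (P z \<bullet> tint R z + R z \<bullet> tint P z))"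
  by (simp add: fun_eq_iff algebra_simps)
 note I = I[unfolded eq]
 have "(LBINT z. indicator {..<T} (snd z) * (P z \<bullet> tint R z + R z \<bullet> tint P z))
  = (LBINT x. \<integral>t. indicator {..<T} t * (P (x, t) \<bullet> tint R (x, t) + R (x, t) \<bullet> tint P (x, t)) \<partial>lborel)"
  using integral_slices(1)[OF I] by simp
 also have "\<dots> = (LBINT x. tint P (x, T) \<bullet> tint R (x, T))"
 proof (rule integral_cong_AE)
  show "AE x in lborel. (LBINT t. indicator {..<T} t * (P (x, t) \<bullet> tint R (x, t) + R (x, t) \<bullet> tint P (x, t))) = tint P (x, T) \<bullet> tint R (x, T)"
   using timed_AE[OF P] timed_AE[OF R]
  proof eventually_elim
   case (elim x)
   have int: "integrable lborel (\<lambda>s. indicator {..<T} s *\<^sub>R P (x, s))" "integrable lborel (\<lambda>s. indicator {..<T} s *\<^sub>R R (x, s))"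
    using elim by (auto intro!: integrable_seg)
   have e: "(LBINT u. indicator {..<s} u *\<^sub>R (indicator {..<T} u *\<^sub>R F (x, u))) = tint F (x, s)" if "s < T" for s and F :: "'a \<times> real => 'b"
    unfolding tint_def using that by (intro lebesgue_cong) (auto simp: indicator_def)
   have "tint P (x, T) \<bullet> tint R (x, T) = (LBINT s. (indicator {..<T} s *\<^sub>R P (x, s)) \<bullet> (LBINT u. indicator {..<s} u *\<^sub>R (indicator {..<T} u *\<^sub>R R (x, u)))
    + (indicator {..<T} s *\<^sub>R R (x, s)) \<bullet> (LBINT u. indicator {..<s} u *\<^sub>R (indicator {..<T} u *\<^sub>R P (x, u))))"
    unfolding tint_def fst_conv snd_conv by (rule product_formula_1d[OF int])
   also have "\<dots> = (LBINT t. indicator {..<T} t * (P (x, t) \<bullet> tint R (x, t) + R (x, t) \<bullet> tint P (x, t)))"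
   proof (rule lebesgue_cong[OF refl])
    fix s
    show "(indicator {..<T} s *\<^sub>R P (x, s)) \<bullet> (LBINT u. indicator {..<s} u *\<^sub>R (indicator {..<T} u *\<^sub>R R (x, u)))
    + (indicator {..<T} s *\<^sub>R R (x, s)) \<bullet> (LBINT u. indicator {..<s} u *\<^sub>R (indicator {..<T} u *\<^sub>R P (x, u)))
    = indicator {..<T} s * (P (x, s) \<bullet> tint R (x, s) + R (x, s) \<bullet> tint P (x, s))"
     by (cases "s < T") (auto simp only: e indicator_simps lessThan_iff, auto)
   qed
   finally show ?case by simp
  qed
  show "(\<lambda>x. \<integral>t. indicator {..<T} t * (P (x, t) \<bullet> tint R (x, t) + R (x, t) \<bullet> tint P (x, t)) \<partial>lborel) \<in> borel_measurable lborel"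
   using integral_slices(3)[OF I] by auto
 qed (use L2_measurable[OF tint_slice(1)[OF P]] L2_measurable[OF tint_slice(1)[OF R]] in measurable)
 finally show ?thesis by simp
qed

subsection \<open>Final values\<close>

text \<open>The counterpart of \<open>has_final_value\<close> for representatives on the whole
  space; \<open>final_norm_eq\<close> translates between the two.\<close>

definition final_limit :: "real => ('a::euclidean_space \<times> real => 'b::euclidean_space) => ('a => 'b) => bool" where
 "final_limit T F g \<longleftrightarrow> (\<forall>\<epsilon>>0. \<exists>\<tau>\<in>{0..<T}. AE t in lborel. \<tau> < t \<and> t < T -->
  (\<lambda>x. F (x, t)) \<in> L2 lborel \<and> nrm (\<lambda>x. F (x, t) - g x) < \<epsilon>)"

text \<open>The squared slice norms of the differences are integrable functions of time whose
  integrals tend to 0, so a subsequence tends to 0 for almost every time.\<close>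

lemma slices_converge:
 fixes F :: "'a::euclidean_space \<times> real => 'b::euclidean_space"
 assumes lim: "L2_lim lborel (\<lambda>n. before T (G n)) (before T F)"
 shows "\<exists>r::nat=>nat. strict_mono r \<and>
  (AE t in lborel. t < T --> (\<lambda>n. nrm (\<lambda>x. G (r n) (x, t) - F (x, t))) \<longlonglongrightarrow> 0)"
proof -
 note D = L2_limD[OF lim]
 define U where "U n = (\<lambda>z. before T (G n) z - before T F z)" for n
 have U: "U n \<in> L2 lborel" for n unfolding U_def by (rule L2_diff[OF D(1,2)])
 have "(\<lambda>n. (nrm (U n))\<^sup>2) \<longlonglongrightarrow> 0\<^sup>2" unfolding U_def by (intro tendsto_power D(3))
 then have "(\<lambda>n. \<integral>t. norm ((slice_norm (U n) t)\<^sup>2) \<partial>lborel) \<longlonglongrightarrow> 0" by (simp add: L2_slices(4)[OF U])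
 from tendsto_L1_AE_subseq[OF L2_slices(3)[OF U] this]
 obtain r :: "nat => nat" where r: "strict_mono r" "AE t in lborel. (\<lambda>n. (slice_norm (U (r n)) t)\<^sup>2) \<longlonglongrightarrow> 0"
  by blast
 from r(2) have "AE t in lborel. t < T --> (\<lambda>n. nrm (\<lambda>x. G (r n) (x, t) - F (x, t))) \<longlonglongrightarrow> 0"
 proof eventually_elim
  case (elim t)
  show ?case
  proof
   assume t: "t < T"
   have "(\<lambda>n. slice_norm (U (r n)) t) \<longlonglongrightarrow> 0"
    using tendsto_real_sqrt[OF elim] by (simp add: L2_norm_nonneg)
   then show "(\<lambda>n. nrm (\<lambda>x. G (r n) (x, t) - F (x, t))) \<longlonglongrightarrow> 0" using t by (simp add: U_def)
  qed
 qed
 with r(1) show ?thesis by blast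
qed

text \<open>Uniform convergence in time lets the limit n to infinity be exchanged with t to T.
  Convergence in space-time identifies the slices of F with those of the uniform limit for almost
  every time, along a subsequence, which is all that \<open>final_limit\<close> asks for.\<close>

theorem final_limit_uniform:
 fixes F :: "'a::euclidean_space \<times> real => 'b::euclidean_space"
 assumes T: "0 < T" and F: "F \<in> L2 lborel" and \<Omega>: "\<Omega> \<in> sets borel"
  and G: "\<And>n t. (\<lambda>x. G n (x, t)) \<in> L2 lborel" and supp: "\<And>n x. x \<notin> \<Omega> ==> G n (x, T) = 0"
  and cont: "\<And>n \<epsilon>. 0 < \<epsilon> ==> \<exists>\<tau>\<in>{0..<T}. \<forall>t. \<tau> < t \<and> t < T --> nrm (\<lambda>x. G n (x, t) - G n (x, T)) < \<epsilon>"
  and cauchy: "\<And>\<epsilon>. 0 < \<epsilon> ==> \<exists>N. \<forall>m\<ge>N. \<forall>n\<ge>N. \<forall>t\<in>{0..T}. nrm (\<lambda>x. G m (x, t) - G n (x, t)) < \<epsilon>"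
  and lim: "L2_lim lborel (\<lambda>n. before T (G n)) (before T F)"
 shows "\<exists>g. g \<in> L2 lborel \<and> (\<forall>x. x \<notin> \<Omega> --> g x = 0) \<and> L2_lim lborel (\<lambda>n x. G n (x, T)) g \<and> final_limit T F g"
proof -
 have "\<exists>g. L2_lim lborel (\<lambda>n x. G n (x, T)) g"
 proof (rule L2_complete[OF G])
  fix \<epsilon> :: real assume "0 < \<epsilon>"
  from cauchy[OF this] T show "\<exists>N. \<forall>m\<ge>N. \<forall>n\<ge>N. nrm (\<lambda>x. G m (x, T) - G n (x, T)) < \<epsilon>" by force
 qed
 then obtain g0 where g0: "L2_lim lborel (\<lambda>n x. G n (x, T)) g0" by blast
 define g where "g x = indicator \<Omega> x *\<^sub>R g0 x" for x
 have "L2_lim lborel (\<lambda>n x. indicator \<Omega> x *\<^sub>R G n (x, T)) g"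
  unfolding g_def by (rule L2_lim_bounded_mult[OF g0, of _ 1]) (use \<Omega> in auto)
 moreover have "(\<lambda>x. indicator \<Omega> x *\<^sub>R G n (x, T)) = (\<lambda>x. G n (x, T))" for n
  using supp by (auto simp: fun_eq_iff indicator_def)
 ultimately have g: "L2_lim lborel (\<lambda>n x. G n (x, T)) g" by simp
 have gL: "g \<in> L2 lborel" by (rule L2_limD(2)[OF g])
 obtain r :: "nat => nat" where r: "strict_mono r"
  "AE t in lborel. t < T --> (\<lambda>n. nrm (\<lambda>x. G (r n) (x, t) - F (x, t))) \<longlonglongrightarrow> 0"
  using slices_converge[OF lim] by blast
 have "final_limit T F g" unfolding final_limit_def
 proof (intro allI impI)
  fix \<epsilon> :: real assume "0 < \<epsilon>"
  then have e4: "0 < \<epsilon>/4" by simp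
  obtain N where N: "\<And>m n t. m \<ge> N ==> n \<ge> N ==> t \<in> {0..T} ==> nrm (\<lambda>x. G m (x, t) - G n (x, t)) < \<epsilon>/4"
   using cauchy[OF e4] by blast
  obtain N' where N': "\<And>n. n \<ge> N' ==> nrm (\<lambda>x. G n (x, T) - g x) < \<epsilon>/4"
   using LIMSEQ_D[OF L2_limD(3)[OF g] e4] by (auto simp: L2_norm_nonneg)
  define n where "n = max N N'"
  obtain \<tau> where \<tau>: "\<tau> \<in> {0..<T}" "\<And>t. \<tau> < t ==> t < T ==> nrm (\<lambda>x. G n (x, t) - G n (x, T)) < \<epsilon>/4"
   using cont[OF e4, of n] by blast
  show "\<exists>\<tau>\<in>{0..<T}. AE t in lborel. \<tau> < t \<and> t < T -->
   (\<lambda>x. F (x, t)) \<in> L2 lborel \<and> nrm (\<lambda>x. F (x, t) - g x) < \<epsilon>"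
  proof (rule bexI[OF _ \<tau>(1)], use r(2) L2_slices(2)[OF F] in eventually_elim)
   fix t assume A: "t < T --> (\<lambda>n. nrm (\<lambda>x. G (r n) (x, t) - F (x, t))) \<longlonglongrightarrow> 0"
    and Ft: "(\<lambda>x. F (x, t)) \<in> L2 lborel"
   show "\<tau> < t \<and> t < T --> (\<lambda>x. F (x, t)) \<in> L2 lborel \<and> nrm (\<lambda>x. F (x, t) - g x) < \<epsilon>"
   proof (intro impI conjI Ft)
    assume t: "\<tau> < t \<and> t < T"
    with A have "(\<lambda>n. nrm (\<lambda>x. G (r n) (x, t) - F (x, t))) \<longlonglongrightarrow> 0" by simp
    from LIMSEQ_D[OF this e4] obtain K where K: "\<And>k. k \<ge> K ==> nrm (\<lambda>x. G (r k) (x, t) - F (x, t)) < \<epsilon>/4"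
     by (auto simp: L2_norm_nonneg)
    \<comment> \<open>This index depends on t, but it is compared with n only through the Cauchy
      bound that is uniform in t; the continuity threshold \<tau> was fixed with n.\<close>
    define m where "m = r (max K N)"
    have m: "m \<ge> N" unfolding m_def using seq_suble[OF r(1), of "max K N"] by simp
    have mK: "nrm (\<lambda>x. G m (x, t) - F (x, t)) < \<epsilon>/4" unfolding m_def by (rule K) simp
    have "nrm (\<lambda>x. F (x, t) - g x) \<le> nrm (\<lambda>x. F (x, t) - G m (x, t)) + nrm (\<lambda>x. G m (x, t) - g x)"
     by (rule L2_norm_triangle_diff[OF Ft G gL])
    also have "nrm (\<lambda>x. G m (x, t) - g x) \<le> nrm (\<lambda>x. G m (x, t) - G n (x, t)) + nrm (\<lambda>x. G n (x, t) - g x)"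
     by (rule L2_norm_triangle_diff[OF G G gL])
    also have "nrm (\<lambda>x. G n (x, t) - g x) \<le> nrm (\<lambda>x. G n (x, t) - G n (x, T)) + nrm (\<lambda>x. G n (x, T) - g x)"
     by (rule L2_norm_triangle_diff[OF G G gL])
    finally have "nrm (\<lambda>x. F (x, t) - g x) \<le> nrm (\<lambda>x. G m (x, t) - F (x, t))
     + (nrm (\<lambda>x. G m (x, t) - G n (x, t)) + (nrm (\<lambda>x. G n (x, t) - G n (x, T)) + nrm (\<lambda>x. G n (x, T) - g x)))"
     by (simp add: L2_norm_minus_commute[of lborel "\<lambda>x. F (x, t)"])
    also have "\<dots> < \<epsilon>/4 + (\<epsilon>/4 + (\<epsilon>/4 + \<epsilon>/4))"
     using t \<tau>(1) by (intro add_strict_mono N N' \<tau>(2) m mK) (auto simp: n_def)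
    finally show "nrm (\<lambda>x. F (x, t) - g x) < \<epsilon>" by simp
   qed
  qed
 qed
 moreover have "\<forall>x. x \<notin> \<Omega> --> g x = 0" by (simp add: g_def)
 ultimately show ?thesis using gL g by blast
qed

lemma tint_cont:
 fixes R :: "'a::euclidean_space \<times> real => 'b::euclidean_space"
 assumes R: "timed S R" and T: "0 < T" and \<epsilon>: "0 < \<epsilon>"
 shows "\<exists>\<tau>\<in>{0..<T}. \<forall>t. \<tau> < t \<and> t < T --> nrm (\<lambda>x. tint R (x, t) - tint R (x, T)) < \<epsilon>"
proof -
 define K where "K = nrm R + 1"
 have K: "0 < K" "nrm R \<le> K" using L2_norm_nonneg[of lborel R] by (auto simp: K_def)
 define \<tau> where "\<tau> = max 0 (T - (\<epsilon> / K)\<^sup>2)"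
 have "\<tau> \<in> {0..<T}" using T \<epsilon> K by (auto simp: \<tau>_def)
 moreover have "nrm (\<lambda>x. tint R (x, t) - tint R (x, T)) < \<epsilon>" if t: "\<tau> < t" "t < T" for t
 proof -
  have "nrm (\<lambda>x. tint R (x, T) - tint R (x, t)) \<le> sqrt (T - t) * nrm R"
   using t by (intro tint_slice(3)[OF R]) simp
  also have "\<dots> \<le> sqrt (T - t) * K" using K t by (intro mult_left_mono) auto
  also have "\<dots> < sqrt ((\<epsilon> / K)\<^sup>2) * K"
   using t K by (intro mult_strict_right_mono real_sqrt_less_mono) (auto simp: \<tau>_def)
  also have "\<dots> = \<epsilon>" using \<epsilon> K by simp
  finally show ?thesis by (subst L2_norm_minus_commute)
 qed
 ultimately show ?thesis by blast
qed

text \<open>Primitives are continuous in time with values in L2, so agreement almost everywhere with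
  c + tint R determines the final value.\<close>

lemma final_limit_tint:
 fixes R :: "'a::euclidean_space \<times> real => 'b::euclidean_space"
 assumes T: "0 < T" and R: "timed S R" and c: "c \<in> L2 lborel"
  and F: "F \<in> L2 lborel" "AE z in lborel. 0 < snd z \<and> snd z < T --> F z = c (fst z) + tint R z"
 shows "final_limit T F (\<lambda>x. c x + tint R (x, T))"
 unfolding final_limit_def
proof (intro allI impI)
 fix \<epsilon> :: real assume "0 < \<epsilon>"
 then obtain \<tau> where \<tau>: "\<tau> \<in> {0..<T}" "\<And>t. \<tau> < t ==> t < T ==> nrm (\<lambda>x. tint R (x, t) - tint R (x, T)) < \<epsilon>"
  using tint_cont[OF R T] by blast
 show "\<exists>\<tau>\<in>{0..<T}. AE t in lborel. \<tau> < t \<and> t < T -->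
  (\<lambda>x. F (x, t)) \<in> L2 lborel \<and> nrm (\<lambda>x. F (x, t) - (c x + tint R (x, T))) < \<epsilon>"
 proof (rule bexI[OF _ \<tau>(1)], use AE_slices(2)[OF F(2)] L2_slices(2)[OF F(1)] in eventually_elim)
  fix t assume A: "AE x in lborel. 0 < snd (x, t) \<and> snd (x, t) < T --> F (x, t) = c (fst (x, t)) + tint R (x, t)"
   and Ft: "(\<lambda>x. F (x, t)) \<in> L2 lborel"
  show "\<tau> < t \<and> t < T --> (\<lambda>x. F (x, t)) \<in> L2 lborel \<and> nrm (\<lambda>x. F (x, t) - (c x + tint R (x, T))) < \<epsilon>"
  proof (intro impI conjI Ft)
   assume t: "\<tau> < t \<and> t < T"
   note m = L2_measurable[OF Ft] L2_measurable[OF c] L2_measurable[OF tint_slice(1)[OF R]]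
   have "nrm (\<lambda>x. F (x, t) - (c x + tint R (x, T))) = nrm (\<lambda>x. tint R (x, t) - tint R (x, T))"
   proof (rule L2_norm_cong_AE)
    show "AE x in lborel. F (x, t) - (c x + tint R (x, T)) = tint R (x, t) - tint R (x, T)"
     using A by eventually_elim (use t \<tau>(1) in auto)
   qed (use m in auto)
   then show "nrm (\<lambda>x. F (x, t) - (c x + tint R (x, T))) < \<epsilon>" using \<tau>(2) t by simp
  qed
 qed
qed

subsection \<open>Steklov averages\<close>

text \<open>The uniform distribution on the times 0 < s \<le> h, placed at the spatial origin: the
  average at time t runs over the preceding interval.\<close>

definition steklov :: "real => ('a::euclidean_space \<times> real) measure" where
 "steklov h = distr (density lborel (\<lambda>s. ennreal (indicator {0<..h} s / h))) borel (\<lambda>s. (0, s))"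

lemma steklov_averaging:
 assumes h: "0 < h" shows "averaging (steklov h :: ('a::euclidean_space \<times> real) measure)"
proof
 have [measurable]: "(\<lambda>s. (0::'a, s)) \<in> Borel"
  by (intro borel_measurable_continuous_onI continuous_intros)
 show "sets (steklov h :: ('a \<times> real) measure) = sets borel" by (simp add: steklov_def)
 have "emeasure (steklov h :: ('a \<times> real) measure) UNIV = (\<integral>\<^sup>+s. ennreal (1 / h) * indicator {0<..h} s \<partial>lborel)"
  by (auto simp: steklov_def emeasure_distr emeasure_density indicator_def intro!: nn_integral_cong)
 also have "\<dots> = ennreal (1 / h) * ennreal h" using h by (subst nn_integral_cmult_indicator) auto
 also have "\<dots> = 1" using h by (simp add: ennreal_mult'[symmetric])
 finally show "emeasure (steklov h :: ('a \<times> real) measure) UNIV = 1" .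
qed

lemma steklov_AE:
 assumes h: "0 < h"
 shows "AE \<xi> in (steklov h :: ('a::euclidean_space \<times> real) measure). fst \<xi> = 0 \<and> 0 < snd \<xi> \<and> snd \<xi> \<le> h"
proof -
 have [measurable]: "(\<lambda>s. (0::'a, s)) \<in> Borel"
  by (intro borel_measurable_continuous_onI continuous_intros)
 have [measurable]: "fst \<in> borel_measurable (borel :: ('a \<times> real) measure)" "snd \<in> borel_measurable (borel :: ('a \<times> real) measure)"
  by (intro borel_measurable_continuous_onI continuous_intros)+
 have m: "{\<xi> \<in> space borel. fst \<xi> = (0::'a) \<and> 0 < snd \<xi> \<and> snd \<xi> \<le> h} \<in> sets (borel :: ('a \<times> real) measure)"
  by measurable
 show ?thesis unfolding steklov_def
  using m h by (subst AE_distr_iff) (auto simp: AE_density indicator_def intro!: AE_I2)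
qed

lemma steklov_AE_norm:
 assumes h: "0 < h"
 shows "AE \<xi> in (steklov h :: ('a::euclidean_space \<times> real) measure). norm \<xi> < 2 * h"
 using steklov_AE[OF h] by eventually_elim (use h in \<open>auto simp: norm_prod_def\<close>)

lemma avg_steklov:
 fixes F :: "'a::euclidean_space \<times> real => 'b::euclidean_space"
 assumes h: "0 < h" and Fm: "F \<in> Borel"
 shows "avg (steklov h) F (x, t) = (1 / h) *\<^sub>R seg (t - h) t F x"
proof -
 have [measurable]: "(\<lambda>s. (0::'a, s)) \<in> Borel"
  by (intro borel_measurable_continuous_onI continuous_intros)
 have c: "(\<lambda>\<xi>. F ((x, t) - \<xi>)) \<in> Borel"
  by (rule measurable_compose[OF borel_measurable_continuous_onI Fm]) (intro continuous_intros)
 have s: "(\<lambda>s. F (x, t - s)) \<in> Borel"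
  by (rule measurable_compose[OF borel_measurable_continuous_onI Fm]) (intro continuous_intros)
 have "avg (steklov h) F (x, t) = (LBINT s. (indicator {0<..h} s / h) *\<^sub>R F (x, t - s))"
  unfolding avg_def steklov_def using c s h by (subst integral_distr) (auto simp: integral_density)
 also have "\<dots> = (LBINT s. (1 / h) *\<^sub>R (indicator {t - h..<t} (t - s) *\<^sub>R F (x, t - s)))"
  by (intro lebesgue_cong) (auto simp: indicator_def)
 also have "\<dots> = (1 / h) *\<^sub>R (LBINT s. indicator {t - h..<t} (t - s) *\<^sub>R F (x, t - s))"
  by (rule integral_scaleR_right)
 also have "(LBINT s. indicator {t - h..<t} (t - s) *\<^sub>R F (x, t - s)) = seg (t - h) t F x"
  unfolding seg_def
  using lborel_integral_reflect[of "\<lambda>s. indicator {t - h..<t} s *\<^sub>R F (x, s)" t] borel_slices(2)[OF Fm, of x] by simp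
 finally show ?thesis .
qed

lemma tint_shift:
 fixes F :: "'a::euclidean_space \<times> real => 'b::euclidean_space"
 assumes Fm: "F \<in> Borel"
 shows "tint (\<lambda>z. F (z - (0, h))) (x, t) = tint F (x, t - h)"
proof -
 have "(LBINT s. indicator {..<t - h} (s - h) *\<^sub>R F (x, s - h)) = (LBINT s. indicator {..<t - h} s *\<^sub>R F (x, s))"
  using lborel_integral_translate[of "\<lambda>s. indicator {..<t - h} s *\<^sub>R F (x, s)" h] borel_slices(2)[OF Fm, of x] by simp
 then show ?thesis by (simp add: tint_def indicator_def)
qed

lemma timed_shift:
 assumes "timed S F" "0 \<le> h" shows "timed (S + h) (\<lambda>z. F (z - (0, h)))"
 using assms L2_translate[OF timed_L2[OF assms(1)], of "(0, h)"] by (auto simp: timed_def)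

lemma timed_scaleR: "timed S F ==> timed S (\<lambda>z. c *\<^sub>R F z)"
 by (auto simp: timed_def intro: L2_scaleR)

lemma tint_scaleR: "tint (\<lambda>z. c *\<^sub>R F z) z = c *\<^sub>R tint F z"
proof -
 have "tint (\<lambda>z. c *\<^sub>R F z) z = (LBINT s. c *\<^sub>R (indicator {..<snd z} s *\<^sub>R F (fst z, s)))"
  unfolding tint_def by (simp only: scaleR_left_commute)
 also have "\<dots> = c *\<^sub>R tint F z" unfolding tint_def by (rule integral_scaleR_right)
 finally show ?thesis .
qed

definition dq :: "real => ('a::euclidean_space \<times> real => 'b::euclidean_space) => 'a \<times> real => 'b" where
 "dq h F z = (1 / h) *\<^sub>R (F z - F (z - (0, h)))"

lemma dq_timed:
 assumes "timed S F" "0 \<le> h" shows "timed (S + h) (dq h F)"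
 unfolding dq_def[abs_def]
 by (intro timed_scaleR timed_diff timed_shift assms timed_mono[OF assms(1)]) (use assms in simp)

text \<open>The integral of F(s) - F(s - h) up to t telescopes to the integral over [t - h, t). A
  function without regularity in time thus has difference quotients whose primitives are its
  averages.\<close>

lemma tint_dq:
 fixes F :: "'a::euclidean_space \<times> real => 'b::euclidean_space"
 assumes F: "timed S F" and h: "0 < h"
 shows "AE x in lborel. \<forall>t. tint (dq h F) (x, t) = avg (steklov h) F (x, t)"
proof -
 have F': "timed (S + h) F" using F by (rule timed_mono) (use h in simp)
 show ?thesis
 using tint_diff[OF F' timed_shift[OF F less_imp_le[OF h]]] timed_AE[OF F]
proof eventually_elim
 fix x assume A: "\<forall>t. tint (\<lambda>z. F z - F (z - (0, h))) (x, t) = tint F (x, t) - tint (\<lambda>z. F (z - (0, h))) (x, t)"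
  and B: "integrable lborel (\<lambda>s. F (x, s))"
 show "\<forall>t. tint (dq h F) (x, t) = avg (steklov h) F (x, t)"
 proof
  fix t
  have "tint (dq h F) (x, t) = (1 / h) *\<^sub>R (tint F (x, t) - tint F (x, t - h))"
   unfolding dq_def[abs_def] tint_scaleR using A by (simp add: tint_shift[OF timed_measurable[OF F]])
  also have "\<dots> = avg (steklov h) F (x, t)"
   using tint_diff_seg[OF B, of "t - h" t] h by (simp add: avg_steklov[OF h timed_measurable[OF F]])
  finally show "tint (dq h F) (x, t) = avg (steklov h) F (x, t)" .
 qed
qed
qed

text \<open>For a primitive the difference quotient is the average of the integrand. The cutoff at T
  spoils this only from T on, and the zero values before time 0 are those of the primitive
  itself.\<close>

lemma dq_before_tint:
 fixes p :: "'a::euclidean_space \<times> real => 'b::euclidean_space"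
 assumes p: "timed S p" and h: "0 < h"
 shows "AE z in lborel. snd z < T --> dq h (before T (tint p)) z = avg (steklov h) p z"
 using AE_fst[OF timed_AE[OF p]]
proof eventually_elim
 case (elim z)
 show ?case
 proof
  assume t: "snd z < T"
  obtain x s where z: "z = (x, s)" by (cases z)
  have "dq h (before T (tint p)) z = (1 / h) *\<^sub>R (tint p (x, s) - tint p (x, s - h))"
   using t h by (simp add: dq_def z)
  also have "\<dots> = avg (steklov h) p z"
   using tint_diff_seg[of p x "s - h" s] elim h by (simp add: z avg_steklov[OF h timed_measurable[OF p]])
  finally show "dq h (before T (tint p)) z = avg (steklov h) p z" .
 qed
qed

lemma test_fun_translate_time:
 fixes \<phi> :: "'a::euclidean_space \<times> real => real"
 assumes \<phi>: "\<phi> \<in> test_fun U" and V: "\<And>z. z \<in> U ==> z + c \<in> V"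
 shows "(\<lambda>z. \<phi> (z - c)) \<in> test_fun V"
proof (rule test_funI[OF C1_translate(1)[OF test_fun_C1[OF \<phi>]], of "(\<lambda>z. z + c) ` closure {z. \<phi> z \<noteq> 0}"])
 show "compact ((\<lambda>z. z + c) ` closure {z. \<phi> z \<noteq> 0})"
  using \<phi> by (intro compact_continuous_image continuous_intros) (simp add: test_fun_def)
 show "(\<lambda>z. z + c) ` closure {z. \<phi> z \<noteq> 0} \<subseteq> V" using \<phi> V by (auto simp: test_fun_def)
 fix z assume z: "z \<notin> (\<lambda>z. z + c) ` closure {z. \<phi> z \<noteq> 0}"
 have "z - c \<notin> closure {z. \<phi> z \<noteq> 0}"
 proof
  assume "z - c \<in> closure {z. \<phi> z \<noteq> 0}"
  then have "(z - c) + c \<in> (\<lambda>z. z + c) ` closure {z. \<phi> z \<noteq> 0}" by (rule imageI)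
  then show False using z by simp
 qed
 then show "\<phi> (z - c) = 0" using closure_subset[of "{z. \<phi> z \<noteq> 0}"] by blast
qed

lemma L2_borel: "f \<in> L2 lborel ==> f \<in> Borel"
 using L2_measurable[of f lborel] by simp

lemma global_grad_translate:
 assumes "global_grad w g" shows "global_grad (\<lambda>z. w (z - c)) (\<lambda>z. g (z - c))"
 unfolding global_grad_def
proof (intro conjI ballI)
 have L: "w \<in> L2 lborel" "g \<in> L2 lborel" using assms by (auto simp: global_grad_def)
 show "(\<lambda>z. w (z - c)) \<in> L2 lborel" "(\<lambda>z. g (z - c)) \<in> L2 lborel" using L by (auto intro: L2_translate)
 fix \<phi> :: "'a \<times> real => real" assume \<phi>: "\<phi> \<in> test_fun UNIV"
 have t: "(\<lambda>z. \<phi> (z - (- c))) \<in> test_fun UNIV" by (rule test_fun_translate_time[OF \<phi>]) simp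
 note C = test_fun_C1[OF \<phi>]
 have [measurable]: "w \<in> Borel" "g \<in> Borel" "\<phi> \<in> Borel" "gradx \<phi> \<in> Borel"
  using L2_borel[OF L(1)] L2_borel[OF L(2)] C1_measurable[OF C] gradx_measurable[OF C] by auto
 have "(LBINT z. w (z - c) *\<^sub>R gradx \<phi> z + \<phi> z *\<^sub>R g (z - c))
  = (LBINT z. w z *\<^sub>R gradx \<phi> (z - (- c)) + \<phi> (z - (- c)) *\<^sub>R g z)"
  using lborel_integral_translate[of "\<lambda>z. w z *\<^sub>R gradx \<phi> (z - (- c)) + \<phi> (z - (- c)) *\<^sub>R g z" c] by simp
 also have "\<dots> = 0"
  using assms t unfolding global_grad_def by (auto simp: gradx_translate[OF C, of "- c", symmetric] simp del: diff_minus_eq_add)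
 finally show "(LBINT z. w (z - c) *\<^sub>R gradx \<phi> z + \<phi> z *\<^sub>R g (z - c)) = 0" .
qed

lemma global_grad_diff:
 assumes 1: "global_grad w g" and 2: "global_grad v k"
 shows "global_grad (\<lambda>z. c *\<^sub>R (w z - v z)) (\<lambda>z. c *\<^sub>R (g z - k z))"
 unfolding global_grad_def
proof (intro conjI ballI)
 have L: "w \<in> L2 lborel" "g \<in> L2 lborel" "v \<in> L2 lborel" "k \<in> L2 lborel" using 1 2 by (auto simp: global_grad_def)
 show "(\<lambda>z. c *\<^sub>R (w z - v z)) \<in> L2 lborel" "(\<lambda>z. c *\<^sub>R (g z - k z)) \<in> L2 lborel" using L by (intro L2_scaleR L2_diff; simp)+
 fix \<phi> :: "'a \<times> real => real" assume \<phi>: "\<phi> \<in> test_fun UNIV"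
 note I = integrable_plus[OF L2_scaleR_integrable[OF _ gradx_L2[OF \<phi>]] L2_scaleR_integrable[OF test_fun_L2(1)[OF \<phi>]]]
 have "(LBINT z. (c *\<^sub>R (w z - v z)) *\<^sub>R gradx \<phi> z + \<phi> z *\<^sub>R (c *\<^sub>R (g z - k z)))
  = (LBINT z. c *\<^sub>R ((w z *\<^sub>R gradx \<phi> z + \<phi> z *\<^sub>R g z) - (v z *\<^sub>R gradx \<phi> z + \<phi> z *\<^sub>R k z)))"
  by (intro lebesgue_cong) (auto simp: algebra_simps)
 also have "\<dots> = c *\<^sub>R ((LBINT z. w z *\<^sub>R gradx \<phi> z + \<phi> z *\<^sub>R g z) - (LBINT z. v z *\<^sub>R gradx \<phi> z + \<phi> z *\<^sub>R k z))"
  using I[OF L(1,2)] I[OF L(3,4)] by simp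
 also have "\<dots> = 0" using 1 2 \<phi> by (simp add: global_grad_def)
 finally show "(LBINT z. (c *\<^sub>R (w z - v z)) *\<^sub>R gradx \<phi> z + \<phi> z *\<^sub>R (c *\<^sub>R (g z - k z))) = 0" .
qed

lemma global_grad_dq: "global_grad w g ==> global_grad (dq h w) (dq h g)"
 unfolding dq_def[abs_def] by (intro global_grad_diff global_grad_translate)

lemma slab_div_diff:
 assumes 1: "slab_div \<Omega> y q" and 2: "slab_div \<Omega> x r"
 shows "slab_div \<Omega> (\<lambda>z. y z - x z) (\<lambda>z. q z - r z)"
 unfolding slab_div_def
proof (intro conjI ballI allI)
 have L: "y \<in> L2 lborel" "q \<in> L2 lborel" "x \<in> L2 lborel" "r \<in> L2 lborel" using 1 2 by (auto simp: slab_div_def)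
 show "(\<lambda>z. y z - x z) \<in> L2 lborel" "(\<lambda>z. q z - r z) \<in> L2 lborel" using L by (auto intro: L2_diff)
 fix \<phi> :: "'a \<times> real => real" and \<tau> assume \<phi>: "\<phi> \<in> test_fun (\<Omega> \<times> UNIV)"
 have I: "integrable lborel (\<lambda>z. indicator {..<\<tau>} (snd z) * (a z \<bullet> gradx \<phi> z + \<phi> z * b z))"
  if "a \<in> L2 lborel" "b \<in> L2 lborel" for a :: "'a \<times> real => 'a" and b
 proof -
  have "integrable lborel (\<lambda>z. before \<tau> a z \<bullet> gradx \<phi> z + \<phi> z * before \<tau> b z)"
   using that by (intro integrable_plus L2_inner_integrable L2_mult_integrable before_L2 gradx_L2[OF \<phi>] test_fun_L2(1)[OF \<phi>])
  then show ?thesis by (simp add: algebra_simps)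
 qed
 have "(LBINT z. indicator {..<\<tau>} (snd z) * ((y z - x z) \<bullet> gradx \<phi> z + \<phi> z * (q z - r z)))
  = (LBINT z. indicator {..<\<tau>} (snd z) * (y z \<bullet> gradx \<phi> z + \<phi> z * q z) - indicator {..<\<tau>} (snd z) * (x z \<bullet> gradx \<phi> z + \<phi> z * r z))"
  by (simp add: algebra_simps)
 also have "\<dots> = 0" using I[OF L(1,2)] I[OF L(3,4)] 1 2 \<phi> by (simp add: slab_div_def)
 finally show "(LBINT z. indicator {..<\<tau>} (snd z) * ((y z - x z) \<bullet> gradx \<phi> z + \<phi> z * (q z - r z))) = 0" .
qed

text \<open>A time shift of a test function is again one, because its support is unrestricted in
  time; the end of the slab moves along, and here the identity for all \<tau> is used. Fubini then
  averages over the shifts.\<close>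

lemma slab_div_avg:
 fixes y :: "'a::euclidean_space \<times> real => 'a"
 assumes Y: "slab_div \<Omega> y q" and h: "0 < h"
 shows "slab_div \<Omega> (avg (steklov h) y) (avg (steklov h) q)"
 unfolding slab_div_def
proof (intro conjI ballI allI)
 interpret averaging "steklov h :: ('a \<times> real) measure" by (rule steklov_averaging[OF h])
 have L: "y \<in> L2 lborel" "q \<in> L2 lborel" using Y by (auto simp: slab_div_def)
 show AL: "avg (steklov h) y \<in> L2 lborel" "avg (steklov h) q \<in> L2 lborel" by (rule avg_L2[OF L(1)], rule avg_L2[OF L(2)])
 fix \<phi> :: "'a \<times> real => real" and \<tau> assume \<phi>: "\<phi> \<in> test_fun (\<Omega> \<times> UNIV)"
 note C = test_fun_C1[OF \<phi>]
 note BL = before_L2[OF gradx_L2[OF \<phi>], of \<tau>] before_L2[OF test_fun_L2(1)[OF \<phi>], of \<tau>]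
 have m[measurable]: "y \<in> Borel" "q \<in> Borel" "\<phi> \<in> Borel" "gradx \<phi> \<in> Borel"
  using L2_borel[OF L(1)] L2_borel[OF L(2)] C1_measurable[OF C] gradx_measurable[OF C] by auto
 have inner: "(LBINT z. y (z - \<xi>) \<bullet> before \<tau> (gradx \<phi>) z) + (LBINT z. q (z - \<xi>) \<bullet> before \<tau> \<phi> z) = 0"
  if \<xi>: "fst \<xi> = 0" for \<xi> :: "'a \<times> real"
 proof -
  have t: "(\<lambda>z. \<phi> (z - (- \<xi>))) \<in> test_fun (\<Omega> \<times> UNIV)"
   by (rule test_fun_translate_time[OF \<phi>]) (use \<xi> in \<open>auto simp: mem_Times_iff\<close>)
  have i': "indicator {..<\<tau> - snd \<xi>} (s - snd \<xi>) = (indicator {..<\<tau>} s :: real)" for s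
   by (simp add: indicator_def)
  have [measurable]: "(\<lambda>z::'a \<times> real. indicator {..<\<tau> - snd \<xi>} (snd z) :: real) \<in> Borel"
   by (rule time_measurable) simp
  have "(LBINT z. y (z - \<xi>) \<bullet> before \<tau> (gradx \<phi>) z) + (LBINT z. q (z - \<xi>) \<bullet> before \<tau> \<phi> z)
   = (LBINT z. y (z - \<xi>) \<bullet> before \<tau> (gradx \<phi>) z + q (z - \<xi>) \<bullet> before \<tau> \<phi> z)"
   by (intro lebesgue_add[symmetric] L2_inner_integrable L2_translate L BL)
  also have "\<dots> = (LBINT z. indicator {..<\<tau> - snd \<xi>} (snd z) * (y z \<bullet> gradx \<phi> (z - (- \<xi>)) + \<phi> (z - (- \<xi>)) * q z))"
   using lborel_integral_translate[of "\<lambda>z. indicator {..<\<tau> - snd \<xi>} (snd z) * (y z \<bullet> gradx \<phi> (z - (- \<xi>)) + \<phi> (z - (- \<xi>)) * q z)" \<xi>]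
   by (simp add: algebra_simps i')
  also have "\<dots> = 0"
   using Y t unfolding slab_div_def by (auto simp: gradx_translate[OF C, of "- \<xi>", symmetric] simp del: diff_minus_eq_add)
  finally show ?thesis .
 qed
 have "(LBINT z. indicator {..<\<tau>} (snd z) * (avg (steklov h) y z \<bullet> gradx \<phi> z + \<phi> z * avg (steklov h) q z))
  = (LBINT z. avg (steklov h) y z \<bullet> before \<tau> (gradx \<phi>) z + avg (steklov h) q z \<bullet> before \<tau> \<phi> z)"
  by (simp add: algebra_simps)
 also have "\<dots> = (LBINT z. avg (steklov h) y z \<bullet> before \<tau> (gradx \<phi>) z) + (LBINT z. avg (steklov h) q z \<bullet> before \<tau> \<phi> z)"
  by (intro lebesgue_add L2_inner_integrable AL BL)
 also have "\<dots> = (\<integral>\<xi>. (LBINT z. y (z - \<xi>) \<bullet> before \<tau> (gradx \<phi>) z) \<partial>steklov h) + (\<integral>\<xi>. (LBINT z. q (z - \<xi>) \<bullet> before \<tau> \<phi> z) \<partial>steklov h)"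
  by (simp only: avg_inner[OF L(1) BL(1)] avg_inner[OF L(2) BL(2)])
 also have "(\<integral>\<xi>. (LBINT z. y (z - \<xi>) \<bullet> before \<tau> (gradx \<phi>) z) \<partial>steklov h) = (\<integral>\<xi>. - (LBINT z. q (z - \<xi>) \<bullet> before \<tau> \<phi> z) \<partial>steklov h)"
 proof (rule integral_cong_AE)
  have bm[measurable]: "before \<tau> (gradx \<phi>) \<in> Borel" "before \<tau> \<phi> \<in> Borel"
   using L2_borel[OF BL(1)] L2_borel[OF BL(2)] by auto
  have "(\<lambda>\<xi>. \<integral>z. y (z - \<xi>) \<bullet> (before \<tau> (gradx \<phi>)) z \<partial>lborel) \<in> Borel" by measurable
  then show "(\<lambda>\<xi>. \<integral>z. y (z - \<xi>) \<bullet> before \<tau> (gradx \<phi>) z \<partial>lborel) \<in> borel_measurable (steklov h)" by simp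
  have "(\<lambda>\<xi>. - (LBINT z. q (z - \<xi>) \<bullet> (before \<tau> \<phi>) z)) \<in> Borel" by measurable
  then show "(\<lambda>\<xi>. - (LBINT z. q (z - \<xi>) \<bullet> before \<tau> \<phi> z)) \<in> borel_measurable (steklov h)" by simp
  show "AE \<xi> in steklov h. (LBINT z. y (z - \<xi>) \<bullet> before \<tau> (gradx \<phi>) z) = - (LBINT z. q (z - \<xi>) \<bullet> before \<tau> \<phi> z)"
   using steklov_AE[OF h] by eventually_elim (use inner in \<open>simp only: eq_neg_iff_add_eq_0\<close>)
 qed
 finally show "(LBINT z. indicator {..<\<tau>} (snd z) * (avg (steklov h) y z \<bullet> gradx \<phi> z + \<phi> z * avg (steklov h) q z)) = 0"
  by simp
qed

subsection \<open>Energy identities\<close>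

lemma L2_lim_cong_AE:
 assumes "L2_lim M F f" "\<And>k. G k \<in> L2 M" "\<And>k. AE z in M. F k z = G k z"
 shows "L2_lim M G f"
proof -
 have "L2_norm M (\<lambda>z. G k z - f z) = L2_norm M (\<lambda>z. F k z - f z)" for k
 proof (rule L2_norm_cong_AE)
  show "AE z in M. G k z - f z = F k z - f z" using assms(3)[of k] by eventually_elim simp
 qed (use L2_measurable[OF L2_limD(1)[OF assms(1)]] L2_measurable[OF L2_limD(2)[OF assms(1)]] L2_measurable[OF assms(2)] in auto)
 then show ?thesis using assms(1,2) by (simp add: L2_lim_def)
qed

text \<open>The square of the primitive is twice the integral of its product with \<open>P\<close>.
  As \<open>tint P\<close> equals \<open>Y\<close>, Green's formula on the slab turns this into
  minus twice the integral of D Q. In the applications \<open>P\<close> is a difference quotient of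
  the gradient and \<open>D\<close> that of the function.\<close>

lemma energy_identity:
 fixes P :: "'a::euclidean_space \<times> real => 'a"
 assumes \<Omega>: "bounded_lipschitz_domain \<Omega>" and DP: "global_grad D P" and D: "\<And>z. fst z \<notin> \<Omega> ==> D z = 0"
  and P: "timed S P" and Y: "slab_div \<Omega> Y Q"
  and pL: "p \<in> L2 lborel" and p: "AE z in lborel. snd z < T --> D z = p z" and t: "AE z in lborel. tint P z = Y z"
  and \<tau>: "0 \<le> \<tau>" "\<tau> \<le> T"
 shows "(slice_norm (tint P) \<tau>)\<^sup>2 = - 2 * (LBINT z. before \<tau> p z * Q z)"
proof -
 have L: "D \<in> L2 lborel" "P \<in> L2 lborel" "Y \<in> L2 lborel" "Q \<in> L2 lborel"
  using DP Y by (auto simp: global_grad_def slab_div_def)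
 have "(slice_norm (tint P) \<tau>)\<^sup>2 = (LBINT x. tint P (x, \<tau>) \<bullet> tint P (x, \<tau>))"
  by (simp add: L2_norm_power2 power2_norm_eq_inner)
 also have "\<dots> = (LBINT z. indicator {..<\<tau>} (snd z) * (P z \<bullet> tint P z + P z \<bullet> tint P z))"
  by (rule product_formula[OF P P \<tau>(1)])
 also have "\<dots> = (LBINT z. 2 * (indicator {..<\<tau>} (snd z) * (P z \<bullet> Y z + D z * Q z)) - 2 * (before \<tau> D z * Q z))"
 proof (rule integral_cong_AE)
  show "AE z in lborel. indicator {..<\<tau>} (snd z) * (P z \<bullet> tint P z + P z \<bullet> tint P z)
   = 2 * (indicator {..<\<tau>} (snd z) * (P z \<bullet> Y z + D z * Q z)) - 2 * (before \<tau> D z * Q z)"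
   using t by eventually_elim (simp add: algebra_simps)
  have [measurable]: "D \<in> Borel" "P \<in> Borel" "Y \<in> Borel" "Q \<in> Borel"
   "tint P \<in> Borel" "(\<lambda>z::'a \<times> real. indicator {..<\<tau>} (snd z) :: real) \<in> Borel"
   using L L2_borel tint_measurable[OF L2_borel[OF L(2)]] by (auto intro: time_measurable)
  show "(\<lambda>z. indicator {..<\<tau>} (snd z) * (P z \<bullet> tint P z + P z \<bullet> tint P z)) \<in> borel_measurable lborel"
   "(\<lambda>z. 2 * (indicator {..<\<tau>} (snd z) * (P z \<bullet> Y z + D z * Q z)) - 2 * (before \<tau> D z * Q z)) \<in> borel_measurable lborel"
   by simp_all
 qed
 also have "\<dots> = 2 * (LBINT z. indicator {..<\<tau>} (snd z) * (P z \<bullet> Y z + D z * Q z)) - 2 * (LBINT z. before \<tau> D z * Q z)"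
 proof -
  have "integrable lborel (\<lambda>z. before \<tau> P z \<bullet> Y z + before \<tau> D z * Q z)"
   by (intro integrable_plus L2_inner_integrable L2_mult_integrable before_L2 L)
  then have "integrable lborel (\<lambda>z. indicator {..<\<tau>} (snd z) * (P z \<bullet> Y z + D z * Q z))" by (simp add: algebra_simps)
  moreover have "integrable lborel (\<lambda>z. before \<tau> D z * Q z)" by (intro L2_mult_integrable before_L2 L)
  ultimately show ?thesis by simp
 qed
 also have "(LBINT z. indicator {..<\<tau>} (snd z) * (P z \<bullet> Y z + D z * Q z)) = 0"
  by (rule green_slab[OF \<Omega> DP Y D])
 also have "(LBINT z. before \<tau> D z * Q z) = (LBINT z. before \<tau> p z * Q z)"
 proof -
  have eq: "AE z in lborel. before \<tau> D z * Q z = before \<tau> p z * Q z"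
   using p by eventually_elim (use \<tau>(2) in \<open>auto simp: indicator_def\<close>)
  have m: "(\<lambda>z. before \<tau> D z * Q z) \<in> borel_measurable lborel"
   using L2_measurable[OF before_L2[OF L(1)]] L2_measurable[OF L(4)] by measurable
  have "(\<lambda>z. before \<tau> p z * Q z) \<in> borel_measurable lborel"
   using L2_measurable[OF before_L2[OF pL]] L2_measurable[OF L(4)] by measurable
  then show ?thesis using eq m by (intro integral_cong_AE)
 qed
 finally show ?thesis by simp
qed

lemma L2_lim_Cauchy:
 assumes "L2_lim M F f" "0 < \<epsilon>"
 shows "\<exists>N. \<forall>m\<ge>N. \<forall>n\<ge>N. L2_norm M (\<lambda>z. F m z - F n z) < \<epsilon>"
proof -
 obtain N where N: "\<And>n. N \<le> n ==> norm (L2_norm M (\<lambda>z. F n z - f z) - 0) < \<epsilon> / 2"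
  using LIMSEQ_D[OF L2_limD(3)[OF assms(1)], of "\<epsilon> / 2"] assms(2) by auto
 have "L2_norm M (\<lambda>z. F m z - F n z) < \<epsilon>" if mn: "N \<le> m" "N \<le> n" for m n
 proof -
  have "L2_norm M (\<lambda>z. F m z - F n z) \<le> L2_norm M (\<lambda>z. F m z - f z) + L2_norm M (\<lambda>z. f z - F n z)"
   using assms(1) by (intro L2_norm_triangle_diff) (auto simp: L2_lim_def)
  moreover have "L2_norm M (\<lambda>z. f z - F n z) = L2_norm M (\<lambda>z. F n z - f z)" by (rule L2_norm_minus_commute)
  ultimately show ?thesis using N[OF mn(1)] N[OF mn(2)] by simp
 qed
 then show ?thesis by blast
qed

lemma cylinder_L2:
 fixes c :: "'a::euclidean_space => 'b::euclidean_space"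
 assumes c: "c \<in> L2 lborel" and ab: "a \<le> b"
 shows "(\<lambda>z. indicator {a<..<b::real} (snd z) *\<^sub>R c (fst z)) \<in> L2 lborel"
  "nrm (\<lambda>z. indicator {a<..<b::real} (snd z) *\<^sub>R c (fst z)) \<le> sqrt (b - a) * nrm c"
proof -
 let ?F = "\<lambda>z. indicator {a<..<b::real} (snd z) *\<^sub>R c (fst z)"
 have [measurable]: "c \<in> Borel" by (rule L2_borel[OF c])
 have [measurable]: "(fst :: 'a \<times> real => 'a) \<in> Borel" "(snd :: 'a \<times> real => real) \<in> Borel"
  by (intro borel_measurable_continuous_onI continuous_intros)+
 have m: "?F \<in> borel_measurable lborel" by measurable
 have "(\<integral>\<^sup>+z. ennreal ((norm (?F z))\<^sup>2) \<partial>lborel)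
  = (\<integral>\<^sup>+x. (\<integral>\<^sup>+t. ennreal ((norm (c x))\<^sup>2) * indicator {a<..<b::real} t \<partial>lborel) \<partial>lborel)"
  by (subst nn_integral_slices(1)) (use m in \<open>auto intro!: nn_integral_cong simp: indicator_def\<close>)
 also have "\<dots> = (\<integral>\<^sup>+x. ennreal ((norm (c x))\<^sup>2) * emeasure lborel {a<..<b} \<partial>lborel)"
  by (intro nn_integral_cong nn_integral_cmult_indicator) auto
 also have "\<dots> = ennreal ((nrm c)\<^sup>2) * emeasure lborel {a<..<b}"
  by (subst nn_integral_multc) (auto simp: L2_nn_integral[OF c])
 also have "\<dots> = ennreal ((sqrt (b - a) * nrm c)\<^sup>2)"
  using ab by (simp add: power_mult_distrib ennreal_mult' mult.commute)
 finally have le: "(\<integral>\<^sup>+z. ennreal ((norm (?F z))\<^sup>2) \<partial>lborel) \<le> ennreal ((sqrt (b - a) * nrm c)\<^sup>2)" by simp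
 have "0 \<le> sqrt (b - a) * nrm c" using ab by (simp add: L2_norm_nonneg)
 from L2_norm_le_nnI[OF m le this]
 show "?F \<in> L2 lborel" "nrm ?F \<le> sqrt (b - a) * nrm c" .
qed

lemma before_norm:
 assumes "F \<in> L2 lborel" shows "nrm (before \<tau> F) \<le> nrm F"
 by (rule L2_mono[OF assms]) (auto simp: indicator_def)

lemma timed_before: "timed T F ==> before T F = F"
 by (auto simp: timed_def fun_eq_iff indicator_def)

text \<open>\<open>p\<close>, \<open>g\<close> and \<open>q\<close> stand for \<open>\<partial>\<^sub>t e\<close>, \<open>\<nabla>\<^sub>x e\<close> and \<open>\<Delta>\<^sub>x e\<close>.\<close>

locale evolution =
 fixes \<Omega> :: "'a::euclidean_space set" and T :: real and e p q :: "'a \<times> real => real" and g :: "'a \<times> real => 'a"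
 assumes \<Omega>: "bounded_lipschitz_domain \<Omega>" and T: "0 < T"
  and p: "timed T p" and g: "timed T g" and q: "timed T q"
  and p_0: "\<And>z. fst z \<notin> \<Omega> ==> p z = 0" and g_0: "\<And>z. fst z \<notin> \<Omega> ==> g z = 0"
  and e: "e = before T (tint p)" and eg: "global_grad e g" and gq: "slab_div \<Omega> g q"
begin

text \<open>Steps of length at most T keep all difference quotients supported before 2 T.\<close>

definition h :: "nat => real" where "h n = T / real (Suc n)"
definition D :: "nat => 'a \<times> real => real" where "D n = dq (h n) e"
definition P :: "nat => 'a \<times> real => 'a" where "P n = dq (h n) g"
definition A :: "nat => ('a \<times> real => 'c::euclidean_space) => 'a \<times> real => 'c" where "A n = avg (steklov (h n))"

lemma h: "0 < h n" "h n \<le> T"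
 using T by (auto simp: h_def field_simps)

lemma L: "p \<in> L2 lborel" "g \<in> L2 lborel" "q \<in> L2 lborel" "e \<in> L2 lborel"
 using p g q timed_L2 before_tint_L2(1)[OF p, of T] T by (auto simp: e)

lemma e_0: "fst z \<notin> \<Omega> ==> e z = 0"
 by (cases z) (simp add: e tint_def p_0)

lemma D_0: "fst z \<notin> \<Omega> ==> D n z = 0"
 by (cases z) (simp add: D_def dq_def e_0)

lemma P_0: "fst z \<notin> \<Omega> ==> P n z = 0"
 by (cases z) (simp add: P_def dq_def g_0)

lemma P_timed: "timed (2 * T) (P n)"
 unfolding P_def by (rule timed_mono[OF dq_timed[OF g]]) (use h[of n] in auto)

lemma DP: "global_grad (D n) (P n)"
 unfolding D_def P_def by (rule global_grad_dq[OF eg])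

lemma A_L2: "F \<in> L2 lborel ==> A n F \<in> L2 lborel"
 unfolding A_def by (rule averaging.avg_L2[OF steklov_averaging[OF h(1)]])

lemma A_lim: "F \<in> L2 lborel ==> L2_lim lborel (\<lambda>n. A n F) F"
 unfolding A_def
proof (rule avg_lim[where r = "\<lambda>n. 2 * h n"])
 show "(\<lambda>n. 2 * h n) \<longlonglongrightarrow> 0"
  unfolding h_def using tendsto_mult[OF tendsto_const[of "2 * T"] LIMSEQ_inverse_real_of_nat] by (simp add: field_simps)
qed (auto intro: steklov_averaging steklov_AE_norm h)

lemma before_A_lim:
 assumes F: "timed T F" shows "L2_lim lborel (\<lambda>n. before T (A n F)) F"
 using L2_lim_bounded_mult[OF A_lim[OF timed_L2[OF F]], of "\<lambda>z. indicator {..<T} (snd z)" 1] timed_before[OF F]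
  time_measurable[of "indicator {..<T} :: real => real"] by auto

lemma A_gq: "slab_div \<Omega> (A n g) (A n q)"
 unfolding A_def by (rule slab_div_avg[OF gq h(1)])

lemma D_A: "AE z in lborel. snd z < T --> D n z = A n p z"
 unfolding D_def A_def by (subst e) (rule dq_before_tint[OF p h(1)])

lemma P_A: "AE z in lborel. tint (P n) z = A n g z"
 using AE_fst[OF tint_dq[OF g h(1)[of n]]] unfolding P_def A_def by eventually_elim (metis prod.collapse)

lemma energy: "0 \<le> \<tau> ==> \<tau> \<le> T ==> (slice_norm (tint (P n)) \<tau>)\<^sup>2 = - 2 * (LBINT z. before \<tau> (A n p) z * A n q z)"
 by (rule energy_identity[OF \<Omega> DP D_0 P_timed A_gq A_L2[OF L(1)] D_A P_A])

text \<open>The difference of two approximations satisfies the same relations, so the energy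
  identity applies to it. The resulting bound does not involve \<tau>, which is the source of
  uniform convergence in time.\<close>

lemma energy_diff:
 assumes \<tau>: "0 \<le> \<tau>" "\<tau> \<le> T"
 shows "(nrm (\<lambda>x. tint (P m) (x, \<tau>) - tint (P n) (x, \<tau>)))\<^sup>2
  \<le> 2 * (nrm (\<lambda>z. A m p z - A n p z) * nrm (\<lambda>z. A m q z - A n q z))"
proof -
 let ?P = "\<lambda>z. P m z - P n z"
 note td = tint_diff[OF P_timed[of m] P_timed[of n]]
 have "nrm (\<lambda>x. tint (P m) (x, \<tau>) - tint (P n) (x, \<tau>)) = slice_norm (tint ?P) \<tau>"
 proof (rule L2_norm_cong_AE)
  show "AE x in lborel. tint (P m) (x, \<tau>) - tint (P n) (x, \<tau>) = tint ?P (x, \<tau>)"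
   using td by eventually_elim simp
 qed (use L2_measurable[OF L2_diff[OF tint_slice(1)[OF P_timed] tint_slice(1)[OF P_timed]]]
   L2_measurable[OF tint_slice(1)[OF timed_diff[OF P_timed P_timed]]] in auto)
 moreover have "(slice_norm (tint ?P) \<tau>)\<^sup>2 = - 2 * (LBINT z. before \<tau> (\<lambda>z. A m p z - A n p z) z * (A m q z - A n q z))"
 proof (rule energy_identity[OF \<Omega> _ _ timed_diff[OF P_timed P_timed] slab_div_diff[OF A_gq A_gq] L2_diff[OF A_L2[OF L(1)] A_L2[OF L(1)]] _ _ \<tau>])
  show "global_grad (\<lambda>z. D m z - D n z) ?P" using global_grad_diff[OF DP DP, of 1 m n] by simp
  show "D m z - D n z = 0" if "fst z \<notin> \<Omega>" for z using that by (simp add: D_0)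
  show "AE z in lborel. snd z < T --> D m z - D n z = A m p z - A n p z"
   using D_A[of m] D_A[of n] by eventually_elim simp
  show "AE z in lborel. tint ?P z = A m g z - A n g z"
   using AE_fst[OF td] P_A[of m] P_A[of n] by eventually_elim (metis prod.collapse)
 qed
 moreover have "\<bar>\<integral>z. before \<tau> (\<lambda>z. A m p z - A n p z) z \<bullet> (A m q z - A n q z) \<partial>lborel\<bar>
  \<le> nrm (\<lambda>z. A m p z - A n p z) * nrm (\<lambda>z. A m q z - A n q z)"
  by (rule order.trans[OF L2_Cauchy_Schwarz mult_right_mono[OF before_norm L2_norm_nonneg]])
   (intro before_L2 L2_diff A_L2 L)+
 ultimately show ?thesis by simp
qed

lemma tint_P_lim: "L2_lim lborel (\<lambda>n. before T (tint (P n))) g"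
proof (rule L2_lim_cong_AE)
 show "L2_lim lborel (\<lambda>n. before T (A n g)) g" by (rule before_A_lim[OF g])
 show "before T (tint (P k)) \<in> L2 lborel" for k using before_tint_L2(1)[OF P_timed, of T] T by simp
 show "AE z in lborel. before T (A k g) z = before T (tint (P k)) z" for k using P_A[of k] by eventually_elim simp
qed

text \<open>The averages of p and q converge in L2, so \<open>energy_diff\<close> verifies the
  hypothesis \<open>cauchy\<close> of \<open>final_limit_uniform\<close>. The energy identity at T
  survives the limit and fixes the norm of the final gradient.\<close>

lemma final_gradient:
 obtains \<gamma> where "\<gamma> \<in> L2 lborel" "\<And>x. x \<notin> \<Omega> ==> \<gamma> x = 0" "L2_lim lborel (\<lambda>n x. tint (P n) (x, T)) \<gamma>"
  "final_limit T g \<gamma>" "(nrm \<gamma>)\<^sup>2 = - 2 * (LBINT z. p z * q z)"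
proof -
 have "\<exists>\<gamma>. \<gamma> \<in> L2 lborel \<and> (\<forall>x. x \<notin> \<Omega> --> \<gamma> x = 0) \<and> L2_lim lborel (\<lambda>n x. tint (P n) (x, T)) \<gamma> \<and> final_limit T g \<gamma>"
 proof (rule final_limit_uniform[OF T L(2)])
  show "\<Omega> \<in> sets borel" using \<Omega> by (auto simp: bounded_lipschitz_domain_def)
  show "(\<lambda>x. tint (P n) (x, t)) \<in> L2 lborel" for n t by (rule tint_slice(1)[OF P_timed])
  show "tint (P n) (x, T) = 0" if "x \<notin> \<Omega>" for n x using that by (simp add: tint_def P_0)
  show "\<exists>\<tau>\<in>{0..<T}. \<forall>t. \<tau> < t \<and> t < T --> nrm (\<lambda>x. tint (P n) (x, t) - tint (P n) (x, T)) < \<epsilon>" if "0 < \<epsilon>" for n \<epsilon>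
   by (rule tint_cont[OF P_timed T that])
  show "L2_lim lborel (\<lambda>n. before T (tint (P n))) (before T g)" using tint_P_lim by (simp add: timed_before[OF g])
  show "\<exists>N. \<forall>m\<ge>N. \<forall>n\<ge>N. \<forall>t\<in>{0..T}. nrm (\<lambda>x. tint (P m) (x, t) - tint (P n) (x, t)) < \<epsilon>" if \<epsilon>: "0 < \<epsilon>" for \<epsilon>
  proof -
   have \<epsilon>2: "0 < \<epsilon> / 2" using \<epsilon> by simp
   obtain N1 where N1: "\<And>m n. N1 \<le> m ==> N1 \<le> n ==> nrm (\<lambda>z. A m p z - A n p z) < \<epsilon> / 2"
    using L2_lim_Cauchy[OF A_lim[OF L(1)] \<epsilon>2] by blast
   obtain N2 where N2: "\<And>m n. N2 \<le> m ==> N2 \<le> n ==> nrm (\<lambda>z. A m q z - A n q z) < \<epsilon> / 2"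
    using L2_lim_Cauchy[OF A_lim[OF L(3)] \<epsilon>2] by blast
   have "nrm (\<lambda>x. tint (P m) (x, t) - tint (P n) (x, t)) < \<epsilon>"
    if mn: "max N1 N2 \<le> m" "max N1 N2 \<le> n" and t: "t \<in> {0..T}" for m n t
   proof -
    have "(nrm (\<lambda>x. tint (P m) (x, t) - tint (P n) (x, t)))\<^sup>2
     \<le> 2 * (nrm (\<lambda>z. A m p z - A n p z) * nrm (\<lambda>z. A m q z - A n q z))"
     using t by (intro energy_diff) auto
    also have "\<dots> \<le> 2 * (\<epsilon> / 2 * (\<epsilon> / 2))"
     using N1[of m n] N2[of m n] mn \<epsilon> by (intro mult_left_mono mult_mono) (auto simp: L2_norm_nonneg)
    also have "\<dots> < \<epsilon>\<^sup>2" using \<epsilon> by (simp add: power2_eq_square)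
    finally show ?thesis using \<epsilon> by (intro power2_less_imp_less[of _ \<epsilon>]) auto
   qed
   then show ?thesis by blast
  qed
 qed
 then obtain \<gamma> where \<gamma>: "\<gamma> \<in> L2 lborel" "\<And>x. x \<notin> \<Omega> ==> \<gamma> x = 0" "L2_lim lborel (\<lambda>n x. tint (P n) (x, T)) \<gamma>" "final_limit T g \<gamma>"
  by blast
 have "(\<lambda>n. (slice_norm (tint (P n)) T)\<^sup>2) \<longlonglongrightarrow> (nrm \<gamma>)\<^sup>2"
  by (intro tendsto_power L2_lim_norm \<gamma>(3))
 moreover have "(\<lambda>n. (slice_norm (tint (P n)) T)\<^sup>2) \<longlonglongrightarrow> - 2 * (LBINT z. p z \<bullet> q z)"
 proof -
  from tendsto_mult_left[OF L2_lim_inner[OF before_A_lim[OF p] A_lim[OF L(3)]], of "- 2"]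
  show ?thesis using energy[of T] T by simp
 qed
 ultimately have "(nrm \<gamma>)\<^sup>2 = - 2 * (LBINT z. p z \<bullet> q z)" by (rule LIMSEQ_unique)
 then show ?thesis using \<gamma> that by simp
qed

lemma final_value:
 shows "final_limit T e (\<lambda>x. tint p (x, T))" "(slice_norm (tint p) T)\<^sup>2 = 2 * (LBINT z. p z * e z)"
proof -
 show "final_limit T e (\<lambda>x. tint p (x, T))"
  using final_limit_tint[OF T p L2_zero L(4)] by (simp add: e)
 have "(slice_norm (tint p) T)\<^sup>2 = (LBINT x. tint p (x, T) \<bullet> tint p (x, T))"
  unfolding L2_norm_power2 by (simp add: power2_eq_square)
 also have "\<dots> = (LBINT z. indicator {..<T} (snd z) * (p z \<bullet> tint p z + p z \<bullet> tint p z))"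
  using T by (intro product_formula[OF p p]) auto
 also have "\<dots> = (LBINT z. 2 * (p z * e z))"
  by (rule lebesgue_cong) (auto simp: e)
 finally show "(slice_norm (tint p) T)\<^sup>2 = 2 * (LBINT z. p z * e z)" by simp
qed

lemma green_e:
 assumes "slab_div \<Omega> r s"
 shows "(LBINT z. before T r z \<bullet> g z) = - (LBINT z. before T s z * e z)"
proof -
 have rs: "r \<in> L2 lborel" "s \<in> L2 lborel" using assms by (auto simp: slab_div_def)
 have "(LBINT z. indicator {..<T} (snd z) * (g z \<bullet> r z + e z * s z))
  = (LBINT z. before T r z \<bullet> g z + before T s z * e z)"
  by (rule lebesgue_cong) (auto simp: algebra_simps inner_commute)
 also have "\<dots> = (LBINT z. before T r z \<bullet> g z) + (LBINT z. before T s z * e z)"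
  by (intro lebesgue_add L2_inner_integrable L2_mult_integrable before_L2 rs L)
 finally show ?thesis using green_slab[OF \<Omega> eg assms e_0, of T] by simp
qed

text \<open>Integration by parts in time, carried out with \<open>P n\<close> in place of the time
  derivative of g. Writing r as c + tint R allows a nonzero initial value c: the part from c gives
  its boundary term at T directly, the part from R through the product formula.\<close>

lemma green_time:
 assumes \<gamma>: "L2_lim lborel (\<lambda>n x. tint (P n) (x, T)) \<gamma>" and rs: "slab_div \<Omega> r s"
  and c: "c \<in> L2 lborel" and R: "timed T R"
  and r: "AE z in lborel. 0 < snd z \<and> snd z < T --> r z = c (fst z) + tint R z"
 shows "(LBINT z. p z * s z) = (LBINT z. R z \<bullet> g z) - (LBINT x. (c x + tint R (x, T)) \<bullet> \<gamma> x)"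
proof -
 have rsL: "r \<in> L2 lborel" "s \<in> L2 lborel" using rs by (auto simp: slab_div_def)
 have DPL: "D n \<in> L2 lborel" "P n \<in> L2 lborel" for n using DP[of n] by (auto simp: global_grad_def)
 have RL: "R \<in> L2 lborel" by (rule timed_L2[OF R])
 define C where "C = (\<lambda>z. indicator {0<..<T} (snd z) *\<^sub>R c (fst z))"
 have CL: "C \<in> L2 lborel" unfolding C_def using T by (intro cylinder_L2(1)[OF c]) simp
 have tRL: "before T (tint R) \<in> L2 lborel" using before_tint_L2(1)[OF R, of T] T by simp
 have tPL: "before T (tint (P n)) \<in> L2 lborel" for n using before_tint_L2(1)[OF P_timed, of T] T by simp
 have id: "(LBINT z. before T (A n p) z * s z)
  = (LBINT z. R z \<bullet> before T (tint (P n)) z) - (LBINT x. (c x + tint R (x, T)) \<bullet> tint (P n) (x, T))" for n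
 proof -
  have "0 = (LBINT z. indicator {..<T} (snd z) * (P n z \<bullet> r z + D n z * s z))"
   using green_slab[OF \<Omega> DP rs D_0] by simp
  also have "\<dots> = (LBINT z. (before T (P n) z \<bullet> C z + P n z \<bullet> before T (tint R) z) + before T (A n p) z * s z)"
  proof (rule integral_cong_AE)
   show "AE z in lborel. indicator {..<T} (snd z) * (P n z \<bullet> r z + D n z * s z)
    = (before T (P n) z \<bullet> C z + P n z \<bullet> before T (tint R) z) + before T (A n p) z * s z"
    using r D_A[of n]
   proof eventually_elim
    case (elim z)
    \<comment> \<open>The representation of r is known only for times in (0, T); at earlier times
      \<open>P n\<close> removes it.\<close>
    have "P n z = 0" if "snd z \<le> 0" using P_timed[of n] that by (cases z) (auto simp: timed_def)
    with elim show ?case by (cases "0 < snd z") (auto simp: indicator_def C_def inner_add_right)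
   qed
   show "(\<lambda>z. indicator {..<T} (snd z) * (P n z \<bullet> r z + D n z * s z)) \<in> borel_measurable lborel"
    using L2_measurable[OF DPL(1)] L2_measurable[OF DPL(2)] L2_measurable[OF rsL(1)] L2_measurable[OF rsL(2)]
     time_measurable[of "indicator {..<T} :: real => real"] by auto
   show "(\<lambda>z. (before T (P n) z \<bullet> C z + P n z \<bullet> before T (tint R) z) + before T (A n p) z * s z) \<in> borel_measurable lborel"
    using L2_measurable[OF before_L2[OF DPL(2)]] L2_measurable[OF DPL(2)] L2_measurable[OF CL] L2_measurable[OF tRL]
     L2_measurable[OF before_L2[OF A_L2[OF L(1)]]] L2_measurable[OF rsL(2)] by measurable
  qed
  also have "\<dots> = (LBINT z. before T (P n) z \<bullet> C z) + (LBINT z. P n z \<bullet> before T (tint R) z) + (LBINT z. before T (A n p) z * s z)"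
   by (subst lebesgue_add lebesgue_add;
     (intro integrable_plus L2_inner_integrable L2_mult_integrable before_L2 DPL CL tRL A_L2 L rsL)?)+ simp
  \<comment> \<open>As c does not depend on time, the time integral falls on \<open>P n\<close>
    alone and produces its primitive at T.\<close>
  also have "(LBINT z. before T (P n) z \<bullet> C z) = (LBINT x. c x \<bullet> tint (P n) (x, T))"
  proof -
   have "(LBINT z. before T (P n) z \<bullet> C z) = (LBINT x. \<integral>t. before T (P n) (x, t) \<bullet> C (x, t) \<partial>lborel)"
    by (intro integral_slices(1) L2_inner_integrable before_L2 DPL CL)
   also have "\<dots> = (LBINT x. c x \<bullet> tint (P n) (x, T))"
   proof (rule integral_cong_AE)
    show "(\<lambda>x. \<integral>t. before T (P n) (x, t) \<bullet> C (x, t) \<partial>lborel) \<in> borel_measurable lborel"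
     by (intro borel_measurable_integrable integral_slices(3) L2_inner_integrable before_L2 DPL CL)
    show "(\<lambda>x. c x \<bullet> tint (P n) (x, T)) \<in> borel_measurable lborel"
     by (intro borel_measurable_integrable L2_inner_integrable c tint_slice(1)[OF P_timed])
    show "AE x in lborel. (LBINT t. before T (P n) (x, t) \<bullet> C (x, t)) = c x \<bullet> tint (P n) (x, T)"
     using timed_AE[OF P_timed[of n]]
    proof eventually_elim
     case (elim x)
     have "before T (P n) (x, t) \<bullet> C (x, t) = c x \<bullet> (indicator {..<T} t *\<^sub>R P n (x, t))" for t
      using P_timed[of n] by (auto simp: timed_def C_def indicator_def inner_commute)
     then have "(LBINT t. before T (P n) (x, t) \<bullet> C (x, t)) = (LBINT t. c x \<bullet> (indicator {..<T} t *\<^sub>R P n (x, t)))"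
      by (rule lebesgue_cong[OF refl])
     also have "\<dots> = c x \<bullet> tint (P n) (x, T)"
      unfolding tint_def fst_conv snd_conv by (rule integral_inner_right) (use integrable_seg[OF elim, of "{..<T}"] in simp)
     finally show ?case .
    qed
   qed
   finally show ?thesis .
  qed
  also have "(LBINT z. P n z \<bullet> before T (tint R) z) = (LBINT x. tint R (x, T) \<bullet> tint (P n) (x, T)) - (LBINT z. R z \<bullet> before T (tint (P n)) z)"
  proof -
   have "(LBINT x. tint R (x, T) \<bullet> tint (P n) (x, T)) = (LBINT z. indicator {..<T} (snd z) * (R z \<bullet> tint (P n) z + P n z \<bullet> tint R z))"
    using T by (intro product_formula[OF timed_mono[OF R] P_timed]) auto
   also have "\<dots> = (LBINT z. R z \<bullet> before T (tint (P n)) z + P n z \<bullet> before T (tint R) z)"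
    by (rule lebesgue_cong) (auto simp: algebra_simps)
   also have "\<dots> = (LBINT z. R z \<bullet> before T (tint (P n)) z) + (LBINT z. P n z \<bullet> before T (tint R) z)"
    by (intro lebesgue_add L2_inner_integrable RL tPL DPL tRL)
   finally show ?thesis by simp
  qed
  also have "(LBINT x. c x \<bullet> tint (P n) (x, T)) + ((LBINT x. tint R (x, T) \<bullet> tint (P n) (x, T)) - (LBINT z. R z \<bullet> before T (tint (P n)) z))
   = (LBINT x. (c x + tint R (x, T)) \<bullet> tint (P n) (x, T)) - (LBINT z. R z \<bullet> before T (tint (P n)) z)"
  proof -
   have "integrable lborel (\<lambda>x. c x \<bullet> tint (P n) (x, T))" "integrable lborel (\<lambda>x. tint R (x, T) \<bullet> tint (P n) (x, T))"
    by (intro L2_inner_integrable c tint_slice(1)[OF P_timed] tint_slice(1)[OF R])+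
   then show ?thesis by (simp add: inner_add_left)
  qed
  finally show ?thesis by simp
 qed
 from L2_lim_inner[OF before_A_lim[OF p] L2_lim_const[OF rsL(2)]]
 have "(\<lambda>n. \<integral>z. before T (A n p) z * s z \<partial>lborel) \<longlonglongrightarrow> (LBINT z. p z * s z)" by simp
 moreover have "(\<lambda>n. \<integral>z. before T (A n p) z * s z \<partial>lborel)
  \<longlonglongrightarrow> (LBINT z. R z \<bullet> g z) - (LBINT x. (c x + tint R (x, T)) \<bullet> \<gamma> x)"
  unfolding id by (intro tendsto_diff L2_lim_inner L2_lim_const RL tint_P_lim \<gamma> L2_add c tint_slice(1)[OF R])
 ultimately show ?thesis by (rule LIMSEQ_unique)
qed

end

subsection \<open>Weak time derivatives and initial values\<close>

lemma seg_deriv: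
 fixes W :: "'a::euclidean_space \<times> real => real"
 assumes W: "C1 W" and ab: "a \<le> b"
 shows "seg a b (\<lambda>z. \<D> W z (0, 1)) x = W (x, b) - W (x, a)"
proof -
 have d: "((\<lambda>s. W (x, s)) has_vector_derivative \<D> W (x, s) (0, 1)) (at s within A)" for s A
 proof -
  have 1: "((\<lambda>s. (x, s)) has_derivative (\<lambda>h. (0, h))) (at s within A)" by (auto intro!: derivative_eq_intros)
  have 2: "(\<lambda>h. \<D> W (x, s) (0, h)) = (\<lambda>h. h *\<^sub>R \<D> W (x, s) (0, 1))"
  proof
   fix h :: real
   have "(0, h) = h *\<^sub>R (0 :: 'a, 1 :: real)" by simp
   then show "\<D> W (x, s) (0, h) = h *\<^sub>R \<D> W (x, s) (0, 1)"
    by (simp only: linear_scale[OF bounded_linear.linear[OF C1_linear[OF W]]])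
  qed
  show ?thesis
   unfolding has_vector_derivative_def
   by (subst 2[symmetric]) (rule has_derivative_compose[OF 1 C1_has_derivative[OF W]])
 qed
 have c: "continuous_on A (\<lambda>s. \<D> W (x, s) (0, 1))" for A
  by (rule continuous_on_compose2[OF C1_continuous_deriv[OF W]]) (auto intro!: continuous_intros)
 have "seg a b (\<lambda>z. \<D> W z (0, 1)) x = (LBINT s. indicator {a..b} s *\<^sub>R \<D> W (x, s) (0, 1))"
  unfolding seg_def
 proof (rule integral_cong_AE)
  show "AE s in lborel. indicator {a..<b} s *\<^sub>R \<D> W (x, s) (0, 1) = indicator {a..b} s *\<^sub>R \<D> W (x, s) (0, 1)"
   using AE_lborel_singleton[of b] by eventually_elim (auto simp: indicator_def)
 qed (use borel_measurable_continuous_onI[OF c] in measurable)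
 also have "\<dots> = W (x, b) - W (x, a)"
  by (rule integral_FTC_atLeastAtMost[OF ab d c])
 finally show ?thesis .
qed

text \<open>Reflection at h/2 preserves the uniform distribution up to the endpoints of the
  interval.\<close>

lemma steklov_reflect:
 fixes f :: "'a::euclidean_space \<times> real => real"
 assumes h: "0 < h" and f: "f \<in> Borel"
 shows "(\<integral>\<xi>. f ((0, h) - \<xi>) \<partial>steklov h) = (\<integral>\<xi>. f \<xi> \<partial>steklov h)"
proof -
 have [measurable]: "(\<lambda>s. (0::'a, s)) \<in> Borel"
  by (intro borel_measurable_continuous_onI continuous_intros)
 have c: "(\<lambda>\<xi>. f ((0, h) - \<xi>)) \<in> Borel"
  by (rule measurable_compose[OF borel_measurable_continuous_onI f]) (intro continuous_intros)
 have s [measurable]: "(\<lambda>s. f (0, h - s)) \<in> Borel" "(\<lambda>s. f (0, s)) \<in> Borel"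
  by (rule measurable_compose[OF borel_measurable_continuous_onI f], intro continuous_intros)+
 have "(\<integral>\<xi>. f ((0, h) - \<xi>) \<partial>steklov h) = (LBINT s. (indicator {0<..h} s / h) * f (0, h - s))"
  unfolding steklov_def using c s h by (subst integral_distr) (auto simp: integral_density)
 also have "\<dots> = (LBINT s. (indicator {0<..h} (h - s) / h) * f (0, s))"
  using lborel_integral_reflect[of "\<lambda>s. (indicator {0<..h} (h - s) / h) * f (0, s)" h] by simp
 also have "\<dots> = (LBINT s. (indicator {0<..h} s / h) * f (0, s))"
 proof (rule integral_cong_AE)
  show "AE s in lborel. (indicator {0<..h} (h - s) / h) * f (0, s) = (indicator {0<..h} s / h) * f (0, s)"
   using AE_lborel_singleton[of 0] AE_lborel_singleton[of h] by eventually_elim (auto simp: indicator_def)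
 qed measurable
 also have "\<dots> = (\<integral>\<xi>. f \<xi> \<partial>steklov h)"
  unfolding steklov_def using f s h by (subst integral_distr) (auto simp: integral_density)
 finally show ?thesis .
qed

lemma test_fun_scaleR_L2: "f \<in> L2 M ==> (\<lambda>z. f z *\<^sub>R (i::'b::euclidean_space)) \<in> L2 M" for f :: "'a => real"
proof (rule L2_dominated[where f = f and B = "norm i"])
 assume f: "f \<in> L2 M"
 show "(\<lambda>z. f z *\<^sub>R i) \<in> borel_measurable M" using L2_measurable[OF f] by measurable
qed (auto simp: mult.commute)

text \<open>Both sides are tested with \<open>\<phi>\<close>; moving the averages to \<open>\<phi>\<close> reduces the claim to
 the fundamental theorem of calculus in time.\<close>

lemma weak_dt_increment:
 fixes y R :: "'a::euclidean_space \<times> real => 'b::euclidean_space"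
 assumes y: "y \<in> L2 lborel" and R: "R \<in> L2 lborel" and V: "open V" and h: "0 < h"
  and shift: "\<And>z s. z \<in> V ==> 0 \<le> s ==> s \<le> h ==> z - (0, s) \<in> U"
  and weak: "\<And>\<phi>. \<phi> \<in> test_fun U ==> (LBINT z. \<D> \<phi> z (0, 1) *\<^sub>R y z + \<phi> z *\<^sub>R R z) = 0"
 shows "AE z in lborel. z \<in> V --> y z - y (z - (0, h)) = h *\<^sub>R avg (steklov h) R z"
proof -
 interpret averaging "steklov h :: ('a \<times> real) measure" by (rule steklov_averaging[OF h])
 have ym: "y \<in> Borel" and Rm: "R \<in> Borel" using y R by (auto dest: L2_borel)
 have AL: "avg (steklov h) R \<in> L2 lborel" by (rule avg_L2[OF R])
 have yhL: "(\<lambda>z. y (z - (0, h))) \<in> L2 lborel" by (rule L2_translate[OF y])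
 define H where "H = (\<lambda>z. (y z - y (z - (0, h))) - h *\<^sub>R avg (steklov h) R z)"
 have HL: "H \<in> L2 lborel" unfolding H_def by (intro L2_diff y yhL L2_scaleR AL)
 have "AE z in lborel. z \<in> V --> H z = 0"
 proof (rule fundamental_lemma[OF V HL])
  fix \<phi> assume \<phi>: "\<phi> \<in> test_fun V"
  note \<phi>L = test_fun_L2(1)[OF \<phi>]
  have \<phi>m: "\<phi> \<in> Borel" by (rule L2_borel[OF \<phi>L])
  \<comment> \<open>Shifting \<psi> by times between 0 and h runs through all positions from
    \<phi>(. + h) to \<phi>, so averaging the time derivative of \<psi> produces a difference of the
    two ends.\<close>
  define \<psi> where "\<psi> = (\<lambda>z. \<phi> (z + (0, h)))"
  have \<psi>t: "(\<lambda>z. \<psi> (z - \<xi>)) \<in> test_fun U" if "fst \<xi> = 0" "0 \<le> snd \<xi>" "snd \<xi> \<le> h" for \<xi>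
  proof -
   have "(\<lambda>z. \<phi> (z - (0, snd \<xi> - h))) \<in> test_fun U"
   proof (rule test_fun_translate_time[OF \<phi>])
    fix z assume "z \<in> V"
    from shift[OF this, of "h - snd \<xi>"] that show "z + (0, snd \<xi> - h) \<in> U" by (cases z) (simp add: algebra_simps)
   qed
   moreover have "\<phi> (z - (0, snd \<xi> - h)) = \<psi> (z - \<xi>)" for z
    using that(1) by (cases \<xi>; cases z) (simp add: \<psi>_def algebra_simps)
   ultimately show ?thesis by simp
  qed
  have \<psi>U: "\<psi> \<in> test_fun U" using \<psi>t[of 0] h by simp
  have \<psi>1: "C1 \<psi>" by (rule test_fun_C1[OF \<psi>U])
  have dL: "(\<lambda>z. \<D> \<psi> z (0, 1)) \<in> L2 lborel" by (rule test_fun_L2(4)[OF \<psi>U])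
  have comp: "(LBINT z. \<phi> z *\<^sub>R H z) \<bullet> i = 0" if i: "i \<in> Basis" for i
  proof -
   define \<Phi> where "\<Phi> = (\<lambda>z. \<phi> z *\<^sub>R i)"
   define F where "F = (\<lambda>z. \<D> \<psi> z (0, 1) *\<^sub>R i)"
   have \<Phi>L: "\<Phi> \<in> L2 lborel" unfolding \<Phi>_def by (rule test_fun_scaleR_L2[OF \<phi>L])
   have FL: "F \<in> L2 lborel" unfolding F_def by (rule test_fun_scaleR_L2[OF dL])
   have \<Phi>m: "\<Phi> \<in> Borel" and Fm: "F \<in> Borel" using \<Phi>L FL by (auto dest: L2_borel)
   have move: "(LBINT z. R (z - ((0, h) - \<xi>)) \<bullet> \<Phi> z) = - (LBINT z. F (z - \<xi>) \<bullet> y z)"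
    if \<xi>: "fst \<xi> = 0 \<and> 0 < snd \<xi> \<and> snd \<xi> \<le> h" for \<xi>
   proof -
    let ?\<chi> = "\<lambda>z. \<psi> (z - \<xi>)"
    have \<chi>: "?\<chi> \<in> test_fun U" using \<psi>t[of \<xi>] \<xi> by simp
    have d: "\<D> ?\<chi> z (0, 1) = \<D> \<psi> (z - \<xi>) (0, 1)" for z
     using C1_translate(2)[OF \<psi>1, of \<xi> z] by simp
    have I: "integrable lborel (\<lambda>z. \<D> ?\<chi> z (0, 1) *\<^sub>R y z)" "integrable lborel (\<lambda>z. ?\<chi> z *\<^sub>R R z)"
     by (intro L2_scaleR_integrable test_fun_L2[OF \<chi>] y R)+
    have "(LBINT z. R (z - ((0, h) - \<xi>)) \<bullet> \<Phi> z) = (LBINT z. R z \<bullet> \<Phi> (z + ((0, h) - \<xi>)))"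
    proof -
     have "(\<lambda>z. R z \<bullet> \<Phi> (z + ((0, h) - \<xi>))) \<in> Borel"
      by (intro borel_measurable_inner Rm measurable_compose[OF borel_measurable_continuous_onI \<Phi>m] continuous_intros)
     from lborel_integral_translate[OF this, of "(0, h) - \<xi>"] show ?thesis by simp
    qed
    also have "\<dots> = (LBINT z. ?\<chi> z *\<^sub>R R z) \<bullet> i"
     using integral_inner_left[OF I(2), of i] by (simp add: \<Phi>_def \<psi>_def algebra_simps)
    also have "(LBINT z. ?\<chi> z *\<^sub>R R z) = - (LBINT z. \<D> ?\<chi> z (0, 1) *\<^sub>R y z)"
     using weak[OF \<chi>] lebesgue_add[OF I] by (simp add: add_eq_0_iff)
    also have "\<dots> \<bullet> i = - (LBINT z. F (z - \<xi>) \<bullet> y z)"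
     using integral_inner_left[OF I(1), of i] by (simp add: F_def d inner_commute)
    finally show ?thesis .
   qed
   have "(LBINT z. avg (steklov h) R z \<bullet> \<Phi> z) = (\<integral>\<xi>. (LBINT z. R (z - \<xi>) \<bullet> \<Phi> z) \<partial>steklov h)"
    by (rule avg_inner[OF R \<Phi>L])
   \<comment> \<open>After reflecting \<xi> at h/2 the test function is shifted as \<psi> by \<xi>
     itself, so the same average reappears, now applied to the derivative of \<psi>.\<close>
   also have "\<dots> = (\<integral>\<xi>. (LBINT z. R (z - ((0, h) - \<xi>)) \<bullet> \<Phi> z) \<partial>steklov h)"
   proof (rule steklov_reflect[OF h, symmetric])
    have "(\<lambda>(\<xi>, z). R (z - \<xi>) \<bullet> \<Phi> z) \<in> borel_measurable (borel \<Otimes>\<^sub>M lborel)"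
     using Rm \<Phi>m by measurable
    then show "(\<lambda>\<xi>. \<integral>z. R (z - \<xi>) \<bullet> \<Phi> z \<partial>lborel) \<in> Borel"
     by (intro lborel.borel_measurable_lebesgue_integral) simp
   qed
   also have "\<dots> = (\<integral>\<xi>. - (LBINT z. F (z - \<xi>) \<bullet> y z) \<partial>steklov h)"
   proof (rule integral_cong_AE)
    show "AE \<xi> in steklov h. (LBINT z. R (z - ((0, h) - \<xi>)) \<bullet> \<Phi> z) = - (LBINT z. F (z - \<xi>) \<bullet> y z)"
     using steklov_AE[OF h] by eventually_elim (rule move)
    have "(\<lambda>(\<xi>, z). R (z - ((0, h) - \<xi>)) \<bullet> \<Phi> z) \<in> borel_measurable (borel \<Otimes>\<^sub>M lborel)"
     "(\<lambda>(\<xi>, z). F (z - \<xi>) \<bullet> y z) \<in> borel_measurable (borel \<Otimes>\<^sub>M lborel)"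
     using Rm \<Phi>m Fm ym by measurable
    then show "(\<lambda>\<xi>. \<integral>z. R (z - ((0, h) - \<xi>)) \<bullet> \<Phi> z \<partial>lborel) \<in> borel_measurable (steklov h)"
     "(\<lambda>\<xi>. - (LBINT z. F (z - \<xi>) \<bullet> y z)) \<in> borel_measurable (steklov h)"
     unfolding measurable_cong_sets[OF sets_\<mu> refl]
     by (auto intro!: lborel.borel_measurable_lebesgue_integral borel_measurable_uminus)
   qed
   also have "\<dots> = - (LBINT z. avg (steklov h) F z \<bullet> y z)"
    by (simp add: avg_inner[OF FL y])
   \<comment> \<open>The average of a time derivative over a window of length h is a difference
     quotient, by the fundamental theorem of calculus for the C1 function \<psi>.\<close>
   also have "(LBINT z. avg (steklov h) F z \<bullet> y z) = (1 / h) * (LBINT z. y z \<bullet> \<Phi> (z + (0, h)) - y z \<bullet> \<Phi> z)"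
   proof -
    have F: "avg (steklov h) F z = (1 / h) *\<^sub>R (\<Phi> (z + (0, h)) - \<Phi> z)" for z
    proof (cases z)
     case (Pair x t)
     have "seg (t - h) t F x = seg (t - h) t (\<lambda>z. \<D> \<psi> z (0, 1)) x *\<^sub>R i"
     proof -
      let ?f = "\<lambda>s. indicator {t - h..<t} s *\<^sub>R \<D> \<psi> (x, s) (0, 1)"
      have "(LBINT s. ?f s *\<^sub>R i) = (LBINT s. ?f s) *\<^sub>R i"
      proof (cases "integrable lborel ?f")
       case False
       have "\<not> integrable lborel (\<lambda>s. ?f s *\<^sub>R i)"
       proof
        assume "integrable lborel (\<lambda>s. ?f s *\<^sub>R i)"
        then have "integrable lborel (\<lambda>s. (?f s *\<^sub>R i) \<bullet> i)" by (intro integrable_inner_left)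
        with False i show False by simp
       qed
       then show ?thesis using False by (simp only: not_integrable_integral_eq scaleR_zero_left not_False_eq_True)
      qed (simp only: integral_scaleR_left)
      then show ?thesis unfolding seg_def F_def by (simp only: scaleR_scaleR real_scaleR_def)
     qed
     also have "\<dots> = (\<psi> (x, t) - \<psi> (x, t - h)) *\<^sub>R i" using h by (simp add: seg_deriv[OF \<psi>1])
     finally have eq: "seg (t - h) t F x = (\<psi> (x, t) - \<psi> (x, t - h)) *\<^sub>R i" .
     show ?thesis unfolding Pair avg_steklov[OF h Fm] eq by (simp add: \<psi>_def \<Phi>_def scaleR_diff_left)
    qed
    show ?thesis unfolding F
     by (subst integral_mult_right_zero[symmetric]) (intro lebesgue_cong refl, simp add: inner_diff_left inner_commute algebra_simps)
   qed
   also have "(LBINT z. y z \<bullet> \<Phi> (z + (0, h)) - y z \<bullet> \<Phi> z) = (LBINT z. y (z - (0, h)) \<bullet> \<Phi> z) - (LBINT z. y z \<bullet> \<Phi> z)"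
   proof -
    have \<Phi>hL: "(\<lambda>z. \<Phi> (z + (0, h))) \<in> L2 lborel" by (rule L2_translate[OF \<Phi>L, of "- (0, h)", unfolded diff_minus_eq_add])
    have "(LBINT z. y (z - (0, h)) \<bullet> \<Phi> z) = (LBINT z. y z \<bullet> \<Phi> (z + (0, h)))"
     using lborel_integral_translate[OF borel_measurable_inner[OF ym L2_borel[OF \<Phi>hL]], of "(0, h)"] by simp
    then show ?thesis using L2_inner_integrable[OF y \<Phi>hL] L2_inner_integrable[OF y \<Phi>L] by simp
   qed
   finally have "h * (LBINT z. avg (steklov h) R z \<bullet> \<Phi> z) = (LBINT z. y z \<bullet> \<Phi> z) - (LBINT z. y (z - (0, h)) \<bullet> \<Phi> z)"
    using h by simp
   moreover have "(LBINT z. \<phi> z *\<^sub>R H z) \<bullet> i = (LBINT z. (y z \<bullet> \<Phi> z - y (z - (0, h)) \<bullet> \<Phi> z) - h * (avg (steklov h) R z \<bullet> \<Phi> z))"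
   proof -
    have "(LBINT z. \<phi> z *\<^sub>R H z) \<bullet> i = (LBINT z. (\<phi> z *\<^sub>R H z) \<bullet> i)"
     by (intro integral_inner_left[symmetric] L2_scaleR_integrable \<phi>L HL)
    then show ?thesis by (simp add: H_def \<Phi>_def algebra_simps)
   qed
   ultimately show ?thesis
    using L2_inner_integrable[OF y \<Phi>L] L2_inner_integrable[OF yhL \<Phi>L] L2_inner_integrable[OF AL \<Phi>L] by simp
  qed
  show "(LBINT z. \<phi> z *\<^sub>R H z) = 0" by (rule euclidean_eqI) (simp add: comp)
 qed
 then show ?thesis by eventually_elim (simp add: H_def)
qed

lemma weak_dt_mult:
 fixes y p :: "'a::euclidean_space \<times> real => 'b::euclidean_space"
 assumes y: "y \<in> L2 lborel" "\<forall>z. z \<notin> \<Omega> \<times> {0<..<T} --> y z = 0" and p: "p \<in> L2 lborel"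
  and weak: "\<forall>\<phi>\<in>test_fun (\<Omega> \<times> {0<..<T}). (LBINT z. \<D> \<phi> z (0, 1) *\<^sub>R y z + \<phi> z *\<^sub>R p z) = 0"
  and \<sigma>: "C1 \<sigma>" "\<forall>s. \<bar>\<sigma> s\<bar> \<le> 1"
  and U: "\<forall>\<phi>\<in>test_fun U. (\<lambda>z. \<phi> z * \<sigma> (snd z)) \<in> test_fun (\<Omega> \<times> {0<..<T})"
 defines "R \<equiv> \<lambda>z. \<D> \<sigma> (snd z) 1 *\<^sub>R y z + \<sigma> (snd z) *\<^sub>R p z"
 shows "(\<lambda>z. \<sigma> (snd z) *\<^sub>R y z) \<in> L2 lborel" "R \<in> L2 lborel"
  "\<And>\<phi>. \<phi> \<in> test_fun U ==> (LBINT z. \<D> \<phi> z (0, 1) *\<^sub>R (\<sigma> (snd z) *\<^sub>R y z) + \<phi> z *\<^sub>R R z) = 0"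
proof -
 have [measurable]: "y \<in> Borel" "p \<in> Borel" using y(1) p by (auto dest: L2_borel)
 have \<sigma>m: "(\<lambda>z::'a \<times> real. \<sigma> (snd z)) \<in> Borel" by (rule time_measurable[OF C1_measurable[OF \<sigma>(1)]])
 have dm [measurable]: "(\<lambda>z::'a \<times> real. \<D> \<sigma> (snd z) 1) \<in> Borel"
  by (rule time_measurable[OF C1_deriv_measurable[OF \<sigma>(1)]])
 show "(\<lambda>z. \<sigma> (snd z) *\<^sub>R y z) \<in> L2 lborel"
  by (rule L2_bounded_mult[OF y(1), of _ 1]) (use \<sigma>m \<sigma>(2) in auto)
 \<comment> \<open>A continuous derivative is bounded on the compact interval [0, T], and y vanishes
   at all other times.\<close>
 have "bounded ((\<lambda>s. \<D> \<sigma> s 1) ` {0..T})"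
  by (intro compact_imp_bounded compact_continuous_image continuous_on_subset[OF C1_continuous_deriv[OF \<sigma>(1)]]) auto
 then obtain B where B: "\<And>s. 0 \<le> s ==> s \<le> T ==> \<bar>\<D> \<sigma> s 1\<bar> \<le> B"
  unfolding bounded_iff by force
 have "(\<lambda>z. \<D> \<sigma> (snd z) 1 *\<^sub>R y z) \<in> L2 lborel"
 proof (rule L2_dominated[OF y(1)])
  show "AE z in lborel. norm (\<D> \<sigma> (snd z) 1 *\<^sub>R y z) \<le> B * norm (y z)"
  proof (rule AE_I2)
   fix z show "norm (\<D> \<sigma> (snd z) 1 *\<^sub>R y z) \<le> B * norm (y z)"
   proof (cases "z \<in> \<Omega> \<times> {0<..<T}")
    case True
    then show ?thesis using B[of "snd z"] by (auto intro!: mult_right_mono)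
   next
    case False
    then have "y z = 0" using y(2) by blast
    then show ?thesis by simp
   qed
  qed
 qed measurable
 moreover have "(\<lambda>z. \<sigma> (snd z) *\<^sub>R p z) \<in> L2 lborel"
  by (rule L2_bounded_mult[OF p, of _ 1]) (use \<sigma>m \<sigma>(2) in auto)
 ultimately show "R \<in> L2 lborel" unfolding R_def by (rule L2_add)
 fix \<phi> assume \<phi>: "\<phi> \<in> test_fun U"
 have eq: "\<D> (\<lambda>z. \<phi> z * \<sigma> (snd z)) z (0, 1) *\<^sub>R y z + (\<phi> z * \<sigma> (snd z)) *\<^sub>R p z
  = \<D> \<phi> z (0, 1) *\<^sub>R (\<sigma> (snd z) *\<^sub>R y z) + \<phi> z *\<^sub>R R z" for z
  unfolding C1_mult(2)[OF test_fun_C1[OF \<phi>] C1_snd(1)[OF \<sigma>(1)]] C1_snd(2)[OF \<sigma>(1)]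
  by (simp add: R_def algebra_simps)
 show "(LBINT z. \<D> \<phi> z (0, 1) *\<^sub>R (\<sigma> (snd z) *\<^sub>R y z) + \<phi> z *\<^sub>R R z) = 0"
  unfolding eq[symmetric] by (rule bspec[OF weak bspec[OF U \<phi>]])
qed

lemma AE_translate:
 fixes c :: "'a::euclidean_space"
 assumes "AE z in lborel. P z" shows "AE z in lborel. P (z - c)"
 by (rule AE_distrD[where M' = borel and P = P]) (use assms in \<open>simp_all only: distr_lborel_translate, simp\<close>)

text \<open>The support of \<phi> confines time to I and the factor \<sigma> confines it to J; the
  intersection lies in (0, T), and closedness of J keeps the common support compact.\<close>

lemma test_fun_time_cut:
 fixes \<phi> :: "'a::euclidean_space \<times> real => real"
 assumes \<phi>: "\<phi> \<in> test_fun (\<Omega> \<times> I)" and \<sigma>: "C1 \<sigma>" and J: "closed J" "I \<inter> J \<subseteq> {0<..<T}" and 0: "\<And>s. s \<notin> J ==> \<sigma> s = 0"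
 shows "(\<lambda>z. \<phi> z * \<sigma> (snd z)) \<in> test_fun (\<Omega> \<times> {0<..<T})"
proof (rule test_funI)
 let ?S = "closure {z. \<phi> z \<noteq> 0} \<inter> (UNIV \<times> J)"
 show "C1 (\<lambda>z. \<phi> z * \<sigma> (snd z))"
  by (rule C1_mult(1)[OF test_fun_C1[OF \<phi>] C1_snd(1)[OF \<sigma>]])
 show "compact ?S"
  using \<phi> J(1) by (intro compact_Int_closed closed_Times) (auto simp: test_fun_def)
 have "closure {z. \<phi> z \<noteq> 0} \<subseteq> \<Omega> \<times> I" using \<phi> by (simp add: test_fun_def)
 then show "?S \<subseteq> \<Omega> \<times> {0<..<T}" using J(2) by blast
 fix z assume "z \<notin> ?S"
 then show "\<phi> z * \<sigma> (snd z) = 0"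
  using closure_subset[of "{z. \<phi> z \<noteq> 0}"] 0[of "snd z"] by (cases z) auto
qed

text \<open>Multiplying by a cutoff that vanishes near \<open>t = 0\<close> (near \<open>t = T\<close>) allows a time shift by \<open>T\<close>
 backwards (forwards), after which nothing but the integral of the derivative is left.\<close>

theorem weak_dt_primitive:
 fixes y p :: "'a::euclidean_space \<times> real => 'b::euclidean_space"
 assumes \<Omega>: "open \<Omega>" and T: "0 < T"
  and y: "y \<in> L2 lborel" "\<And>z. z \<notin> \<Omega> \<times> {0<..<T} ==> y z = 0"
  and p: "p \<in> L2 lborel" "\<And>z. z \<notin> \<Omega> \<times> {0<..<T} ==> p z = 0"
  and weak: "\<And>\<phi>. \<phi> \<in> test_fun (\<Omega> \<times> {0<..<T}) ==> (LBINT z. \<D> \<phi> z (0, 1) *\<^sub>R y z + \<phi> z *\<^sub>R p z) = 0"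
 obtains c where "c \<in> L2 lborel" "\<And>x. x \<notin> \<Omega> ==> c x = 0" "AE z in lborel. 0 < snd z \<and> snd z < T --> y z = c (fst z) + tint p z"
proof -
 \<comment> \<open>Rises from 0 at T/3 to 1 at 2T/3, so that \<sigma> y can be extended by 0 to
   negative times and (1 - \<sigma>) y beyond T without losing the weak derivative.\<close>
 define \<sigma> where "\<sigma> = (\<lambda>s. ramp (3 / T * s + - 1))"
 have \<sigma>: "C1 \<sigma>" unfolding \<sigma>_def
  by (intro C1_compose_affine(1)[OF ramp_C1] bounded_linear_mult_right)
 have \<sigma>1: "\<forall>s. \<bar>\<sigma> s\<bar> \<le> 1" "\<forall>s. \<bar>1 - \<sigma> s\<bar> \<le> 1"
  using ramp_range by (auto simp: \<sigma>_def)
 have \<sigma>0: "\<sigma> s = 0" if "s \<notin> {T / 3..}" for s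
  unfolding \<sigma>_def by (rule ramp_0) (use T that in \<open>auto simp: field_simps\<close>)
 have \<sigma>2: "1 - \<sigma> s = 0" if "s \<notin> {..2 * T / 3}" for s
  unfolding \<sigma>_def by (subst ramp_1) (use T that in \<open>auto simp: field_simps\<close>)
 have d: "((\<lambda>u::real. 1 - u) has_real_derivative - 1) (at u)" for u
  by (auto intro!: derivative_eq_intros)
 note \<sigma>' = C1_compose_real[OF \<sigma> d continuous_on_const]
 have y0: "\<forall>z. z \<notin> \<Omega> \<times> {0<..<T} --> y z = 0"
  and weak': "\<forall>\<phi>\<in>test_fun (\<Omega> \<times> {0<..<T}). (LBINT z. \<D> \<phi> z (0, 1) *\<^sub>R y z + \<phi> z *\<^sub>R p z) = 0"
  using y(2) weak by blast+
 define R where "R = (\<lambda>z. \<D> \<sigma> (snd z) 1 *\<^sub>R y z + \<sigma> (snd z) *\<^sub>R p z)"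
 define R' where "R' = (\<lambda>z. p z - R z)"
 have R'_eq: "(\<lambda>z. \<D> (\<lambda>s. 1 - \<sigma> s) (snd z) 1 *\<^sub>R y z + (1 - \<sigma> (snd z)) *\<^sub>R p z) = R'"
  by (auto simp: R'_def R_def \<sigma>'(2) algebra_simps)
 have 1: "\<forall>\<phi>\<in>test_fun (\<Omega> \<times> {..<T}). (\<lambda>z. \<phi> z * \<sigma> (snd z)) \<in> test_fun (\<Omega> \<times> {0<..<T})"
  by (rule ballI, rule test_fun_time_cut[OF _ \<sigma> closed_atLeast[of "T / 3"] _ \<sigma>0]) (use T in auto)
 note 1 = weak_dt_mult[OF y(1) y0 p(1) weak' \<sigma> \<sigma>1(1) 1, folded R_def]
 have 2: "\<forall>\<phi>\<in>test_fun (\<Omega> \<times> {0<..}). (\<lambda>z. \<phi> z * (1 - \<sigma> (snd z))) \<in> test_fun (\<Omega> \<times> {0<..<T})"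
  by (rule ballI, rule test_fun_time_cut[OF _ \<sigma>'(1) closed_atMost[of "2 * T / 3"] _ \<sigma>2]) (use T in auto)
 note 2 = weak_dt_mult[OF y(1) y0 p(1) weak' \<sigma>'(1) \<sigma>1(2) 2, unfolded R'_eq]
 have 13: "(LBINT z. \<D> \<phi> z (0, 1) *\<^sub>R (\<sigma> (snd z) *\<^sub>R y z) + \<phi> z *\<^sub>R R z) = 0"
  if "\<phi> \<in> test_fun (\<Omega> \<times> {..<T})" for \<phi>
  unfolding R_def by (rule 1(3)[OF that])
 have 23: "(LBINT z. \<D> \<phi> z (0, 1) *\<^sub>R ((1 - \<sigma> (snd z)) *\<^sub>R y z) + \<phi> z *\<^sub>R R' z) = 0"
  if "\<phi> \<in> test_fun (\<Omega> \<times> {0<..})" for \<phi>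
  unfolding R'_eq[symmetric] by (rule 2(3)[OF that])
 have pT: "timed T p" using p by (auto simp: timed_def)
 have RT: "timed T R" using 1(2) y(2) p(2) by (auto simp: timed_def R_def)
 have R'T: "timed T R'" unfolding R'_def by (rule timed_diff[OF pT RT])
 have seg: "T *\<^sub>R avg (steklov T) F (x, t) = seg (t - T) t F x" if "F \<in> L2 lborel" for F :: "'a \<times> real => 'b" and x t
  using T by (simp add: avg_steklov[OF T L2_borel[OF that]])
 \<comment> \<open>For times in (0, T) the shifted argument lies before 0, where y vanishes, and the
   average over a window of length T is the full primitive of R.\<close>
 have A: "AE z in lborel. z \<in> \<Omega> \<times> {0<..<T} --> \<sigma> (snd z) *\<^sub>R y z = tint R z"
 proof -
  have "AE z in lborel. z \<in> \<Omega> \<times> {..<T} -->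
   \<sigma> (snd z) *\<^sub>R y z - \<sigma> (snd (z - (0, T))) *\<^sub>R y (z - (0, T)) = T *\<^sub>R avg (steklov T) R z"
   by (rule weak_dt_increment[OF 1(1,2) _ T _ 13]) (use \<Omega> in \<open>auto intro: open_Times\<close>)
  then show ?thesis
  proof eventually_elim
   case (elim z)
   show ?case
   proof
    assume z: "z \<in> \<Omega> \<times> {0<..<T}"
    obtain x t where zx: "z = (x, t)" by (cases z)
    have "y (z - (0, T)) = 0" using z by (intro y(2)) (auto simp: zx)
    moreover have "seg (t - T) t R x = tint R (x, t)"
     unfolding tint_eq_seg[OF RT] seg_def using z RT
     by (intro lebesgue_cong) (auto simp: zx timed_def indicator_def)
    ultimately show "\<sigma> (snd z) *\<^sub>R y z = tint R z" using elim z seg[OF 1(2), of x t] by (auto simp: zx)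
   qed
  qed
 qed
 \<comment> \<open>Read at time t + T, where y vanishes: only the value at t survives, with a minus
   sign, and the integral runs from t to T.\<close>
 have B: "AE z in lborel. z \<in> \<Omega> \<times> {0<..<T} --> (1 - \<sigma> (snd z)) *\<^sub>R y z = tint R' z - tint R' (fst z, T)"
 proof -
  have "AE z in lborel. z \<in> \<Omega> \<times> {T<..} -->
   (1 - \<sigma> (snd z)) *\<^sub>R y z - (1 - \<sigma> (snd (z - (0, T)))) *\<^sub>R y (z - (0, T)) = T *\<^sub>R avg (steklov T) R' z"
   by (rule weak_dt_increment[OF 2(1,2) _ T _ 23]) (use \<Omega> in \<open>auto intro: open_Times\<close>)
  from AE_translate[OF this, of "(0, - T)"]
  show ?thesis using AE_fst[OF timed_AE[OF R'T]]
  proof eventually_elim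
   case (elim z)
   show ?case
   proof
    assume z: "z \<in> \<Omega> \<times> {0<..<T}"
    obtain x t where zx: "z = (x, t)" by (cases z)
    have y0: "y (x, t + T) = 0" using z by (intro y(2)) (auto simp: zx)
    have "- ((1 - \<sigma> t) *\<^sub>R y (x, t)) = seg t (t + T) R' x"
     using elim(1) z seg[OF 2(2), of x "t + T"] y0 by (auto simp: zx)
    also have "seg t (t + T) R' x = seg t T R' x"
     unfolding seg_def using z R'T
     by (intro lebesgue_cong) (auto simp: zx timed_def indicator_def)
    also have "\<dots> = tint R' (x, T) - tint R' (x, t)"
     using tint_diff_seg[of R' x t T] elim(2) z by (auto simp: zx)
    finally show "(1 - \<sigma> (snd z)) *\<^sub>R y z = tint R' z - tint R' (fst z, T)" by (simp add: zx algebra_simps)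
   qed
  qed
 qed
 show ?thesis
 \<comment> \<open>Since R + R' = p, adding the two halves leaves the primitive of p and this
   time-independent remainder, which acts as the initial value of y.\<close>
 proof (rule that[of "\<lambda>x. - tint R' (x, T)"])
  show "(\<lambda>x. - tint R' (x, T)) \<in> L2 lborel" by (rule L2_uminus[OF tint_slice(1)[OF R'T]])
  show "- tint R' (x, T) = 0" if "x \<notin> \<Omega>" for x
   using that y(2) p(2) by (simp add: tint_def R'_def R_def)
  show "AE z in lborel. 0 < snd z \<and> snd z < T --> y z = - tint R' (fst z, T) + tint p z"
   using A B AE_fst[OF tint_diff[OF pT RT]]
  proof eventually_elim
   case (elim z)
   obtain x t where zx: "z = (x, t)" by (cases z)
   have s: "tint R' (x, s) = tint p (x, s) - tint R (x, s)" for s using elim(3) by (simp add: zx R'_def)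
   show ?case
   proof (cases "x \<in> \<Omega>")
    case True
    have "y z = \<sigma> t *\<^sub>R y z + (1 - \<sigma> t) *\<^sub>R y z" by (simp add: algebra_simps)
    then show ?thesis using elim(1,2) True s by (auto simp: zx)
   next
    case False
    then show ?thesis using y(2) p(2) by (simp add: zx tint_def R'_def R_def)
   qed
  qed
 qed
qed

lemma before_tint_lim:
 assumes F: "\<And>k. timed T (F k)" and f: "timed T f" and lim: "L2_lim lborel F f" and T: "0 \<le> T"
 shows "L2_lim lborel (\<lambda>k. before T (tint (F k))) (before T (tint f))"
proof (rule L2_lim_bound)
 show "(\<lambda>k. T * nrm (\<lambda>z. F k z - f z)) \<longlonglongrightarrow> 0"
  using tendsto_mult_left[OF L2_limD(3)[OF lim], of T] by simp
 fix k
 show L: "before T (tint (F k)) \<in> L2 lborel" "before T (tint f) \<in> L2 lborel"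
  by (rule before_tint_L2(1)[OF F T], rule before_tint_L2(1)[OF f T])
 have d: "timed T (\<lambda>z. F k z - f z)" by (intro timed_diff F f)
 have "nrm (\<lambda>z. before T (tint (F k)) z - before T (tint f) z) = nrm (before T (tint (\<lambda>z. F k z - f z)))"
 proof (rule L2_norm_cong_AE)
  show "AE z in lborel. before T (tint (F k)) z - before T (tint f) z = before T (tint (\<lambda>z. F k z - f z)) z"
   using AE_fst[OF tint_diff[OF F[of k] f]]
  proof eventually_elim
   case (elim z) then show ?case by (cases z) (simp add: scaleR_diff_right)
  qed
 qed (use L2_measurable[OF L2_diff[OF L]] L2_measurable[OF before_tint_L2(1)[OF d T]] in auto)
 also have "\<dots> \<le> T * nrm (\<lambda>z. F k z - f z)" by (rule before_tint_L2(2)[OF d T])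
 finally show "nrm (\<lambda>z. before T (tint (F k)) z - before T (tint f) z) \<le> T * nrm (\<lambda>z. F k z - f z)" .
qed

text \<open>For the C1 approximants the fundamental theorem of calculus writes W k(x, t) as W k(x,
  0) plus the primitive of the time derivative. The first term tends to 0 by the bottom trace, and
  primitives depend continuously on their integrands.\<close>

theorem zero_initial_tint:
 fixes w p :: "'a::euclidean_space \<times> real => real"
 assumes \<Omega>: "open \<Omega>" and T: "0 < T" and z: "zero_initial \<Omega> T w" and wp: "has_dt (\<Omega> \<times> {0<..<T}) w p"
  and w': "version (\<Omega> \<times> {0<..<T}) w w'" and p': "version (\<Omega> \<times> {0<..<T}) p p'"
 shows "AE z in lborel. w' z = before T (tint p') z"
proof -
 let ?Q = "\<Omega> \<times> {0<..<T}" and ?M = "bottom_measure \<Omega>"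
 have Qo: "open ?Q" using \<Omega> by (intro open_Times) auto
 have Qb [measurable]: "?Q \<in> sets borel" using Qo by simp
 have \<Omega>b [measurable]: "\<Omega> \<in> sets borel" using \<Omega> by simp
 have "(0, 1) \<in> (Basis :: ('a \<times> real) set)" by (simp add: Basis_prod_def)
 then obtain W p1 where W: "\<And>k. C1 (W k)" "L2_lim (lebesgue_on ?Q) W w" "L2_lim ?M W (\<lambda>_. 0)"
  and p1: "has_dt ?Q w p1" "L2_lim (lebesgue_on ?Q) (\<lambda>k z. \<D> (W k) z (0, 1)) p1"
  using z unfolding zero_initial_def has_trace_def by blast
 define B where "B k x = indicator \<Omega> x *\<^sub>R W k (x, 0)" for k x
 define W' where "W' k z = indicator ?Q z *\<^sub>R W k z" for k z
 define D where "D k z = indicator ?Q z *\<^sub>R \<D> (W k) z (0, 1)" for k z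
 have Wl: "L2_lim lborel W' w'"
  unfolding W'_def
  by (rule L2_lim_version[OF Qb W(2) w' version_indicator[OF Qb C1_measurable[OF W(1)] L2_limD(1)[OF W(2)]]])
 have "version ?Q p1 p'"
  by (rule version_cong[OF Qb p' weak_deriv_L2(2)[OF p1(1)] weak_deriv_unique[OF Qo wp p1(1)]])
 then have Dl: "L2_lim lborel D p'"
  unfolding D_def
  by (rule L2_lim_version[OF Qb p1(2) _ version_indicator[OF Qb C1_deriv_measurable[OF W(1)] L2_limD(1)[OF p1(2)]]])
 have DT: "timed T (D k)" for k using L2_limD(1)[OF Dl, of k] by (auto simp: timed_def D_def indicator_def)
 have pT: "timed T p'" using versionD(2,4)[OF p'] by (auto simp: timed_def)
 have B: "B k \<in> L2 lborel" "nrm (B k) = L2_norm ?M (\<lambda>z. W k z - 0)" for k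
 proof -
  have m0: "(\<lambda>x. (x, 0::real)) \<in> Borel" by (intro borel_measurable_continuous_onI continuous_intros)
  have Wm: "W k \<in> Borel" by (rule C1_measurable[OF W(1)])
  have W0: "(\<lambda>x. W k (x, 0)) \<in> Borel" by (rule measurable_compose[OF m0 Wm])
  have m: "(\<lambda>x. (x, 0::real)) \<in> restrict_space lborel \<Omega> \<rightarrow>\<^sub>M borel"
   using m0 by (intro measurable_restrict_space1) simp
  have sq: "(\<lambda>z. (norm (W k z))\<^sup>2) \<in> Borel" using Wm by measurable
  have eq: "(\<lambda>x. (norm (B k x))\<^sup>2) = (\<lambda>x. indicator \<Omega> x *\<^sub>R (norm (W k (x, 0)))\<^sup>2)"
   by (auto simp: B_def indicator_def)
  have "integrable ?M (\<lambda>z. (norm (W k z))\<^sup>2)" using L2_integrable[OF L2_limD(1)[OF W(3)]] .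
  then have "integrable lborel (\<lambda>x. (norm (B k x))\<^sup>2)"
   unfolding eq bottom_measure_def integrable_distr_eq[OF m sq] by (simp add: integrable_restrict_space)
  moreover have "B k \<in> borel_measurable lborel" unfolding B_def using W0 by measurable
  ultimately show "B k \<in> L2 lborel" by (intro L2I)
  have "(\<integral>z. (norm (W k z))\<^sup>2 \<partial>?M) = (LBINT x. (norm (B k x))\<^sup>2)"
   unfolding eq bottom_measure_def integral_distr[OF m sq] by (simp add: integral_restrict_space)
  then show "nrm (B k) = L2_norm ?M (\<lambda>z. W k z - 0)" by (simp add: L2_norm_def)
 qed
 have "W' k z - before T (tint (D k)) z = indicator {0<..<T} (snd z) *\<^sub>R B k (fst z)" for k z
 proof (cases "z \<in> ?Q")
  case True
  obtain x t where zx: "z = (x, t)" by (cases z)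
  have t: "0 < t" "t < T" "x \<in> \<Omega>" using True by (auto simp: zx)
  have "tint (D k) (x, t) = seg 0 t (\<lambda>z. \<D> (W k) z (0, 1)) x"
   unfolding tint_eq_seg[OF DT] seg_def
  proof (rule integral_cong_AE)
   show "AE s in lborel. indicator {0..<t} s *\<^sub>R D k (x, s) = indicator {0..<t} s *\<^sub>R \<D> (W k) (x, s) (0, 1)"
    using AE_lborel_singleton[of 0] by eventually_elim (use t in \<open>auto simp: D_def indicator_def\<close>)
   show "(\<lambda>s. indicator {0..<t} s *\<^sub>R D k (x, s)) \<in> borel_measurable lborel"
    using borel_slices(2)[OF timed_measurable[OF DT[of k]], of x] by measurable
   show "(\<lambda>s. indicator {0..<t} s *\<^sub>R \<D> (W k) (x, s) (0, 1)) \<in> borel_measurable lborel"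
    using borel_slices(2)[OF C1_deriv_measurable[OF W(1)[of k]], of x "(0, 1)"] by measurable
  qed
  also have "\<dots> = W k (x, t) - W k (x, 0)" using t by (intro seg_deriv W) simp
  finally show ?thesis using t by (simp add: zx W'_def B_def)
 next
  case False
  obtain x t where zx: "z = (x, t)" by (cases z)
  show ?thesis
  proof (cases "x \<in> \<Omega>")
   case True
   then have "t \<le> 0 \<or> T \<le> t" using False by (auto simp: zx)
   then show ?thesis using False tint_0[OF DT, of t] by (auto simp: zx W'_def)
  next
   case x: False
   then show ?thesis by (simp add: zx W'_def tint_def D_def B_def)
  qed
 qed
 then have eq: "(\<lambda>k z. W' k z - before T (tint (D k)) z) = (\<lambda>k z. indicator {0<..<T} (snd z) *\<^sub>R B k (fst z))"
  by (intro ext)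
 have "(\<lambda>k. nrm (B k)) \<longlonglongrightarrow> 0" using L2_limD(3)[OF W(3)] by (simp only: B(2))
 then have "(\<lambda>k. sqrt (T - 0) * nrm (B k)) \<longlonglongrightarrow> 0" using tendsto_mult_left[of _ 0] by fastforce
 then have "L2_lim lborel (\<lambda>k z. indicator {0<..<T} (snd z) *\<^sub>R B k (fst z)) (\<lambda>_. 0)"
  by (rule L2_lim_bound[rotated 3]) (use T cylinder_L2[OF B(1), of 0 T] in auto)
 moreover have lim: "L2_lim lborel (\<lambda>k z. W' k z - before T (tint (D k)) z) (\<lambda>z. w' z - before T (tint p') z)"
  by (intro L2_lim_diff Wl before_tint_lim DT pT Dl) (use T in simp)
 ultimately have "nrm (\<lambda>z. w' z - before T (tint p') z) = nrm (\<lambda>_::'a \<times> real. 0 :: real)"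
  unfolding eq by (intro LIMSEQ_unique[OF L2_lim_norm L2_lim_norm])
 then have "nrm (\<lambda>z. w' z - before T (tint p') z) = 0" by (simp only: L2_norm_zero)
 then have "AE z in lborel. w' z - before T (tint p') z = 0"
  using L2_norm_eq_0[OF L2_limD(2)[OF lim]] by simp
 then show ?thesis by eventually_elim simp
qed

lemma before_tint_0:
 assumes F: "timed T F" and z: "z \<notin> \<Omega> \<times> {0<..<T}" and 0: "\<And>z. fst z \<notin> \<Omega> ==> F z = 0"
 shows "before T (tint F) z = 0"
proof (cases z)
 case (Pair x t)
 then have "x \<notin> \<Omega> \<or> t \<le> 0 \<or> T \<le> t" using z by auto
 moreover have "tint F (x, t) = 0" if "x \<notin> \<Omega>" using that 0 by (simp add: tint_def)
 ultimately show ?thesis using tint_0[OF F, of t x] by (auto simp: Pair)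
qed

text \<open>\<open>product_formula\<close> with the time derivative of \<phi> as second factor: its
  primitive is \<phi>, which vanishes at T, so there is no boundary term.\<close>

lemma weak_dt_tint:
 fixes F :: "'a::euclidean_space \<times> real => 'b::euclidean_space"
 assumes F: "timed T F" and T: "0 < T" and \<phi>: "\<phi> \<in> test_fun (\<Omega> \<times> {0<..<T})"
 shows "(LBINT z. \<D> \<phi> z (0, 1) *\<^sub>R before T (tint F) z + \<phi> z *\<^sub>R F z) = 0"
proof (rule euclidean_eqI)
 fix i :: 'b assume i: "i \<in> Basis"
 let ?d = "\<lambda>z. \<D> \<phi> z (0, 1)" and ?R = "\<lambda>z. \<D> \<phi> z (0, 1) *\<^sub>R i"
 have supp: "closure {z. \<phi> z \<noteq> 0} \<subseteq> \<Omega> \<times> {0<..<T}" using \<phi> by (simp add: test_fun_def)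
 have \<phi>0: "\<phi> z = 0" if "snd z \<notin> {0<..<T}" for z
  using supp closure_subset[of "{z. \<phi> z \<noteq> 0}"] that by (cases z) auto
 have "?d z = 0" if "snd z \<notin> {0<..<T}" for z
  using supp that by (intro test_fun_deriv_0[OF \<phi>]) auto
 then have R: "timed T ?R" using test_fun_scaleR_L2[OF test_fun_L2(4)[OF \<phi>]] by (simp add: timed_def)
 have tR: "tint ?R (x, t) = \<phi> (x, t) *\<^sub>R i" for x t
 proof (cases "0 \<le> t")
  case True
  have int: "integrable lborel (\<lambda>s. indicator {0..<t} s *\<^sub>R ?d (x, s))"
  proof -
   have "continuous_on {0..t} (\<lambda>s. ?d (x, s))"
    by (rule continuous_on_compose2[OF C1_continuous_deriv[OF test_fun_C1[OF \<phi>]]]) (auto intro!: continuous_intros)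
   then have "set_integrable lborel {0..t} (\<lambda>s. ?d (x, s))" by (rule borel_integrable_atLeastAtMost')
   then have "set_integrable lborel {0..<t} (\<lambda>s. ?d (x, s))" by (rule set_integrable_subset) auto
   then show ?thesis by (simp add: set_integrable_def)
  qed
  have "tint ?R (x, t) = (LBINT s. (indicator {0..<t} s *\<^sub>R ?d (x, s)) *\<^sub>R i)"
   unfolding tint_eq_seg[OF R] seg_def by (intro lebesgue_cong) auto
  also have "\<dots> = seg 0 t ?d x *\<^sub>R i" unfolding seg_def using int by (intro integral_scaleR_left)
  also have "seg 0 t ?d x = \<phi> (x, t)" using seg_deriv[OF test_fun_C1[OF \<phi>] True] \<phi>0[of "(x, 0)"] by simp
  finally show ?thesis .
 qed (use tint_0[OF R] \<phi>0[of "(x, t)"] in auto)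
 have L: "before T (tint F) \<in> L2 lborel" "F \<in> L2 lborel"
  using before_tint_L2(1)[OF F, of T] T timed_L2[OF F] by auto
 have I: "integrable lborel (\<lambda>z. ?d z *\<^sub>R before T (tint F) z + \<phi> z *\<^sub>R F z)"
  by (intro integrable_plus L2_scaleR_integrable test_fun_L2[OF \<phi>] L)
 have "0 = (LBINT x. tint F (x, T) \<bullet> tint ?R (x, T))" using \<phi>0 by (simp add: tR)
 also have "\<dots> = (LBINT z. indicator {..<T} (snd z) * (F z \<bullet> tint ?R z + ?R z \<bullet> tint F z))"
  using T by (intro product_formula[OF F R]) simp
 also have "\<dots> = (LBINT z. (?d z *\<^sub>R before T (tint F) z + \<phi> z *\<^sub>R F z) \<bullet> i)"
 proof (rule lebesgue_cong[OF refl])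
  fix z :: "'a \<times> real"
  have "tint ?R z = \<phi> z *\<^sub>R i" using tR[of "fst z" "snd z"] by simp
  then show "indicator {..<T} (snd z) * (F z \<bullet> tint ?R z + ?R z \<bullet> tint F z) = (?d z *\<^sub>R before T (tint F) z + \<phi> z *\<^sub>R F z) \<bullet> i"
   using \<phi>0[of z] by (auto simp: indicator_def inner_add_right inner_commute)
 qed
 also have "\<dots> = (LBINT z. ?d z *\<^sub>R before T (tint F) z + \<phi> z *\<^sub>R F z) \<bullet> i"
  using I by (rule integral_inner_left)
 finally show "(LBINT z. ?d z *\<^sub>R before T (tint F) z + \<phi> z *\<^sub>R F z) \<bullet> i = 0 \<bullet> i" by simp
qed

text \<open>With step T the averaging window reaches back to negative times, where F vanishes. Facts
  about averages thereby become facts about primitives.\<close>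

lemma avg_tint:
 fixes F :: "'a::euclidean_space \<times> real => 'b::euclidean_space"
 assumes F: "timed T F" and T: "0 < T" and t: "t < T"
 shows "avg (steklov T) F (x, t) = (1 / T) *\<^sub>R tint F (x, t)"
proof -
 have "seg (t - T) t F x = tint F (x, t)"
  unfolding tint_eq_seg[OF F] seg_def using t F
  by (intro lebesgue_cong) (auto simp: timed_def indicator_def)
 then show ?thesis by (simp add: avg_steklov[OF T timed_measurable[OF F]])
qed

text \<open>Since v is the primitive of p, its gradient has to be the primitive of g. For the proof
  a component of a gradient is read as the divergence of a field in a coordinate direction, so that
  \<open>slab_div_avg\<close> with step T applies; \<open>weak_dt_tint\<close> then differentiates
  the primitive.\<close>

theorem grad_x_dt_commute:
 fixes v p :: "'a::euclidean_space \<times> real => real"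
 assumes \<Omega>: "open \<Omega>" and T: "0 < T" and Q: "Q = \<Omega> \<times> {0<..<T}"
  and vG: "has_grad_x Q v G" and pg: "has_grad_x Q p g"
  and v': "version Q v v'" and p': "version Q p p'" and vp: "AE z in lborel. v' z = before T (tint p') z"
 shows "has_dt Q G g"
proof -
 have Qo: "open Q" unfolding Q using \<Omega> by (intro open_Times) auto
 have Qb: "Q \<in> sets borel" using Qo by simp
 define G' where "G' = repr Q G"
 define g' where "g' = repr Q g"
 have G': "version Q G G'" and g': "version Q g g'"
  unfolding G'_def g'_def by (intro version_repr Qb grad_L2(1)[OF vG] grad_L2(1)[OF pg])+
 have slab: "slab_div \<Omega> (\<lambda>z. w' z *\<^sub>R i) (\<lambda>z. k' z \<bullet> i)"
  if i: "i \<in> Basis" and wk: "has_grad_x Q w k" and w': "version Q w w'" and k': "version Q k k'" for i w k w' k'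
 proof -
  have wi: "version Q (\<lambda>z. w' z *\<^sub>R i) (\<lambda>z. w' z *\<^sub>R i)"
   using versionD(4)[OF w'] by (intro version_self Qb test_fun_scaleR_L2 versionD(2)[OF w']) simp
  have ki: "version Q (\<lambda>z. k' z \<bullet> i) (\<lambda>z. k' z \<bullet> i)"
   using versionD(4)[OF k'] by (intro version_self Qb L2_inner_left versionD(2)[OF k']) simp
  have "has_div_x Q (\<lambda>z. w' z *\<^sub>R i) (\<lambda>z. k' z \<bullet> i)"
   unfolding div_version[OF Qb wi ki]
  proof
   fix \<phi> assume \<phi>: "\<phi> \<in> test_fun Q"
   have "has_weak_deriv Q (i, 0) w (\<lambda>z. k z \<bullet> i)" using wk i by (simp add: has_grad_x_def)
   then have "(LBINT z. \<D> \<phi> z (i, 0) *\<^sub>R w' z + \<phi> z *\<^sub>R (k' z \<bullet> i)) = 0"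
    using weak_deriv_version[OF Qb w' version_inner[OF k']] \<phi> by blast
   then show "(LBINT z. (w' z *\<^sub>R i) \<bullet> gradx \<phi> z + \<phi> z * (k' z \<bullet> i)) = 0"
    by (simp add: gradx_inner[OF i, symmetric] inner_commute mult.commute)
  qed
  from slab_div_version[OF \<Omega> this[unfolded Q] wi[unfolded Q] ki[unfolded Q]] show ?thesis .
 qed
 have pT: "timed T p'" "timed T g'" using versionD(2,4)[OF p'] versionD(2,4)[OF g'] by (auto simp: timed_def Q)
 have gL: "before T (tint g') \<in> L2 lborel" using before_tint_L2(1)[OF pT(2), of T] T by simp
 define H where "H = (\<lambda>z. before T G' z - before T (tint g') z)"
 have HL: "H \<in> L2 lborel" unfolding H_def by (intro L2_diff before_L2 versionD(2)[OF G'] gL)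
 have "AE z in lborel. z \<in> \<Omega> \<times> UNIV --> H z = 0"
 proof (rule fundamental_lemma[OF open_Times[OF \<Omega> open_UNIV] HL])
  fix \<phi> :: "'a \<times> real => real" assume \<phi>: "\<phi> \<in> test_fun (\<Omega> \<times> UNIV)"
  note \<phi>L = test_fun_L2(1)[OF \<phi>] gradx_L2[OF \<phi>]
  show "(LBINT z. \<phi> z *\<^sub>R H z) = 0"
  proof (rule euclidean_eqI)
   fix i :: 'a assume i: "i \<in> Basis"
   let ?p = "\<lambda>z. p' z *\<^sub>R i" and ?g = "\<lambda>z. g' z \<bullet> i"
   have piT: "timed T ?p" "timed T ?g"
    using pT test_fun_scaleR_L2[of p' lborel i] L2_inner_left[of g' lborel i] by (auto simp: timed_def)
   have a: "(LBINT z. indicator {..<T} (snd z) * ((v' z *\<^sub>R i) \<bullet> gradx \<phi> z + \<phi> z * (G' z \<bullet> i))) = 0"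
    using slab[OF i vG v' G'] \<phi> by (simp add: slab_div_def)
   have b: "(LBINT z. indicator {..<T} (snd z) * (avg (steklov T) ?p z \<bullet> gradx \<phi> z + \<phi> z * avg (steklov T) ?g z)) = 0"
    using slab_div_avg[OF slab[OF i pg p' g'] T] \<phi> by (simp add: slab_div_def)
   have AL: "avg (steklov T) ?p \<in> L2 lborel" "avg (steklov T) ?g \<in> L2 lborel"
    using slab_div_avg[OF slab[OF i pg p' g'] T] by (auto simp: slab_div_def)
   have ae: "AE z in lborel. \<phi> z * (H z \<bullet> i)
    = indicator {..<T} (snd z) * ((v' z *\<^sub>R i) \<bullet> gradx \<phi> z + \<phi> z * (G' z \<bullet> i))
    - T * (indicator {..<T} (snd z) * (avg (steklov T) ?p z \<bullet> gradx \<phi> z + \<phi> z * avg (steklov T) ?g z))"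
    using vp AE_fst[OF timed_AE[OF pT(1)]] AE_fst[OF timed_AE[OF pT(2)]]
   proof eventually_elim
    case (elim z)
    obtain x t where z: "z = (x, t)" by (cases z)
    show ?case
    proof (cases "t < T")
     case True
     have "tint ?p z = tint p' z *\<^sub>R i"
      using integral_scaleR_left[of i lborel "\<lambda>s. indicator {..<t} s *\<^sub>R p' (x, s)"] integrable_seg[of p' x "{..<t}"] elim(2)
      by (simp add: z tint_def)
     moreover have "tint ?g z = tint g' z \<bullet> i"
      using integral_inner_left[of i lborel "\<lambda>s. indicator {..<t} s *\<^sub>R g' (x, s)"] integrable_seg[of g' x "{..<t}"] elim(3)
      by (simp add: z tint_def)
     ultimately show ?thesis
      using True T elim(1) avg_tint[OF piT(1) T True, of x] avg_tint[OF piT(2) T True, of x]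
      by (simp add: z H_def inner_diff_left algebra_simps)
    next
     case False then show ?thesis by (simp add: z H_def)
    qed
   qed
   have int: "integrable lborel (\<lambda>z. indicator {..<T} (snd z) * ((v' z *\<^sub>R i) \<bullet> gradx \<phi> z + \<phi> z * (G' z \<bullet> i)))"
    "integrable lborel (\<lambda>z. indicator {..<T} (snd z) * (avg (steklov T) ?p z \<bullet> gradx \<phi> z + \<phi> z * avg (steklov T) ?g z))"
   proof -
    have "integrable lborel (\<lambda>z. before T (\<lambda>z. v' z *\<^sub>R i) z \<bullet> gradx \<phi> z + \<phi> z * before T (\<lambda>z. G' z \<bullet> i) z)"
     "integrable lborel (\<lambda>z. before T (avg (steklov T) ?p) z \<bullet> gradx \<phi> z + \<phi> z * before T (avg (steklov T) ?g) z)"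
     by (intro integrable_plus L2_inner_integrable L2_mult_integrable before_L2 \<phi>L AL
      test_fun_scaleR_L2 L2_inner_left versionD(2)[OF v'] versionD(2)[OF G'])+
    then show "integrable lborel (\<lambda>z. indicator {..<T} (snd z) * ((v' z *\<^sub>R i) \<bullet> gradx \<phi> z + \<phi> z * (G' z \<bullet> i)))"
     "integrable lborel (\<lambda>z. indicator {..<T} (snd z) * (avg (steklov T) ?p z \<bullet> gradx \<phi> z + \<phi> z * avg (steklov T) ?g z))"
     by (simp_all add: algebra_simps)
   qed
   have \<phi>H: "integrable lborel (\<lambda>z. \<phi> z *\<^sub>R H z)" by (intro L2_scaleR_integrable \<phi>L HL)
   have "(LBINT z. \<phi> z *\<^sub>R H z) \<bullet> i = (LBINT z. \<phi> z * (H z \<bullet> i))"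
    using integral_inner_left[OF \<phi>H, of i] by simp
   also have "\<dots> = (LBINT z. indicator {..<T} (snd z) * ((v' z *\<^sub>R i) \<bullet> gradx \<phi> z + \<phi> z * (G' z \<bullet> i))
    - T * (indicator {..<T} (snd z) * (avg (steklov T) ?p z \<bullet> gradx \<phi> z + \<phi> z * avg (steklov T) ?g z)))"
   proof (rule integral_cong_AE[OF _ _ ae])
    show "(\<lambda>z. \<phi> z * (H z \<bullet> i)) \<in> borel_measurable lborel"
     using borel_measurable_integrable[OF integrable_inner_left[OF \<phi>H, of i]] by simp
   qed (intro borel_measurable_integrable integrable_minus integrable_mult_right int)
   also have "\<dots> = 0" using int a b by simp
   finally show "(LBINT z. \<phi> z *\<^sub>R H z) \<bullet> i = 0 \<bullet> i" by simp
  qed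
 qed
 then have "AE z in lborel. G' z = before T (tint g') z"
 proof eventually_elim
  case (elim z)
  obtain x t where z: "z = (x, t)" by (cases z)
  show ?case
  proof (cases "z \<in> Q")
   case True then show ?thesis using elim by (auto simp: z Q H_def)
  next
   case False
   then have "x \<notin> \<Omega> \<or> t \<le> 0 \<or> T \<le> t" by (auto simp: z Q)
   moreover have "tint g' (x, t) = 0" if "x \<notin> \<Omega>" using that versionD(4)[OF g'] by (simp add: tint_def Q)
   ultimately show ?thesis using False versionD(4)[OF G'] tint_0[OF pT(2), of t x] by (auto simp: z)
  qed
 qed
 moreover have "before T (tint g') z = 0" if "z \<notin> Q" for z
  using before_tint_0[OF pT(2), of z \<Omega>] that versionD(4)[OF g'] by (auto simp: Q)
 ultimately have "version Q G (before T (tint g'))" by (intro version_change[OF G' gL]) auto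
 from weak_deriv_version[OF Qb this g', of "(0, 1)"] show ?thesis
  using weak_dt_tint[OF pT(2) T, of _ \<Omega>] by (simp add: Q)
qed

subsection \<open>The value at the final time\<close>

text \<open>Equality almost everywhere transfers Lebesgue measurability from f' to f on \<Omega>,
  because the measure is complete.\<close>

lemma version_AE:
 fixes f f' :: "'a::euclidean_space => 'b::euclidean_space"
 assumes \<Omega>: "\<Omega> \<in> sets borel" and f': "f' \<in> L2 lborel" "\<And>x. x \<notin> \<Omega> ==> f' x = 0" and ae: "AE x in lborel. x \<in> \<Omega> --> f' x = f x"
 shows "version \<Omega> f f'"
proof -
 have "f' \<in> borel_measurable lebesgue" using L2_borel[OF f'(1)] by (simp add: measurable_completion)
 moreover have "AE x in lebesgue. f' x = (if x \<in> \<Omega> then f x else 0)"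
  using AE_completion[OF ae] by eventually_elim (simp add: f'(2))
 ultimately have "(\<lambda>x. if x \<in> \<Omega> then f x else 0) \<in> borel_measurable lebesgue" by (rule borel_measurable_AE)
 then have "(\<lambda>x. if x \<in> \<Omega> then f x else 0) \<in> borel_measurable (lebesgue_on \<Omega>)" by (rule measurable_restrict_space1)
 then have "f \<in> borel_measurable (lebesgue_on \<Omega>)"
  by (rule measurable_cong[THEN iffD1, rotated]) (simp add: space_restrict_space)
 then show ?thesis
  using L2_on_iff(1)[OF \<Omega> _ L2_borel[OF f'(1)] f'(2) ae] f' ae by (simp add: version_def)
qed

lemma AE_interval:
 assumes "AE t in lborel. t \<in> {a<..<b::real} --> P t" "a < b"
 shows "\<exists>t\<in>{a<..<b}. P t"
proof (rule ccontr)
 assume "\<not> (\<exists>t\<in>{a<..<b}. P t)"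
 then have "AE t in lborel. t \<notin> {a<..<b}" using assms(1) by (auto elim: eventually_mono)
 then have "emeasure lborel {a<..<b} = 0" by (subst (asm) AE_iff_null_sets[symmetric]) auto
 then show False using assms(2) by simp
qed

text \<open>Two final values are compared through a common slice, which exists because the
  exceptional times form a null set. This frees \<open>final_norm\<close> from the choice it
  contains.\<close>

lemma has_final_value_unique:
 assumes 1: "has_final_value \<Omega> T F g" and 2: "has_final_value \<Omega> T F k"
 shows "norm_on \<Omega> g = norm_on \<Omega> k"
proof -
 have gk: "g \<in> L2 (lebesgue_on \<Omega>)" "k \<in> L2 (lebesgue_on \<Omega>)" using 1 2 by (auto simp: has_final_value_def)
 have "norm_on \<Omega> (\<lambda>x. g x - k x) \<le> 0"
 proof (rule field_le_epsilon)
  fix \<epsilon> :: real assume "0 < \<epsilon>"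
  then have \<epsilon>: "0 < \<epsilon> / 2" by simp
  obtain \<tau> where \<tau>: "\<tau> \<in> {0..<T}" "AE t in lebesgue_on {\<tau><..<T}.
    (\<lambda>x. F (x, t)) \<in> L2 (lebesgue_on \<Omega>) \<and> norm_on \<Omega> (\<lambda>x. F (x, t) - g x) < \<epsilon> / 2"
   using 1 \<epsilon> unfolding has_final_value_def by blast
  obtain \<tau>' where \<tau>': "\<tau>' \<in> {0..<T}" "AE t in lebesgue_on {\<tau>'<..<T}.
    (\<lambda>x. F (x, t)) \<in> L2 (lebesgue_on \<Omega>) \<and> norm_on \<Omega> (\<lambda>x. F (x, t) - k x) < \<epsilon> / 2"
   using 2 \<epsilon> unfolding has_final_value_def by blast
  have "AE t in lborel. t \<in> {max \<tau> \<tau>'<..<T} --> (\<lambda>x. F (x, t)) \<in> L2 (lebesgue_on \<Omega>) \<and>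
   norm_on \<Omega> (\<lambda>x. F (x, t) - g x) < \<epsilon> / 2 \<and> norm_on \<Omega> (\<lambda>x. F (x, t) - k x) < \<epsilon> / 2"
   using \<tau>(2) \<tau>'(2) by (auto simp: AE_lebesgue_on_iff elim!: eventually_elim2)
  from AE_interval[OF this] \<tau>(1) \<tau>'(1) obtain t where t: "(\<lambda>x. F (x, t)) \<in> L2 (lebesgue_on \<Omega>)"
   "norm_on \<Omega> (\<lambda>x. F (x, t) - g x) < \<epsilon> / 2" "norm_on \<Omega> (\<lambda>x. F (x, t) - k x) < \<epsilon> / 2" by auto
  have "norm_on \<Omega> (\<lambda>x. g x - k x) \<le> norm_on \<Omega> (\<lambda>x. g x - F (x, t)) + norm_on \<Omega> (\<lambda>x. F (x, t) - k x)"
   by (rule L2_norm_triangle_diff[OF gk(1) t(1) gk(2)])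
  also have "norm_on \<Omega> (\<lambda>x. g x - F (x, t)) = norm_on \<Omega> (\<lambda>x. F (x, t) - g x)" by (rule L2_norm_minus_commute)
  finally show "norm_on \<Omega> (\<lambda>x. g x - k x) \<le> 0 + \<epsilon>" using t(2,3) by simp
 qed
 then show ?thesis using L2_norm_diff_bound[OF gk] by linarith
qed

text \<open>For almost every time the slice of a version is a version of the slice, so limits of
  slices may be computed with the representative.\<close>

theorem final_norm_eq:
 fixes F :: "'a::euclidean_space \<times> real => 'b::euclidean_space"
 assumes \<Omega>: "\<Omega> \<in> sets borel" and F': "version (\<Omega> \<times> {0<..<T}) F F'"
  and lim: "final_limit T F' g" and g: "g \<in> L2 lborel" "\<And>x. x \<notin> \<Omega> ==> g x = 0"
 shows "final_norm \<Omega> T F = nrm g"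
proof -
 have gv: "version \<Omega> g g" by (rule version_self[OF \<Omega> g])
 have fin: "has_final_value \<Omega> T F g"
  unfolding has_final_value_def
 proof (intro conjI allI impI versionD(1)[OF gv])
  fix \<epsilon> :: real assume "0 < \<epsilon>"
  then obtain \<tau> where \<tau>: "\<tau> \<in> {0..<T}" "AE t in lborel. \<tau> < t \<and> t < T -->
   (\<lambda>x. F' (x, t)) \<in> L2 lborel \<and> nrm (\<lambda>x. F' (x, t) - g x) < \<epsilon>"
   using lim unfolding final_limit_def by blast
  have "AE t in lborel. t \<in> {\<tau><..<T} --> (\<lambda>x. F (x, t)) \<in> L2 (lebesgue_on \<Omega>) \<and> norm_on \<Omega> (\<lambda>x. F (x, t) - g x) < \<epsilon>"
   using \<tau>(2) AE_slices(2)[OF versionD(5)[OF F']]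
  proof eventually_elim
   case (elim t)
   show ?case
   proof
    assume t: "t \<in> {\<tau><..<T}"
    have v: "version \<Omega> (\<lambda>x. F (x, t)) (\<lambda>x. F' (x, t))"
    proof (rule version_AE[OF \<Omega>])
     show "(\<lambda>x. F' (x, t)) \<in> L2 lborel" using elim(1) t by simp
     show "F' (x, t) = 0" if "x \<notin> \<Omega>" for x using that by (intro versionD(4)[OF F']) simp
     show "AE x in lborel. x \<in> \<Omega> --> F' (x, t) = F (x, t)"
     proof -
      have Q: "(x, t) \<in> \<Omega> \<times> {0<..<T} \<longleftrightarrow> x \<in> \<Omega>" for x using t \<tau>(1) by auto
      show ?thesis using elim(2) unfolding Q .
     qed
    qed
    show "(\<lambda>x. F (x, t)) \<in> L2 (lebesgue_on \<Omega>) \<and> norm_on \<Omega> (\<lambda>x. F (x, t) - g x) < \<epsilon>"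
     using versionD(1)[OF v] version_norm[OF \<Omega> version_diff[OF v gv]] elim(1) t by simp
   qed
  qed
  then have "AE t in lebesgue_on {\<tau><..<T}. (\<lambda>x. F (x, t)) \<in> L2 (lebesgue_on \<Omega>) \<and> norm_on \<Omega> (\<lambda>x. F (x, t) - g x) < \<epsilon>"
   by (rule iffD2[OF AE_lebesgue_on_iff, rotated]) simp
  then show "\<exists>\<tau>\<in>{0..<T}. AE t in lebesgue_on {\<tau><..<T}.
    (\<lambda>x. F (x, t)) \<in> L2 (lebesgue_on \<Omega>) \<and> norm_on \<Omega> (\<lambda>x. F (x, t) - g x) < \<epsilon>"
   using \<tau>(1) by blast
 qed
 have "norm_on \<Omega> (SOME k. has_final_value \<Omega> T F k) = norm_on \<Omega> g"
  by (rule has_final_value_unique[OF someI[of "has_final_value \<Omega> T F", OF fin] fin])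
 then show ?thesis by (simp add: final_norm_def version_norm[OF \<Omega> gv])
qed

subsection \<open>Scalar inequalities and minimisers\<close>

text \<open>As functions of \<open>\<alpha>\<close> or \<open>\<beta>\<close> alone, the right-hand sides have this form up to affine changes.\<close>

lemma weighted_sum_excess:
 fixes a b x :: real
 assumes "0 < x"
 shows "(1 + x) * a\<^sup>2 + (1 + 1 / x) * b\<^sup>2 = (a + b)\<^sup>2 + (a * x - b)\<^sup>2 / x"
 using assms by (simp add: power2_eq_square field_simps)

lemma power2_sum_le: "0 < x ==> (a + b)\<^sup>2 \<le> (1 + x) * a\<^sup>2 + (1 + 1 / x) * b\<^sup>2" for a b x :: real
 by (simp add: weighted_sum_excess)

text \<open>By the completed square the excess over (a + b)^2 is (a x - b)^2 / x, which vanishes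
  exactly at x = b / a.\<close>

lemma is_arg_min_weighted_sum:
 fixes a b c k :: real and F :: "real => real"
 assumes ab: "0 < a" "0 < b" and k: "0 < k"
  and F: "\<And>x. 0 < x ==> F x = c + k * ((1 + x) * a\<^sup>2 + (1 + 1 / x) * b\<^sup>2)"
 shows "is_arg_min F (\<lambda>x. 0 < x) x \<longleftrightarrow> x = b / a"
proof -
 have F': "F x = c + k * ((a + b)\<^sup>2 + (a * x - b)\<^sup>2 / x)" if "0 < x" for x
  using F[OF that] weighted_sum_excess[OF that, of a b] by simp
 have min: "F (b / a) = c + k * (a + b)\<^sup>2" "0 < b / a" using ab F'[of "b / a"] by simp_all
 have le: "F (b / a) \<le> F x" if "0 < x" for x using F'[OF that] min that k by simp
 have "x = b / a" if x: "0 < x" "F x \<le> F (b / a)" for x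
 proof -
  have "k * ((a * x - b)\<^sup>2 / x) \<le> 0" using F'[OF x(1)] min(1) x(2) by (simp add: algebra_simps)
  then have "(a * x - b)\<^sup>2 \<le> 0" using k x(1) by (simp add: mult_le_0_iff divide_le_0_iff)
  then show ?thesis using ab by (simp add: field_simps)
 qed
 then show ?thesis using le min(2) unfolding is_arg_min_def by (meson linorder_not_le)
qed

text \<open>The optimal \<beta> is the same for every \<alpha>, so a joint minimum is found by
  minimising in \<beta> first and then in \<alpha> at that \<beta>, even though the optimal \<alpha>
  may depend on \<beta>.\<close>

lemma is_arg_min_pair:
 fixes F :: "real => real => real"
 assumes \<beta>: "\<And>a b. 0 < a ==> is_arg_min (F a) (\<lambda>b. 0 < b) b \<longleftrightarrow> b = \<beta>\<^sub>0"
  and \<alpha>: "\<And>a b. 0 < b ==> is_arg_min (\<lambda>a. F a b) (\<lambda>a. 0 < a) a \<longleftrightarrow> a = \<alpha>\<^sub>0 b"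
 shows "is_arg_min (\<lambda>(a, b). F a b) (\<lambda>(a, b). 0 < a \<and> 0 < b) (\<alpha>, \<beta>) \<longleftrightarrow> \<beta> = \<beta>\<^sub>0 \<and> \<alpha> = \<alpha>\<^sub>0 \<beta>"
proof
 assume m: "is_arg_min (\<lambda>(a, b). F a b) (\<lambda>(a, b). 0 < a \<and> 0 < b) (\<alpha>, \<beta>)"
 then have "is_arg_min (F \<alpha>) (\<lambda>b. 0 < b) \<beta>" "is_arg_min (\<lambda>a. F a \<beta>) (\<lambda>a. 0 < a) \<alpha>" "0 < \<alpha>" "0 < \<beta>"
  by (auto simp: is_arg_min_def)
 then show "\<beta> = \<beta>\<^sub>0 \<and> \<alpha> = \<alpha>\<^sub>0 \<beta>" using \<alpha> \<beta> by blast
next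
 assume m: "\<beta> = \<beta>\<^sub>0 \<and> \<alpha> = \<alpha>\<^sub>0 \<beta>"
 have b: "is_arg_min (F a) (\<lambda>b. 0 < b) \<beta>\<^sub>0" if "0 < a" for a using \<beta>[OF that] by blast
 have \<beta>0: "0 < \<beta>\<^sub>0" using b[of 1] by (simp add: is_arg_min_def)
 have a: "is_arg_min (\<lambda>a. F a \<beta>\<^sub>0) (\<lambda>a. 0 < a) (\<alpha>\<^sub>0 \<beta>\<^sub>0)" using \<alpha>[OF \<beta>0] by blast
 have "F (\<alpha>\<^sub>0 \<beta>\<^sub>0) \<beta>\<^sub>0 \<le> F x y" if "0 < x" "0 < y" for x y
 proof -
  have "F (\<alpha>\<^sub>0 \<beta>\<^sub>0) \<beta>\<^sub>0 \<le> F x \<beta>\<^sub>0" using a that(1) by (simp add: is_arg_min_linorder)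
  also have "\<dots> \<le> F x y" using b[OF that(1)] that(2) by (simp add: is_arg_min_linorder)
  finally show ?thesis .
 qed
 then show "is_arg_min (\<lambda>(a, b). F a b) (\<lambda>(a, b). 0 < a \<and> 0 < b) (\<alpha>, \<beta>)"
  using m a \<beta>0 by (auto simp: is_arg_min_linorder)
qed

lemma Young:
 fixes a b \<gamma> :: real
 assumes "0 < \<gamma>" shows "2 * (a * b) \<le> a\<^sup>2 / \<gamma> + \<gamma> * b\<^sup>2"
proof -
 have "0 \<le> (a - \<gamma> * b)\<^sup>2 / \<gamma>" using assms by simp
 also have "\<dots> = a\<^sup>2 / \<gamma> + \<gamma> * b\<^sup>2 - 2 * (a * b)" using assms by (simp add: power2_eq_square field_simps)
 finally show ?thesis by simp
qed

text \<open>G, P, E, F stand for the norms of grad e, e_t, e(T) and grad e(T). Young's inequality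
  with one \<gamma> for both products returns 1/\<gamma> of G^2 + d P^2 to the left; the squares of
  the two residual sums are split afterwards with \<beta> and \<alpha>.\<close>

lemma majorant_I:
 fixes G P E F d C Rd Req Rdiv :: real
 assumes id: "2 * (G\<^sup>2 + d * P\<^sup>2) + E\<^sup>2 + d * F\<^sup>2 \<le> 2 * (G * (Rd + C * Req)) + 2 * d * (P * (Rdiv + Req))"
  and d: "0 \<le> d" and par: "1 / 2 \<le> \<gamma>" "0 < \<alpha>" "0 < \<beta>"
 shows "(2 - 1 / \<gamma>) * (G\<^sup>2 + d * P\<^sup>2) + E\<^sup>2 + d * F\<^sup>2
  \<le> \<gamma> * (((1 + \<beta>) * Rd\<^sup>2 + (1 + 1 / \<beta>) * C\<^sup>2 * Req\<^sup>2) + d * ((1 + \<alpha>) * Rdiv\<^sup>2 + (1 + 1 / \<alpha>) * Req\<^sup>2))"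
proof -
 have \<gamma>: "0 < \<gamma>" using par(1) by linarith
 let ?A = "Rd + C * Req" and ?B = "Rdiv + Req"
 have A: "?A\<^sup>2 \<le> (1 + \<beta>) * Rd\<^sup>2 + (1 + 1 / \<beta>) * C\<^sup>2 * Req\<^sup>2"
  using power2_sum_le[OF par(3), of Rd "C * Req"] by (simp add: power_mult_distrib mult.assoc)
 have B: "?B\<^sup>2 \<le> (1 + \<alpha>) * Rdiv\<^sup>2 + (1 + 1 / \<alpha>) * Req\<^sup>2" by (rule power2_sum_le[OF par(2)])
 have "2 * (G * ?A) + 2 * d * (P * ?B) \<le> (G\<^sup>2 / \<gamma> + \<gamma> * ?A\<^sup>2) + d * (P\<^sup>2 / \<gamma> + \<gamma> * ?B\<^sup>2)"
  using Young[OF \<gamma>, of G ?A] mult_left_mono[OF Young[OF \<gamma>, of P ?B] d] by simp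
 also have "\<dots> = 1 / \<gamma> * (G\<^sup>2 + d * P\<^sup>2) + \<gamma> * (?A\<^sup>2 + d * ?B\<^sup>2)" by (simp add: algebra_simps)
 also have "\<gamma> * (?A\<^sup>2 + d * ?B\<^sup>2) \<le> \<gamma> * (((1 + \<beta>) * Rd\<^sup>2 + (1 + 1 / \<beta>) * C\<^sup>2 * Req\<^sup>2) + d * ((1 + \<alpha>) * Rdiv\<^sup>2 + (1 + 1 / \<alpha>) * Req\<^sup>2))"
  using \<gamma> by (intro mult_left_mono add_mono A B d) simp
 finally show ?thesis using id by (simp add: algebra_simps)
qed

text \<open>The product at the final time is absorbed separately with \<epsilon>. In the sum of
  three residuals \<alpha> splits off the time derivative first and \<beta> divides the rest, which
  places the \<beta>-majorant inside the factor 1 + \<alpha>.\<close>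

lemma majorant_II:
 fixes G P E F d C Rd Req Rdt RT :: real
 assumes id: "2 * (G\<^sup>2 + d * P\<^sup>2) + E\<^sup>2 + d * F\<^sup>2 \<le> 2 * (G * (Rd + C * Req + d * Rdt)) + 2 * d * (P * Req) + 2 * d * (RT * F)"
  and d: "0 \<le> d" and par: "1 / 2 \<le> \<xi>" "1 \<le> \<epsilon>" "0 < \<alpha>" "0 < \<beta>"
 shows "(2 - 1 / \<xi>) * (G\<^sup>2 + d * P\<^sup>2) + d * (1 - 1 / \<epsilon>) * F\<^sup>2 + E\<^sup>2
  \<le> \<epsilon> * d * RT\<^sup>2 + \<xi> * ((1 + \<alpha>) * ((1 + \<beta>) * Rd\<^sup>2 + (1 + 1 / \<beta>) * C\<^sup>2 * Req\<^sup>2) + (1 + 1 / \<alpha>) * d\<^sup>2 * Rdt\<^sup>2 + d * Req\<^sup>2)"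
proof -
 have \<xi>: "0 < \<xi>" and \<epsilon>: "0 < \<epsilon>" using par(1,2) by linarith+
 let ?A = "Rd + C * Req" let ?B = "?A + d * Rdt"
 have A: "?A\<^sup>2 \<le> (1 + \<beta>) * Rd\<^sup>2 + (1 + 1 / \<beta>) * C\<^sup>2 * Req\<^sup>2"
  using power2_sum_le[OF par(4), of Rd "C * Req"] by (simp add: power_mult_distrib mult.assoc)
 have "?B\<^sup>2 \<le> (1 + \<alpha>) * ?A\<^sup>2 + (1 + 1 / \<alpha>) * (d * Rdt)\<^sup>2" by (rule power2_sum_le[OF par(3)])
 also have "\<dots> \<le> (1 + \<alpha>) * ((1 + \<beta>) * Rd\<^sup>2 + (1 + 1 / \<beta>) * C\<^sup>2 * Req\<^sup>2) + (1 + 1 / \<alpha>) * d\<^sup>2 * Rdt\<^sup>2"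
  using mult_left_mono[OF A, of "1 + \<alpha>"] par(3) by (simp add: power_mult_distrib)
 finally have B: "?B\<^sup>2 \<le> (1 + \<alpha>) * ((1 + \<beta>) * Rd\<^sup>2 + (1 + 1 / \<beta>) * C\<^sup>2 * Req\<^sup>2) + (1 + 1 / \<alpha>) * d\<^sup>2 * Rdt\<^sup>2" .
 have Y: "2 * (RT * F) \<le> F\<^sup>2 / \<epsilon> + \<epsilon> * RT\<^sup>2" using Young[OF \<epsilon>, of F RT] by (simp add: mult.commute)
 have "2 * (G * ?B) + 2 * d * (P * Req) + 2 * d * (RT * F)
  \<le> (G\<^sup>2 / \<xi> + \<xi> * ?B\<^sup>2) + d * (P\<^sup>2 / \<xi> + \<xi> * Req\<^sup>2) + d * (F\<^sup>2 / \<epsilon> + \<epsilon> * RT\<^sup>2)"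
  using Young[OF \<xi>, of G ?B] mult_left_mono[OF Young[OF \<xi>, of P Req] d] mult_left_mono[OF Y d] by simp
 also have "\<dots> = 1 / \<xi> * (G\<^sup>2 + d * P\<^sup>2) + d * (F\<^sup>2 / \<epsilon>) + \<epsilon> * d * RT\<^sup>2 + \<xi> * (?B\<^sup>2 + d * Req\<^sup>2)" by (simp add: algebra_simps)
 also have "\<xi> * (?B\<^sup>2 + d * Req\<^sup>2) \<le> \<xi> * ((1 + \<alpha>) * ((1 + \<beta>) * Rd\<^sup>2 + (1 + 1 / \<beta>) * C\<^sup>2 * Req\<^sup>2) + (1 + 1 / \<alpha>) * d\<^sup>2 * Rdt\<^sup>2 + d * Req\<^sup>2)"
  using \<xi> B by simp
 finally show ?thesis using id by (simp add: algebra_simps)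
qed

subsection \<open>The error equation\<close>

lemma C1_diff:
 assumes "C1 \<phi>" "C1 \<psi>"
 shows "C1 (\<lambda>z. \<phi> z - \<psi> z)"
  "\<D> (\<lambda>z. \<phi> z - \<psi> z) z = (\<lambda>v. \<D> \<phi> z v - \<D> \<psi> z v)"
proof -
 note d = has_derivative_diff[OF C1_has_derivative[OF assms(1)] C1_has_derivative[OF assms(2)]]
 show "C1 (\<lambda>z. \<phi> z - \<psi> z)"
  "\<D> (\<lambda>z. \<phi> z - \<psi> z) z = (\<lambda>v. \<D> \<phi> z v - \<D> \<psi> z v)"
  by (rule C1I[OF d]; intro continuous_on_diff C1_continuous_deriv assms)+
qed

lemma has_trace_diff:
 assumes Q: "open Q" and 1: "has_trace Q D M w a" and 2: "has_trace Q D M v b"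
 shows "has_trace Q D M (\<lambda>z. w z - v z) (\<lambda>z. a z - b z)"
proof -
 obtain W where W: "\<forall>k. C1 (W k)" "L2_lim (lebesgue_on Q) W w" "L2_lim M W a"
  "\<forall>b\<in>D. \<exists>p. has_weak_deriv Q b w p \<and> L2_lim (lebesgue_on Q) (\<lambda>k z. \<D> (W k) z b) p"
  using 1 unfolding has_trace_def by blast
 obtain V where V: "\<forall>k. C1 (V k)" "L2_lim (lebesgue_on Q) V v" "L2_lim M V b"
  "\<forall>b\<in>D. \<exists>p. has_weak_deriv Q b v p \<and> L2_lim (lebesgue_on Q) (\<lambda>k z. \<D> (V k) z b) p"
  using 2 unfolding has_trace_def by blast
 have "\<exists>p. has_weak_deriv Q d (\<lambda>z. w z - v z) p \<and>
  L2_lim (lebesgue_on Q) (\<lambda>k z. \<D> (\<lambda>z. W k z - V k z) z d) p" if d: "d \<in> D" for d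
 proof -
  obtain p p' where "has_weak_deriv Q d w p" "L2_lim (lebesgue_on Q) (\<lambda>k z. \<D> (W k) z d) p"
   "has_weak_deriv Q d v p'" "L2_lim (lebesgue_on Q) (\<lambda>k z. \<D> (V k) z d) p'"
   using W(4) V(4) d by blast
  then show ?thesis
   using weak_deriv_diff[OF Q] L2_lim_diff W(1) V(1)
   by (intro exI[of _ "\<lambda>z. p z - p' z"]) (fastforce simp: C1_diff(2))
 qed
 then show ?thesis
  unfolding has_trace_def using W V C1_diff(1) L2_lim_diff
  by (intro exI[of _ "\<lambda>k z. W k z - V k z"]) blast
qed

lemma div_cong:
 assumes Q: "Q \<in> sets borel" and 1: "has_div_x Q y q" and x: "x \<in> L2 (lebesgue_on Q)" "AE z in lebesgue_on Q. y z = x z"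
 shows "has_div_x Q x q"
proof -
 have y: "version Q y (repr Q y)" and q: "version Q q (repr Q q)"
  by (intro version_repr Q div_L2(1)[OF 1] div_L2(2)[OF 1])+
 show ?thesis
  using 1 div_version[OF Q y q] div_version[OF Q version_cong[OF Q y x] q] by blast
qed

lemma V_lapD:
 assumes w: "w \<in> V_lap \<Omega> T" and Q: "Q = \<Omega> \<times> {0<..<T}"
 shows "has_grad_x Q w (grad_x Q w)" "has_dt Q w (dt Q w)" "has_div_x Q (grad_x Q w) (lap_x Q w)"
  "zero_lateral \<Omega> T w" "zero_initial \<Omega> T w" "w \<in> H10_0 \<Omega> T"
 using w grad_x_D dt_D div_x_D unfolding V_lap_def V1_0_def H10_0_def lap_x_def Q by blast+

text \<open>The chosen derivatives of a difference agree with the differences of the chosen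
  derivatives only almost everywhere. For the Laplacian the divergence is first carried over to the
  chosen gradient by \<open>div_cong\<close>.\<close>

lemma V_lap_diff:
 fixes \<Omega> :: "'a::euclidean_space set"
 assumes \<Omega>: "open \<Omega>" and w: "w \<in> V_lap \<Omega> T" and v: "v \<in> V_lap \<Omega> T" and Q: "Q = \<Omega> \<times> {0<..<T}"
 shows "(\<lambda>z. w z - v z) \<in> V_lap \<Omega> T"
  "AE z in lebesgue_on Q. dt Q (\<lambda>z. w z - v z) z = dt Q w z - dt Q v z"
  "AE z in lebesgue_on Q. lap_x Q (\<lambda>z. w z - v z) z = lap_x Q w z - lap_x Q v z"
proof -
 let ?e = "\<lambda>z. w z - v z"
 have Qo: "open Q" unfolding Q using \<Omega> by (intro open_Times) auto
 have Qb: "Q \<in> sets borel" using Qo by simp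
 note W = V_lapD[OF w Q] and V = V_lapD[OF v Q]
 have g: "has_grad_x Q ?e (\<lambda>z. grad_x Q w z - grad_x Q v z)" by (rule grad_diff[OF Qo W(1) V(1)])
 have p: "has_dt Q ?e (\<lambda>z. dt Q w z - dt Q v z)" by (rule weak_deriv_diff[OF Qo W(2) V(2)])
 note ge = grad_x_D[OF g]
 have q: "has_div_x Q (grad_x Q ?e) (\<lambda>z. lap_x Q w z - lap_x Q v z)"
  by (rule div_cong[OF Qb div_diff[OF Qo W(3) V(3)] grad_L2(1)[OF ge] grad_unique[OF Qo g ge]])
 have "zero_lateral \<Omega> T ?e" "zero_initial \<Omega> T ?e"
  using has_trace_diff[OF Qo W(4)[unfolded zero_lateral_def, folded Q] V(4)[unfolded zero_lateral_def, folded Q]]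
   has_trace_diff[OF Qo W(5)[unfolded zero_initial_def, folded Q] V(5)[unfolded zero_initial_def, folded Q]]
  by (simp_all add: zero_lateral_def zero_initial_def Q)
 then show e: "?e \<in> V_lap \<Omega> T" using g p q unfolding V_lap_def V1_0_def Q by blast
 show "AE z in lebesgue_on Q. dt Q ?e z = dt Q w z - dt Q v z"
  by (rule weak_deriv_unique[OF Qo V_lapD(2)[OF e Q] p])
 show "AE z in lebesgue_on Q. lap_x Q ?e z = lap_x Q w z - lap_x Q v z"
  by (rule div_unique[OF Qo V_lapD(3)[OF e Q] q])
qed

text \<open>The passage from function spaces to representatives: the initial trace makes w the
  primitive of its time derivative, the lateral trace makes its gradient global, and the Laplacian
  becomes a slab divergence.\<close>

lemma V_lap_evolution:
 fixes \<Omega> :: "'a::euclidean_space set"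
 assumes \<Omega>: "bounded_lipschitz_domain \<Omega>" and T: "0 < T" and w: "w \<in> V_lap \<Omega> T" and Q: "Q = \<Omega> \<times> {0<..<T}"
  and p: "version Q (dt Q w) p" and g: "version Q (grad_x Q w) g" and q: "version Q (lap_x Q w) q"
 shows "version Q w (before T (tint p))" "evolution \<Omega> T (before T (tint p)) p q g"
proof -
 have \<Omega>o: "open \<Omega>" using \<Omega> by (simp add: bounded_lipschitz_domain_def)
 have Qb: "Q \<in> sets borel" unfolding Q using \<Omega>o by (intro borel_open open_Times) auto
 note W = V_lapD[OF w Q]
 have r: "version Q w (repr Q w)" by (rule version_repr[OF Qb grad_L2(2)[OF W(1)]])
 have pT: "timed T p" "timed T g" "timed T q"
  using versionD(2,4)[OF p] versionD(2,4)[OF g] versionD(2,4)[OF q] by (auto simp: timed_def Q)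
 have 0: "before T (tint p) z = 0" if "z \<notin> Q" for z
  using before_tint_0[OF pT(1), of z \<Omega>] that versionD(4)[OF p] by (auto simp: Q)
 show v: "version Q w (before T (tint p))"
 proof (rule version_change[OF r])
  show "before T (tint p) \<in> L2 lborel" using before_tint_L2(1)[OF pT(1), of T] T by simp
  show "AE z in lborel. repr Q w z = before T (tint p) z"
   using zero_initial_tint[OF \<Omega>o T W(5) W(2)[unfolded Q] r[unfolded Q] p[unfolded Q]] by (simp add: Q)
 qed (rule 0)
 show "evolution \<Omega> T (before T (tint p)) p q g"
 proof
  show "global_grad (before T (tint p)) g"
   by (rule zero_lateral_global_grad[OF \<Omega> W(4) W(1)[unfolded Q] v[unfolded Q] g[unfolded Q]])
  show "slab_div \<Omega> g q"
   by (rule slab_div_version[OF \<Omega>o W(3)[unfolded Q] g[unfolded Q] q[unfolded Q]])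
  show "p z = 0" if "fst z \<notin> \<Omega>" for z using that versionD(4)[OF p, of z] by (cases z) (auto simp: Q)
  show "g z = 0" if "fst z \<notin> \<Omega>" for z using that versionD(4)[OF g, of z] by (cases z) (auto simp: Q)
 qed (use \<Omega> T pT in auto)
qed

section \<open>Energy balance and residual estimates for the error\<close>

locale heat_error =
 fixes \<Omega> :: "'a::euclidean_space set" and T :: real and Q :: "('a \<times> real) set"
  and f u v :: "'a \<times> real => real" and y :: "'a \<times> real => 'a"
 assumes \<Omega>: "bounded_lipschitz_domain \<Omega>" and T: "0 < T" and Q: "Q = \<Omega> \<times> {0<..<T}"
  and f: "f \<in> L2 (lebesgue_on Q)" and u: "u \<in> V_lap \<Omega> T"
  and heat: "AE z in lebesgue_on Q. dt Q u z - lap_x Q u z = f z"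
  and v: "v \<in> V_lap \<Omega> T" and y: "y \<in> Hdiv0 Q"
begin

abbreviation e :: "'a \<times> real => real" where "e \<equiv> \<lambda>z. u z - v z"
definition p :: "'a \<times> real => real" where "p = repr Q (dt Q e)"
definition g :: "'a \<times> real => 'a" where "g = repr Q (grad_x Q e)"
definition q :: "'a \<times> real => real" where "q = repr Q (lap_x Q e)"
text \<open>Not \<open>repr Q e\<close>: this representative of e is literally the primitive of
  \<open>p\<close>, as \<open>evolution\<close> demands.\<close>

definition w :: "'a \<times> real => real" where "w = before T (tint p)"
definition r :: "'a \<times> real => 'a" where "r = repr Q (r_d Q v y)"
definition s :: "'a \<times> real => real" where "s = repr Q (div_x Q (r_d Q v y))"
definition k :: "'a \<times> real => real" where "k = repr Q (r_eq Q f v y)"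

lemma \<Omega>o: "open \<Omega>" using \<Omega> by (simp add: bounded_lipschitz_domain_def)
lemma Qo: "open Q" unfolding Q using \<Omega>o by (intro open_Times) auto
lemmas final_norm_Q = final_norm_eq[where \<Omega> = \<Omega> and T = T, folded Q]
lemmas slab_div_Q = slab_div_version[where \<Omega> = \<Omega> and T = T, folded Q]
lemma Qb: "Q \<in> sets borel" using Qo by simp

lemmas E = V_lap_diff[OF \<Omega>o u v Q]
lemmas eD = V_lapD[OF E(1) Q]
lemmas vD = V_lapD[OF v Q]

lemma y_div: "has_div_x Q y (div_x Q y)"
 using y div_x_D by (auto simp: Hdiv0_def)

lemma rd: "has_div_x Q (r_d Q v y) (\<lambda>z. div_x Q y z - lap_x Q v z)"
 unfolding r_d_def by (rule div_diff[OF Qo y_div vD(3)])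

lemma versions: "version Q (dt Q e) p" "version Q (grad_x Q e) g" "version Q (lap_x Q e) q"
 "version Q (r_d Q v y) r" "version Q (div_x Q (r_d Q v y)) s" "version Q (r_eq Q f v y) k"
 unfolding p_def g_def q_def r_def s_def k_def r_eq_def
 by (intro version_repr Qb weak_deriv_L2(2)[OF eD(2)] grad_L2(1)[OF eD(1)] div_L2[OF eD(3)] div_L2[OF div_x_D[OF rd]]
  L2_add L2_diff f weak_deriv_L2(2)[OF vD(2)] div_L2(2)[OF y_div] div_L2(1)[OF rd])+

lemma w_version: "version Q e w"
 unfolding w_def by (rule V_lap_evolution(1)[OF \<Omega> T E(1) Q versions(1-3)])

sublocale ev: evolution \<Omega> T w p q g
 unfolding w_def by (rule V_lap_evolution(2)[OF \<Omega> T E(1) Q versions(1-3)])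

lemmas L = versionD(2)[OF versions(1)] versionD(2)[OF versions(2)] versionD(2)[OF versions(3)]
 versionD(2)[OF versions(4)] versionD(2)[OF versions(5)] versionD(2)[OF versions(6)] versionD(2)[OF w_version]

lemma rT: "timed T r" "timed T s"
 using versionD(2,4)[OF versions(4)] versionD(2,4)[OF versions(5)] by (auto simp: timed_def Q)

lemma rs: "slab_div \<Omega> r s"
 by (rule slab_div_Q[OF \<Omega>o div_x_D[OF rd] versions(4,5)])

lemma error_equation: "AE z in lborel. p z = q z + k z - s z"
proof -
 have "AE z in lebesgue_on Q. dt Q e z = lap_x Q e z + r_eq Q f v y z - div_x Q (r_d Q v y) z"
  using E(2,3) heat div_unique[OF Qo rd div_x_D[OF rd]] by eventually_elim (simp add: r_eq_def)
 then have "AE z in lborel. z \<in> Q --> dt Q e z = lap_x Q e z + r_eq Q f v y z - div_x Q (r_d Q v y) z"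
  by (simp add: AE_lebesgue_on_iff[OF Qb])
 then show ?thesis
  using versionD(5)[OF versions(1)] versionD(5)[OF versions(3)] versionD(5)[OF versions(5)] versionD(5)[OF versions(6)]
 proof eventually_elim
  case (elim z)
  then show ?case
   using versionD(4)[OF versions(1), of z] versionD(4)[OF versions(3), of z] versionD(4)[OF versions(5), of z] versionD(4)[OF versions(6), of z]
   by (cases "z \<in> Q") auto
 qed
qed

lemma test_error:
 assumes h: "h \<in> L2 lborel"
 shows "(LBINT z. p z * h z) = (LBINT z. q z * h z) + (LBINT z. k z * h z) - (LBINT z. s z * h z)"
proof -
 note I = L2_mult_integrable[OF L(1) h] L2_mult_integrable[OF L(3) h] L2_mult_integrable[OF L(5) h] L2_mult_integrable[OF L(6) h]
 have "(LBINT z. p z * h z) = (LBINT z. q z * h z + k z * h z - s z * h z)"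
 proof (rule integral_cong_AE)
  show "AE z in lborel. p z * h z = q z * h z + k z * h z - s z * h z"
   using error_equation by eventually_elim (simp only: left_diff_distrib distrib_right)
 qed (intro borel_measurable_integrable integrable_plus integrable_minus I)+
 then show ?thesis using I by simp
qed

text \<open>Testing with w, \<open>green_e\<close> turns the q-term into minus the squared gradient
  norm and moves the divergence s onto the gradient, while the left side is half the final square.
  Testing with p, the q-term is minus half the squared norm of the final gradient, by
  \<open>ev.final_gradient\<close>; there s is kept, to be treated differently in the two
  estimates.\<close>

lemma energy_balance:
 obtains \<gamma> where "\<gamma> \<in> L2 lborel" "L2_lim lborel (\<lambda>n x. tint (ev.P n) (x, T)) \<gamma>"
  "final_norm \<Omega> T (grad_x Q e) = nrm \<gamma>"
  "(final_norm \<Omega> T e)\<^sup>2 + 2 * (norm_on Q (grad_x Q e))\<^sup>2 = 2 * ((LBINT z. k z * w z) + (LBINT z. r z \<bullet> g z))"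
  "(final_norm \<Omega> T (grad_x Q e))\<^sup>2 + 2 * (norm_on Q (dt Q e))\<^sup>2 = 2 * ((LBINT z. k z * p z) - (LBINT z. p z * s z))"
proof -
 obtain \<gamma> where \<gamma>: "\<gamma> \<in> L2 lborel" "\<And>x. x \<notin> \<Omega> ==> \<gamma> x = 0" "L2_lim lborel (\<lambda>n x. tint (ev.P n) (x, T)) \<gamma>"
  "final_limit T g \<gamma>" "(nrm \<gamma>)\<^sup>2 = - 2 * (LBINT z. p z * q z)"
  by (rule ev.final_gradient) blast
 have \<Omega>b: "\<Omega> \<in> sets borel" using \<Omega>o by simp
 have F: "final_norm \<Omega> T (grad_x Q e) = nrm \<gamma>"
  by (rule final_norm_Q[OF \<Omega>b versions(2) \<gamma>(4,1,2)])
 have "final_norm \<Omega> T e = slice_norm (tint p) T"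
 proof (rule final_norm_Q[OF \<Omega>b w_version ev.final_value(1)])
  show "(\<lambda>x. tint p (x, T)) \<in> L2 lborel" by (rule tint_slice(1)[OF ev.p])
  show "tint p (x, T) = 0" if "x \<notin> \<Omega>" for x using that by (simp add: tint_def ev.p_0)
 qed
 then have "(final_norm \<Omega> T e)\<^sup>2 = 2 * (LBINT z. p z * w z)" by (simp only: ev.final_value(2))
 moreover have "(LBINT z. r z \<bullet> g z) = - (LBINT z. s z * w z)"
  using ev.green_e[OF rs] by (simp only: timed_before[OF rT(1), THEN fun_cong] timed_before[OF rT(2), THEN fun_cong])
 moreover have "(norm_on Q (grad_x Q e))\<^sup>2 = - (LBINT z. q z * w z)"
  using ev.green_e[OF ev.gq] by (simp only: timed_before[OF ev.g, THEN fun_cong] timed_before[OF ev.q, THEN fun_cong]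
    version_norm[OF Qb versions(2)] L2_norm_power2 power2_norm_eq_inner)
 ultimately have 1: "(final_norm \<Omega> T e)\<^sup>2 + 2 * (norm_on Q (grad_x Q e))\<^sup>2 = 2 * ((LBINT z. k z * w z) + (LBINT z. r z \<bullet> g z))"
  using test_error[OF L(7)] by simp
 have "(norm_on Q (dt Q e))\<^sup>2 = (LBINT z. p z * p z)"
  unfolding version_norm[OF Qb versions(1)] L2_norm_power2 by (simp add: power2_eq_square)
 then have 2: "(final_norm \<Omega> T (grad_x Q e))\<^sup>2 + 2 * (norm_on Q (dt Q e))\<^sup>2 = 2 * ((LBINT z. k z * p z) - (LBINT z. p z * s z))"
  using test_error[OF L(1)] \<gamma>(5) by (simp add: F mult.commute)
 show ?thesis by (rule that[OF \<gamma>(1,3) F 1 2])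
qed

lemma norm_eqs:
 "norm_on Q e = nrm w" "norm_on Q (dt Q e) = nrm p" "norm_on Q (grad_x Q e) = nrm g"
 "norm_on Q (r_d Q v y) = nrm r" "norm_on Q (div_x Q (r_d Q v y)) = nrm s"
 "norm_on Q (r_eq Q f v y) = nrm k"
 by (intro version_norm Qb w_version versions)+

lemma inner_le: "a \<in> L2 lborel ==> b \<in> L2 lborel ==> (LBINT z. a z \<bullet> b z) \<le> nrm a * nrm b"
 using L2_Cauchy_Schwarz[of a lborel b] by simp

lemma neg_inner_le: "a \<in> L2 lborel ==> b \<in> L2 lborel ==> - (LBINT z. a z \<bullet> b z) \<le> nrm a * nrm b"
 using L2_Cauchy_Schwarz[of a lborel b] by simp

context
 fixes C d :: real
 assumes C: "norm_on Q e \<le> C * norm_on Q (grad_x Q e)" and d: "0 \<le> d"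
begin

lemma residual_le:
 "(LBINT z. k z * w z) + (LBINT z. r z \<bullet> g z) \<le> norm_on Q (grad_x Q e) * (norm_on Q (r_d Q v y) + C * norm_on Q (r_eq Q f v y))"
 "(LBINT z. k z * p z) \<le> norm_on Q (dt Q e) * norm_on Q (r_eq Q f v y)"
proof -
 have "(LBINT z. k z * w z) \<le> norm_on Q (r_eq Q f v y) * (C * norm_on Q (grad_x Q e))"
  using inner_le[OF L(6) L(7)] mult_left_mono[OF C L2_norm_nonneg, of "lebesgue_on Q" "r_eq Q f v y"] by (simp add: norm_eqs)
 then show "(LBINT z. k z * w z) + (LBINT z. r z \<bullet> g z) \<le> norm_on Q (grad_x Q e) * (norm_on Q (r_d Q v y) + C * norm_on Q (r_eq Q f v y))"
  using inner_le[OF L(4) L(2)] by (simp add: norm_eqs algebra_simps)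
 show "(LBINT z. k z * p z) \<le> norm_on Q (dt Q e) * norm_on Q (r_eq Q f v y)"
  using inner_le[OF L(6) L(1)] by (simp add: norm_eqs mult.commute)
qed

lemma estimate_I:
 "2 * ((norm_on Q (grad_x Q e))\<^sup>2 + d * (norm_on Q (dt Q e))\<^sup>2) + (final_norm \<Omega> T e)\<^sup>2 + d * (final_norm \<Omega> T (grad_x Q e))\<^sup>2
  \<le> 2 * (norm_on Q (grad_x Q e) * (norm_on Q (r_d Q v y) + C * norm_on Q (r_eq Q f v y)))
   + 2 * d * (norm_on Q (dt Q e) * (norm_on Q (div_x Q (r_d Q v y)) + norm_on Q (r_eq Q f v y)))"
proof -
 obtain \<gamma> where 1: "(final_norm \<Omega> T e)\<^sup>2 + 2 * (norm_on Q (grad_x Q e))\<^sup>2 = 2 * ((LBINT z. k z * w z) + (LBINT z. r z \<bullet> g z))"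
  and 2: "(final_norm \<Omega> T (grad_x Q e))\<^sup>2 + 2 * (norm_on Q (dt Q e))\<^sup>2 = 2 * ((LBINT z. k z * p z) - (LBINT z. p z * s z))"
  by (rule energy_balance)
 have "(final_norm \<Omega> T (grad_x Q e))\<^sup>2 + 2 * (norm_on Q (dt Q e))\<^sup>2
  \<le> 2 * (norm_on Q (dt Q e) * (norm_on Q (div_x Q (r_d Q v y)) + norm_on Q (r_eq Q f v y)))"
  using 2 residual_le(2) neg_inner_le[OF L(1) L(5)] by (simp add: norm_eqs algebra_simps)
 from mult_left_mono[OF this d] show ?thesis using 1 residual_le(1) by (simp add: algebra_simps)
qed

lemma error_majorant_I:
 assumes "1 / 2 \<le> \<gamma>" "0 < \<alpha>" "0 < \<beta>"
 shows "(2 - 1 / \<gamma>) * ((norm_on Q (grad_x Q e))\<^sup>2 + d * (norm_on Q (dt Q e))\<^sup>2)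
  + (final_norm \<Omega> T e)\<^sup>2 + d * (final_norm \<Omega> T (grad_x Q e))\<^sup>2 \<le> rhs1 Q f C d v y \<gamma> \<alpha> \<beta>"
 unfolding rhs1_def M_bar_def M_tilde_def by (rule majorant_I[OF estimate_I d assms])

text \<open>The extra regularity gives r_d a weak time derivative, so its representative is an
  initial value plus a primitive and \<open>green_time\<close> rewrites the term with s. The balance
  for e_t is then multiplied by d and added to the balance for e.\<close>

lemma estimate_II:
 assumes vg: "v \<in> V_grad_dt \<Omega> T" and y1: "y \<in> Hdiv1 Q"
 shows "2 * ((norm_on Q (grad_x Q e))\<^sup>2 + d * (norm_on Q (dt Q e))\<^sup>2) + (final_norm \<Omega> T e)\<^sup>2 + d * (final_norm \<Omega> T (grad_x Q e))\<^sup>2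
  \<le> 2 * (norm_on Q (grad_x Q e) * (norm_on Q (r_d Q v y) + C * norm_on Q (r_eq Q f v y) + d * norm_on Q (dt Q (r_d Q v y))))
   + 2 * d * (norm_on Q (dt Q e) * norm_on Q (r_eq Q f v y)) + 2 * d * (final_norm \<Omega> T (r_d Q v y) * final_norm \<Omega> T (grad_x Q e))"
proof -
 obtain \<gamma> where \<gamma>: "\<gamma> \<in> L2 lborel" "L2_lim lborel (\<lambda>n x. tint (ev.P n) (x, T)) \<gamma>" "final_norm \<Omega> T (grad_x Q e) = nrm \<gamma>"
  and 1: "(final_norm \<Omega> T e)\<^sup>2 + 2 * (norm_on Q (grad_x Q e))\<^sup>2 = 2 * ((LBINT z. k z * w z) + (LBINT z. r z \<bullet> g z))"
  and 2: "(final_norm \<Omega> T (grad_x Q e))\<^sup>2 + 2 * (norm_on Q (dt Q e))\<^sup>2 = 2 * ((LBINT z. k z * p z) - (LBINT z. p z * s z))"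
  by (rule energy_balance)
 obtain g\<^sub>v where gv: "has_grad_x Q (dt Q v) g\<^sub>v" using vg by (auto simp: V_grad_dt_def Q)
 have vv: "version Q (dt Q v) (repr Q (dt Q v))" "version Q (grad_x Q v) (repr Q (grad_x Q v))" "version Q (lap_x Q v) (repr Q (lap_x Q v))"
  by (intro version_repr Qb weak_deriv_L2(2)[OF vD(2)] grad_L2(1)[OF vD(1)] div_L2(2)[OF vD(3)])+
 \<comment> \<open>The space of v provides the gradient of a time derivative, whereas r_d calls for
   the time derivative of a gradient.\<close>
 have "has_dt Q (grad_x Q v) g\<^sub>v"
  by (rule grad_x_dt_commute[OF \<Omega>o T Q vD(1) gv V_lap_evolution(1)[OF \<Omega> T v Q vv] vv(1)]) simp
 moreover have "has_dt Q y (dt Q y)" using y1 dt_D by (auto simp: Hdiv1_def)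
 ultimately have "has_dt Q (r_d Q v y) (\<lambda>z. dt Q y z - g\<^sub>v z)" unfolding r_d_def by (intro weak_deriv_diff Qo)
 note rt = dt_D[OF this]
 define R where "R = repr Q (dt Q (r_d Q v y))"
 have Rv: "version Q (dt Q (r_d Q v y)) R" unfolding R_def by (intro version_repr Qb weak_deriv_L2(2)[OF rt])
 have RT: "timed T R" using versionD(2,4)[OF Rv] by (auto simp: timed_def Q)
 have r0: "r z = 0" "R z = 0" if "z \<notin> \<Omega> \<times> {0<..<T}" for z
  using that versionD(4)[OF versions(4)] versionD(4)[OF Rv] by (auto simp: Q)
 have weak: "(LBINT z. \<D> \<phi> z (0, 1) *\<^sub>R r z + \<phi> z *\<^sub>R R z) = 0" if "\<phi> \<in> test_fun (\<Omega> \<times> {0<..<T})" for \<phi>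
  using rt weak_deriv_version[OF Qb versions(4) Rv] that by (simp add: Q)
 obtain c where c: "c \<in> L2 lborel" "\<And>x. x \<notin> \<Omega> ==> c x = 0" "AE z in lborel. 0 < snd z \<and> snd z < T --> r z = c (fst z) + tint R z"
  by (rule weak_dt_primitive[OF \<Omega>o T L(4) r0(1) versionD(2)[OF Rv] r0(2) weak]) blast+
 have cL: "(\<lambda>x. c x + tint R (x, T)) \<in> L2 lborel" by (intro L2_add c tint_slice(1)[OF RT])
 have "final_norm \<Omega> T (r_d Q v y) = nrm (\<lambda>x. c x + tint R (x, T))"
 proof (rule final_norm_Q[OF _ versions(4) final_limit_tint[OF T RT c(1) L(4) c(3)] cL])
  show "\<Omega> \<in> sets borel" using \<Omega>o by simp
  show "c x + tint R (x, T) = 0" if "x \<notin> \<Omega>" for x using that c(2) r0(2) by (simp add: tint_def)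
 qed
 then have dts: "- (LBINT z. p z * s z) \<le> norm_on Q (dt Q (r_d Q v y)) * norm_on Q (grad_x Q e) + final_norm \<Omega> T (r_d Q v y) * final_norm \<Omega> T (grad_x Q e)"
  using ev.green_time[OF \<gamma>(2) rs c(1) RT c(3)] neg_inner_le[OF versionD(2)[OF Rv] L(2)] L2_Cauchy_Schwarz[OF cL \<gamma>(1)]
  by (simp add: norm_eqs version_norm[OF Qb Rv] \<gamma>(3))
 have "(final_norm \<Omega> T (grad_x Q e))\<^sup>2 + 2 * (norm_on Q (dt Q e))\<^sup>2
  \<le> 2 * (norm_on Q (dt Q e) * norm_on Q (r_eq Q f v y) + norm_on Q (dt Q (r_d Q v y)) * norm_on Q (grad_x Q e) + final_norm \<Omega> T (r_d Q v y) * final_norm \<Omega> T (grad_x Q e))"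
 proof -
  have "X \<le> 2 * (a + b + c)" if "- i \<le> b + c" "X = 2 * (j - i)" "j \<le> a" for X a b c i j :: real using that by simp
  from this[OF dts 2 residual_le(2)] show ?thesis .
 qed
 from mult_left_mono[OF this d] show ?thesis using 1 residual_le(1) by (simp add: algebra_simps)
qed

lemma error_majorant_II:
 assumes "v \<in> V_grad_dt \<Omega> T" "y \<in> Hdiv1 Q" "1 / 2 \<le> \<xi>" "1 \<le> \<epsilon>" "0 < \<alpha>" "0 < \<beta>"
 shows "(2 - 1 / \<xi>) * ((norm_on Q (grad_x Q e))\<^sup>2 + d * (norm_on Q (dt Q e))\<^sup>2)
  + d * (1 - 1 / \<epsilon>) * (final_norm \<Omega> T (grad_x Q e))\<^sup>2 + (final_norm \<Omega> T e)\<^sup>2 \<le> rhs2 \<Omega> T f C d v y \<xi> \<epsilon> \<alpha> \<beta>"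
 unfolding rhs2_def Let_def Q[symmetric] M_bar_def by (rule majorant_II[OF estimate_II[OF assms(1,2)] d assms(3-6)])

end

end

section \<open>Optimal parameters of the two right-hand sides\<close>

lemma rhs1_arg_min:
 fixes f v :: "'a::euclidean_space \<times> real => real" and y :: "'a \<times> real => 'a" and Q :: "('a \<times> real) set" and \<gamma> d C \<alpha> \<beta> :: real
 assumes pos: "0 < \<gamma>" "0 < d" "0 < C"
 defines "Req \<equiv> norm_on Q (r_eq Q f v y)" and "Rd \<equiv> norm_on Q (r_d Q v y)" and "Rdiv \<equiv> norm_on Q (div_x Q (r_d Q v y))"
 shows "Req \<noteq> 0 ==> Rd \<noteq> 0 ==> is_arg_min (rhs1 Q f C d v y \<gamma> \<alpha>) (\<lambda>b. 0 < b) \<beta> \<longleftrightarrow> \<beta> = C * Req / Rd" (is "_ ==> _ ==> ?\<beta> \<alpha> \<beta>")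
  "Req \<noteq> 0 ==> Rdiv \<noteq> 0 ==> is_arg_min (\<lambda>a. rhs1 Q f C d v y \<gamma> a \<beta>) (\<lambda>a. 0 < a) \<alpha> \<longleftrightarrow> \<alpha> = Req / Rdiv" (is "_ ==> _ ==> ?\<alpha> \<alpha> \<beta>")
  "Req \<noteq> 0 ==> Rd \<noteq> 0 ==> Rdiv \<noteq> 0 ==>
   is_arg_min (\<lambda>(a, b). rhs1 Q f C d v y \<gamma> a b) (\<lambda>(a, b). 0 < a \<and> 0 < b) (\<alpha>, \<beta>) \<longleftrightarrow> \<beta> = C * Req / Rd \<and> \<alpha> = Req / Rdiv"
proof -
 have nn: "0 \<le> Req" "0 \<le> Rd" "0 \<le> Rdiv" by (simp_all add: Req_def Rd_def Rdiv_def L2_norm_nonneg)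
 have \<beta>: "?\<beta> \<alpha> \<beta>" if "Req \<noteq> 0" "Rd \<noteq> 0" for \<alpha> \<beta>
  by (rule is_arg_min_weighted_sum[of _ _ \<gamma> _ "\<gamma> * (d * M_tilde Q f v y \<alpha>)"])
   (use that nn pos in \<open>simp_all add: rhs1_def M_bar_def Req_def Rd_def power_mult_distrib algebra_simps\<close>)
 have \<alpha>: "?\<alpha> \<alpha> \<beta>" if "Req \<noteq> 0" "Rdiv \<noteq> 0" for \<alpha> \<beta>
  by (rule is_arg_min_weighted_sum[of _ _ "\<gamma> * d" _ "\<gamma> * M_bar Q f C v y \<beta>"])
   (use that nn pos in \<open>simp_all add: rhs1_def M_tilde_def Req_def Rdiv_def algebra_simps\<close>)
 show "Req \<noteq> 0 ==> Rd \<noteq> 0 ==> ?\<beta> \<alpha> \<beta>" "Req \<noteq> 0 ==> Rdiv \<noteq> 0 ==> ?\<alpha> \<alpha> \<beta>" by (rule \<beta> \<alpha>; assumption)+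
 show "is_arg_min (\<lambda>(a, b). rhs1 Q f C d v y \<gamma> a b) (\<lambda>(a, b). 0 < a \<and> 0 < b) (\<alpha>, \<beta>) \<longleftrightarrow> \<beta> = C * Req / Rd \<and> \<alpha> = Req / Rdiv"
  if "Req \<noteq> 0" "Rd \<noteq> 0" "Rdiv \<noteq> 0"
  by (rule is_arg_min_pair[where \<alpha>\<^sub>0 = "\<lambda>_. Req / Rdiv"]) (use \<alpha> \<beta> that in auto)
qed

text \<open>For fixed \<alpha> the part depending on \<beta> is merely scaled by \<xi> (1 +
  \<alpha>), which does not move the minimiser. For fixed \<beta> the whole of \<open>M_bar\<close>
  takes the place of a^2 in the weighted sum, hence the square root in
  \<open>\<alpha>\<^sub>0\<close>.\<close>

lemma rhs2_arg_min:
 fixes f v :: "'a::euclidean_space \<times> real => real" and y :: "'a \<times> real => 'a" and Q :: "('a \<times> real) set" and \<xi> d C \<alpha> \<beta> :: real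
 assumes Q: "Q = \<Omega> \<times> {0<..<T}" and pos: "0 < \<xi>" "0 < d" "0 < C"
 defines "Req \<equiv> norm_on Q (r_eq Q f v y)" and "Rd \<equiv> norm_on Q (r_d Q v y)" and "Rdt \<equiv> norm_on Q (dt Q (r_d Q v y))"
 defines "\<alpha>\<^sub>0 \<equiv> \<lambda>\<beta>. d * Rdt / sqrt ((1 + \<beta>) * Rd\<^sup>2 + (1 + 1 / \<beta>) * C\<^sup>2 * Req\<^sup>2)"
 shows "Req \<noteq> 0 ==> Rd \<noteq> 0 ==> 0 < \<alpha> ==>
   is_arg_min (rhs2 \<Omega> T f C d v y \<xi> \<epsilon> \<alpha>) (\<lambda>b. 0 < b) \<beta> \<longleftrightarrow> \<beta> = C * Req / Rd" (is "_ ==> _ ==> _ ==> ?\<beta> \<alpha> \<beta>")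
  "Rdt \<noteq> 0 ==> Rd \<noteq> 0 \<or> Req \<noteq> 0 ==> 0 < \<beta> ==>
   is_arg_min (\<lambda>a. rhs2 \<Omega> T f C d v y \<xi> \<epsilon> a \<beta>) (\<lambda>a. 0 < a) \<alpha> \<longleftrightarrow> \<alpha> = \<alpha>\<^sub>0 \<beta>" (is "_ ==> _ ==> _ ==> ?\<alpha> \<alpha> \<beta>")
  "Req \<noteq> 0 ==> Rd \<noteq> 0 ==> Rdt \<noteq> 0 ==>
   is_arg_min (\<lambda>(a, b). rhs2 \<Omega> T f C d v y \<xi> \<epsilon> a b) (\<lambda>(a, b). 0 < a \<and> 0 < b) (\<alpha>, \<beta>) \<longleftrightarrow> \<beta> = C * Req / Rd \<and> \<alpha> = \<alpha>\<^sub>0 \<beta>"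
proof -
 have nn: "0 \<le> Req" "0 \<le> Rd" "0 \<le> Rdt" by (simp_all add: Req_def Rd_def Rdt_def L2_norm_nonneg)
 have rhs2: "rhs2 \<Omega> T f C d v y \<xi> \<epsilon> a b = \<epsilon> * d * (final_norm \<Omega> T (r_d Q v y))\<^sup>2
  + \<xi> * ((1 + a) * ((1 + b) * Rd\<^sup>2 + (1 + 1 / b) * C\<^sup>2 * Req\<^sup>2) + (1 + 1 / a) * d\<^sup>2 * Rdt\<^sup>2 + d * Req\<^sup>2)" for a b
  by (simp add: rhs2_def Let_def Q[symmetric] M_bar_def Req_def Rd_def Rdt_def)
 have \<beta>: "?\<beta> \<alpha> \<beta>" if "Req \<noteq> 0" "Rd \<noteq> 0" "0 < \<alpha>" for \<alpha> \<beta>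
 proof (rule is_arg_min_weighted_sum[of _ _ "\<xi> * (1 + \<alpha>)"])
  fix x :: real
  show "rhs2 \<Omega> T f C d v y \<xi> \<epsilon> \<alpha> x = (\<epsilon> * d * (final_norm \<Omega> T (r_d Q v y))\<^sup>2 + \<xi> * ((1 + 1 / \<alpha>) * d\<^sup>2 * Rdt\<^sup>2 + d * Req\<^sup>2))
   + \<xi> * (1 + \<alpha>) * ((1 + x) * Rd\<^sup>2 + (1 + 1 / x) * (C * Req)\<^sup>2)"
   unfolding rhs2 power_mult_distrib by (simp add: algebra_simps)
 qed (use that nn pos in auto)
 have \<alpha>: "?\<alpha> \<alpha> \<beta>" if "Rdt \<noteq> 0" "Rd \<noteq> 0 \<or> Req \<noteq> 0" "0 < \<beta>" for \<alpha> \<beta>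
  unfolding \<alpha>\<^sub>0_def
 proof (rule is_arg_min_weighted_sum[of _ _ \<xi>])
  let ?M = "(1 + \<beta>) * Rd\<^sup>2 + (1 + 1 / \<beta>) * C\<^sup>2 * Req\<^sup>2"
  \<comment> \<open>A single nonzero residual norm suffices, as both coefficients are
    positive.\<close>
  have M: "0 < ?M"
  proof (cases "Rd = 0")
   case True then show ?thesis using that pos by (simp add: add_pos_pos)
  next
   case False then show ?thesis using that(3) by (intro add_pos_nonneg) auto
  qed
  then show "0 < sqrt ?M" by simp
  fix x :: real
  show "rhs2 \<Omega> T f C d v y \<xi> \<epsilon> x \<beta> = (\<epsilon> * d * (final_norm \<Omega> T (r_d Q v y))\<^sup>2 + \<xi> * (d * Req\<^sup>2))
   + \<xi> * ((1 + x) * (sqrt ?M)\<^sup>2 + (1 + 1 / x) * (d * Rdt)\<^sup>2)"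
   unfolding rhs2 power_mult_distrib real_sqrt_pow2[OF less_imp_le[OF M]] by (simp add: algebra_simps)
 qed (use that nn pos in auto)
 show "Req \<noteq> 0 ==> Rd \<noteq> 0 ==> 0 < \<alpha> ==> ?\<beta> \<alpha> \<beta>" "Rdt \<noteq> 0 ==> Rd \<noteq> 0 \<or> Req \<noteq> 0 ==> 0 < \<beta> ==> ?\<alpha> \<alpha> \<beta>"
  by (rule \<beta> \<alpha>; assumption)+
 show "is_arg_min (\<lambda>(a, b). rhs2 \<Omega> T f C d v y \<xi> \<epsilon> a b) (\<lambda>(a, b). 0 < a \<and> 0 < b) (\<alpha>, \<beta>) \<longleftrightarrow> \<beta> = C * Req / Rd \<and> \<alpha> = \<alpha>\<^sub>0 \<beta>"
  if "Req \<noteq> 0" "Rd \<noteq> 0" "Rdt \<noteq> 0"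
  by (rule is_arg_min_pair) (use \<alpha> \<beta> that in auto)
qed

section \<open>Both error majorants with their optimal parameters\<close>

theorem corollary1:
  fixes \<Omega> :: "(real ^ 'n) set" and Q :: "((real ^ 'n) \<times> real) set"
    and T h \<theta> \<delta> C\<^sub>F :: real
    and f u :: "(real ^ 'n) \<times> real \<Rightarrow> real"
  assumes dim: "CARD('n) \<in> {1, 2, 3}"
    and dom: "bounded_lipschitz_domain \<Omega>"
    and T: "0 < T"
    and Q: "Q = \<Omega> \<times> {0<..<T}"
    and h: "0 < h" and \<theta>: "0 < \<theta>" and \<delta>: "\<delta> = \<theta> * h"
    and f: "f \<in> L2 (lebesgue_on Q)"
    and u: "u \<in> V_lap \<Omega> T"
    and heat: "AE z in lebesgue_on Q. dt Q u z - lap_x Q u z = f z"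
    and CF: "0 < C\<^sub>F"
    and friedrichs: "\<And>w. w \<in> H10_0 \<Omega> T \<Longrightarrow> norm_on Q w \<le> C\<^sub>F * norm_on Q (grad_x Q w)"
  shows
    "(\<forall>v \<in> V_lap \<Omega> T. \<forall>y \<in> Hdiv0 Q.
       let e = (\<lambda>z. u z - v z);
           R\<^sub>e\<^sub>q = norm_on Q (r_eq Q f v y);
           R\<^sub>d = norm_on Q (r_d Q v y);
           R\<^sub>d\<^sub>i\<^sub>v = norm_on Q (div_x Q (r_d Q v y));
           RHS = rhs1 Q f C\<^sub>F \<delta> v y
       in
       (\<forall>\<gamma>\<ge>1/2. \<forall>\<alpha>>0. \<forall>\<beta>>0.
          (2 - 1 / \<gamma>) * ((norm_on Q (grad_x Q e))\<^sup>2 + \<delta> * (norm_on Q (dt Q e))\<^sup>2)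
            + (final_norm \<Omega> T e)\<^sup>2 + \<delta> * (final_norm \<Omega> T (grad_x Q e))\<^sup>2
          \<le> RHS \<gamma> \<alpha> \<beta>) \<and>
       (\<forall>\<gamma>\<ge>1/2.
          (R\<^sub>e\<^sub>q \<noteq> 0 \<and> R\<^sub>d \<noteq> 0 \<longrightarrow>
             (\<forall>\<alpha>>0. \<forall>\<beta>. is_arg_min (RHS \<gamma> \<alpha>) (\<lambda>b. 0 < b) \<beta> \<longleftrightarrow> \<beta> = C\<^sub>F * R\<^sub>e\<^sub>q / R\<^sub>d)) \<and>
          (R\<^sub>e\<^sub>q \<noteq> 0 \<and> R\<^sub>d\<^sub>i\<^sub>v \<noteq> 0 \<longrightarrow>
             (\<forall>\<beta>>0. \<forall>\<alpha>. is_arg_min (\<lambda>a. RHS \<gamma> a \<beta>) (\<lambda>a. 0 < a) \<alpha> \<longleftrightarrow> \<alpha> = R\<^sub>e\<^sub>q / R\<^sub>d\<^sub>i\<^sub>v)) \<and>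
          (R\<^sub>e\<^sub>q \<noteq> 0 \<and> R\<^sub>d \<noteq> 0 \<and> R\<^sub>d\<^sub>i\<^sub>v \<noteq> 0 \<longrightarrow>
             (\<forall>\<alpha> \<beta>. is_arg_min (\<lambda>(a, b). RHS \<gamma> a b) (\<lambda>(a, b). 0 < a \<and> 0 < b) (\<alpha>, \<beta>) \<longleftrightarrow>
                \<beta> = C\<^sub>F * R\<^sub>e\<^sub>q / R\<^sub>d \<and> \<alpha> = R\<^sub>e\<^sub>q / R\<^sub>d\<^sub>i\<^sub>v))) \<and>
       (\<forall>\<alpha>>0. \<forall>\<beta>>0.
          (norm_on Q (grad_x Q e))\<^sup>2 + \<delta> * (norm_on Q (dt Q e))\<^sup>2
            + (final_norm \<Omega> T e)\<^sup>2 + \<delta> * (final_norm \<Omega> T (grad_x Q e))\<^sup>2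
          \<le> M_bar Q f C\<^sub>F v y \<beta> + \<delta> * M_tilde Q f v y \<alpha>))
     \<and>
     (\<forall>v \<in> V_grad_dt \<Omega> T. \<forall>y \<in> Hdiv1 Q.
       let e = (\<lambda>z. u z - v z);
           R\<^sub>e\<^sub>q = norm_on Q (r_eq Q f v y);
           R\<^sub>d = norm_on Q (r_d Q v y);
           R\<^sub>d\<^sub>t = norm_on Q (dt Q (r_d Q v y));
           RHS = rhs2 \<Omega> T f C\<^sub>F \<delta> v y;
           \<alpha>\<^sub>o\<^sub>p\<^sub>t = (\<lambda>\<beta>. \<delta> * R\<^sub>d\<^sub>t / sqrt ((1 + \<beta>) * R\<^sub>d\<^sup>2 + (1 + 1 / \<beta>) * C\<^sub>F\<^sup>2 * R\<^sub>e\<^sub>q\<^sup>2))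
       in
       (\<forall>\<zeta>\<ge>1/2. \<forall>\<epsilon>\<ge>1. \<forall>\<alpha>>0. \<forall>\<beta>>0.
          (2 - 1 / \<zeta>) * ((norm_on Q (grad_x Q e))\<^sup>2 + \<delta> * (norm_on Q (dt Q e))\<^sup>2)
            + \<delta> * (1 - 1 / \<epsilon>) * (final_norm \<Omega> T (grad_x Q e))\<^sup>2 + (final_norm \<Omega> T e)\<^sup>2
          \<le> RHS \<zeta> \<epsilon> \<alpha> \<beta>) \<and>
       (\<forall>\<zeta>\<ge>1/2. \<forall>\<epsilon>\<ge>1.
          (R\<^sub>e\<^sub>q \<noteq> 0 \<and> R\<^sub>d \<noteq> 0 \<longrightarrow>
             (\<forall>\<alpha>>0. \<forall>\<beta>. is_arg_min (RHS \<zeta> \<epsilon> \<alpha>) (\<lambda>b. 0 < b) \<beta> \<longleftrightarrow> \<beta> = C\<^sub>F * R\<^sub>e\<^sub>q / R\<^sub>d)) \<and>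
          (R\<^sub>d\<^sub>t \<noteq> 0 \<and> (R\<^sub>d \<noteq> 0 \<or> R\<^sub>e\<^sub>q \<noteq> 0) \<longrightarrow>
             (\<forall>\<beta>>0. \<forall>\<alpha>. is_arg_min (\<lambda>a. RHS \<zeta> \<epsilon> a \<beta>) (\<lambda>a. 0 < a) \<alpha> \<longleftrightarrow> \<alpha> = \<alpha>\<^sub>o\<^sub>p\<^sub>t \<beta>)) \<and>
          (R\<^sub>e\<^sub>q \<noteq> 0 \<and> R\<^sub>d \<noteq> 0 \<and> R\<^sub>d\<^sub>t \<noteq> 0 \<longrightarrow>
             (\<forall>\<alpha> \<beta>. is_arg_min (\<lambda>(a, b). RHS \<zeta> \<epsilon> a b) (\<lambda>(a, b). 0 < a \<and> 0 < b) (\<alpha>, \<beta>) \<longleftrightarrow>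
                \<beta> = C\<^sub>F * R\<^sub>e\<^sub>q / R\<^sub>d \<and> \<alpha> = \<alpha>\<^sub>o\<^sub>p\<^sub>t \<beta>))) \<and>
       (\<forall>\<alpha>>0. \<forall>\<beta>>0.
          (norm_on Q (grad_x Q e))\<^sup>2 + \<delta> * (norm_on Q (dt Q e))\<^sup>2
            + (final_norm \<Omega> T e)\<^sup>2 + \<delta> / 2 * (final_norm \<Omega> T (grad_x Q e))\<^sup>2
          \<le> 2 * \<delta> * (final_norm \<Omega> T (r_d Q v y))\<^sup>2
            + (1 + \<alpha>) * M_bar Q f C\<^sub>F v y \<beta>
            + (1 + 1 / \<alpha>) * \<delta>\<^sup>2 * (norm_on Q (dt Q (r_d Q v y)))\<^sup>2
            + \<delta> * (norm_on Q (r_eq Q f v y))\<^sup>2))"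
proof -
 have \<delta>0: "0 < \<delta>" using h \<theta> by (simp add: \<delta>)
 have err: "heat_error \<Omega> T Q f u v y" if "v \<in> V_lap \<Omega> T" "y \<in> Hdiv0 Q" for v y
  using dom T Q f u heat that by unfold_locales
 have fr: "norm_on Q (\<lambda>z. u z - v z) \<le> C\<^sub>F * norm_on Q (grad_x Q (\<lambda>z. u z - v z))" if "v \<in> V_lap \<Omega> T" "y \<in> Hdiv0 Q" for v y
  by (rule friedrichs[OF heat_error.eD(6)[OF err[OF that]]])
 have sub: "v \<in> V_lap \<Omega> T" "y \<in> Hdiv0 Q" if "v \<in> V_grad_dt \<Omega> T" "y \<in> Hdiv1 Q" for v y
  using that by (auto simp: V_grad_dt_def Hdiv1_def)
 note I = heat_error.error_majorant_I[OF err fr less_imp_le[OF \<delta>0]]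
 note II = heat_error.error_majorant_II[OF err[OF sub] fr[OF sub] less_imp_le[OF \<delta>0]]
 note min1 = rhs1_arg_min[OF _ \<delta>0 CF] and min2 = rhs2_arg_min[OF Q _ \<delta>0 CF]
 show ?thesis
  unfolding Let_def
 proof (intro conjI ballI allI impI, goal_cases)
  case (1 v y \<gamma> \<alpha> \<beta>)
  then show ?case by (intro I)
 next
  case (2 v y \<gamma> \<alpha> \<beta>)
  then show ?case by (intro min1) auto
 next
  case (3 v y \<gamma> \<beta> \<alpha>)
  then show ?case by (intro min1) auto
 next
  case (4 v y \<gamma> \<alpha> \<beta>)
  then show ?case by (intro min1) auto
 next
  case (5 v y \<alpha> \<beta>)
  \<comment> \<open>\<gamma> = 1 makes the coefficient 2 - 1/\<gamma> equal to 1.\<close>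
  show ?case using I[OF 5(1,2,1,2) _ 5(3,4), of 1] by (simp add: rhs1_def)
 next
  case (6 v y \<zeta> \<epsilon> \<alpha> \<beta>)
  then show ?case by (intro II)
 next
  case (7 v y \<zeta> \<epsilon> \<alpha> \<beta>)
  then show ?case by (intro min2) auto
 next
  case (8 v y \<zeta> \<epsilon> \<beta> \<alpha>)
  then show ?case by (intro min2) auto
 next
  case (9 v y \<zeta> \<epsilon> \<alpha> \<beta>)
  then show ?case by (intro min2) auto
 next
  case (10 v y \<alpha> \<beta>)
  \<comment> \<open>\<zeta> = 1 and \<epsilon> = 2 give the coefficients 1 and 1/2. The membership
    facts recur because each of the combined rules carries them as premises.\<close>
  show ?case using II[OF 10(1,2,1,2,1,2,1,2,1,2) _ _ 10(3,4), of 1 2] by (simp add: rhs2_def Q[symmetric])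
 qed
qed

end
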